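(* Let $V\subseteq\mathbb{C}^n$ be an affine algebraic variety satisfying properties (0)–(3) listed in the context, with $I=\mathbf{I}(V)$, and let $K\subseteq V$ be compact. Suppose that the ordinary polynomial products $( * )$ $z^{\alpha}z_m^lz^{\beta}$ ($\alpha\in\mathbb{Z}_{\ge0}^{m-1}$, $z_m^lz^\beta\in\mathcal{B}$), and $( ** )$ $z^{\alpha}z_m^l\mathbf{v}_i$ ($\alpha\in\mathbb{Z}_{\ge0}^{m-1}$, $l\ge0$, $i=1,\dots,d$) are already in normal form with respect to $I$. Let $W_{m_s}:=\sup\{|\mathrm{Van}(\zeta_1,\dots,\zeta_{m_s})| : \{\zeta_1,\dots,\zeta_{m_s}\}\subseteq K\}$, where $\mathrm{Van}$ is the Vandermonde determinant formed with the grevlex-ordered monomial basis $\{z^\gamma : z^\gamma\notin\langle \mathrm{LT}(I)\rangle\}$ of $\mathbb{C}[V]$. Then $$\lim_{s\to\infty}W_{m_s}^{1/l_s}=d(K),$$ where $d(K)=\lim_{s\to\infty}V_{m_s}^{1/l_s}$ is the transfinite diameter of $K$ defined with the basis $\mathcal{C}$.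
   Context: **Grevlex and normal forms.** $\mathbb{C}[z]=\mathbb{C}[z_1,\dots,z_n]$. The grevlex order (with $z_1<_{gr}\cdots<_{gr}z_n$): $z^\alpha<_{gr}z^\beta$ if $|\alpha|<|\beta|$, or $|\alpha|=|\beta|$ and for some $i$ one has $\alpha_i>\beta_i$ and $\alpha_j=\beta_j$ for all $j<i$. For an ideal $I$, $\langle \mathrm{LT}(I)\rangle$ is the ideal generated by grevlex leading terms of elements of $I$. Each class in $\mathbb{C}[z]/I$ has a unique representative containing no monomial of $\langle \mathrm{LT}(I)\rangle$, its normal form; $\mathbb{C}[z]_I$ is the space of normal forms, an algebra isomorphic to $\mathbb{C}[z]/I$ under $r_1*r_2:=$ the normal form of $r_1r_2$. **The variety.** $1\le m\le n$, $V\subseteq\mathbb{C}^n$ is an affine algebraic variety, $I=\mathbf{I}(V)$ is the ideal of all polynomials vanishing on $V$, and $\mathbb{C}[V]\simeq\mathbb{C}[z]/I$ is identified with $\mathbb{C}[z]_I$. $\mathbb{C}[V]_{\le s}$ (resp. $\mathbb{C}[V]_{=s}$) is the space of normal forms of degree $\le s$ (resp. homogeneous of degree $s$). $\mathbb{C}^n\subseteq\mathbb{P}^n$ via $a\mapsto[1:a]$, $I^h\subseteq\mathbb{C}[z_0,\dots,z_n]$ is the homogeneous ideal generated by homogenizations (with respect to $z_0$) of elements of $I$, and $\bar V=\mathbf{V}(I^h)\subseteq\mathbb{P}^n$. Assume: (0) $V$ is pure of dimension $m$ and has degree $d$; (1) $\mathbb{C}[z_1,\dots,z_m]\subseteq\mathbb{C}[V]$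 is a Noether normalization, i.e. $\mathbb{C}[z_1,\dots,z_m]\cap I=\{0\}$ and for each $i=m+1,\dots,n$ there is $g_i\in I$ of the form $g_i=z_i^{d_i}+\sum_{j=0}^{d_i-1}h_{ij}(z_1,\dots,z_{i-1})z_i^j$ with $\deg(h_{ij})+j\le d_i$; (2) $\bar V\cap P$ consists of $d$ distinct points, $P=\mathbf{V}(z_0,\dots,z_{m-1})\subseteq\mathbb{P}^n$; (3) writing $\bar V\cap P=\{p_1,\dots,p_d\}$, $p_i=[0:\cdots:0:p_{im}:\cdots:p_{in}]$, one has $p_{im}\ne0$ for all $i$. **The polynomials $\mathbf{v}_i$.** A form $f\in\mathbb{C}[z_0,\dots,z_n]_\tau$ is evaluated at a point $a=[a_0:\cdots:a_n]$ with $a_m\ne0$ by $f(a):=a_m^{-\tau}f(a_0,\dots,a_n)$. Fix an integer $t\ge0$ large enough that for all $\tau\ge t$ the map $\mathbb{C}[z_0,\dots,z_n]_\tau\to\mathbb{C}^d$, $f\mapsto(f(p_1),\dots,f(p_d))$, is onto with kernel $(I^h+\langle z_0,\dots,z_{m-1}\rangle)_\tau$. Fix $v_1,\dots,v_d\in\mathbb{C}[z_0,\dots,z_n]_t$ with $v_i(p_j)=\delta_{ij}$. Let $\mathbf{v}_i\in\mathbb{C}[V]_{=t}$ be the unique homogeneous normal form of degree $t$ having the same class as $v_i$ in $\mathbb{C}[z_0,\dots,z_n]/(I^h+\langle z_0\rangle)$ (using $\mathbb{C}[V]_{=t}\simeq(\mathbb{C}[z_0,\dots,z_n]/(I^h+\langle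 z_0\rangle))_t$). **The basis $\mathcal{C}$ and order $\prec$.** Write $z^\alpha=z_1^{a_1}\cdots z_{m-1}^{a_{m-1}}$, $z^\beta=z_{m+1}^{b_1}\cdots z_n^{b_{n-m}}$, and $\mathcal{B}:=\{z_m^lz^\beta\notin\langle \mathrm{LT}(I)\rangle : l+|\beta|\le t-1\}$. Consider the elements of $\mathbb{C}[V]$: $( * )$ $z^\alpha z_m^l*z^\beta$ with $\alpha\in\mathbb{Z}_{\ge0}^{m-1}$, $z_m^lz^\beta\in\mathcal{B}$; $( ** )$ $z^\alpha z_m^l*\mathbf{v}_i$ with $\alpha\in\mathbb{Z}_{\ge0}^{m-1}$, $l\ge0$, $1\le i\le d$. These span $\mathbb{C}[V]$ and those of type $( ** )$ are linearly independent. $\mathcal{C}$ consists of all elements $( ** )$ together with the elements $( * )$ kept by this procedure: list the elements $( * )$ in grevlex order, and discard each one that is linearly dependent on the elements $( ** )$ together with the previous elements of $( * )$. Order $\mathcal{C}$ by $\prec$: first by total degree; within a degree, elements $( * )$ precede elements $( ** )$; elements $( * )$ are ordered by grevlex; $z^\alpha z_m^l*\mathbf{v}_i\prec z^{\hat\alpha}z_m^{\hat l}*\mathbf{v}_j$ if $z^\alpha z_m^l<_{gr}z^{\hat\alpha}z_m^{\hat l}$; $z^\alpha z_m^l*\mathbf{v}_i\prec z^\alpha z_m^l*\mathbf{v}_j$ if $i<j$. Let $\mathbf{e}_1,\mathbf{e}_2,\dots$ enumerate $\mathcal{C}$ according to $\prec$. **Vandermonde determinants.** $\mathrm{Van}_{\mathcal{C}}(\zeta_1,\dots,\zeta_M)=\det(\mathbf{e}_j(\zeta_i))_{i,j=1}^M$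 and $V_M=\sup\{|\mathrm{Van}_{\mathcal{C}}(\zeta_1,\dots,\zeta_M)| : \{\zeta_1,\dots,\zeta_M\}\subseteq K\}$. Let $\tilde{\mathbf{e}}_1,\tilde{\mathbf{e}}_2,\dots$ enumerate the monomials $z^\gamma\notin\langle \mathrm{LT}(I)\rangle$, $\gamma\in\mathbb{Z}_{\ge0}^n$, in grevlex order; $\mathrm{Van}(\zeta_1,\dots,\zeta_M)=\det(\tilde{\mathbf{e}}_j(\zeta_i))_{i,j=1}^M$. Put $h_s=\dim\mathbb{C}[V]_{=s}$, $m_s=\sum_{\nu=0}^sh_\nu=\dim\mathbb{C}[V]_{\le s}$, $l_s=\sum_{\nu=0}^s\nu h_\nu$. The paper proves that $d(K)=\lim_{s\to\infty}V_{m_s}^{1/l_s}$ exists. *)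

theory Defs
  imports
    "HOL-Analysis.Function_Topology"
    "HOL-Library.Poly_Mapping"
    "HOL-Library.Set_Algebras"
    "HOL-Library.Extended_Nat"
    "HOL-Computational_Algebra.Polynomial"
    "Jordan_Normal_Form.Determinant"
begin

section \<open>Polynomials and grevlex\<close>

text \<open>
  Polynomials are finitely supported maps from exponent vectors to coefficients, with the
  convolution product of \<^theory>\<open>HOL-Library.Poly_Mapping\<close>.  The type has variables indexed by all
  natural numbers; \<open>polys A\<close> is the polynomial ring in the variables with index in \<open>A\<close>, so that
  \<open>polys {1..n}\<close> is \<open>C[z_1,...,z_n]\<close> and \<open>polys {0..n}\<close> is \<open>C[z_0,...,z_n]\<close>.
\<close>

type_synonym expo = "nat \<Rightarrow>\<^sub>0 nat"
type_synonym cpoly = "expo \<Rightarrow>\<^sub>0 complex"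

abbreviation zmon :: "expo \<Rightarrow> cpoly" where
  "zmon \<gamma> \<equiv> Poly_Mapping.single \<gamma> 1"

abbreviation zvar :: "nat \<Rightarrow> cpoly" where
  "zvar i \<equiv> zmon (Poly_Mapping.single i 1)"

definition polys :: "nat set \<Rightarrow> cpoly set" where
  "polys A = {f. \<forall>\<gamma>\<in>Poly_Mapping.keys f. Poly_Mapping.keys \<gamma> \<subseteq> A}"

definition edeg :: "expo \<Rightarrow> nat" where
  "edeg \<gamma> = (\<Sum>i\<in>Poly_Mapping.keys \<gamma>. Poly_Mapping.lookup \<gamma> i)"

definition pdeg :: "cpoly \<Rightarrow> nat" where
  "pdeg f = (if f = 0 then 0 else Max (edeg ` Poly_Mapping.keys f))"

definition homog :: "nat set \<Rightarrow> nat \<Rightarrow> cpoly set" where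
  "homog A s = {f \<in> polys A. \<forall>\<gamma>\<in>Poly_Mapping.keys f. edeg \<gamma> = s}"

definition peval :: "(nat \<Rightarrow> complex) \<Rightarrow> cpoly \<Rightarrow> complex" where
  "peval a f = (\<Sum>\<gamma>\<in>Poly_Mapping.keys f.
     Poly_Mapping.lookup f \<gamma> * (\<Prod>i\<in>Poly_Mapping.keys \<gamma>. a i ^ Poly_Mapping.lookup \<gamma> i))"

definition cscale :: "complex \<Rightarrow> cpoly \<Rightarrow> cpoly" where
  "cscale c f = Poly_Mapping.map ((*) c) f"

interpretation cpoly: vector_space cscale
  by unfold_locales
    (simp_all add: cscale_def mult_map_scale_conv_mult algebra_simps single_add
      mult_single flip: mult.assoc)

definition grevlex :: "expo \<Rightarrow> expo \<Rightarrow> bool" where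
  "grevlex \<alpha> \<beta> \<longleftrightarrow> edeg \<alpha> < edeg \<beta> \<or>
     edeg \<alpha> = edeg \<beta> \<and>
       (\<exists>i. Poly_Mapping.lookup \<alpha> i > Poly_Mapping.lookup \<beta> i \<and>
         (\<forall>j<i. Poly_Mapping.lookup \<alpha> j = Poly_Mapping.lookup \<beta> j))"

definition lead_expo :: "cpoly \<Rightarrow> expo" where
  "lead_expo f =
     (THE \<gamma>. \<gamma> \<in> Poly_Mapping.keys f \<and> (\<forall>\<delta>\<in>Poly_Mapping.keys f. \<delta> \<noteq> \<gamma> \<longrightarrow> grevlex \<delta> \<gamma>))"

definition lead_term :: "cpoly \<Rightarrow> cpoly" where
  "lead_term f = Poly_Mapping.single (lead_expo f) (Poly_Mapping.lookup f (lead_expo f))"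

definition ideal_gen :: "nat set \<Rightarrow> cpoly set \<Rightarrow> cpoly set" where
  "ideal_gen A S = {\<Sum>g\<in>T. q g * g | T q. finite T \<and> T \<subseteq> S \<and> (\<forall>g\<in>T. q g \<in> polys A)}"

definition LT_ideal :: "nat \<Rightarrow> cpoly set \<Rightarrow> cpoly set" where
  "LT_ideal n I = ideal_gen {1..n} (lead_term ` (I - {0}))"

definition normal_forms :: "nat \<Rightarrow> cpoly set \<Rightarrow> cpoly set" where
  "normal_forms n I = {r \<in> polys {1..n}. \<forall>\<gamma>\<in>Poly_Mapping.keys r. zmon \<gamma> \<notin> LT_ideal n I}"

definition nf :: "nat \<Rightarrow> cpoly set \<Rightarrow> cpoly \<Rightarrow> cpoly" where
  "nf n I f = (THE r. r \<in> normal_forms n I \<and> f - r \<in> I)"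

definition nf_mult :: "nat \<Rightarrow> cpoly set \<Rightarrow> cpoly \<Rightarrow> cpoly \<Rightarrow> cpoly" where
  "nf_mult n I r1 r2 = nf n I (r1 * r2)"

text \<open>The graded piece \<open>C[V]_{=s}\<close>.\<close>

definition nf_homog :: "nat \<Rightarrow> cpoly set \<Rightarrow> nat \<Rightarrow> cpoly set" where
  "nf_homog n I s = normal_forms n I \<inter> homog {1..n} s"


section \<open>Affine varieties, dimension\<close>

text \<open>
  \<open>C^n\<close> is the set of sequences vanishing outside \<open>{1..n}\<close>; the product topology of
  \<open>nat \<Rightarrow> complex\<close> induces on it the usual topology.
\<close>

definition affine_pts :: "nat \<Rightarrow> (nat \<Rightarrow> complex) set" where
  "affine_pts n = {a. \<forall>i. i \<notin> {1..n} \<longrightarrow> a i = 0}"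

definition algebraic_set :: "nat \<Rightarrow> (nat \<Rightarrow> complex) set \<Rightarrow> bool" where
  "algebraic_set n V \<longleftrightarrow>
     (\<exists>S \<subseteq> polys {1..n}. V = {a \<in> affine_pts n. \<forall>f\<in>S. peval a f = 0})"

definition vanishing_ideal :: "nat \<Rightarrow> (nat \<Rightarrow> complex) set \<Rightarrow> cpoly set" where
  "vanishing_ideal n V = {f \<in> polys {1..n}. \<forall>a\<in>V. peval a f = 0}"

definition irreducible_set :: "nat \<Rightarrow> (nat \<Rightarrow> complex) set \<Rightarrow> bool" where
  "irreducible_set n Z \<longleftrightarrow> algebraic_set n Z \<and> Z \<noteq> {} \<and>
     (\<forall>Z1 Z2. algebraic_set n Z1 \<and> algebraic_set n Z2 \<and> Z = Z1 \<union> Z2 \<longrightarrow> Z = Z1 \<or> Z = Z2)"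

definition irreducible_component ::
    "nat \<Rightarrow> (nat \<Rightarrow> complex) set \<Rightarrow> (nat \<Rightarrow> complex) set \<Rightarrow> bool" where
  "irreducible_component n V Z \<longleftrightarrow> irreducible_set n Z \<and> Z \<subseteq> V \<and>
     (\<forall>Z'. irreducible_set n Z' \<and> Z \<subseteq> Z' \<and> Z' \<subseteq> V \<longrightarrow> Z' = Z)"

text \<open>Dimension is the supremum of lengths of chains of irreducible closed subsets.\<close>

definition alg_dim :: "nat \<Rightarrow> (nat \<Rightarrow> complex) set \<Rightarrow> enat" where
  "alg_dim n W = Sup {enat k | k. \<exists>Z :: nat \<Rightarrow> (nat \<Rightarrow> complex) set.
     (\<forall>i\<le>k. irreducible_set n (Z i) \<and> Z i \<subseteq> W) \<and> (\<forall>i<k. Z i \<subset> Z (Suc i))}"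

definition pure_dim :: "nat \<Rightarrow> (nat \<Rightarrow> complex) set \<Rightarrow> nat \<Rightarrow> bool" where
  "pure_dim n V m \<longleftrightarrow> (\<forall>Z. irreducible_component n V Z \<longrightarrow> alg_dim n Z = enat m)"


section \<open>Projective closure, degree\<close>

definition homogenize :: "cpoly \<Rightarrow> cpoly" where
  "homogenize f = (\<Sum>\<gamma>\<in>Poly_Mapping.keys f.
     Poly_Mapping.single (Poly_Mapping.single 0 (pdeg f - edeg \<gamma>) + \<gamma>) (Poly_Mapping.lookup f \<gamma>))"

definition homog_ideal :: "nat \<Rightarrow> cpoly set \<Rightarrow> cpoly set" where
  "homog_ideal n I = ideal_gen {0..n} (homogenize ` I)"

text \<open>Homogeneous coordinate vectors of \<open>P^n\<close>; a point of \<open>P^n\<close> is a class \<open>proj_pt a\<close>.\<close>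

definition hcoords :: "nat \<Rightarrow> (nat \<Rightarrow> complex) set" where
  "hcoords n = {a. (\<forall>i. i \<notin> {0..n} \<longrightarrow> a i = 0) \<and> a \<noteq> (\<lambda>_. 0)}"

definition proj_pt :: "(nat \<Rightarrow> complex) \<Rightarrow> (nat \<Rightarrow> complex) set" where
  "proj_pt a = {\<lambda>i. c * a i | c. c \<noteq> 0}"

definition proj_zeros :: "nat \<Rightarrow> cpoly set \<Rightarrow> (nat \<Rightarrow> complex) set set" where
  "proj_zeros n J = {proj_pt a | a. a \<in> hcoords n \<and> (\<forall>f\<in>J. peval a f = 0)}"

text \<open>
  The degree of an affine variety with ideal \<open>I\<close> is that of its projective closure: \<open>r!\<close> times the
  leading coefficient of the Hilbert polynomial of \<open>C[z_0,...,z_n] / I^h\<close>, \<open>r\<close> being the degree of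
  that polynomial.
\<close>

definition hilbert_function :: "nat \<Rightarrow> cpoly set \<Rightarrow> nat \<Rightarrow> nat" where
  "hilbert_function n J s = cpoly.dim (homog {0..n} s) - cpoly.dim (J \<inter> homog {0..n} s)"

definition has_degree :: "nat \<Rightarrow> cpoly set \<Rightarrow> nat \<Rightarrow> bool" where
  "has_degree n I d \<longleftrightarrow> (\<exists>H :: real poly.
     (\<forall>\<^sub>F s in sequentially. real (hilbert_function n (homog_ideal n I) s) = poly H (real s)) \<and>
     fact (Polynomial.degree H) * lead_coeff H = real d)"

definition noether_normalization :: "nat \<Rightarrow> nat \<Rightarrow> cpoly set \<Rightarrow> bool" where
  "noether_normalization n m I \<longleftrightarrow> polys {1..m} \<inter> I = {0} \<and>
     (\<forall>i\<in>{m+1..n}. \<exists>D h. (\<forall>j<D. h j \<in> polys {1..i-1} \<and> pdeg (h j) + j \<le> D) \<and>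
        zvar i ^ D + (\<Sum>j<D. h j * zvar i ^ j) \<in> I)"

text \<open>
  Value of a form of degree \<open>\<tau>\<close> at the point with homogeneous coordinates \<open>a\<close>, normalised at the
  \<open>m\<close>-th coordinate; it depends only on \<open>proj_pt a\<close>.
\<close>

definition form_eval :: "nat \<Rightarrow> nat \<Rightarrow> (nat \<Rightarrow> complex) \<Rightarrow> cpoly \<Rightarrow> complex" where
  "form_eval m \<tau> a f = peval a f / a m ^ \<tau>"

text \<open>\<open>bold_v n I t f\<close> represents in \<open>C[V]_{=t}\<close> the class of the form \<open>f\<close> modulo \<open>I^h + (z_0)\<close>.\<close>

definition bold_v :: "nat \<Rightarrow> cpoly set \<Rightarrow> nat \<Rightarrow> cpoly \<Rightarrow> cpoly" where
  "bold_v n I t f = (THE w. w \<in> nf_homog n I t \<and>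
     f - w \<in> homog_ideal n I + ideal_gen {0..n} {zvar 0})"


section \<open>The basis \<open>\<C>\<close>\<close>

text \<open>
  Elements of the two families are handled through their labels: \<open>Ord \<alpha> l \<beta>\<close> stands for
  \<open>z^\<alpha> z_m^l * z^\<beta>\<close> and \<open>Ext \<alpha> l i\<close> for \<open>z^\<alpha> z_m^l * v_i\<close>.  The family \<open>w\<close> below is that of the
  polynomials \<open>v_i\<close> in normal form.
\<close>

datatype label = Ord expo nat expo | Ext expo nat nat

definition basisB :: "nat \<Rightarrow> nat \<Rightarrow> cpoly set \<Rightarrow> nat \<Rightarrow> (nat \<times> expo) set" where
  "basisB n m I t = {(l, \<beta>). Poly_Mapping.keys \<beta> \<subseteq> {m+1..n} \<and>
     zmon (Poly_Mapping.single m l + \<beta>) \<notin> LT_ideal n I \<and> l + edeg \<beta> < t}"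

definition ord_labels :: "nat \<Rightarrow> nat \<Rightarrow> cpoly set \<Rightarrow> nat \<Rightarrow> label set" where
  "ord_labels n m I t = {Ord \<alpha> l \<beta> | \<alpha> l \<beta>.
     Poly_Mapping.keys \<alpha> \<subseteq> {1..<m} \<and> (l, \<beta>) \<in> basisB n m I t}"

definition ext_labels :: "nat \<Rightarrow> nat \<Rightarrow> label set" where
  "ext_labels m d = {Ext \<alpha> l i | \<alpha> l i. Poly_Mapping.keys \<alpha> \<subseteq> {1..<m} \<and> i \<in> {1..d}}"

fun elem :: "nat \<Rightarrow> nat \<Rightarrow> cpoly set \<Rightarrow> (nat \<Rightarrow> cpoly) \<Rightarrow> label \<Rightarrow> cpoly" where
  "elem n m I w (Ord \<alpha> l \<beta>) = nf_mult n I (zmon (\<alpha> + Poly_Mapping.single m l)) (zmon \<beta>)"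
| "elem n m I w (Ext \<alpha> l i) = nf_mult n I (zmon (\<alpha> + Poly_Mapping.single m l)) (w i)"

text \<open>Labels of one and the same family, compared by the grevlex order of their monomials.\<close>

fun label_grevlex :: "nat \<Rightarrow> label \<Rightarrow> label \<Rightarrow> bool" where
  "label_grevlex m (Ord \<alpha> l \<beta>) (Ord \<alpha>' l' \<beta>') =
     grevlex (\<alpha> + Poly_Mapping.single m l + \<beta>) (\<alpha>' + Poly_Mapping.single m l' + \<beta>')"
| "label_grevlex m (Ext \<alpha> l i) (Ext \<alpha>' l' j) =
     grevlex (\<alpha> + Poly_Mapping.single m l) (\<alpha>' + Poly_Mapping.single m l')"
| "label_grevlex m _ _ = False"

text \<open>Discarding against all previous elements or against the previous kept ones is the same.\<close>

definition basisC ::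
    "nat \<Rightarrow> nat \<Rightarrow> nat \<Rightarrow> cpoly set \<Rightarrow> nat \<Rightarrow> (nat \<Rightarrow> cpoly) \<Rightarrow> label set" where
  "basisC n m d I t w = ext_labels m d \<union>
     {x \<in> ord_labels n m I t.
        elem n m I w x \<notin> cpoly.span
          (elem n m I w ` (ext_labels m d \<union> {y \<in> ord_labels n m I t. label_grevlex m y x}))}"

fun prec_same_degree :: "nat \<Rightarrow> label \<Rightarrow> label \<Rightarrow> bool" where
  "prec_same_degree m (Ord \<alpha> l \<beta>) (Ord \<alpha>' l' \<beta>') =
     label_grevlex m (Ord \<alpha> l \<beta>) (Ord \<alpha>' l' \<beta>')"
| "prec_same_degree m (Ord \<alpha> l \<beta>) (Ext \<alpha>' l' j) = True"
| "prec_same_degree m (Ext \<alpha> l i) (Ord \<alpha>' l' \<beta>') = False"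
| "prec_same_degree m (Ext \<alpha> l i) (Ext \<alpha>' l' j) =
     (label_grevlex m (Ext \<alpha> l i) (Ext \<alpha>' l' j) \<or> \<alpha> = \<alpha>' \<and> l = l' \<and> i < j)"

definition prec ::
    "nat \<Rightarrow> nat \<Rightarrow> cpoly set \<Rightarrow> (nat \<Rightarrow> cpoly) \<Rightarrow> label \<Rightarrow> label \<Rightarrow> bool" where
  "prec n m I w x y \<longleftrightarrow> pdeg (elem n m I w x) < pdeg (elem n m I w y) \<or>
     pdeg (elem n m I w x) = pdeg (elem n m I w y) \<and> prec_same_degree m x y"

text \<open>The element of \<open>S\<close> with exactly \<open>k\<close> predecessors; the enumeration starts at \<open>k = 0\<close>.\<close>

definition enum_by :: "('a \<Rightarrow> 'a \<Rightarrow> bool) \<Rightarrow> 'a set \<Rightarrow> nat \<Rightarrow> 'a" where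
  "enum_by lt S k =
     (THE x. x \<in> S \<and> finite {y \<in> S. lt y x} \<and> card {y \<in> S. lt y x} = k)"

definition enumC ::
    "nat \<Rightarrow> nat \<Rightarrow> nat \<Rightarrow> cpoly set \<Rightarrow> nat \<Rightarrow> (nat \<Rightarrow> cpoly) \<Rightarrow> nat \<Rightarrow> cpoly" where
  "enumC n m d I t w k = elem n m I w (enum_by (prec n m I w) (basisC n m d I t w) k)"

definition enum_mon :: "nat \<Rightarrow> cpoly set \<Rightarrow> nat \<Rightarrow> cpoly" where
  "enum_mon n I k =
     zmon (enum_by grevlex {\<gamma>. Poly_Mapping.keys \<gamma> \<subseteq> {1..n} \<and> zmon \<gamma> \<notin> LT_ideal n I} k)"


section \<open>Vandermonde determinants and transfinite diameter\<close>

definition vandermonde :: "(nat \<Rightarrow> cpoly) \<Rightarrow> nat \<Rightarrow> (nat \<Rightarrow> nat \<Rightarrow> complex) \<Rightarrow> complex" where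
  "vandermonde e M \<zeta> = Determinant.det (Matrix.mat M M (\<lambda>(i, j). peval (\<zeta> i) (e j)))"

text \<open>The supremum is taken in the nonnegative reals, so it is \<open>0\<close> for empty \<open>K\<close> and \<open>M > 0\<close>.\<close>

definition vdm_sup :: "(nat \<Rightarrow> cpoly) \<Rightarrow> (nat \<Rightarrow> complex) set \<Rightarrow> nat \<Rightarrow> real" where
  "vdm_sup e K M = Sup (insert 0 {cmod (vandermonde e M \<zeta>) | \<zeta>. \<forall>i<M. \<zeta> i \<in> K})"

definition h_dim :: "nat \<Rightarrow> cpoly set \<Rightarrow> nat \<Rightarrow> nat" where
  "h_dim n I s = cpoly.dim (nf_homog n I s)"

definition m_dim :: "nat \<Rightarrow> cpoly set \<Rightarrow> nat \<Rightarrow> nat" where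
  "m_dim n I s = (\<Sum>\<nu>\<le>s. h_dim n I \<nu>)"

definition l_dim :: "nat \<Rightarrow> cpoly set \<Rightarrow> nat \<Rightarrow> nat" where
  "l_dim n I s = (\<Sum>\<nu>\<le>s. \<nu> * h_dim n I \<nu>)"

definition transfinite_diameter ::
    "nat \<Rightarrow> nat \<Rightarrow> nat \<Rightarrow> cpoly set \<Rightarrow> nat \<Rightarrow> (nat \<Rightarrow> cpoly) \<Rightarrow> (nat \<Rightarrow> complex) set \<Rightarrow> real" where
  "transfinite_diameter n m d I t w K =
     lim (\<lambda>s. vdm_sup (enumC n m d I t w) K (m_dim n I s) powr (1 / real (l_dim n I s)))"

end

theory Submission
  imports Defs "HOL-Real_Asymp.Real_Asymp"
begin

text \<open>
  Both sides come from Vandermonde determinants of the same spaces, the functions on \<open>V\<close> of degree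
  at most \<open>s\<close>, taken with respect to two bases.  The determinant of the change of basis is at most
  \<open>B ^ m_s\<close> in either direction, and \<open>m_s\<close> is \<open>O(s ^ m)\<close> while \<open>l_s\<close> grows like \<open>s ^ (m + 1)\<close>, so
  its \<open>l_s\<close>-th root disappears in the limit.  The transfinite diameter is a \<open>lim\<close>, which says
  something only if the sequence converges; convergence for the basis \<open>\<C>\<close> is the larger part of
  the proof.

  \<^bold>\<open>The basis.\<close>  Exactly \<open>d\<close> standard monomials \<open>mu 1, ..., mu d\<close> of degree \<open>t\<close> involve only
  \<open>z_m, ..., z_n\<close>: evaluation at \<open>p_1, ..., p_d\<close> is injective on their span and sends (the leading
  parts of) \<open>w 1, ..., w d\<close> to the unit vectors.  Since the products \<open>z^\<alpha> z_m^l w_i\<close> are normal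
  forms, a standard exponent is either ``ordinary'' (degree below \<open>t\<close> in \<open>z_m, ..., z_n\<close>) or of the
  form \<open>a + mu i\<close> with \<open>a\<close> in the first \<open>m\<close> variables.  Attaching the monomial itself to the former
  and \<open>z^a w_i\<close> to the latter gives a basis \<open>eb\<close> indexed by all standard exponents; it is
  \<open>\<C>\<close>, and no element is discarded (\<open>basisC_eq\<close>).  Expanding a monomial in \<open>eb\<close> produces coefficients
  that grow geometrically, but only together with the degree in \<open>z_1, ..., z_{m-1}\<close>; weighting by a
  power of \<open>R\<close> with that exponent keeps all row sums bounded (\<open>zmon_expand\<close>), the weights cancel in the
  determinant, and a determinant is at most the product of its row sums (\<open>vdm_sup_transition\<close>).

  \<^bold>\<open>The upper bound.\<close>  Let \<open>T \<gamma>\<close> be the least sup norm on \<open>K\<close> of \<open>eb \<gamma>\<close> plus lower terms.  By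
  Zaharjuta's expansion argument the maximal Vandermonde determinant is at most \<open>m_s!\<close> times the
  product of the \<open>T \<gamma>\<close>.  Ordinary exponents are too few to matter.  On exponents \<open>a + mu i\<close> with fixed
  \<open>i\<close>, \<open>T\<close> is submultiplicative up to a shift, because \<open>w_j w_k\<close> is \<open>z_m^t w_j\<close> or \<open>0\<close>, according to
  whether \<open>j = k\<close>, up to smaller terms (both sides agree at all \<open>p_l\<close>).  A version of Fekete's lemma for families
  over \<open>\<nat>^m\<close> (\<open>P_root_converges\<close>) gives convergence of the roots of the products.

  \<^bold>\<open>The lower bound.\<close>  The determinant is also at least the product of the \<open>T \<gamma>\<close>, but nothing
  prevents \<open>T\<close> from being tiny at ordinary exponents.  They are avoided as follows.  Counting unknowns gives a
  nonzero polynomial \<open>h\<close> in \<open>z_1, ..., z_m\<close> that multiplies every function into the span of the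
  elements \<open>z^a w_i\<close> (\<open>conductor_exists\<close>), and \<open>h\<close> is not a zero divisor because \<open>V\<close> is pure
  dimensional (\<open>nonzero_divisor\<close>).  So the products \<open>h f\<close> with \<open>deg f \<le> s\<close> have exactly \<open>m_s\<close> leading
  exponents, none ordinary.  By Dickson's lemma functions \<open>f\<close> realising them can be chosen whose
  coordinates have \<open>l1\<close> norm at most \<open>C ^ (s + 1)\<close>, and norm at most \<open>1\<close> for all but \<open>O(s ^ (m - 1))\<close> of them.
  Hence the product of \<open>T\<close> over those exponents is a lower bound for the determinant up to factors
  without influence on the limit (\<open>vdm_eb_lower\<close>).  The two bounds have the same limit
  (\<open>Ve_root_converges\<close>).
\<close>

section \<open>Exponents, polynomials and the grevlex order\<close>

abbreviation "keys \<equiv> Poly_Mapping.keys"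
abbreviation "lookup \<equiv> Poly_Mapping.lookup"

text \<open>
  The part of a finitely supported function on the indices satisfying \<open>P\<close>; it serves both for
  exponents (cutting off variables) and for polynomials (selecting monomials).
\<close>

definition restr :: "('a \<Rightarrow> bool) \<Rightarrow> ('a \<Rightarrow>\<^sub>0 'b::zero) \<Rightarrow> ('a \<Rightarrow>\<^sub>0 'b)" where
  "restr P f = Poly_Mapping.mapp (\<lambda>x c. if P x then c else 0) f"

lemma lookup_restr [simp]: "lookup (restr P f) x = (if P x then lookup f x else 0)"
  by (auto simp: restr_def lookup_mapp when_def in_keys_iff)

lemma keys_restr [simp]: "keys (restr P f) = {x \<in> keys f. P x}"
  by (auto simp: in_keys_iff split: if_splits)

lemma restr_add: "restr P (f + g) = restr P f + restr P (g :: 'a \<Rightarrow>\<^sub>0 'b::monoid_add)"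
  by (rule poly_mapping_eqI) (simp add: lookup_add)

lemma restr_sum: "restr P (sum f A) = (\<Sum>x\<in>A. restr P (f x :: 'a \<Rightarrow>\<^sub>0 'b::comm_monoid_add))"
  by (rule poly_mapping_eqI) (simp add: lookup_sum)

lemma restr_split: "restr P f + restr (\<lambda>x. \<not> P x) f = (f :: 'a \<Rightarrow>\<^sub>0 'b::monoid_add)"
  by (rule poly_mapping_eqI) (simp add: lookup_add)

lemma keys_nat_add: "keys (\<gamma> + \<delta> :: expo) = keys \<gamma> \<union> keys \<delta>"
  by (auto simp: in_keys_iff lookup_add)

lemma keys_expo_add: "keys (\<gamma> + \<delta> :: expo) \<subseteq> A \<longleftrightarrow> keys \<gamma> \<subseteq> A \<and> keys \<delta> \<subseteq> A"
  by (simp add: keys_nat_add)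

lemma keys_single_subset: "keys (Poly_Mapping.single i (k::nat)) \<subseteq> A \<longleftrightarrow> k = 0 \<or> i \<in> A"
  by (auto simp: in_keys_iff lookup_single when_def)

lemma edeg_superset:
  assumes "finite A" "keys \<gamma> \<subseteq> A"
  shows "edeg \<gamma> = (\<Sum>i\<in>A. lookup \<gamma> i)"
  unfolding edeg_def
  by (rule sum.mono_neutral_left) (use assms in \<open>auto simp: in_keys_iff\<close>)

lemma edeg_add [simp]: "edeg (\<gamma> + \<delta>) = edeg \<gamma> + edeg \<delta>"
proof -
  let ?A = "keys \<gamma> \<union> keys \<delta>"
  have "edeg (\<gamma> + \<delta>) = (\<Sum>i\<in>?A. lookup (\<gamma> + \<delta>) i)"
    by (rule edeg_superset) (auto simp: keys_nat_add)
  also have "\<dots> = (\<Sum>i\<in>?A. lookup \<gamma> i) + (\<Sum>i\<in>?A. lookup \<delta> i)"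
    by (simp add: lookup_add sum.distrib)
  also have "\<dots> = edeg \<gamma> + edeg \<delta>"
    by (simp add: edeg_superset[of ?A])
  finally show ?thesis .
qed

lemma edeg_0 [simp]: "edeg 0 = 0"
  by (simp add: edeg_def)

lemma edeg_single [simp]: "edeg (Poly_Mapping.single i k) = k"
  by (simp add: edeg_def)

lemma lookup_le_edeg: "lookup \<gamma> i \<le> edeg \<gamma>"
  by (cases "i \<in> keys \<gamma>") (auto simp: edeg_def in_keys_iff intro: member_le_sum)

lemma edeg_restr_split: "edeg (restr P \<gamma>) + edeg (restr (\<lambda>i. \<not> P i) \<gamma>) = edeg \<gamma>"
  by (metis edeg_add restr_split)

definition mval :: "(nat \<Rightarrow> complex) \<Rightarrow> expo \<Rightarrow> complex" where
  "mval a \<gamma> = (\<Prod>i\<in>keys \<gamma>. a i ^ lookup \<gamma> i)"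

lemma mval_superset:
  assumes "finite A" "keys \<gamma> \<subseteq> A"
  shows "mval a \<gamma> = (\<Prod>i\<in>A. a i ^ lookup \<gamma> i)"
  unfolding mval_def
  by (rule prod.mono_neutral_left) (use assms in \<open>auto simp: in_keys_iff\<close>)

lemma mval_add: "mval a (\<gamma> + \<delta>) = mval a \<gamma> * mval a \<delta>"
proof -
  let ?A = "keys \<gamma> \<union> keys \<delta>"
  have "mval a (\<gamma> + \<delta>) = (\<Prod>i\<in>?A. a i ^ lookup (\<gamma> + \<delta>) i)"
    by (rule mval_superset) (auto simp: keys_nat_add)
  also have "\<dots> = (\<Prod>i\<in>?A. a i ^ lookup \<gamma> i) * (\<Prod>i\<in>?A. a i ^ lookup \<delta> i)"
    by (simp add: lookup_add power_add prod.distrib)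
  also have "\<dots> = mval a \<gamma> * mval a \<delta>"
    by (simp add: mval_superset[of ?A])
  finally show ?thesis .
qed

lemma mval_0 [simp]: "mval a 0 = 1"
  by (simp add: mval_def)

lemma mval_single [simp]: "mval a (Poly_Mapping.single i k) = a i ^ k"
  by (simp add: mval_def)

lemma mval_eq_0: "i \<in> keys \<gamma> \<Longrightarrow> a i = 0 \<Longrightarrow> mval a \<gamma> = 0"
  by (auto simp: mval_def in_keys_iff)

lemma mval_cong: "(\<And>i. i \<in> keys \<gamma> \<Longrightarrow> a i = b i) \<Longrightarrow> mval a \<gamma> = mval b \<gamma>"
  by (simp add: mval_def)

lemma peval_mval: "peval a f = (\<Sum>\<gamma>\<in>keys f. lookup f \<gamma> * mval a \<gamma>)"
  by (simp add: peval_def mval_def)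

lemma peval_superset:
  assumes "finite A" "keys f \<subseteq> A"
  shows "peval a f = (\<Sum>\<gamma>\<in>A. lookup f \<gamma> * mval a \<gamma>)"
  unfolding peval_mval
  by (rule sum.mono_neutral_left) (use assms in \<open>auto simp: in_keys_iff\<close>)

lemma peval_0 [simp]: "peval a 0 = 0"
  by (simp add: peval_mval)

lemma peval_single [simp]: "peval a (Poly_Mapping.single \<gamma> c) = c * mval a \<gamma>"
  by (simp add: peval_mval)

lemma peval_add [simp]: "peval a (f + g) = peval a f + peval a g"
proof -
  let ?A = "keys f \<union> keys g"
  have "peval a (f + g) = (\<Sum>i\<in>?A. lookup (f + g) i * mval a i)"
    by (rule peval_superset) (use keys_add[of f g] in auto)
  also have "\<dots> = (\<Sum>i\<in>?A. lookup f i * mval a i) + (\<Sum>i\<in>?A. lookup g i * mval a i)"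
    by (simp add: lookup_add distrib_right sum.distrib)
  also have "\<dots> = peval a f + peval a g"
    by (simp add: peval_superset[of ?A])
  finally show ?thesis .
qed

lemma peval_uminus [simp]: "peval a (- f) = - peval a f"
  by (simp add: peval_mval sum_negf)

lemma peval_minus [simp]: "peval a (f - g) = peval a f - peval a g"
  using peval_add[of a f "- g"] by simp

lemma peval_sum [simp]: "peval a (sum f A) = (\<Sum>x\<in>A. peval a (f x))"
  by (induction A rule: infinite_finite_induct) auto

lemma poly_sum_monomials: "(\<Sum>\<gamma>\<in>keys f. Poly_Mapping.single \<gamma> (lookup f \<gamma>)) = f"
  by (rule poly_mapping_eqI)
     (auto simp: lookup_sum lookup_single when_def in_keys_iff sum.delta)

lemma peval_mult [simp]: "peval a (f * g) = peval a f * peval a g"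
proof -
  have "f * g = (\<Sum>\<gamma>\<in>keys f. Poly_Mapping.single \<gamma> (lookup f \<gamma>)) *
                (\<Sum>\<delta>\<in>keys g. Poly_Mapping.single \<delta> (lookup g \<delta>))"
    by (simp only: poly_sum_monomials)
  also have "\<dots> = (\<Sum>\<gamma>\<in>keys f. \<Sum>\<delta>\<in>keys g.
                 Poly_Mapping.single (\<gamma> + \<delta>) (lookup f \<gamma> * lookup g \<delta>))"
    by (simp add: sum_product mult_single)
  finally have "peval a (f * g) = (\<Sum>\<gamma>\<in>keys f. \<Sum>\<delta>\<in>keys g.
                 lookup f \<gamma> * lookup g \<delta> * (mval a \<gamma> * mval a \<delta>))"
    by (simp add: mval_add)
  also have "\<dots> = peval a f * peval a g"
    by (simp add: peval_mval sum_product algebra_simps)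
  finally show ?thesis .
qed

lemma cscale_mult: "cscale c f = Poly_Mapping.single 0 c * f"
  by (simp add: cscale_def mult_map_scale_conv_mult)

lemma peval_cscale [simp]: "peval a (cscale c f) = c * peval a f"
  by (simp add: cscale_mult)

lemma lookup_cscale [simp]: "lookup (cscale c f) \<gamma> = c * lookup f \<gamma>"
  by (simp add: cscale_def Poly_Mapping.map.rep_eq when_def)

lemma keys_cscale: "keys (cscale c f) = (if c = 0 then {} else keys f)"
  by (auto simp: in_keys_iff)

lemma single_eq_cscale: "Poly_Mapping.single \<gamma> c = cscale c (zmon \<gamma>)"
  by (simp add: cscale_mult mult_single)

lemma peval_1 [simp]: "peval a 1 = 1"
  using peval_single[of a 0 1] by simp

lemma peval_power [simp]: "peval a (f ^ k) = peval a f ^ k"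
  by (induction k) auto

lemma lookup_zmon_mult [simp]: "lookup (zmon \<gamma> * f) (\<gamma> + \<delta>) = lookup f \<delta>"
proof -
  have "lookup (zmon \<gamma> * f) (\<gamma> + \<delta>) =
      (\<Sum>\<epsilon>\<in>keys f. lookup (Poly_Mapping.single (\<gamma> + \<epsilon>) (lookup f \<epsilon>)) (\<gamma> + \<delta>))"
    by (subst poly_sum_monomials[of f, symmetric])
       (simp add: sum_distrib_left mult_single lookup_sum)
  also have "\<dots> = lookup f \<delta>"
    by (auto simp: lookup_single when_def sum.delta in_keys_iff)
  finally show ?thesis .
qed

lemma keys_zmon_mult: "keys (zmon \<gamma> * f) = (+) \<gamma> ` keys f"
proof
  show "keys (zmon \<gamma> * f) \<subseteq> (+) \<gamma> ` keys f"
    using keys_mult[of "zmon \<gamma>" f] by auto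
  show "(+) \<gamma> ` keys f \<subseteq> keys (zmon \<gamma> * f)"
    by (auto simp: in_keys_iff)
qed

lemma keys_diff_subset: "keys (f - g :: 'a \<Rightarrow>\<^sub>0 'b::ab_group_add) \<subseteq> keys f \<union> keys g"
  by (auto simp: in_keys_iff lookup_minus)

lemma keys_uminus [simp]: "keys (- f :: 'a \<Rightarrow>\<^sub>0 'b::ab_group_add) = keys f"
  by (auto simp: in_keys_iff)

lemma polys_0 [simp]: "0 \<in> polys A" and polys_1 [simp]: "1 \<in> polys A"
  by (auto simp: polys_def)

lemma polys_single [simp]: "Poly_Mapping.single \<gamma> c \<in> polys A \<longleftrightarrow> c = 0 \<or> keys \<gamma> \<subseteq> A"
  by (auto simp: polys_def)

lemma polys_add: "f \<in> polys A \<Longrightarrow> g \<in> polys A \<Longrightarrow> f + g \<in> polys A"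
  using keys_add[of f g] by (auto simp: polys_def)

lemma polys_diff: "f \<in> polys A \<Longrightarrow> g \<in> polys A \<Longrightarrow> f - g \<in> polys A"
  using keys_diff_subset[of f g] by (auto simp: polys_def)

lemma polys_uminus: "f \<in> polys A \<Longrightarrow> - f \<in> polys A"
  by (auto simp: polys_def)

lemma polys_mult: "f \<in> polys A \<Longrightarrow> g \<in> polys A \<Longrightarrow> f * g \<in> polys A"
  using keys_mult[of f g] by (fastforce simp: polys_def keys_nat_add)

lemma polys_cscale: "f \<in> polys A \<Longrightarrow> cscale c f \<in> polys A"
  by (auto simp: polys_def keys_cscale)

lemma polys_sum: "(\<And>x. x \<in> B \<Longrightarrow> f x \<in> polys A) \<Longrightarrow> sum f B \<in> polys A"
  by (induction B rule: infinite_finite_induct) (auto intro: polys_add)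

lemma polys_power: "f \<in> polys A \<Longrightarrow> f ^ k \<in> polys A"
  by (induction k) (auto intro: polys_mult)

lemma polys_mono: "A \<subseteq> B \<Longrightarrow> f \<in> polys A \<Longrightarrow> f \<in> polys B"
  by (auto simp: polys_def)

text \<open>
  Exponents bounded by \<open>s\<close> in each variable correspond to functions \<open>A \<rightarrow> {..s}\<close>.
\<close>

lemma finite_expo_box:
  assumes "finite A"
  shows "finite {\<gamma> :: expo. keys \<gamma> \<subseteq> A \<and> (\<forall>i. lookup \<gamma> i \<le> s)}"
    and "card {\<gamma> :: expo. keys \<gamma> \<subseteq> A \<and> (\<forall>i. lookup \<gamma> i \<le> s)} = (s + 1) ^ card A"
proof -
  let ?B = "{\<gamma> :: expo. keys \<gamma> \<subseteq> A \<and> (\<forall>i. lookup \<gamma> i \<le> s)}"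
  let ?F = "\<lambda>\<gamma> :: expo. restrict (lookup \<gamma>) A"
  have "bij_betw ?F ?B (PiE A (\<lambda>_. {..s}))"
  proof (rule bij_betw_byWitness[where f' = "\<lambda>f. Abs_poly_mapping (\<lambda>i. if i \<in> A then f i else 0)"])
    show "\<forall>\<gamma>\<in>?B. Abs_poly_mapping (\<lambda>i. if i \<in> A then ?F \<gamma> i else 0) = \<gamma>"
    proof
      fix \<gamma> :: expo assume "\<gamma> \<in> ?B"
      then have "(\<lambda>i. if i \<in> A then ?F \<gamma> i else 0) = lookup \<gamma>"
        by (force simp: fun_eq_iff in_keys_iff subset_iff)
      then show "Abs_poly_mapping (\<lambda>i. if i \<in> A then ?F \<gamma> i else 0) = \<gamma>"
        by simp
    qed
    have fin: "finite {i. (if i \<in> A then f i else 0) \<noteq> 0}" for f :: "nat \<Rightarrow> nat"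
      by (rule finite_subset[OF _ assms]) auto
    have lk: "lookup (Abs_poly_mapping (\<lambda>i. if i \<in> A then f i else 0)) x = (if x \<in> A then f x else 0)"
      for f :: "nat \<Rightarrow> nat" and x
      by (subst lookup_Abs_poly_mapping[OF fin]) rule
    show "\<forall>f\<in>PiE A (\<lambda>_. {..s}). ?F (Abs_poly_mapping (\<lambda>i. if i \<in> A then f i else 0)) = f"
      by (auto simp: lk fun_eq_iff PiE_def extensional_def)
    show "?F ` ?B \<subseteq> PiE A (\<lambda>_. {..s})"
      by auto
    show "(\<lambda>f. Abs_poly_mapping (\<lambda>i. if i \<in> A then f i else 0)) ` PiE A (\<lambda>_. {..s}) \<subseteq> ?B"
      by (auto simp: lk in_keys_iff PiE_def Pi_def split: if_splits)
  qed
  moreover have "finite (PiE A (\<lambda>_. {..s}))" "card (PiE A (\<lambda>_. {..s})) = (s + 1) ^ card A"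
    using assms by (simp_all add: finite_PiE card_PiE)
  ultimately show "finite ?B" "card ?B = (s + 1) ^ card A"
    by (auto simp: bij_betw_finite dest: bij_betw_same_card)
qed

definition expos :: "nat set \<Rightarrow> nat \<Rightarrow> expo set" where
  "expos A s = {\<gamma>. keys \<gamma> \<subseteq> A \<and> edeg \<gamma> \<le> s}"

lemma expos_subset_box: "expos A s \<subseteq> {\<gamma>. keys \<gamma> \<subseteq> A \<and> (\<forall>i. lookup \<gamma> i \<le> s)}"
  using lookup_le_edeg le_trans by (fastforce simp: expos_def)

lemma finite_expos [simp]: "finite A \<Longrightarrow> finite (expos A s)"
  by (rule finite_subset[OF expos_subset_box finite_expo_box(1)])

lemma card_expos_le: "finite A \<Longrightarrow> card (expos A s) \<le> (s + 1) ^ card A"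
  using card_mono[OF finite_expo_box(1) expos_subset_box, of A s] finite_expo_box(2)[of A s] by simp

lemma grevlex_irrefl [simp]: "\<not> grevlex \<gamma> \<gamma>"
  by (auto simp: grevlex_def)

lemma grevlex_trans: "grevlex \<alpha> \<beta> \<Longrightarrow> grevlex \<beta> \<gamma> \<Longrightarrow> grevlex \<alpha> \<gamma>"
proof -
  assume 1: "grevlex \<alpha> \<beta>" and 2: "grevlex \<beta> \<gamma>"
  show ?thesis
  proof (cases "edeg \<alpha> = edeg \<beta> \<and> edeg \<beta> = edeg \<gamma>")
    case True
    then obtain i j where i: "lookup \<alpha> i > lookup \<beta> i" "\<forall>k<i. lookup \<alpha> k = lookup \<beta> k"
      and j: "lookup \<beta> j > lookup \<gamma> j" "\<forall>k<j. lookup \<beta> k = lookup \<gamma> k"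
      using 1 2 by (auto simp: grevlex_def)
    have "lookup \<alpha> (min i j) > lookup \<gamma> (min i j) \<and> (\<forall>k<min i j. lookup \<alpha> k = lookup \<gamma> k)"
      using i j by (cases i j rule: linorder_cases) (auto simp: min_def)
    with True show ?thesis by (auto simp: grevlex_def)
  qed (use 1 2 in \<open>auto simp: grevlex_def\<close>)
qed

lemma grevlex_asym: "grevlex \<alpha> \<beta> \<Longrightarrow> \<not> grevlex \<beta> \<alpha>"
  using grevlex_trans grevlex_irrefl by blast

lemma grevlex_total: "\<alpha> = \<beta> \<or> grevlex \<alpha> \<beta> \<or> grevlex \<beta> \<alpha>"
proof (cases "edeg \<alpha> = edeg \<beta> \<and> \<alpha> \<noteq> \<beta>")
  case True
  then have "\<exists>i. lookup \<alpha> i \<noteq> lookup \<beta> i"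
    by (metis poly_mapping_eqI)
  then obtain i where "lookup \<alpha> i \<noteq> lookup \<beta> i" "\<And>j. j < i \<Longrightarrow> lookup \<alpha> j = lookup \<beta> j"
    using exists_least_iff[of "\<lambda>i. lookup \<alpha> i \<noteq> lookup \<beta> i"] by blast
  then show ?thesis using True
    by (cases "lookup \<alpha> i" "lookup \<beta> i" rule: linorder_cases) (auto simp: grevlex_def)
qed (auto simp: grevlex_def)

lemma grevlex_add: "grevlex (\<alpha> + \<gamma>) (\<beta> + \<gamma>) \<longleftrightarrow> grevlex \<alpha> \<beta>"
  by (simp add: grevlex_def lookup_add)

lemma grevlex_add_left: "grevlex (\<gamma> + \<alpha>) (\<gamma> + \<beta>) \<longleftrightarrow> grevlex \<alpha> \<beta>"
  by (simp add: grevlex_def lookup_add)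

lemma grevlex_edeg: "grevlex \<alpha> \<beta> \<Longrightarrow> edeg \<alpha> \<le> edeg \<beta>"
  by (auto simp: grevlex_def)

lemma finite_grevlex_below:
  "finite A \<Longrightarrow> finite {\<delta>. keys \<delta> \<subseteq> A \<and> grevlex \<delta> \<gamma>}"
  by (rule finite_subset[OF _ finite_expos[of A "edeg \<gamma>"]]) (auto simp: expos_def dest: grevlex_edeg)

text \<open>
  Grevlex compares total degrees first, so an exponent in finitely many variables has only
  finitely many predecessors.
\<close>

lemma grevlex_induct [consumes 2, case_names less]:
  assumes "finite A" "keys \<gamma> \<subseteq> A"
    and step: "\<And>\<gamma>. keys \<gamma> \<subseteq> A \<Longrightarrow> (\<And>\<delta>. keys \<delta> \<subseteq> A \<Longrightarrow> grevlex \<delta> \<gamma> \<Longrightarrow> P \<delta>) \<Longrightarrow> P \<gamma>"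
  shows "P \<gamma>"
  using assms(2)
proof (induction "card {\<delta>. keys \<delta> \<subseteq> A \<and> grevlex \<delta> \<gamma>}" arbitrary: \<gamma> rule: less_induct)
  case less
  show ?case
  proof (rule step[OF less.prems])
    fix \<delta> assume \<delta>: "keys \<delta> \<subseteq> A" "grevlex \<delta> \<gamma>"
    have "{\<epsilon>. keys \<epsilon> \<subseteq> A \<and> grevlex \<epsilon> \<delta>} \<subset> {\<epsilon>. keys \<epsilon> \<subseteq> A \<and> grevlex \<epsilon> \<gamma>}"
      using \<delta> grevlex_trans[of _ \<delta> \<gamma>] grevlex_irrefl[of \<delta>] by blast
    then show "P \<delta>"
      using less.hyps[OF _ \<delta>(1)] psubset_card_mono[OF finite_grevlex_below[OF assms(1)]] by blast
  qed
qed

lemma finite_has_grevlex_max: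
  assumes "finite S" "S \<noteq> {}"
  obtains \<gamma> where "\<gamma> \<in> S" "\<And>\<delta>. \<delta> \<in> S \<Longrightarrow> \<delta> \<noteq> \<gamma> \<Longrightarrow> grevlex \<delta> \<gamma>"
proof -
  have "\<exists>\<gamma>\<in>S. \<forall>\<delta>\<in>S. \<delta> \<noteq> \<gamma> \<longrightarrow> grevlex \<delta> \<gamma>"
    using assms
  proof (induction S rule: finite_ne_induct)
    case (insert x S)
    then obtain \<gamma> where "\<gamma> \<in> S" "\<forall>\<delta>\<in>S. \<delta> \<noteq> \<gamma> \<longrightarrow> grevlex \<delta> \<gamma>" by blast
    then show ?case
      using grevlex_total[of x \<gamma>] grevlex_trans by (metis insert_iff)
  qed auto
  then show thesis using that by blast
qed

text \<open>
  A relational form of \<open>lead_expo\<close>, free of the description operator.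
\<close>

definition is_lead :: "cpoly \<Rightarrow> expo \<Rightarrow> bool" where
  "is_lead f \<gamma> \<longleftrightarrow> \<gamma> \<in> keys f \<and> (\<forall>\<delta>\<in>keys f. \<delta> \<noteq> \<gamma> \<longrightarrow> grevlex \<delta> \<gamma>)"

lemma is_lead_lead_expo:
  assumes "is_lead f \<gamma>" shows "lead_expo f = \<gamma>"
  unfolding lead_expo_def
proof (rule the_equality)
  show "\<gamma> \<in> keys f \<and> (\<forall>\<delta>\<in>keys f. \<delta> \<noteq> \<gamma> \<longrightarrow> grevlex \<delta> \<gamma>)"
    using assms by (simp add: is_lead_def)
  show "\<And>x. x \<in> keys f \<and> (\<forall>\<delta>\<in>keys f. \<delta> \<noteq> x \<longrightarrow> grevlex \<delta> x) \<Longrightarrow> x = \<gamma>"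
    using assms grevlex_asym by (metis is_lead_def)
qed

lemma ex_is_lead: "f \<noteq> 0 \<Longrightarrow> \<exists>\<gamma>. is_lead f \<gamma>"
  using finite_has_grevlex_max[of "keys f"] unfolding is_lead_def
  by (metis finite_keys keys_eq_empty)

lemma is_lead_expo: "f \<noteq> 0 \<Longrightarrow> is_lead f (lead_expo f)"
  using ex_is_lead is_lead_lead_expo by metis

lemma is_lead_zmon_mult: "is_lead f \<gamma> \<Longrightarrow> is_lead (zmon \<delta> * f) (\<delta> + \<gamma>)"
  by (auto simp: is_lead_def keys_zmon_mult grevlex_add_left)

lemma pdeg_ge: "\<gamma> \<in> keys f \<Longrightarrow> edeg \<gamma> \<le> pdeg f"
  by (auto simp: pdeg_def)

lemma pdeg_is_lead: "is_lead f \<gamma> \<Longrightarrow> pdeg f = edeg \<gamma>"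
  unfolding pdeg_def is_lead_def by (auto intro!: Max_eqI dest: grevlex_edeg)

lemma pdeg_homog: "f \<in> homog A s \<Longrightarrow> f \<noteq> 0 \<Longrightarrow> pdeg f = s"
  using is_lead_expo[of f] pdeg_is_lead[of f] by (auto simp: homog_def is_lead_def)

section \<open>Normal forms and forms at infinity\<close>

declare One_nat_def [simp del]

lemma keys_lin_comb:
  "keys (\<Sum>\<gamma>\<in>A. cscale (c \<gamma>) (R \<gamma>)) \<subseteq> (\<Union>\<gamma>\<in>A. keys (R \<gamma>))"
  by (rule order_trans[OF keys_sum]) (auto simp: keys_cscale split: if_splits)

lemma poly_sum_zmon: "f = (\<Sum>\<gamma>\<in>keys f. cscale (lookup f \<gamma>) (zmon \<gamma>))"
  by (subst (1) poly_sum_monomials[of f, symmetric]) (simp only: single_eq_cscale[symmetric])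

lemma ideal_gen_0: "0 \<in> ideal_gen A S"
  by (auto simp: ideal_gen_def intro!: exI[of _ "{}"])

lemma ideal_gen_base: "q \<in> polys A \<Longrightarrow> g \<in> S \<Longrightarrow> q * g \<in> ideal_gen A S"
  unfolding ideal_gen_def by (rule CollectI, rule exI[of _ "{g}"], rule exI[of _ "\<lambda>_. q"]) auto

lemma ideal_gen_add:
  assumes "f \<in> ideal_gen A S" "g \<in> ideal_gen A S" shows "f + g \<in> ideal_gen A S"
proof -
  obtain T q where T: "f = (\<Sum>g\<in>T. q g * g)" "finite T" "T \<subseteq> S" "\<forall>g\<in>T. q g \<in> polys A"
    using assms(1) by (auto simp: ideal_gen_def)
  obtain T' q' where T': "g = (\<Sum>g\<in>T'. q' g * g)" "finite T'" "T' \<subseteq> S" "\<forall>g\<in>T'. q' g \<in> polys A"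
    using assms(2) by (auto simp: ideal_gen_def)
  define Q where "Q h = (if h \<in> T then q h else 0) + (if h \<in> T' then q' h else 0)" for h
  have e1: "(\<Sum>h\<in>T \<union> T'. (if h \<in> T then q h else 0) * h) = f"
    unfolding T(1) by (rule sum.mono_neutral_cong_right) (use T T' in auto)
  have e2: "(\<Sum>h\<in>T \<union> T'. (if h \<in> T' then q' h else 0) * h) = g"
    unfolding T'(1) by (rule sum.mono_neutral_cong_right) (use T T' in auto)
  have "f + g = (\<Sum>h\<in>T \<union> T'. Q h * h)"
    by (simp only: Q_def distrib_right sum.distrib e1 e2)
  then show ?thesis
    unfolding ideal_gen_def using T T'
    by (intro CollectI exI[of _ "T \<union> T'"] exI[of _ Q]) (auto simp: Q_def intro!: polys_add)
qed

lemma ideal_gen_mult: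
  assumes "f \<in> ideal_gen A S" "p \<in> polys A" shows "p * f \<in> ideal_gen A S"
proof -
  obtain T q where T: "f = (\<Sum>g\<in>T. q g * g)" "finite T" "T \<subseteq> S" "\<forall>g\<in>T. q g \<in> polys A"
    using assms(1) by (auto simp: ideal_gen_def)
  then have "p * f = (\<Sum>g\<in>T. (p * q g) * g)"
    by (simp add: sum_distrib_left mult.assoc)
  with T assms(2) show ?thesis
    unfolding ideal_gen_def
    by (intro CollectI exI[of _ T] exI[of _ "\<lambda>g. p * q g"]) (auto intro!: polys_mult)
qed

lemma homogenize_homog: "f \<in> polys {1..n} \<Longrightarrow> homogenize f \<in> homog {0..n} (pdeg f)"
proof -
  assume f: "f \<in> polys {1..n}"
  have "keys (homogenize f) \<subseteq> (\<lambda>\<gamma>. Poly_Mapping.single 0 (pdeg f - edeg \<gamma>) + \<gamma>) ` keys f"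
    unfolding homogenize_def by (rule order_trans[OF keys_sum]) (auto split: if_splits)
  then show ?thesis
    using f pdeg_ge[of _ f] 
    by (fastforce simp: homog_def polys_def keys_nat_add keys_single_subset split: if_splits)
qed

lemma peval_homogenize:
  assumes "f \<in> polys {1..n}" shows "peval (a(0 := 1)) (homogenize f) = peval a f"
proof -
  have "mval (a(0 := 1)) \<gamma> = mval a \<gamma>" if "\<gamma> \<in> keys f" for \<gamma>
    using assms that by (intro mval_cong) (fastforce simp: polys_def)
  then show ?thesis
    by (simp add: homogenize_def peval_mval[of a f] mval_add)
qed

text \<open>
  For polynomials in \<open>z_1, ..., z_n\<close> this is congruence modulo the ideal of \<open>V\<close>.
\<close>

definition eqV :: "(nat \<Rightarrow> complex) set \<Rightarrow> cpoly \<Rightarrow> cpoly \<Rightarrow> bool" where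
  "eqV V f g \<longleftrightarrow> (\<forall>a\<in>V. peval a f = peval a g)"

lemma eqV_lin_comb:
  assumes "\<And>\<gamma>. \<gamma> \<in> keys f \<Longrightarrow> eqV V (zmon \<gamma>) (R \<gamma>)"
  shows "eqV V f (\<Sum>\<gamma>\<in>keys f. cscale (lookup f \<gamma>) (R \<gamma>))"
  using assms by (auto simp: eqV_def peval_mval[of _ f] intro!: sum.cong)

definition std_expos :: "nat \<Rightarrow> cpoly set \<Rightarrow> expo set" where
  "std_expos n I = {\<gamma>. keys \<gamma> \<subseteq> {1..n} \<and> zmon \<gamma> \<notin> LT_ideal n I}"

locale affine_variety =
  fixes n :: nat and V :: "(nat \<Rightarrow> complex) set" and I :: "cpoly set"
  assumes I_def: "I = vanishing_ideal n V"
begin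

abbreviation Std :: "expo set" where "Std \<equiv> std_expos n I"

lemma I_iff: "f \<in> I \<longleftrightarrow> f \<in> polys {1..n} \<and> eqV V f 0"
  by (auto simp: I_def vanishing_ideal_def eqV_def)

lemma I_diff_iff: "f \<in> polys {1..n} \<Longrightarrow> g \<in> polys {1..n} \<Longrightarrow> f - g \<in> I \<longleftrightarrow> eqV V f g"
  by (auto simp: I_iff eqV_def polys_diff)

lemma Std_keys: "\<gamma> \<in> Std \<Longrightarrow> keys \<gamma> \<subseteq> {1..n}"
  by (simp add: std_expos_def)

lemma normal_forms_iff: "r \<in> normal_forms n I \<longleftrightarrow> keys r \<subseteq> Std"
  by (auto simp: normal_forms_def std_expos_def polys_def)

lemma Std_polys: "keys r \<subseteq> Std \<Longrightarrow> r \<in> polys {1..n}"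
  using Std_keys by (auto simp: polys_def)

lemma I_zmon_mult: "f \<in> I \<Longrightarrow> keys \<delta> \<subseteq> {1..n} \<Longrightarrow> zmon \<delta> * f \<in> I"
  by (auto simp: I_iff eqV_def intro!: polys_mult)

lemma is_lead_not_Std:
  assumes "f \<in> I" "is_lead f \<gamma>" shows "\<gamma> \<notin> Std"
proof
  assume "\<gamma> \<in> Std"
  let ?c = "lookup f \<gamma>"
  have nz: "f \<noteq> 0" "?c \<noteq> 0" using assms(2) by (auto simp: is_lead_def in_keys_iff)
  have "lead_term f = Poly_Mapping.single \<gamma> ?c"
    using is_lead_lead_expo[OF assms(2)] by (simp add: lead_term_def)
  then have "Poly_Mapping.single 0 (inverse ?c) * lead_term f = zmon \<gamma>"
    using nz by (simp add: mult_single)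
  moreover have "Poly_Mapping.single 0 (inverse ?c) * lead_term f \<in> LT_ideal n I"
    unfolding LT_ideal_def by (rule ideal_gen_base) (use assms nz in auto)
  ultimately show False using \<open>\<gamma> \<in> Std\<close> by (simp add: std_expos_def)
qed

text \<open>
  An exponent in the monomial ideal of leading terms is itself a leading exponent of an element of
  \<open>I\<close>: it is a multiple of one, and grevlex is compatible with multiplication.
\<close>

lemma not_Std_is_lead:
  assumes "keys \<gamma> \<subseteq> {1..n}" "\<gamma> \<notin> Std"
  shows "\<exists>f\<in>I. is_lead f \<gamma>"
proof -
  have "zmon \<gamma> \<in> LT_ideal n I" using assms by (simp add: std_expos_def)
  then obtain T q where T: "zmon \<gamma> = (\<Sum>g\<in>T. q g * g)" "finite T" "T \<subseteq> lead_term ` (I - {0})"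
    "\<forall>g\<in>T. q g \<in> polys {1..n}"
    unfolding LT_ideal_def ideal_gen_def by blast
  have "\<gamma> \<in> keys (zmon \<gamma>)" by simp
  then obtain g where g: "g \<in> T" "\<gamma> \<in> keys (q g * g)"
    unfolding T(1) using keys_sum[of "\<lambda>g. q g * g" T] by blast
  obtain f where f: "f \<in> I" "f \<noteq> 0" "g = lead_term f" using T(3) g(1) by blast
  have "keys g \<subseteq> {lead_expo f}" by (simp add: f(3) lead_term_def)
  obtain \<delta> \<epsilon> where "\<delta> \<in> keys (q g)" "\<epsilon> \<in> keys g" "\<gamma> = \<delta> + \<epsilon>"
    using g(2) keys_mult[of "q g" g] by blast
  then have \<delta>: "\<delta> \<in> keys (q g)" "\<gamma> = \<delta> + lead_expo f"
    using \<open>keys g \<subseteq> {lead_expo f}\<close> by auto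
  have "keys \<delta> \<subseteq> {1..n}" using \<delta>(1) T(4) g(1) by (auto simp: polys_def)
  then have "zmon \<delta> * f \<in> I" "is_lead (zmon \<delta> * f) \<gamma>"
    using f is_lead_zmon_mult[OF is_lead_expo[OF f(2)]] \<delta>(2) I_zmon_mult by auto
  then show ?thesis by blast
qed

text \<open>
  Standard exponents are closed under division, leading exponents being closed under multiples.
\<close>

lemma Std_divisor:
  assumes "\<gamma> + \<delta> \<in> Std" shows "\<gamma> \<in> Std"
proof (rule ccontr)
  assume "\<gamma> \<notin> Std"
  have k: "keys \<gamma> \<subseteq> {1..n}" "keys \<delta> \<subseteq> {1..n}"
    using Std_keys[OF assms] by (simp_all add: keys_expo_add)
  obtain f where f: "f \<in> I" "is_lead f \<gamma>" using not_Std_is_lead[OF k(1) \<open>\<gamma> \<notin> Std\<close>] by blast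
  have "\<delta> + \<gamma> \<notin> Std"
    using is_lead_not_Std[OF I_zmon_mult[OF f(1) k(2)] is_lead_zmon_mult[OF f(2)]] .
  with assms show False by (simp add: add.commute)
qed

lemma not_Std_reduce:
  assumes "keys \<gamma> \<subseteq> {1..n}" "\<gamma> \<notin> Std"
  shows "\<exists>r\<in>polys {1..n}. (\<forall>\<delta>\<in>keys r. grevlex \<delta> \<gamma>) \<and> eqV V (zmon \<gamma>) r"
proof -
  obtain f where f: "f \<in> I" "is_lead f \<gamma>" using not_Std_is_lead[OF assms] by blast
  let ?c = "lookup f \<gamma>"
  have c: "?c \<noteq> 0" using f(2) by (auto simp: is_lead_def in_keys_iff)
  define r where "r = zmon \<gamma> - cscale (inverse ?c) f"
  have "r \<in> polys {1..n}" using assms(1) f(1) by (auto simp: r_def I_iff intro!: polys_diff polys_cscale)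
  moreover have "\<forall>\<delta>\<in>keys r. grevlex \<delta> \<gamma>"
  proof
    fix \<delta> assume \<delta>: "\<delta> \<in> keys r"
    have "\<delta> \<noteq> \<gamma>" using \<delta> c by (auto simp: r_def in_keys_iff lookup_minus)
    moreover have "\<delta> \<in> keys f" using \<delta> \<open>\<delta> \<noteq> \<gamma>\<close>
      by (auto simp: r_def in_keys_iff lookup_minus lookup_single)
    ultimately show "grevlex \<delta> \<gamma>" using f(2) by (auto simp: is_lead_def)
  qed
  moreover have "eqV V (zmon \<gamma>) r" using f(1) by (auto simp: r_def I_iff eqV_def)
  ultimately show ?thesis by blast
qed

lemma reduce_zmon:
  assumes "keys \<gamma> \<subseteq> {1..n}"
  shows "\<exists>r. keys r \<subseteq> {\<delta>\<in>Std. \<delta> = \<gamma> \<or> grevlex \<delta> \<gamma>} \<and> eqV V (zmon \<gamma>) r"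
  using finite_atLeastAtMost[of 1 n] assms
proof (induction \<gamma> rule: grevlex_induct)
  case (less \<gamma>)
  show ?case
  proof (cases "\<gamma> \<in> Std")
    case True
    then show ?thesis by (intro exI[of _ "zmon \<gamma>"]) (auto simp: eqV_def)
  next
    case False
    then obtain r where r: "r \<in> polys {1..n}" "\<forall>\<delta>\<in>keys r. grevlex \<delta> \<gamma>" "eqV V (zmon \<gamma>) r"
      using not_Std_reduce less.hyps by blast
    have "\<forall>\<delta>\<in>keys r. \<exists>r'. keys r' \<subseteq> {\<epsilon>\<in>Std. \<epsilon> = \<delta> \<or> grevlex \<epsilon> \<delta>} \<and> eqV V (zmon \<delta>) r'"
      by (intro ballI less.IH) (use r in \<open>auto simp: polys_def\<close>)
    from bchoice[OF this] obtain R where R: "\<forall>\<delta>\<in>keys r. keys (R \<delta>) \<subseteq> {\<epsilon>\<in>Std. \<epsilon> = \<delta> \<or> grevlex \<epsilon> \<delta>} \<and> eqV V (zmon \<delta>) (R \<delta>)" ..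
    let ?r = "\<Sum>\<delta>\<in>keys r. cscale (lookup r \<delta>) (R \<delta>)"
    have "keys ?r \<subseteq> {\<delta>\<in>Std. \<delta> = \<gamma> \<or> grevlex \<delta> \<gamma>}"
    proof
      fix \<epsilon> assume "\<epsilon> \<in> keys ?r"
      then obtain \<delta> where "\<delta> \<in> keys r" "\<epsilon> \<in> keys (R \<delta>)"
        using keys_lin_comb[of "lookup r" R "keys r"] by blast
      then have "\<epsilon> \<in> Std" "\<epsilon> = \<delta> \<or> grevlex \<epsilon> \<delta>" "grevlex \<delta> \<gamma>" using R r(2) by blast+
      then show "\<epsilon> \<in> {\<delta>\<in>Std. \<delta> = \<gamma> \<or> grevlex \<delta> \<gamma>}" using grevlex_trans by blast
    qed
    moreover have "eqV V r ?r" by (rule eqV_lin_comb) (use R in blast)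
    then have "eqV V (zmon \<gamma>) ?r" using r(3) by (simp add: eqV_def)
    ultimately show ?thesis by blast
  qed
qed

text \<open>
  Division with remainder by the leading terms, keeping track of the fact that no monomial of
  the remainder exceeds all monomials of \<open>f\<close>.
\<close>

lemma reduce_poly:
  assumes "f \<in> polys {1..n}"
  obtains r where "keys r \<subseteq> Std" "\<And>\<delta>. \<delta> \<in> keys r \<Longrightarrow> \<exists>\<gamma>\<in>keys f. \<delta> = \<gamma> \<or> grevlex \<delta> \<gamma>" "eqV V f r"
proof -
  have "\<forall>\<gamma>\<in>keys f. \<exists>r. keys r \<subseteq> {\<delta>\<in>Std. \<delta> = \<gamma> \<or> grevlex \<delta> \<gamma>} \<and> eqV V (zmon \<gamma>) r"
    by (intro ballI reduce_zmon) (use assms in \<open>auto simp: polys_def\<close>)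
  from bchoice[OF this] obtain R where R: "\<forall>\<gamma>\<in>keys f. keys (R \<gamma>) \<subseteq> {\<delta>\<in>Std. \<delta> = \<gamma> \<or> grevlex \<delta> \<gamma>} \<and> eqV V (zmon \<gamma>) (R \<gamma>)" ..
  let ?r = "\<Sum>\<gamma>\<in>keys f. cscale (lookup f \<gamma>) (R \<gamma>)"
  have k: "keys ?r \<subseteq> (\<Union>\<gamma>\<in>keys f. {\<delta>\<in>Std. \<delta> = \<gamma> \<or> grevlex \<delta> \<gamma>})"
    by (rule order_trans[OF keys_lin_comb]) (use R in blast)
  show thesis
  proof (rule that)
    show "keys ?r \<subseteq> Std" using k by blast
    show "\<exists>\<gamma>\<in>keys f. \<delta> = \<gamma> \<or> grevlex \<delta> \<gamma>" if "\<delta> \<in> keys ?r" for \<delta> using k that by blast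
    show "eqV V f ?r" by (rule eqV_lin_comb) (use R in blast)
  qed
qed

text \<open>
  Standard monomials are linearly independent as functions on \<open>V\<close>, since a nontrivial relation would
  have a standard leading exponent.
\<close>

lemma Std_eqV_0:
  assumes "keys r \<subseteq> Std" "eqV V r 0" shows "r = 0"
proof (rule ccontr)
  assume "r \<noteq> 0"
  then have l: "is_lead r (lead_expo r)" by (rule is_lead_expo)
  moreover have "r \<in> I" using assms by (simp add: I_iff Std_polys)
  ultimately show False using is_lead_not_Std assms(1) by (auto simp: is_lead_def)
qed

lemma nf_id: assumes "r \<in> normal_forms n I" shows "nf n I r = r"
  unfolding nf_def
proof (rule the_equality)
  have r: "r \<in> polys {1..n}" "keys r \<subseteq> Std" using assms normal_forms_iff Std_polys by auto
  show "r \<in> normal_forms n I \<and> r - r \<in> I" using assms by (simp add: I_iff eqV_def)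
  fix r' assume r': "r' \<in> normal_forms n I \<and> r - r' \<in> I"
  then have "keys (r - r') \<subseteq> Std" using r(2) keys_diff_subset[of r r'] by (auto simp: normal_forms_iff)
  then have "r - r' = 0" using r' Std_eqV_0[of "r - r'"] by (auto simp: I_iff)
  then show "r' = r" by simp
qed

text \<open>
  The ideal of the part of the projective closure on \<open>z_0 = ... = z_{k-1} = 0\<close>: for \<open>k = 1\<close> the part at
  infinity, for \<open>k = m\<close> the points \<open>p_i\<close>.
\<close>

definition Jdl :: "nat \<Rightarrow> cpoly set" where
  "Jdl k = homog_ideal n I + ideal_gen {0..n} (zvar ` {0..<k})"

lemma restr_homog: "f \<in> homog A s \<Longrightarrow> restr (\<lambda>\<gamma>. edeg \<gamma> = s) f = f"
  by (rule poly_mapping_eqI) (auto simp: homog_def in_keys_iff)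

lemma restr_single_mult:
  assumes "g \<in> homog A e"
  shows "restr (\<lambda>\<gamma>. edeg \<gamma> = s) (Poly_Mapping.single \<gamma> c * g) =
    (if edeg \<gamma> + e = s then Poly_Mapping.single \<gamma> c * g else 0)"
proof -
  have k: "edeg \<delta> = edeg \<gamma> + e" if "\<delta> \<in> keys (Poly_Mapping.single \<gamma> c * g)" for \<delta>
    using that keys_mult[of "Poly_Mapping.single \<gamma> c" g] assms 
    by (fastforce simp: homog_def split: if_splits)
  show ?thesis
  proof (cases "edeg \<gamma> + e = s")
    case True
    then show ?thesis using k by (intro poly_mapping_eqI) (auto simp: in_keys_iff)
  next
    case False
    then have "edeg \<delta> \<noteq> s" if "\<delta> \<in> keys (Poly_Mapping.single \<gamma> c * g)" for \<delta>
      using k[OF that] by simp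
    with False show ?thesis by (intro poly_mapping_eqI) (auto simp: in_keys_iff)
  qed
qed

text \<open>
  Homogenisations are homogeneous, so the graded parts of an element of \<open>I^h\<close> lie in \<open>I^h\<close>; setting
  \<open>z_0 = 1\<close> returns to \<open>I\<close>.
\<close>

lemma peval_restr_homog_ideal:
  assumes "f \<in> homog_ideal n I" "a \<in> V"
  shows "peval (a(0 := 1)) (restr (\<lambda>\<gamma>. edeg \<gamma> = s) f) = 0"
proof -
  obtain T q where T: "f = (\<Sum>g\<in>T. q g * g)" "finite T" "T \<subseteq> homogenize ` I"
    using assms(1) unfolding homog_ideal_def ideal_gen_def by blast
  have "peval (a(0 := 1)) (restr (\<lambda>\<gamma>. edeg \<gamma> = s) (q g * g)) = 0" if "g \<in> T" for g
  proof -
    obtain f' where f': "f' \<in> I" "g = homogenize f'" using T(3) \<open>g \<in> T\<close> by blast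
    have g: "g \<in> homog {0..n} (pdeg f')" "peval (a(0 := 1)) g = 0"
      using f' homogenize_homog[of f' n] peval_homogenize[of f' n a] assms(2) by (auto simp: I_iff eqV_def)
    have "restr (\<lambda>\<gamma>. edeg \<gamma> = s) (q g * g) =
      (\<Sum>\<gamma>\<in>keys (q g). restr (\<lambda>\<gamma>. edeg \<gamma> = s) (Poly_Mapping.single \<gamma> (lookup (q g) \<gamma>) * g))"
      by (subst poly_sum_monomials[of "q g", symmetric]) (simp only: sum_distrib_right restr_sum)
    then show ?thesis by (simp add: restr_single_mult[OF g(1)] g(2) if_distrib cong: if_cong)
  qed
  then show ?thesis by (simp add: T(1) restr_sum)
qed

text \<open>
  What membership of a form in \<open>I^h + (z_0, ..., z_{k-1})\<close> means on the affine variety.  Setting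
  \<open>z_0 = 1\<close> kills \<open>I^h\<close> on \<open>V\<close>, turns multiples of \<open>z_0\<close> into terms of lower degree and leaves
  monomials divisible by one of \<open>z_1, ..., z_{k-1}\<close>.
\<close>

lemma kernel_transfer:
  assumes f: "f \<in> homog {1..n} s" and J: "f \<in> Jdl k" and k: "k \<le> Suc n"
  obtains g where "g \<in> polys {1..n}" "eqV V f g"
    "\<And>\<delta>. \<delta> \<in> keys g \<Longrightarrow> edeg \<delta> < s \<or> edeg \<delta> = s \<and> (\<exists>i\<in>{1..<k}. lookup \<delta> i > 0)"
proof -
  obtain A B where AB: "f = A + B" "A \<in> homog_ideal n I" "B \<in> ideal_gen {0..n} (zvar ` {0..<k})"
    using J by (auto simp: Jdl_def set_plus_def)
  obtain T q where T: "B = (\<Sum>g\<in>T. q g * g)" "finite T" "T \<subseteq> zvar ` {0..<k}" "\<forall>g\<in>T. q g \<in> polys {0..n}"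
    using AB(3) unfolding ideal_gen_def by blast
  define G where "G = restr (\<lambda>\<gamma>. edeg \<gamma> = s) B"
  have fG: "f = restr (\<lambda>\<gamma>. edeg \<gamma> = s) A + G"
    using restr_homog[OF f] by (simp add: AB(1) restr_add G_def)
  have Gk: "edeg \<gamma> = s \<and> (\<exists>i\<in>{0..<k}. lookup \<gamma> i > 0)" "keys (restr (\<lambda>i. i \<noteq> 0) \<gamma>) \<subseteq> {1..n}" if \<gamma>: "\<gamma> \<in> keys G" for \<gamma>
  proof -
    have "\<gamma> \<in> keys B" "edeg \<gamma> = s" using \<gamma> by (auto simp: G_def)
    then obtain g where g: "g \<in> T" "\<gamma> \<in> keys (q g * g)"
      unfolding T(1) using keys_sum[of "\<lambda>g. q g * g" T] by blast
    then obtain i where i: "i < k" "g = zvar i" using T(3) by auto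
    then obtain \<delta> where "\<delta> \<in> keys (q g)" "\<gamma> = \<delta> + Poly_Mapping.single i 1"
      using g(2) keys_mult[of "q g" g] by auto
    moreover have "keys \<delta> \<subseteq> {0..n}" if "\<delta> \<in> keys (q g)" for \<delta>
      using T(4) g(1) that by (auto simp: polys_def)
    ultimately show "edeg \<gamma> = s \<and> (\<exists>i\<in>{0..<k}. lookup \<gamma> i > 0)" 
      using i \<open>edeg \<gamma> = s\<close> by (auto simp: lookup_add intro!: bexI[of _ i])
    have "B \<in> polys {0..n}"
      unfolding T(1)
    proof (intro polys_sum polys_mult)
      fix g assume "g \<in> T"
      then show "q g \<in> polys {0..n}" "g \<in> polys {0..n}"
        using T(3,4) k by (auto simp: keys_single_subset)
    qed
    then have "keys \<gamma> \<subseteq> {0..n}" using \<open>\<gamma> \<in> keys B\<close> by (auto simp: polys_def)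
    then show "keys (restr (\<lambda>i. i \<noteq> 0) \<gamma>) \<subseteq> {1..n}"
      by (auto simp: Suc_le_eq)
  qed
  define dh where "dh = (\<lambda>\<gamma>::expo. restr (\<lambda>i. i \<noteq> 0) \<gamma>)"
  define g where "g = (\<Sum>\<gamma>\<in>keys G. cscale (lookup G \<gamma>) (zmon (dh \<gamma>)))"
  have kg: "\<exists>\<gamma>\<in>keys G. \<delta> = dh \<gamma>" if "\<delta> \<in> keys g" for \<delta>
    using that keys_lin_comb[of "lookup G" "\<lambda>\<gamma>. zmon (dh \<gamma>)" "keys G"] by (auto simp: g_def)
  show thesis
  proof (rule that[of g])
    show "g \<in> polys {1..n}"
      unfolding g_def dh_def by (intro polys_sum polys_cscale) (use Gk(2) in auto)
    show "eqV V f g"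
      unfolding eqV_def
    proof
      fix a assume a: "a \<in> V"
      have m: "mval (a(0 := 1)) \<gamma> = mval a (dh \<gamma>)" for \<gamma>
      proof -
        have "mval (a(0 := 1)) (restr (\<lambda>i. \<not> i \<noteq> 0) \<gamma>) = 1"
          unfolding mval_def by (rule prod.neutral) auto
        moreover have "mval (a(0 := 1)) (dh \<gamma>) = mval a (dh \<gamma>)"
          by (rule mval_cong) (auto simp: dh_def)
        ultimately show ?thesis
          using mval_add[of "a(0 := 1)" "dh \<gamma>" "restr (\<lambda>i. \<not> i \<noteq> 0) \<gamma>"]
          unfolding dh_def restr_split by simp
      qed
      have "peval a f = peval (a(0 := 1)) f"
        unfolding peval_mval using f by (intro sum.cong refl arg_cong2[where f = "(*)"] mval_cong)
          (fastforce simp: homog_def polys_def)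
      also have "\<dots> = peval (a(0 := 1)) G"
        by (subst fG) (simp add: peval_restr_homog_ideal[OF AB(2) a])
      also have "\<dots> = peval a g"
        by (simp add: g_def peval_mval[of _ G] m)
      finally show "peval a f = peval a g" .
    qed
    fix \<delta> assume "\<delta> \<in> keys g"
    then obtain \<gamma> where \<gamma>: "\<gamma> \<in> keys G" "\<delta> = dh \<gamma>" using kg by blast
    obtain i where i: "i < k" "lookup \<gamma> i > 0" "edeg \<gamma> = s" using Gk(1)[OF \<gamma>(1)] by auto
    have e: "edeg \<delta> + edeg (restr (\<lambda>i. \<not> i \<noteq> 0) \<gamma>) = s"
      using edeg_restr_split[of "\<lambda>i. i \<noteq> 0" \<gamma>] i by (simp add: \<gamma>(2) dh_def)
    show "edeg \<delta> < s \<or> edeg \<delta> = s \<and> (\<exists>i\<in>{1..<k}. lookup \<delta> i > 0)"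
    proof (cases "lookup \<gamma> 0 = 0")
      case True
      then have "i \<noteq> 0" using i(2) by (metis less_irrefl)
      moreover have "edeg (restr (\<lambda>i. \<not> i \<noteq> 0) \<gamma>) = 0"
        using True by (auto simp: edeg_def)
      moreover have "i \<in> {1..<k}" using i \<open>i \<noteq> 0\<close> by (simp add: One_nat_def)
      ultimately show ?thesis using i e by (auto simp: \<gamma>(2) dh_def intro!: bexI[of _ i])
    next
      case False
      then have "edeg (restr (\<lambda>i. \<not> i \<noteq> 0) \<gamma>) > 0"
        using lookup_le_edeg[of "restr (\<lambda>i. \<not> i \<noteq> 0) \<gamma>" 0] by simp
      then show ?thesis using e by auto
    qed
  qed
qed

lemma Jdl_add: "f \<in> Jdl k \<Longrightarrow> g \<in> Jdl k \<Longrightarrow> f + g \<in> Jdl k"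
proof -
  assume "f \<in> Jdl k" "g \<in> Jdl k"
  then obtain a b c d where "f = a + b" "g = c + d" "a \<in> homog_ideal n I" "c \<in> homog_ideal n I"
    "b \<in> ideal_gen {0..n} (zvar ` {0..<k})" "d \<in> ideal_gen {0..n} (zvar ` {0..<k})"
    by (auto simp: Jdl_def set_plus_def)
  then have "f + g = (a + c) + (b + d)" "a + c \<in> homog_ideal n I" "b + d \<in> ideal_gen {0..n} (zvar ` {0..<k})"
    by (auto simp: homog_ideal_def ideal_gen_add)
  then show ?thesis unfolding Jdl_def by (simp only: set_plus_intro)
qed

lemma Jdl_mult: "f \<in> Jdl k \<Longrightarrow> p \<in> polys {0..n} \<Longrightarrow> p * f \<in> Jdl k"
  by (auto simp: Jdl_def set_plus_def distrib_left homog_ideal_def intro!: bexI ideal_gen_mult)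

lemma Jdl_cscale: "f \<in> Jdl k \<Longrightarrow> cscale c f \<in> Jdl k"
  by (simp add: cscale_mult Jdl_mult)

lemma Jdl_diff: "f \<in> Jdl k \<Longrightarrow> g \<in> Jdl k \<Longrightarrow> f - g \<in> Jdl k"
  using Jdl_add[of f k "- g"] Jdl_mult[of g k "- 1"] polys_uminus[OF polys_1, of "{0..n}"] by simp

lemma Jdl_0: "0 \<in> Jdl k"
  unfolding Jdl_def using set_plus_intro[OF ideal_gen_0 ideal_gen_0] by (simp add: homog_ideal_def)

lemma Jdl_sum: "(\<And>x. x \<in> B \<Longrightarrow> f x \<in> Jdl k) \<Longrightarrow> sum f B \<in> Jdl k"
  by (induction B rule: infinite_finite_induct) (auto intro: Jdl_0 Jdl_add)

lemma homog_ideal_Jdl: "f \<in> homog_ideal n I \<Longrightarrow> f \<in> Jdl k"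
  unfolding Jdl_def using set_plus_intro[OF _ ideal_gen_0, of f "homog_ideal n I"] by simp

lemma Jdl_zmon:
  assumes "keys \<gamma> \<subseteq> {0..n}" "i < k" "lookup \<gamma> i > 0"
  shows "zmon \<gamma> \<in> Jdl k"
proof -
  let ?\<delta> = "\<gamma> - Poly_Mapping.single i 1"
  have e: "\<gamma> = ?\<delta> + Poly_Mapping.single i 1"
    using assms(3) by (intro poly_mapping_eqI) (auto simp: lookup_add lookup_minus lookup_single when_def)
  then have "keys ?\<delta> \<subseteq> {0..n}" using assms(1) keys_expo_add by metis
  then have "zmon ?\<delta> * zvar i \<in> ideal_gen {0..n} (zvar ` {0..<k})"
    using assms(2) by (intro ideal_gen_base) auto
  then have "zmon \<gamma> \<in> ideal_gen {0..n} (zvar ` {0..<k})"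
    by (subst e) (simp add: mult_single)
  moreover have "0 \<in> homog_ideal n I" unfolding homog_ideal_def by (rule ideal_gen_0)
  ultimately have "0 + zmon \<gamma> \<in> Jdl k" unfolding Jdl_def by (intro set_plus_intro)
  then show ?thesis by simp
qed

text \<open>
  Uniqueness of the representative: the difference of two would be a combination of standard
  monomials of degree \<open>s\<close> that equals a polynomial of lower degree on \<open>V\<close>.
\<close>

lemma bold_v_eqI:
  assumes "w \<in> nf_homog n I s" "f - w \<in> Jdl 1"
  shows "bold_v n I s f = w"
  unfolding bold_v_def
proof (rule the_equality)
  have "{0..<1::nat} = {0}" by auto
  then have J: "Jdl 1 = homog_ideal n I + ideal_gen {0..n} {zvar 0}"
    unfolding Jdl_def by (simp only: image_insert image_empty)
  show "w \<in> nf_homog n I s \<and> f - w \<in> homog_ideal n I + ideal_gen {0..n} {zvar 0}"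
    using assms J by simp
  fix w' assume "w' \<in> nf_homog n I s \<and> f - w' \<in> homog_ideal n I + ideal_gen {0..n} {zvar 0}"
  then have w': "w' \<in> nf_homog n I s" "f - w' \<in> Jdl 1" using J by auto
  have "(f - w) - (f - w') \<in> Jdl 1" using assms(2) w'(2) by (rule Jdl_diff)
  then have u: "w' - w \<in> Jdl 1" by simp
  have k: "keys (w' - w) \<subseteq> Std" "w' - w \<in> homog {1..n} s"
    using assms(1) w'(1) keys_diff_subset[of w' w]
    by (auto simp: nf_homog_def normal_forms_iff homog_def intro!: polys_diff)
  show "w' = w"
  proof (rule ccontr)
    assume "w' \<noteq> w"
    then have l: "is_lead (w' - w) (lead_expo (w' - w))" (is "is_lead _ ?\<gamma>") by (intro is_lead_expo) auto
    obtain g where g: "g \<in> polys {1..n}" "eqV V (w' - w) g"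
      "\<And>\<delta>. \<delta> \<in> keys g \<Longrightarrow> edeg \<delta> < s \<or> edeg \<delta> = s \<and> (\<exists>i\<in>{1..<1::nat}. lookup \<delta> i > 0)"
      using kernel_transfer[OF k(2) u] by auto
    have es: "edeg ?\<gamma> = s" using k(2) l by (auto simp: is_lead_def homog_def)
    have gg: "grevlex \<delta> ?\<gamma>" if "\<delta> \<in> keys g" for \<delta>
      using g(3)[OF that] es by (auto simp: grevlex_def)
    have "is_lead (w' - w - g) ?\<gamma>"
      unfolding is_lead_def
    proof (intro conjI ballI impI)
      have "?\<gamma> \<notin> keys g" using gg grevlex_irrefl by blast
      then show "?\<gamma> \<in> keys (w' - w - g)" using l
        by (simp add: is_lead_def in_keys_iff lookup_minus[of "w' - w" g])
      fix \<delta> assume "\<delta> \<in> keys (w' - w - g)" "\<delta> \<noteq> ?\<gamma>"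
      then show "grevlex \<delta> ?\<gamma>" using keys_diff_subset[of "w' - w" g] gg l by (auto simp: is_lead_def)
    qed
    moreover have "w' - w - g \<in> I"
      by (subst I_diff_iff) (use g(1,2) k(2) in \<open>auto simp: homog_def\<close>)
    ultimately have "?\<gamma> \<notin> Std" using is_lead_not_Std by blast
    then show False using l k(1) by (auto simp: is_lead_def)
  qed
qed

text \<open>
  Homogeneous reduction.  If \<open>\<gamma>\<close> leads \<open>f \<in> I\<close>, the homogenisation of \<open>f\<close> shows that modulo
  \<open>I^h + (z_0)\<close> the top degree part of \<open>f\<close> is zero, which expresses \<open>z^\<gamma>\<close> by smaller monomials of
  the same degree.
\<close>

lemma zmon_normal_form_at_infinity:
  assumes "keys \<gamma> \<subseteq> {1..n}"
  shows "\<exists>w. keys w \<subseteq> {\<delta>\<in>Std. edeg \<delta> = edeg \<gamma>} \<and> zmon \<gamma> - w \<in> Jdl 1"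
  using finite_atLeastAtMost[of 1 n] assms
proof (induction \<gamma> rule: grevlex_induct)
  case (less \<gamma>)
  show ?case
  proof (cases "\<gamma> \<in> Std")
    case True
    then show ?thesis by (intro exI[of _ "zmon \<gamma>"]) (auto simp: Jdl_0)
  next
    case False
    then obtain f where f: "f \<in> I" "is_lead f \<gamma>" using not_Std_is_lead less.hyps by blast
    have fp: "f \<in> polys {1..n}" using f(1) by (simp add: I_iff)
    let ?c = "lookup f \<gamma>"
    have c: "?c \<noteq> 0" using f(2) by (auto simp: is_lead_def in_keys_iff)
    define r where "r = restr (\<lambda>\<delta>. edeg \<delta> = edeg \<gamma> \<and> \<delta> \<noteq> \<gamma>) f"
    have "\<forall>\<delta>\<in>keys r. \<exists>w. keys w \<subseteq> {\<epsilon>\<in>Std. edeg \<epsilon> = edeg \<delta>} \<and> zmon \<delta> - w \<in> Jdl 1"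
      by (intro ballI less.IH) (use f fp in \<open>auto simp: polys_def r_def is_lead_def\<close>)
    from bchoice[OF this] obtain W where W: "\<forall>\<delta>\<in>keys r. keys (W \<delta>) \<subseteq> {\<epsilon>\<in>Std. edeg \<epsilon> = edeg \<delta>} \<and> zmon \<delta> - W \<delta> \<in> Jdl 1" ..
    let ?s = "\<Sum>\<delta>\<in>keys r. cscale (lookup r \<delta>) (W \<delta>)"
    define w where "w = cscale (- inverse ?c) ?s"
    have kw: "keys w \<subseteq> {\<delta>\<in>Std. edeg \<delta> = edeg \<gamma>}"
    proof -
      have "keys w \<subseteq> (\<Union>\<delta>\<in>keys r. keys (W \<delta>))"
        using keys_lin_comb[of "lookup r" W "keys r"] by (auto simp: w_def keys_cscale split: if_splits)
      also have "\<dots> \<subseteq> {\<delta>\<in>Std. edeg \<delta> = edeg \<gamma>}" using W by (fastforce simp: r_def)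
      finally show ?thesis .
    qed
    have pd: "pdeg f = edeg \<gamma>" using pdeg_is_lead[OF f(2)] .
    have h: "homogenize f = (\<Sum>\<delta>\<in>keys f. cscale (lookup f \<delta>) (zmon (Poly_Mapping.single 0 (edeg \<gamma> - edeg \<delta>) + \<delta>)))"
      by (simp only: homogenize_def pd single_eq_cscale[symmetric])
    have "homogenize f - (cscale ?c (zmon \<gamma>) + r) \<in> Jdl 1"
    proof -
      have "cscale ?c (zmon \<gamma>) + r = restr (\<lambda>\<delta>. edeg \<delta> = edeg \<gamma>) f"
        by (rule poly_mapping_eqI) (auto simp: r_def lookup_add lookup_single when_def)
      also have "\<dots> = (\<Sum>\<delta>\<in>keys f. cscale (lookup f \<delta>) (if edeg \<delta> = edeg \<gamma> then zmon \<delta> else 0))"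
        by (subst poly_sum_zmon[of f], unfold restr_sum, intro sum.cong refl poly_mapping_eqI)
           (auto simp: lookup_single when_def)
      finally have "homogenize f - (cscale ?c (zmon \<gamma>) + r) =
        (\<Sum>\<delta>\<in>keys f. cscale (lookup f \<delta>) (zmon (Poly_Mapping.single 0 (edeg \<gamma> - edeg \<delta>) + \<delta>) -
            (if edeg \<delta> = edeg \<gamma> then zmon \<delta> else 0)))"
        by (simp only: h sum_subtractf[symmetric] cpoly.scale_right_diff_distrib)
      also have "\<dots> \<in> Jdl 1"
      proof (intro Jdl_sum Jdl_cscale)
        fix \<delta> assume \<delta>: "\<delta> \<in> keys f"
        then have le: "edeg \<delta> \<le> edeg \<gamma>" using pdeg_ge[OF \<delta>] pd by simp
        show "zmon (Poly_Mapping.single 0 (edeg \<gamma> - edeg \<delta>) + \<delta>) - (if edeg \<delta> = edeg \<gamma> then zmon \<delta> else 0) \<in> Jdl 1"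
        proof (cases "edeg \<delta> = edeg \<gamma>")
          case True
          then show ?thesis by (simp add: Jdl_0)
        next
          case False
          have "zmon (Poly_Mapping.single 0 (edeg \<gamma> - edeg \<delta>) + \<delta>) \<in> Jdl 1"
          proof (rule Jdl_zmon)
            have "keys \<delta> \<subseteq> {1..n}" using \<delta> fp by (auto simp: polys_def)
            then have "keys \<delta> \<subseteq> {0..n}" by auto
            then show "keys (Poly_Mapping.single 0 (edeg \<gamma> - edeg \<delta>) + \<delta>) \<subseteq> {0..n}"
              by (simp add: keys_expo_add keys_single_subset)
            show "0 < lookup (Poly_Mapping.single 0 (edeg \<gamma> - edeg \<delta>) + \<delta>) 0"
              using False le by (simp add: lookup_add)
          qed simp
          with False show ?thesis by simp
        qed
      qed
      finally show ?thesis .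
    qed
    moreover have "homogenize f \<in> Jdl 1"
      using f(1) ideal_gen_base[of 1 "{0..n}" "homogenize f" "homogenize ` I"]
      by (intro homog_ideal_Jdl) (auto simp: homog_ideal_def)
    ultimately have "cscale ?c (zmon \<gamma>) + r \<in> Jdl 1"
      using Jdl_diff[of "homogenize f" 1 "homogenize f - (cscale ?c (zmon \<gamma>) + r)"] by simp
    moreover have "r - ?s \<in> Jdl 1"
    proof -
      have "r - ?s = (\<Sum>\<delta>\<in>keys r. cscale (lookup r \<delta>) (zmon \<delta> - W \<delta>))"
        by (subst (1) poly_sum_zmon[of r]) (simp only: sum_subtractf[symmetric] cpoly.scale_right_diff_distrib)
      then show ?thesis using W by (auto intro!: Jdl_sum Jdl_cscale)
    qed
    ultimately have "cscale ?c (zmon \<gamma>) + r - (r - ?s) \<in> Jdl 1" by (rule Jdl_diff)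
    then have "cscale (inverse ?c) (cscale ?c (zmon \<gamma>) + ?s) \<in> Jdl 1" by (intro Jdl_cscale) simp
    moreover have "cscale (inverse ?c) (cscale ?c (zmon \<gamma>) + ?s) = zmon \<gamma> - w"
      by (rule poly_mapping_eqI) (use c in \<open>simp add: w_def lookup_add lookup_minus distrib_left\<close>)
    ultimately show ?thesis using kw by metis
  qed
qed

lemma bold_v:
  assumes "f \<in> homog {0..n} s"
  shows "bold_v n I s f \<in> nf_homog n I s" "f - bold_v n I s f \<in> Jdl 1"
proof -
  have "\<exists>w. keys w \<subseteq> {\<delta>\<in>Std. edeg \<delta> = s} \<and> zmon \<gamma> - w \<in> Jdl 1" if "\<gamma> \<in> keys f" for \<gamma>
  proof (cases "lookup \<gamma> 0 = 0")
    case True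
    have "0 \<notin> keys \<gamma>" "keys \<gamma> \<subseteq> {0..n}" "edeg \<gamma> = s" using True assms that 
      by (auto simp: homog_def polys_def in_keys_iff)
    moreover from this have "keys \<gamma> \<subseteq> {1..n}"
      using gr0I by (force simp: One_nat_def Suc_le_eq)
    ultimately
    show ?thesis using zmon_normal_form_at_infinity[of \<gamma>] by simp
  next
    case False
    then have "zmon \<gamma> \<in> Jdl 1" using assms that by (intro Jdl_zmon[of _ 0]) (auto simp: homog_def polys_def)
    then show ?thesis by (intro exI[of _ 0]) auto
  qed
  then have "\<forall>\<gamma>\<in>keys f. \<exists>w. keys w \<subseteq> {\<delta>\<in>Std. edeg \<delta> = s} \<and> zmon \<gamma> - w \<in> Jdl 1" by blast
  from bchoice[OF this] obtain W where W: "\<forall>\<gamma>\<in>keys f. keys (W \<gamma>) \<subseteq> {\<delta>\<in>Std. edeg \<delta> = s} \<and> zmon \<gamma> - W \<gamma> \<in> Jdl 1" ..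
  let ?w = "\<Sum>\<gamma>\<in>keys f. cscale (lookup f \<gamma>) (W \<gamma>)"
  have "keys ?w \<subseteq> {\<delta>\<in>Std. edeg \<delta> = s}"
    by (rule order_trans[OF keys_lin_comb]) (use W in blast)
  then have 1: "?w \<in> nf_homog n I s"
    by (auto simp: nf_homog_def normal_forms_iff homog_def intro!: Std_polys)
  have "f - ?w = (\<Sum>\<gamma>\<in>keys f. cscale (lookup f \<gamma>) (zmon \<gamma> - W \<gamma>))"
    by (subst (1) poly_sum_zmon[of f]) (simp only: sum_subtractf[symmetric] cpoly.scale_right_diff_distrib)
  then have 2: "f - ?w \<in> Jdl 1" using W by (auto intro!: Jdl_sum Jdl_cscale)
  show "bold_v n I s f \<in> nf_homog n I s" "f - bold_v n I s f \<in> Jdl 1"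
    using bold_v_eqI[OF 1 2] 1 2 by auto
qed

end

section \<open>The two kinds of standard exponents\<close>

text \<open>
  The hypotheses on \<open>V\<close> at infinity in the form in which they are used.  The family \<open>w\<close> already
  consists of normal forms, with values \<open>p_{jm}^t \<delta>_{ij}\<close> at the chosen coordinates of \<open>p_j\<close>.
\<close>

locale noether_setup = affine_variety n V I
  for n :: nat and V :: "(nat \<Rightarrow> complex) set" and I :: "cpoly set" +
  fixes m d t :: nat and p :: "nat \<Rightarrow> nat \<Rightarrow> complex" and w :: "nat \<Rightarrow> cpoly"
  assumes m1: "1 \<le> m" and mn: "m \<le> n"
    and p_zero: "i \<in> {1..d} \<Longrightarrow> k < m \<Longrightarrow> p i k = 0"
    and p_nz: "i \<in> {1..d} \<Longrightarrow> p i m \<noteq> 0"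
    and kernel: "t \<le> s \<Longrightarrow> f \<in> homog {0..n} s \<Longrightarrow> (\<And>i. i \<in> {1..d} \<Longrightarrow> peval (p i) f = 0) \<Longrightarrow> f \<in> Jdl m"
    and w_nf: "i \<in> {1..d} \<Longrightarrow> w i \<in> nf_homog n I t"
    and w_val: "i \<in> {1..d} \<Longrightarrow> j \<in> {1..d} \<Longrightarrow> peval (p j) (w i) = (if i = j then p j m ^ t else 0)"
    and ord_nf: "keys \<alpha> \<subseteq> {1..<m} \<Longrightarrow> (l, \<beta>) \<in> basisB n m I t \<Longrightarrow>
           zmon (\<alpha> + Poly_Mapping.single m l) * zmon \<beta> \<in> normal_forms n I"
    and ext_nf: "keys \<alpha> \<subseteq> {1..<m} \<Longrightarrow> i \<in> {1..d} \<Longrightarrow>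
           zmon (\<alpha> + Poly_Mapping.single m l) * w i \<in> normal_forms n I"
begin

text \<open>
  \<open>low\<close> is the part of an exponent in \<open>z_1, ..., z_{m-1}\<close>, the variables that vanish at the points
  \<open>p_i\<close>; \<open>upp\<close> is the rest.
\<close>

definition low :: "expo \<Rightarrow> expo" where "low \<gamma> = restr (\<lambda>i. i < m) \<gamma>"
definition upp :: "expo \<Rightarrow> expo" where "upp \<gamma> = restr (\<lambda>i. \<not> i < m) \<gamma>"

lemma low_upp: "low \<gamma> + upp \<gamma> = \<gamma>"
  by (simp add: low_def upp_def restr_split)

lemma low_add: "low (\<gamma> + \<delta>) = low \<gamma> + low \<delta>" and upp_add: "upp (\<gamma> + \<delta>) = upp \<gamma> + upp \<delta>"
  by (simp_all add: low_def upp_def restr_add)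

lemma edeg_low_upp: "edeg \<gamma> = edeg (low \<gamma>) + edeg (upp \<gamma>)"
  using edeg_add[of "low \<gamma>" "upp \<gamma>"] by (simp add: low_upp)

lemma low_eq_iff: "low \<gamma> = low \<delta> \<longleftrightarrow> (\<forall>i<m. lookup \<gamma> i = lookup \<delta> i)"
  by (auto simp: low_def poly_mapping_eq_iff fun_eq_iff)

lemma low_eq_0_iff: "low \<gamma> = 0 \<longleftrightarrow> (\<forall>i<m. lookup \<gamma> i = 0)"
  by (auto simp: low_def poly_mapping_eq_iff fun_eq_iff)

lemma low_keys: "keys \<gamma> \<subseteq> {1..n} \<Longrightarrow> keys (low \<gamma>) \<subseteq> {1..<m}"
  by (auto simp: low_def)

text \<open>
  Grevlex restricted to the total degree and \<open>low\<close>.  It does not separate the exponents \<open>a + mu i\<close> with the same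
  \<open>a\<close>, so that every monomial of \<open>w i\<close> is at most every \<open>mu j\<close>.
\<close>

definition kless :: "expo \<Rightarrow> expo \<Rightarrow> bool" where
  "kless \<delta> \<gamma> \<longleftrightarrow> edeg \<delta> < edeg \<gamma> \<or> edeg \<delta> = edeg \<gamma> \<and>
     (\<exists>i<m. lookup \<delta> i > lookup \<gamma> i \<and> (\<forall>j<i. lookup \<delta> j = lookup \<gamma> j))"

definition keq :: "expo \<Rightarrow> expo \<Rightarrow> bool" where
  "keq \<delta> \<gamma> \<longleftrightarrow> edeg \<delta> = edeg \<gamma> \<and> low \<delta> = low \<gamma>"

abbreviation kle :: "expo \<Rightarrow> expo \<Rightarrow> bool" where
  "kle \<delta> \<gamma> \<equiv> kless \<delta> \<gamma> \<or> keq \<delta> \<gamma>"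

lemma kless_grevlex: "kless \<delta> \<gamma> \<Longrightarrow> grevlex \<delta> \<gamma>"
  by (auto simp: kless_def grevlex_def)

lemma grevlex_kle: "grevlex \<delta> \<gamma> \<Longrightarrow> kle \<delta> \<gamma>"
proof -
  assume g: "grevlex \<delta> \<gamma>"
  show ?thesis
  proof (cases "edeg \<delta> < edeg \<gamma>")
    case False
    then obtain i where i: "edeg \<delta> = edeg \<gamma>" "lookup \<delta> i > lookup \<gamma> i" "\<forall>j<i. lookup \<delta> j = lookup \<gamma> j"
      using g by (auto simp: grevlex_def)
    show ?thesis
    proof (cases "i < m")
      case True then show ?thesis using i by (auto simp: kless_def)
    next
      case False then show ?thesis using i by (auto simp: keq_def low_eq_iff)
    qed
  qed (simp add: kless_def)
qed

lemma kless_keq1: "kless \<delta> \<gamma> \<Longrightarrow> keq \<delta>' \<delta> \<Longrightarrow> kless \<delta>' \<gamma>"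
  and kless_keq2: "kless \<delta> \<gamma> \<Longrightarrow> keq \<gamma> \<gamma>' \<Longrightarrow> kless \<delta> \<gamma>'"
  unfolding kless_def keq_def low_eq_iff by (metis (no_types, lifting) less_trans)+

lemma keq_refl [simp]: "keq \<gamma> \<gamma>" and keq_sym: "keq \<gamma> \<delta> \<Longrightarrow> keq \<delta> \<gamma>"
  and keq_trans: "keq \<gamma> \<delta> \<Longrightarrow> keq \<delta> \<epsilon> \<Longrightarrow> keq \<gamma> \<epsilon>"
  by (auto simp: keq_def)

lemma keq_add: "keq \<gamma> \<gamma>' \<Longrightarrow> keq \<delta> \<delta>' \<Longrightarrow> keq (\<gamma> + \<delta>) (\<gamma>' + \<delta>')"
  by (simp add: keq_def low_add)

lemma keq_edeg_upp: "keq \<delta> \<gamma> \<Longrightarrow> edeg (upp \<delta>) = edeg (upp \<gamma>)"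
proof -
  assume "keq \<delta> \<gamma>"
  then have "edeg \<delta> = edeg \<gamma>" "edeg (low \<delta>) = edeg (low \<gamma>)" by (auto simp: keq_def)
  then show ?thesis using edeg_low_upp[of \<delta>] edeg_low_upp[of \<gamma>] by linarith
qed

lemma kless_kless_add: 
  assumes "kless \<gamma> \<gamma>'" "kless \<delta> \<delta>'" shows "kless (\<gamma> + \<delta>) (\<gamma>' + \<delta>')"
proof (cases "edeg \<gamma> = edeg \<gamma>' \<and> edeg \<delta> = edeg \<delta>'")
  case True
  then obtain i j where i: "i < m" "lookup \<gamma> i > lookup \<gamma>' i" "\<forall>k<i. lookup \<gamma> k = lookup \<gamma>' k"
    and j: "j < m" "lookup \<delta> j > lookup \<delta>' j" "\<forall>k<j. lookup \<delta> k = lookup \<delta>' k"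
    using assms by (auto simp: kless_def)
  have "min i j < m \<and> lookup (\<gamma> + \<delta>) (min i j) > lookup (\<gamma>' + \<delta>') (min i j) \<and>
      (\<forall>k<min i j. lookup (\<gamma> + \<delta>) k = lookup (\<gamma>' + \<delta>') k)"
    using i j by (cases i j rule: linorder_cases) (auto simp: min_def lookup_add)
  with True show ?thesis unfolding kless_def by auto
qed (use assms in \<open>auto simp: kless_def\<close>)

lemma kless_keq_add: "kless \<gamma> \<gamma>' \<Longrightarrow> keq \<delta> \<delta>' \<Longrightarrow> kless (\<gamma> + \<delta>) (\<gamma>' + \<delta>')"
proof -
  assume 1: "kless \<gamma> \<gamma>'" and 2: "keq \<delta> \<delta>'"
  have "kless (\<gamma> + \<delta>) (\<gamma>' + \<delta>)" using 1 by (auto simp: kless_def lookup_add)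
  then show ?thesis using kless_keq2 keq_add[OF keq_refl 2] by blast
qed

lemma kless_kle_add: "kless \<gamma> \<gamma>' \<Longrightarrow> kle \<delta> \<delta>' \<Longrightarrow> kless (\<gamma> + \<delta>) (\<gamma>' + \<delta>')"
  using kless_kless_add kless_keq_add by blast

lemma kless_trans: "kless \<gamma> \<delta> \<Longrightarrow> kless \<delta> \<epsilon> \<Longrightarrow> kless \<gamma> \<epsilon>"
  using kless_kless_add[of \<gamma> \<delta> \<delta> \<epsilon>] by (simp add: kless_def lookup_add)

lemma kle_kless_trans: "kle \<gamma> \<delta> \<Longrightarrow> kless \<delta> \<epsilon> \<Longrightarrow> kless \<gamma> \<epsilon>"
  and kless_kle_trans: "kless \<gamma> \<delta> \<Longrightarrow> kle \<delta> \<epsilon> \<Longrightarrow> kless \<gamma> \<epsilon>"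
  and kle_trans: "kle \<gamma> \<delta> \<Longrightarrow> kle \<delta> \<epsilon> \<Longrightarrow> kle \<gamma> \<epsilon>"
  using kless_trans kless_keq1 kless_keq2 keq_sym keq_trans by blast+

lemma kle_edeg: "kle \<gamma> \<delta> \<Longrightarrow> edeg \<gamma> \<le> edeg \<delta>"
  by (auto simp: kless_def keq_def)

lemma w_keys: "i \<in> {1..d} \<Longrightarrow> \<gamma> \<in> keys (w i) \<Longrightarrow> \<gamma> \<in> Std \<and> edeg \<gamma> = t"
  using w_nf[of i] by (auto simp: nf_homog_def normal_forms_iff homog_def)

lemma w_polys: "i \<in> {1..d} \<Longrightarrow> w i \<in> polys {1..n}"
  using w_keys by (intro Std_polys) blast

lemma homog_mono: "f \<in> homog {1..n} s \<Longrightarrow> f \<in> homog {0..n} s"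
  by (auto simp: homog_def intro: polys_mono[rotated])

text \<open>
  A form vanishing at all \<open>p_i\<close> coincides on \<open>V\<close> with a polynomial whose monomials have smaller degree or
  contain one of \<open>z_1, ..., z_{m-1}\<close>.
\<close>

lemma evaluation_kernel:
  assumes "f \<in> homog {1..n} s" "t \<le> s" "\<And>i. i \<in> {1..d} \<Longrightarrow> peval (p i) f = 0"
  obtains g where "g \<in> polys {1..n}" "eqV V f g"
    "\<And>\<delta>. \<delta> \<in> keys g \<Longrightarrow> edeg \<delta> < s \<or> edeg \<delta> = s \<and> low \<delta> \<noteq> 0"
proof -
  have "f \<in> Jdl m" using kernel[OF assms(2) homog_mono[OF assms(1)] assms(3)] by blast
  then obtain g where g: "g \<in> polys {1..n}" "eqV V f g"
    "\<And>\<delta>. \<delta> \<in> keys g \<Longrightarrow> edeg \<delta> < s \<or> edeg \<delta> = s \<and> (\<exists>i\<in>{1..<m}. lookup \<delta> i > 0)"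
    using kernel_transfer[OF assms(1)] mn by (metis le_SucI)
  show thesis
    by (rule that[OF g(1,2)]) (use g(3) in \<open>fastforce simp: low_eq_0_iff\<close>)
qed

lemma low_nz_kless:
  assumes "edeg \<delta> < edeg \<gamma> \<or> edeg \<delta> = edeg \<gamma> \<and> low \<delta> \<noteq> 0" "low \<gamma> = 0"
  shows "kless \<delta> \<gamma>"
proof (cases "edeg \<delta> < edeg \<gamma>")
  case False
  then have e: "edeg \<delta> = edeg \<gamma>" and "\<exists>i. i < m \<and> lookup \<delta> i \<noteq> 0"
    using assms by (auto simp: low_eq_0_iff)
  then obtain i where i: "i < m" "lookup \<delta> i \<noteq> 0" "\<And>j. j < i \<Longrightarrow> \<not> (j < m \<and> lookup \<delta> j \<noteq> 0)"
    using exists_least_iff[of "\<lambda>i. i < m \<and> lookup \<delta> i \<noteq> 0"] by blast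
  then have "\<forall>j<i. lookup \<delta> j = lookup \<gamma> j" "lookup \<delta> i > lookup \<gamma> i"
    using assms(2) by (auto simp: low_eq_0_iff)
  then show ?thesis using e i(1) by (auto simp: kless_def)
qed (simp add: kless_def)

text \<open>
  For standard monomials in \<open>z_m, ..., z_n\<close> all terms provided by \<open>evaluation_kernel\<close> are smaller than
  the leading one, which would therefore be the leading exponent of an element of \<open>I\<close>.
\<close>

lemma evaluation_inj:
  assumes "f \<in> homog {1..n} s" "t \<le> s" "keys f \<subseteq> Std" "\<And>\<gamma>. \<gamma> \<in> keys f \<Longrightarrow> low \<gamma> = 0"
    "\<And>i. i \<in> {1..d} \<Longrightarrow> peval (p i) f = 0"
  shows "f = 0"
proof (rule ccontr)
  assume "f \<noteq> 0"
  then have l: "is_lead f (lead_expo f)" (is "is_lead f ?\<gamma>") by (rule is_lead_expo)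
  then have \<gamma>: "?\<gamma> \<in> keys f" "edeg ?\<gamma> = s" using assms(1) by (auto simp: is_lead_def homog_def)
  obtain g where g: "g \<in> polys {1..n}" "eqV V f g"
    "\<And>\<delta>. \<delta> \<in> keys g \<Longrightarrow> edeg \<delta> < s \<or> edeg \<delta> = s \<and> low \<delta> \<noteq> 0"
    using evaluation_kernel[OF assms(1,2,5)] by metis
  have gg: "grevlex \<delta> ?\<gamma>" if "\<delta> \<in> keys g" for \<delta>
    by (rule kless_grevlex[OF low_nz_kless]) (use g(3)[OF that] \<gamma> assms(4) in auto)
  have "is_lead (f - g) ?\<gamma>"
    unfolding is_lead_def
  proof (intro conjI ballI impI)
    have "?\<gamma> \<notin> keys g" using gg grevlex_irrefl by blast
    then show "?\<gamma> \<in> keys (f - g)" using l by (simp add: is_lead_def in_keys_iff lookup_minus[of f g])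
    fix \<delta> assume "\<delta> \<in> keys (f - g)" "\<delta> \<noteq> ?\<gamma>"
    then show "grevlex \<delta> ?\<gamma>" using keys_diff_subset[of f g] gg l by (auto simp: is_lead_def)
  qed
  moreover have "f - g \<in> I"
    by (subst I_diff_iff) (use g(1,2) assms(1) in \<open>auto simp: homog_def\<close>)
  ultimately show False using is_lead_not_Std \<gamma>(1) assms(3) by blast
qed

text \<open>
  \<open>Q\<close> collects the standard monomials of degree \<open>t\<close> in \<open>z_m, ..., z_n\<close>.  The matrix \<open>E\<close> of their normalised
  values at the \<open>p_i\<close> and the matrix of the coefficients of the \<open>w i\<close> on \<open>Q\<close> turn out to be inverse to
  each other (\<open>ED\<close>, \<open>DE\<close>).
\<close>

definition Q :: "expo set" where "Q = {\<mu>\<in>Std. low \<mu> = 0 \<and> edeg \<mu> = t}"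
definition E :: "expo \<Rightarrow> nat \<Rightarrow> complex" where "E \<mu> i = mval (p i) \<mu> / p i m ^ t"
definition w0 :: "nat \<Rightarrow> cpoly" where "w0 i = restr (\<lambda>\<gamma>. low \<gamma> = 0) (w i)"

lemma finite_Q: "finite Q"
  by (rule finite_subset[OF _ finite_expos[of "{1..n}" t]]) (auto simp: Q_def expos_def dest: Std_keys)

lemma w0_keys: "i \<in> {1..d} \<Longrightarrow> keys (w0 i) \<subseteq> Q"
  using w_keys[of i] by (auto simp: w0_def Q_def)

lemma mval_p_low: "i \<in> {1..d} \<Longrightarrow> low \<gamma> \<noteq> 0 \<Longrightarrow> mval (p i) \<gamma> = 0"
  using p_zero[of i] mval_eq_0[of _ \<gamma> "p i"] by (fastforce simp: low_eq_0_iff in_keys_iff)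

lemma w0_val:
  assumes "i \<in> {1..d}" "j \<in> {1..d}"
  shows "peval (p j) (w0 i) = (if i = j then p j m ^ t else 0)"
proof -
  have "peval (p j) (restr (\<lambda>\<gamma>. \<not> low \<gamma> = 0) (w i)) = 0"
    unfolding peval_mval by (rule sum.neutral) (use mval_p_low[OF assms(2)] in auto)
  moreover have "w i = w0 i + restr (\<lambda>\<gamma>. \<not> low \<gamma> = 0) (w i)" by (simp add: w0_def restr_split)
  ultimately have "peval (p j) (w i) = peval (p j) (w0 i)" by (metis peval_add add.right_neutral)
  then show ?thesis using w_val[OF assms] by simp
qed

text \<open>
  Both sides are combinations of standard monomials in \<open>z_m, ..., z_n\<close> with the same values at all
  points \<open>p_j\<close>.  That the right side is standard is the normal form hypothesis for \<open>z_m^k w_i\<close>.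
\<close>

lemma zmon_upper_expand:
  assumes "\<nu> \<in> Std" "low \<nu> = 0" "edeg \<nu> = t + k"
  shows "zmon \<nu> = (\<Sum>i=1..d. cscale (mval (p i) \<nu> / p i m ^ (t + k)) (zmon (Poly_Mapping.single m k) * w0 i))"
    (is "_ = (\<Sum>i=1..d. cscale (?c i) (?g i))")
proof -
  let ?r = "zmon \<nu> - (\<Sum>i=1..d. cscale (?c i) (?g i))"
  have gk: "keys (?g i) \<subseteq> {\<delta>\<in>Std. low \<delta> = 0 \<and> edeg \<delta> = t + k}" if i: "i \<in> {1..d}" for i
  proof
    fix \<delta> assume \<delta>: "\<delta> \<in> keys (?g i)"
    then obtain \<mu> where \<mu>: "\<mu> \<in> keys (w0 i)" "\<delta> = Poly_Mapping.single m k + \<mu>" by (auto simp: keys_zmon_mult)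
    have "\<delta> \<in> keys (zmon (0 + Poly_Mapping.single m k) * w i)"
      using \<mu> by (simp add: keys_zmon_mult w0_def)
    then have "\<delta> \<in> Std" using ext_nf[of 0 i k] i by (auto simp: normal_forms_iff)
    moreover have "low (Poly_Mapping.single m k) = 0" by (auto simp: low_eq_0_iff lookup_single)
    then have "low \<delta> = 0" "edeg \<delta> = t + k" using \<mu> w0_keys[OF i]
      by (auto simp: Q_def low_add)
    ultimately show "\<delta> \<in> {\<delta>\<in>Std. low \<delta> = 0 \<and> edeg \<delta> = t + k}" by simp
  qed
  have rk: "keys ?r \<subseteq> {\<delta>\<in>Std. low \<delta> = 0 \<and> edeg \<delta> = t + k}"
  proof
    fix \<delta> assume "\<delta> \<in> keys ?r"
    then have "\<delta> = \<nu> \<or> \<delta> \<in> (\<Union>i\<in>{1..d}. keys (?g i))"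
      using keys_diff_subset[of "zmon \<nu>" "\<Sum>i=1..d. cscale (?c i) (?g i)"] keys_lin_comb[of ?c ?g "{1..d}"] by auto
    then show "\<delta> \<in> {\<delta>\<in>Std. low \<delta> = 0 \<and> edeg \<delta> = t + k}" using gk assms by blast
  qed
  have "?r = 0"
  proof (rule evaluation_inj)
    show "?r \<in> homog {1..n} (t + k)"
      using rk Std_polys[of ?r] by (auto simp: homog_def)
    show "peval (p j) ?r = 0" if j: "j \<in> {1..d}" for j
    proof -
      have "(\<Sum>i=1..d. ?c i * (p j m ^ k * peval (p j) (w0 i))) =
          (\<Sum>i=1..d. if i = j then ?c j * p j m ^ (t + k) else 0)"
        by (rule sum.cong) (use j in \<open>auto simp: w0_val power_add\<close>)
      also have "\<dots> = mval (p j) \<nu>" using j p_nz[OF j] by (simp add: sum.delta')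
      finally show ?thesis by simp
    qed
  qed (use rk in auto)
  then show ?thesis by simp
qed

lemma zmon_Q: "\<mu> \<in> Q \<Longrightarrow> zmon \<mu> = (\<Sum>i=1..d. cscale (E \<mu> i) (w0 i))"
  using zmon_upper_expand[of \<mu> 0] by (simp add: Q_def E_def)

lemma ED: "\<mu> \<in> Q \<Longrightarrow> \<nu> \<in> Q \<Longrightarrow> (\<Sum>i=1..d. E \<mu> i * lookup (w i) \<nu>) = (if \<mu> = \<nu> then 1 else 0)"
  using arg_cong[OF zmon_Q, of \<mu> "\<lambda>f. lookup f \<nu>"]
  by (simp add: lookup_sum w0_def Q_def lookup_single when_def)

lemma DE:
  assumes "i \<in> {1..d}" "j \<in> {1..d}"
  shows "(\<Sum>\<mu>\<in>Q. lookup (w i) \<mu> * E \<mu> j) = (if i = j then 1 else 0)"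
proof -
  have "peval (p j) (w0 i) = (\<Sum>\<mu>\<in>Q. lookup (w0 i) \<mu> * mval (p j) \<mu>)"
    by (rule peval_superset[OF finite_Q w0_keys[OF assms(1)]])
  also have "\<dots> = (\<Sum>\<mu>\<in>Q. lookup (w i) \<mu> * E \<mu> j) * p j m ^ t"
    unfolding sum_distrib_right by (rule sum.cong) (use p_nz[OF assms(2)] in \<open>auto simp: E_def w0_def Q_def\<close>)
  finally show ?thesis using w0_val[OF assms] p_nz[OF assms(2)] by (auto split: if_splits)
qed

text \<open>
  Two rectangular matrices that are inverse to each other on both sides are square: compare the traces
  of the two products.
\<close>

lemma card_Q: "card Q = d"
proof -
  have "of_nat (card Q) = (\<Sum>\<mu>\<in>Q. \<Sum>i=1..d. E \<mu> i * lookup (w i) \<mu>)"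
    by (simp add: ED)
  also have "\<dots> = (\<Sum>i=1..d. \<Sum>\<mu>\<in>Q. lookup (w i) \<mu> * E \<mu> i)"
    by (subst sum.swap) (simp add: mult.commute)
  also have "\<dots> = of_nat d" by (simp add: DE)
  finally show ?thesis using of_nat_eq_iff[where 'a = complex] by blast
qed

text \<open>
  A numbering of \<open>Q\<close>, unrelated to that of the \<open>w i\<close>.
\<close>

definition mu :: "nat \<Rightarrow> expo" where "mu = (SOME f. bij_betw f {1..d} Q)"

lemma mu_bij: "bij_betw mu {1..d} Q"
proof -
  have "\<exists>f. bij_betw f {1..d} Q"
    by (rule finite_same_card_bij) (simp_all add: finite_Q card_Q)
  then show ?thesis unfolding mu_def by (rule someI_ex)
qed

lemma mu_Q: "i \<in> {1..d} \<Longrightarrow> mu i \<in> Q"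
  using mu_bij by (auto simp: bij_betw_def)

lemma mu_inj: "i \<in> {1..d} \<Longrightarrow> j \<in> {1..d} \<Longrightarrow> mu i = mu j \<longleftrightarrow> i = j"
  using inj_on_eq_iff[OF bij_betw_imp_inj_on[OF mu_bij]] by blast

lemma sum_Q: "(\<Sum>\<mu>\<in>Q. f \<mu>) = (\<Sum>i=1..d. f (mu i))"
  using sum.reindex_bij_betw[OF mu_bij, of f] by simp

lemma split_m:
  assumes "keys a \<subseteq> {1..m}"
  shows "a = low a + Poly_Mapping.single m (lookup a m)" "keys (low a) \<subseteq> {1..<m}"
proof -
  show "a = low a + Poly_Mapping.single m (lookup a m)"
    using assms by (intro poly_mapping_eqI) (force simp: low_def lookup_add lookup_single when_def in_keys_iff)
  show "keys (low a) \<subseteq> {1..<m}" using assms by (auto simp: low_def)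
qed

lemma edeg_split_m:
  assumes "keys a \<subseteq> {1..m}" shows "edeg a = edeg (low a) + lookup a m"
  using arg_cong[OF split_m(1)[OF assms], of edeg] by simp

lemma zmon_w_Std: "keys a \<subseteq> {1..m} \<Longrightarrow> i \<in> {1..d} \<Longrightarrow> keys (zmon a * w i) \<subseteq> Std"
  using ext_nf[of "low a" i "lookup a m"] split_m[of a] by (metis normal_forms_iff)

text \<open>
  Some \<open>w j\<close> contains the monomial \<open>mu i\<close>, because a row of an invertible matrix is nonzero; then
  \<open>z^a w_j\<close> contains \<open>a + mu i\<close>.
\<close>

lemma ext_Std:
  assumes "keys a \<subseteq> {1..m}" "i \<in> {1..d}" shows "a + mu i \<in> Std"
proof -
  have "(\<Sum>j=1..d. E (mu i) j * lookup (w j) (mu i)) \<noteq> 0"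
    using ED[OF mu_Q mu_Q] assms(2) by simp
  then obtain j where j: "j \<in> {1..d}" "lookup (w j) (mu i) \<noteq> 0"
    by (metis (no_types, lifting) mult_zero_right sum.neutral)
  then have "a + mu i \<in> keys (zmon a * w j)" by (simp add: in_keys_iff)
  then show ?thesis using zmon_w_Std[OF assms(1) j(1)] by blast
qed

lemma mu_low: "i \<in> {1..d} \<Longrightarrow> low (mu i) = 0" and mu_edeg: "i \<in> {1..d} \<Longrightarrow> edeg (mu i) = t"
  using mu_Q by (auto simp: Q_def)

lemma upper_Std:
  assumes "\<nu> \<in> Std" "low \<nu> = 0" "edeg \<nu> = t + k"
  shows "\<exists>i\<in>{1..d}. \<nu> = Poly_Mapping.single m k + mu i"
proof -
  have "\<nu> \<in> keys (\<Sum>i=1..d. cscale (mval (p i) \<nu> / p i m ^ (t + k)) (zmon (Poly_Mapping.single m k) * w0 i))"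
    by (subst zmon_upper_expand[OF assms, symmetric]) simp
  then have "\<nu> \<in> (\<Union>i\<in>{1..d}. keys (zmon (Poly_Mapping.single m k) * w0 i))"
    by (rule subsetD[OF keys_lin_comb])
  then obtain i \<mu> where i: "i \<in> {1..d}" "\<mu> \<in> keys (w0 i)" "\<nu> = Poly_Mapping.single m k + \<mu>"
    by (auto simp: keys_zmon_mult)
  then have "\<mu> \<in> mu ` {1..d}" using w0_keys[OF i(1)] mu_bij by (auto simp: bij_betw_def)
  then show ?thesis using i(3) by blast
qed

text \<open>
  \<open>ExtE\<close> indexes the products \<open>z^\<alpha> z_m^l w_i\<close>, \<open>OrdE\<close> the monomials of the first family.
\<close>

definition ExtE :: "expo set" where "ExtE = {a + mu i | a i. keys a \<subseteq> {1..m} \<and> i \<in> {1..d}}"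
definition OrdE :: "expo set" where "OrdE = {\<gamma>\<in>Std. edeg (upp \<gamma>) < t}"

lemma ExtI: "keys a \<subseteq> {1..m} \<Longrightarrow> i \<in> {1..d} \<Longrightarrow> a + mu i \<in> ExtE"
  by (auto simp: ExtE_def)

lemma ext_edeg_upp:
  assumes "keys a \<subseteq> {1..m}" "i \<in> {1..d}"
  shows "edeg (upp (a + mu i)) = lookup a m + t" "low (a + mu i) = low a" "edeg (a + mu i) = edeg a + t"
proof -
  show l: "low (a + mu i) = low a" using mu_low[OF assms(2)] by (simp add: low_add)
  show e: "edeg (a + mu i) = edeg a + t" using mu_edeg[OF assms(2)] by simp
  have "edeg a = edeg (low a) + lookup a m" by (rule edeg_split_m[OF assms(1)])
  then show "edeg (upp (a + mu i)) = lookup a m + t"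
    using edeg_low_upp[of "a + mu i"] l e by simp
qed

lemma keq_ext_eq:
  assumes "keys a \<subseteq> {1..m}" "i \<in> {1..d}" "keys b \<subseteq> {1..m}" "j \<in> {1..d}" "keq (a + mu i) (b + mu j)"
  shows "a = b"
proof -
  have l: "low a = low b" and "edeg a = edeg b"
    using assms(5) ext_edeg_upp[OF assms(1,2)] ext_edeg_upp[OF assms(3,4)] by (auto simp: keq_def)
  moreover have "edeg a = edeg (low a) + lookup a m" "edeg b = edeg (low b) + lookup b m"
    by (rule edeg_split_m, rule assms)+
  ultimately have "lookup a m = lookup b m" by simp
  then show ?thesis using split_m(1)[OF assms(1)] split_m(1)[OF assms(3)] l by simp
qed

lemma ext_inj:
  assumes "keys a \<subseteq> {1..m}" "i \<in> {1..d}" "keys b \<subseteq> {1..m}" "j \<in> {1..d}"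
  shows "a + mu i = b + mu j \<longleftrightarrow> a = b \<and> i = j"
  using keq_ext_eq[OF assms] mu_inj assms by auto

text \<open>
  If the degree in \<open>z_m, ..., z_n\<close> is at least \<open>t\<close>, the upper part is a standard monomial, hence
  \<open>z_m^k\<close> times some \<open>mu i\<close>.
\<close>

lemma Std_cases:
  assumes "\<gamma> \<in> Std"
  obtains "\<gamma> \<in> OrdE" | a i where "keys a \<subseteq> {1..m}" "i \<in> {1..d}" "\<gamma> = a + mu i"
proof (cases "edeg (upp \<gamma>) < t")
  case True then show thesis using that(1) assms by (simp add: OrdE_def)
next
  case False
  have "upp \<gamma> \<in> Std" using Std_divisor[of "upp \<gamma>" "low \<gamma>"] assms low_upp[of \<gamma>] by (simp add: add.commute)
  moreover have "low (upp \<gamma>) = 0" by (auto simp: low_def upp_def poly_mapping_eq_iff fun_eq_iff)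
  ultimately obtain i where i: "i \<in> {1..d}" "upp \<gamma> = Poly_Mapping.single m (edeg (upp \<gamma>) - t) + mu i"
    using upper_Std[of "upp \<gamma>" "edeg (upp \<gamma>) - t"] False by auto
  let ?a = "low \<gamma> + Poly_Mapping.single m (edeg (upp \<gamma>) - t)"
  have "keys (low \<gamma>) \<subseteq> {1..<m}" using low_keys Std_keys[OF assms] by blast
  then have "keys ?a \<subseteq> {1..m}" using m1 by (auto simp: keys_expo_add keys_single_subset)
  moreover have "\<gamma> = ?a + mu i" using low_upp[of \<gamma>] i(2) by (simp add: add.assoc)
  ultimately show thesis using that(2) i(1) by blast
qed

lemma Ext_Std: "\<gamma> \<in> ExtE \<Longrightarrow> \<gamma> \<in> Std"
  by (auto simp: ExtE_def ext_Std)

lemma Ord_Ext: "\<gamma> \<in> OrdE \<Longrightarrow> \<gamma> \<notin> ExtE"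
  using ext_edeg_upp(1) by (fastforce simp: OrdE_def ExtE_def)

lemma Std_Ord_Ext: "Std = OrdE \<union> ExtE"
proof -
  have "\<gamma> \<in> OrdE \<or> \<gamma> \<in> ExtE" if "\<gamma> \<in> Std" for \<gamma>
    using that by (cases rule: Std_cases) (auto intro: ExtI)
  then show ?thesis using Ext_Std by (auto simp: OrdE_def)
qed

text \<open>
  The basis \<open>\<C>\<close> of the coordinate ring indexed by standard exponents; the decomposition
  \<open>\<gamma> = a + mu i\<close> selected by \<open>SOME\<close> is unique.
\<close>

definition eb :: "expo \<Rightarrow> cpoly" where
  "eb \<gamma> = (if \<gamma> \<in> ExtE then
     (case (SOME (a, i). keys a \<subseteq> {1..m} \<and> i \<in> {1..d} \<and> \<gamma> = a + mu i) of (a, i) \<Rightarrow> zmon a * w i)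
     else zmon \<gamma>)"

lemma eb_ext:
  assumes "keys a \<subseteq> {1..m}" "i \<in> {1..d}" shows "eb (a + mu i) = zmon a * w i"
proof -
  have "(SOME (b, j). keys b \<subseteq> {1..m} \<and> j \<in> {1..d} \<and> a + mu i = b + mu j) = (a, i)"
    by (rule some_equality) (use assms ext_inj in \<open>auto split: prod.splits\<close>)
  then show ?thesis using ExtI[OF assms] by (simp add: eb_def)
qed

lemma eb_ord: "\<gamma> \<in> OrdE \<Longrightarrow> eb \<gamma> = zmon \<gamma>"
  using Ord_Ext by (simp add: eb_def)

lemma eb_Std: "\<gamma> \<in> Std \<Longrightarrow> keys (eb \<gamma>) \<subseteq> Std"
proof -
  assume "\<gamma> \<in> Std"
  then show ?thesis
  proof (cases rule: Std_cases)
    case 1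
    then show ?thesis by (simp add: eb_ord OrdE_def)
  next
    case (2 a i)
    then show ?thesis using zmon_w_Std[OF 2(1,2)] by (simp add: eb_ext)
  qed
qed

lemma eb_polys: "\<gamma> \<in> Std \<Longrightarrow> eb \<gamma> \<in> polys {1..n}"
  using eb_Std Std_polys by blast

lemma w_keys_kle:
  assumes "i \<in> {1..d}" "\<delta> \<in> keys (w i)" "j \<in> {1..d}"
  shows "edeg \<delta> = t" "kless \<delta> (mu j) \<or> \<delta> \<in> Q"
proof -
  show e: "edeg \<delta> = t" using w_keys assms by blast
  show "kless \<delta> (mu j) \<or> \<delta> \<in> Q"
    using low_nz_kless[of \<delta> "mu j"] w_keys[OF assms(1,2)] mu_low[OF assms(3)] mu_edeg[OF assms(3)]
    by (auto simp: Q_def)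
qed

text \<open>
  The triangularity of the basis with respect to the monomials, up to exponents that agree in degree and
  \<open>low\<close>.
\<close>

lemma eb_keys:
  assumes "\<gamma> \<in> Std" "\<delta> \<in> keys (eb \<gamma>)"
  shows "edeg \<delta> = edeg \<gamma>" "kle \<delta> \<gamma>" "edeg (low \<gamma>) \<le> edeg (low \<delta>)"
proof -
  have "edeg \<delta> = edeg \<gamma> \<and> kle \<delta> \<gamma> \<and> edeg (low \<gamma>) \<le> edeg (low \<delta>)"
    using assms(1)
  proof (cases rule: Std_cases)
    case 1
    then show ?thesis using assms(2) by (auto simp: eb_ord)
  next
    case (2 a i)
    then obtain \<epsilon> where \<epsilon>: "\<epsilon> \<in> keys (w i)" "\<delta> = a + \<epsilon>" using assms(2) by (auto simp: eb_ext keys_zmon_mult)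
    have "kle \<epsilon> (mu i)" using w_keys_kle[OF 2(2) \<epsilon>(1) 2(2)] mu_low[OF 2(2)] mu_edeg[OF 2(2)]
      by (auto simp: Q_def keq_def)
    then have "kle (\<epsilon> + a) (mu i + a)" using kless_keq_add keq_add keq_refl by blast
    then show ?thesis
      using w_keys_kle(1)[OF 2(2) \<epsilon>(1) 2(2)] 2 \<epsilon>(2) mu_low[OF 2(2)] mu_edeg[OF 2(2)]
      by (simp add: add.commute low_add)
  qed
  then show "edeg \<delta> = edeg \<gamma>" "kle \<delta> \<gamma>" "edeg (low \<gamma>) \<le> edeg (low \<delta>)" by auto
qed

lemma eb_nz:
  assumes "\<gamma> \<in> Std" shows "eb \<gamma> \<noteq> 0"
  using assms
proof (cases rule: Std_cases)
  case (2 a i)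
  have "w i \<noteq> 0" using w_val[OF 2(2,2)] p_nz[OF 2(2)] by auto
  then show ?thesis using 2 by (auto simp: eb_ext keys_zmon_mult simp flip: keys_eq_empty)
qed (auto simp: eb_ord simp flip: keys_eq_empty)

lemma eb_homog: "\<gamma> \<in> Std \<Longrightarrow> eb \<gamma> \<in> homog {1..n} (edeg \<gamma>)"
  using eb_keys(1) eb_polys by (auto simp: homog_def)

text \<open>
  In a relation take the grevlex greatest exponent \<open>\<delta>0\<close> with nonzero coefficient.  By triangularity only the basis
  elements with the same degree and \<open>low\<close> contribute at such exponents.  For \<open>\<delta>0\<close> ordinary
  there is just one; for \<open>\<delta>0 = a + mu i\<close> these are the \<open>z^a w_j\<close>, whose coefficient matrix on \<open>Q\<close> is
  invertible.
\<close>

lemma eb_independent: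
  assumes S: "finite S" "S \<subseteq> Std"
    and z: "\<And>a. a \<in> V \<Longrightarrow> (\<Sum>\<delta>\<in>S. c \<delta> * peval a (eb \<delta>)) = 0"
  shows "\<forall>\<delta>\<in>S. c \<delta> = 0"
proof (rule ccontr)
  assume ne: "\<not> (\<forall>\<delta>\<in>S. c \<delta> = 0)"
  define r where "r = (\<Sum>\<delta>\<in>S. cscale (c \<delta>) (eb \<delta>))"
  have "keys r \<subseteq> (\<Union>\<delta>\<in>S. keys (eb \<delta>))" unfolding r_def by (rule keys_lin_comb)
  also have "\<dots> \<subseteq> Std" using eb_Std S(2) by blast
  finally have "keys r \<subseteq> Std" .
  then have r0: "r = 0" using z by (intro Std_eqV_0) (auto simp: r_def eqV_def)
  obtain \<delta>0 where \<delta>0: "\<delta>0 \<in> {\<delta>\<in>S. c \<delta> \<noteq> 0}" "\<And>\<delta>. \<delta> \<in> {\<delta>\<in>S. c \<delta> \<noteq> 0} \<Longrightarrow> \<delta> \<noteq> \<delta>0 \<Longrightarrow> grevlex \<delta> \<delta>0"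
    using finite_has_grevlex_max[of "{\<delta>\<in>S. c \<delta> \<noteq> 0}"] S(1) ne by auto
  have keq: "keq \<delta> \<delta>0" if "\<delta> \<in> S" "c \<delta> \<noteq> 0" "lookup (eb \<delta>) \<nu> \<noteq> 0" "keq \<nu> \<delta>0" for \<delta> \<nu>
  proof -
    have "kle \<nu> \<delta>" using eb_keys(2)[of \<delta> \<nu>] that S(2) by (auto simp: in_keys_iff)
    then have "kle \<delta>0 \<delta>" using kle_trans keq_sym[OF that(4)] by blast
    moreover have "\<not> kless \<delta>0 \<delta>"
      using \<delta>0(2)[of \<delta>] that(1,2) kless_grevlex grevlex_asym grevlex_irrefl by blast
    ultimately show ?thesis using keq_sym by blast
  qed
  have lr: "(\<Sum>\<delta>\<in>S. c \<delta> * lookup (eb \<delta>) \<nu>) = 0" for \<nu>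
    using arg_cong[OF r0, of "\<lambda>f. lookup f \<nu>"] by (simp add: r_def lookup_sum)
  have "\<delta>0 \<in> Std" using \<delta>0(1) S(2) by auto
  then show False
  proof (cases rule: Std_cases)
    case 1
    have "c \<delta> * lookup (eb \<delta>) \<delta>0 = (if \<delta> = \<delta>0 then c \<delta>0 else 0)" if "\<delta> \<in> S" for \<delta>
    proof (cases "c \<delta> \<noteq> 0 \<and> lookup (eb \<delta>) \<delta>0 \<noteq> 0")
      case True
      then have k: "keq \<delta> \<delta>0" using keq[OF that, of \<delta>0] by simp
      have "edeg (upp \<delta>) = edeg (upp \<delta>0)" by (rule keq_edeg_upp[OF k])
      then have "\<delta> \<in> OrdE" using 1 that S(2) by (auto simp: OrdE_def)
      then show ?thesis by (auto simp: eb_ord lookup_single when_def)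
    next
      case False
      then show ?thesis using 1 by (auto simp: eb_ord)
    qed
    then have "(\<Sum>\<delta>\<in>S. c \<delta> * lookup (eb \<delta>) \<delta>0) = (\<Sum>\<delta>\<in>S. if \<delta> = \<delta>0 then c \<delta>0 else 0)"
      by (rule sum.cong[OF refl])
    then show False using lr[of \<delta>0] \<delta>0(1) S(1) by (simp add: sum.delta')
  next
    case (2 a i)
    define c' where "c' j = (if a + mu j \<in> S then c (a + mu j) else 0)" for j
    have *: "(\<Sum>j=1..d. c' j * lookup (w j) (mu k)) = 0" if k: "k \<in> {1..d}" for k
    proof -
      have kq: "keq (a + mu k) \<delta>0" using 2 k ext_edeg_upp by (simp add: keq_def)
      let ?S = "(\<lambda>j. a + mu j) ` {j\<in>{1..d}. a + mu j \<in> S}"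
      have "(\<Sum>\<delta>\<in>S. c \<delta> * lookup (eb \<delta>) (a + mu k)) = (\<Sum>\<delta>\<in>?S. c \<delta> * lookup (eb \<delta>) (a + mu k))"
      proof (rule sum.mono_neutral_right)
        show "\<forall>\<delta>\<in>S - ?S. c \<delta> * lookup (eb \<delta>) (a + mu k) = 0"
        proof
          fix \<delta> assume \<delta>: "\<delta> \<in> S - ?S"
          show "c \<delta> * lookup (eb \<delta>) (a + mu k) = 0"
          proof (rule ccontr)
            assume "\<not> ?thesis"
            then have k: "keq \<delta> \<delta>0" using keq[of \<delta> "a + mu k"] \<delta> kq by auto
            have "edeg (upp \<delta>) = edeg (upp \<delta>0)" by (rule keq_edeg_upp[OF k])
            also have "\<dots> \<ge> t" using 2 ext_edeg_upp by simp
            finally have "\<delta> \<notin> OrdE" by (simp add: OrdE_def)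
            then obtain b j where b: "keys b \<subseteq> {1..m}" "j \<in> {1..d}" "\<delta> = b + mu j"
              using Std_cases[of \<delta>] \<delta> S(2) by blast
            then have "b = a" using keq_ext_eq[OF b(1,2) 2(1,2)] k 2 by simp
            then show False using \<delta> b by blast
          qed
        qed
      qed (use S in auto)
      also have "\<dots> = (\<Sum>j\<in>{j\<in>{1..d}. a + mu j \<in> S}. c (a + mu j) * lookup (eb (a + mu j)) (a + mu k))"
        by (rule sum.reindex_cong[OF _ refl refl]) (use mu_inj in \<open>auto simp: inj_on_def\<close>)
      also have "\<dots> = (\<Sum>j\<in>{j\<in>{1..d}. a + mu j \<in> S}. c' j * lookup (w j) (mu k))"
        by (rule sum.cong) (use 2 in \<open>auto simp: eb_ext c'_def\<close>)
      also have "\<dots> = (\<Sum>j=1..d. c' j * lookup (w j) (mu k))"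
        by (rule sum.mono_neutral_left) (auto simp: c'_def)
      finally show ?thesis using lr by simp
    qed
    have "0 = (\<Sum>k=1..d. (\<Sum>j=1..d. c' j * lookup (w j) (mu k)) * E (mu k) i)" using * by simp
    also have "\<dots> = (\<Sum>j=1..d. c' j * (\<Sum>k=1..d. lookup (w j) (mu k) * E (mu k) i))"
      unfolding sum_distrib_left sum_distrib_right by (subst sum.swap) (simp add: mult.assoc)
    also have "\<dots> = (\<Sum>j=1..d. c' j * (if j = i then 1 else 0))"
      by (rule sum.cong) (use DE 2 in \<open>auto simp: sum_Q\<close>)
    also have "\<dots> = (\<Sum>j=1..d. if j = i then c' j else 0)"
      by (rule sum.cong) auto
    also have "\<dots> = c' i" using 2(2) by simp
    finally show False using 2 \<delta>0(1) by (auto simp: c'_def)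
  qed
qed

end

section \<open>Expansion in the basis and enumerations\<close>

text \<open>
  On a finite initial segment \<open>D\<close> of a linear order, counting predecessors is a bijection onto
  \<open>{..<card D}\<close>, and the count within \<open>D\<close> is the count within all of \<open>S\<close>.
\<close>

lemma enum_by_initial_segment:
  assumes irrefl: "\<And>x. x \<in> S \<Longrightarrow> \<not> lt x x"
    and trans: "\<And>x y z. x \<in> S \<Longrightarrow> y \<in> S \<Longrightarrow> z \<in> S \<Longrightarrow> lt x y \<Longrightarrow> lt y z \<Longrightarrow> lt x z"
    and total: "\<And>x y. x \<in> S \<Longrightarrow> y \<in> S \<Longrightarrow> x = y \<or> lt x y \<or> lt y x"
    and D: "finite D" "D \<subseteq> S" "\<And>x y. x \<in> D \<Longrightarrow> y \<in> S \<Longrightarrow> lt y x \<Longrightarrow> y \<in> D"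
  shows "bij_betw (enum_by lt S) {..<card D} D"
    and "x \<in> D \<Longrightarrow> y \<in> D \<Longrightarrow> lt x y \<Longrightarrow> \<exists>i j. i < j \<and> j < card D \<and> enum_by lt S i = x \<and> enum_by lt S j = y"
proof -
  define P where "P x = {y \<in> S. lt y x}" for x
  have P: "P x \<subseteq> D" "finite (P x)" "x \<notin> P x" if "x \<in> D" for x
  proof -
    show "P x \<subseteq> D" using D(3) that by (auto simp: P_def)
    then show "finite (P x)" using D(1) finite_subset by blast
    show "x \<notin> P x" using irrefl D(2) that by (auto simp: P_def)
  qed
  have less: "card (P x) < card (P y)" if "x \<in> S" "y \<in> S" "lt x y" "finite (P y)" for x y
  proof (rule psubset_card_mono[OF that(4)])
    show "P x \<subset> P y" using trans[OF _ that(1,2) _ that(3)] irrefl[OF that(1)] that by (auto simp: P_def)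
  qed
  have inj: "inj_on (\<lambda>x. card (P x)) D"
    using total less P(2) D(2) by (intro inj_onI) (metis less_irrefl subsetD)
  have "(\<lambda>x. card (P x)) ` D \<subseteq> {..<card D}"
  proof
    fix k assume "k \<in> (\<lambda>x. card (P x)) ` D"
    then obtain x where x: "x \<in> D" "k = card (P x)" by blast
    have "P x \<subset> D" using P[OF x(1)] x(1) by blast
    then show "k \<in> {..<card D}" using psubset_card_mono[OF D(1)] x(2) by simp
  qed
  then have img: "(\<lambda>x. card (P x)) ` D = {..<card D}"
    by (rule card_subset_eq[OF finite_lessThan]) (simp add: card_image[OF inj])
  have en: "enum_by lt S (card (P x)) = x" if "x \<in> D" for x
    unfolding enum_by_def P_def[symmetric]
  proof (rule the_equality)
    show "x \<in> S \<and> finite (P x) \<and> card (P x) = card (P x)" using that P D(2) by auto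
    fix y assume y: "y \<in> S \<and> finite (P y) \<and> card (P y) = card (P x)"
    then show "y = x" using total[of x y] less[of x y] less[of y x] that D(2) P(2)[OF that] by auto
  qed
  show "bij_betw (enum_by lt S) {..<card D} D"
  proof -
    have "bij_betw (\<lambda>x. card (P x)) D {..<card D}" using inj img by (simp add: bij_betw_def)
    from bij_betw_inv_into[OF this] show ?thesis
    proof (subst bij_betw_cong)
      fix k assume "k \<in> {..<card D}"
      then obtain x where x: "x \<in> D" "k = card (P x)" using img by blast
      then show "enum_by lt S k = inv_into D (\<lambda>x. card (P x)) k"
        using en inv_into_f_f[OF inj] by simp
    qed
  qed
  show "\<exists>i j. i < j \<and> j < card D \<and> enum_by lt S i = x \<and> enum_by lt S j = y"
    if "x \<in> D" "y \<in> D" "lt x y"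
    using less[of x y] that D(2) P(2) en img
    by (intro exI[of _ "card (P x)"] exI[of _ "card (P y)"]) auto
qed

lemma span_image_coeffs:
  assumes "finite S" "f \<in> cpoly.span (g ` S)"
  shows "\<exists>c. f = (\<Sum>x\<in>S. cscale (c x) (g x))"
  using assms(2)
proof (induction rule: cpoly.span_induct_alt)
  case base
  show ?case by (rule exI[of _ "\<lambda>_. 0"]) simp
next
  case (step k h f)
  obtain x where x: "x \<in> S" "h = g x" using step by blast
  obtain c where c: "f = (\<Sum>x\<in>S. cscale (c x) (g x))" using step by blast
  have "cscale k h + f = (\<Sum>y\<in>S. cscale ((if y = x then k else 0) + c y) (g y))"
    using x assms(1)
    by (simp add: cpoly.scale_left_distrib sum.distrib c if_distrib[of "\<lambda>k. cscale k _"] sum.delta cong: if_cong)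
  then show ?case by (rule exI[of _ "\<lambda>y. (if y = x then k else 0) + c y"])
qed

context noether_setup
begin

definition StdS :: "nat \<Rightarrow> expo set" where "StdS s = {\<gamma>\<in>Std. edeg \<gamma> \<le> s}"

text \<open>
  \<open>Sd \<gamma>\<close> indexes all basis elements that can occur in the expansion of \<open>z^\<gamma>\<close>.
\<close>

definition Sd :: "expo \<Rightarrow> expo set" where "Sd \<gamma> = {\<delta>\<in>Std. edeg \<delta> = edeg \<gamma> \<and> kle \<delta> \<gamma>}"

lemma finite_StdS [simp]: "finite (StdS s)"
  by (rule finite_subset[OF _ finite_expos[of "{1..n}" s]]) (auto simp: StdS_def expos_def dest: Std_keys)

lemma finite_Sd [simp]: "finite (Sd \<gamma>)"
  by (rule finite_subset[OF _ finite_StdS[of "edeg \<gamma>"]]) (auto simp: StdS_def Sd_def)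

lemma Sd_mono: "\<delta> \<in> Sd \<gamma> \<Longrightarrow> Sd \<delta> \<subseteq> Sd \<gamma>"
  unfolding Sd_def using kle_trans by auto

text \<open>
  The weight makes exponents with large \<open>low\<close> cheap, which is where the coefficients grow.
\<close>

definition wrep :: "real \<Rightarrow> expo set \<Rightarrow> cpoly \<Rightarrow> real \<Rightarrow> bool" where
  "wrep R S f b \<longleftrightarrow> (\<exists>x. f = (\<Sum>\<delta>\<in>S. cscale (x \<delta>) (eb \<delta>)) \<and>
     (\<Sum>\<delta>\<in>S. cmod (x \<delta>) / R ^ edeg (low \<delta>)) \<le> b)"

lemma wrep_add:
  assumes "R > 0" "wrep R S f b" "wrep R S g b'" shows "wrep R S (f + g) (b + b')"
proof -
  obtain x y where x: "f = (\<Sum>\<delta>\<in>S. cscale (x \<delta>) (eb \<delta>))" "(\<Sum>\<delta>\<in>S. cmod (x \<delta>) / R ^ edeg (low \<delta>)) \<le> b"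
    and y: "g = (\<Sum>\<delta>\<in>S. cscale (y \<delta>) (eb \<delta>))" "(\<Sum>\<delta>\<in>S. cmod (y \<delta>) / R ^ edeg (low \<delta>)) \<le> b'"
    using assms by (auto simp: wrep_def)
  have "(\<Sum>\<delta>\<in>S. cmod (x \<delta> + y \<delta>) / R ^ edeg (low \<delta>)) \<le>
      (\<Sum>\<delta>\<in>S. cmod (x \<delta>) / R ^ edeg (low \<delta>) + cmod (y \<delta>) / R ^ edeg (low \<delta>))"
    using assms(1) by (intro sum_mono) (simp add: add_divide_distrib[symmetric] divide_right_mono norm_triangle_ineq)
  also have "\<dots> \<le> b + b'" using x(2) y(2) by (simp add: sum.distrib)
  finally show ?thesis
    unfolding wrep_def by (intro exI[of _ "\<lambda>\<delta>. x \<delta> + y \<delta>"]) (simp add: x(1) y(1) cpoly.scale_left_distrib sum.distrib)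
qed

lemma wrep_cscale:
  assumes "wrep R S f b" shows "wrep R S (cscale c f) (cmod c * b)"
proof -
  obtain x where x: "f = (\<Sum>\<delta>\<in>S. cscale (x \<delta>) (eb \<delta>))" "(\<Sum>\<delta>\<in>S. cmod (x \<delta>) / R ^ edeg (low \<delta>)) \<le> b"
    using assms by (auto simp: wrep_def)
  have "(\<Sum>\<delta>\<in>S. cmod (c * x \<delta>) / R ^ edeg (low \<delta>)) = cmod c * (\<Sum>\<delta>\<in>S. cmod (x \<delta>) / R ^ edeg (low \<delta>))"
    by (simp add: sum_distrib_left norm_mult)
  also have "\<dots> \<le> cmod c * b" using x(2) by (intro mult_left_mono) auto
  finally show ?thesis
    unfolding wrep_def by (intro exI[of _ "\<lambda>\<delta>. c * x \<delta>"]) (simp add: x(1) cpoly.scale_sum_right)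
qed

lemma wrep_0: "wrep R S 0 0"
  unfolding wrep_def by (rule exI[of _ "\<lambda>_. 0"]) simp

lemma wrep_sum:
  assumes "R > 0" "\<And>x. x \<in> A \<Longrightarrow> wrep R S (f x) (b x)" shows "wrep R S (sum f A) (sum b A)"
  using assms by (induction A rule: infinite_finite_induct) (auto intro: wrep_0 wrep_add)

lemma wrep_mono:
  assumes "wrep R S f b" "S \<subseteq> S'" "finite S'" "b \<le> b'" shows "wrep R S' f b'"
proof -
  obtain x where x: "f = (\<Sum>\<delta>\<in>S. cscale (x \<delta>) (eb \<delta>))" "(\<Sum>\<delta>\<in>S. cmod (x \<delta>) / R ^ edeg (low \<delta>)) \<le> b"
    using assms by (auto simp: wrep_def)
  let ?y = "\<lambda>\<delta>. if \<delta> \<in> S then x \<delta> else 0"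
  have "f = (\<Sum>\<delta>\<in>S'. cscale (?y \<delta>) (eb \<delta>))"
    unfolding x(1) by (rule sum.mono_neutral_cong_left) (use assms in auto)
  moreover have "(\<Sum>\<delta>\<in>S'. cmod (?y \<delta>) / R ^ edeg (low \<delta>)) = (\<Sum>\<delta>\<in>S. cmod (x \<delta>) / R ^ edeg (low \<delta>))"
    by (rule sum.mono_neutral_cong_right) (use assms in auto)
  ultimately show ?thesis unfolding wrep_def using x(2) assms(4) by (intro exI[of _ ?y]) simp
qed

lemma wrep_eb: 
  assumes "\<delta> \<in> S" "finite S" shows "wrep R S (eb \<delta>) (1 / R ^ edeg (low \<delta>))"
  unfolding wrep_def
  by (rule exI[of _ "\<lambda>\<epsilon>. if \<epsilon> = \<delta> then 1 else 0"])
     (use assms in \<open>simp add: if_distrib[of cmod] if_distrib[of "\<lambda>c. cscale c _"] if_distrib[of "\<lambda>c. c / _"] sum.delta cong: if_cong\<close>)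

text \<open>
  On \<open>Q\<close> the matrix \<open>E\<close> expresses \<open>z^(a + mu i)\<close> by the \<open>z^a w_j\<close> up to monomials of the same degree
  with strictly larger degree of \<open>low\<close>.  Each further substitution multiplies the coefficients by at most \<open>B1\<close> while the weight
  gains a factor \<open>1 / R\<close>; with \<open>R \<ge> 2 B1\<close> the geometric series is summed by the induction.
\<close>

lemma zmon_expand:
  obtains R B where "R \<ge> 1" "B \<ge> 1" "\<And>\<gamma>. \<gamma> \<in> Std \<Longrightarrow> wrep R (Sd \<gamma>) (zmon \<gamma>) (B / R ^ edeg (low \<gamma>))"
proof -
  \<comment> \<open>\<open>L j\<close>: the monomials of \<open>w j\<close> outside \<open>Q\<close>, on which \<open>w j\<close> and \<open>w0 j\<close> differ.\<close>
  define B0 where "B0 = 1 + (\<Sum>i=1..d. \<Sum>j=1..d. cmod (E (mu i) j))"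
  define L where "L j = {\<delta>\<in>keys (w j). low \<delta> \<noteq> 0}" for j
  define B1 where "B1 = (\<Sum>i=1..d. \<Sum>j=1..d. cmod (E (mu i) j) * (\<Sum>\<delta>\<in>L j. cmod (lookup (w j) \<delta>)))"
  define R where "R = max 1 (2 * B1)"
  define B where "B = 2 * B0"
  have B0: "B0 \<ge> 1" unfolding B0_def by (simp add: sum_nonneg)
  have R: "R \<ge> 1" "2 * B1 \<le> R" by (auto simp: R_def)
  have "\<gamma> \<in> Std \<Longrightarrow> wrep R (Sd \<gamma>) (zmon \<gamma>) (B / R ^ edeg (low \<gamma>))" if "keys \<gamma> \<subseteq> {1..n}" for \<gamma>
    using finite_atLeastAtMost[of 1 n] that
  proof (induction \<gamma> rule: grevlex_induct)
    case (less \<gamma>)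
    show ?case using \<open>\<gamma> \<in> Std\<close>
    proof (cases rule: Std_cases)
      case 1
      have "wrep R (Sd \<gamma>) (eb \<gamma>) (1 / R ^ edeg (low \<gamma>))"
        by (rule wrep_eb[OF _ finite_Sd]) (use less.prems in \<open>auto simp: Sd_def\<close>)
      then show ?thesis using 1 B0 R(1) by (auto simp: eb_ord B_def intro!: wrep_mono[where S' = "Sd \<gamma>"] divide_right_mono)
    next
      case (2 a i)
      let ?r = "R ^ edeg (low \<gamma>)"
      have rpos: "?r > 0" using R(1) by simp
      have lg: "low \<gamma> = low a" using ext_edeg_upp(2) 2 by simp
      let ?f = "\<lambda>j. cscale (E (mu i) j) (eb (a + mu j))"
      let ?g = "\<lambda>j. cscale (- E (mu i) j) (\<Sum>\<delta>\<in>L j. cscale (lookup (w j) \<delta>) (zmon (a + \<delta>)))"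
      have "zmon \<gamma> = zmon a * zmon (mu i)" by (simp add: 2 mult_single)
      also have "\<dots> = (\<Sum>j=1..d. cscale (E (mu i) j) (zmon a * w0 j))"
        by (subst zmon_Q[OF mu_Q[OF 2(2)]]) (simp add: sum_distrib_left cscale_mult mult.left_commute)
      also have "\<dots> = (\<Sum>j=1..d. ?f j + ?g j)"
      proof (rule sum.cong[OF refl])
        fix j assume j: "j \<in> {1..d}"
        have "w j = w0 j + restr (\<lambda>\<gamma>. low \<gamma> \<noteq> 0) (w j)" by (simp add: w0_def restr_split)
        then have "zmon a * w0 j = zmon a * w j - zmon a * restr (\<lambda>\<gamma>. low \<gamma> \<noteq> 0) (w j)"
          by (metis add_diff_cancel_right' distrib_left)
        also have "restr (\<lambda>\<gamma>. low \<gamma> \<noteq> 0) (w j) = (\<Sum>\<delta>\<in>L j. cscale (lookup (w j) \<delta>) (zmon \<delta>))"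
          by (subst poly_sum_zmon) (auto simp: L_def intro!: sum.cong)
        also have "zmon a * \<dots> = (\<Sum>\<delta>\<in>L j. cscale (lookup (w j) \<delta>) (zmon (a + \<delta>)))"
          by (simp add: sum_distrib_left cscale_mult mult.left_commute mult_single)
        also have "zmon a * w j = eb (a + mu j)" using 2 j by (simp add: eb_ext)
        finally show "cscale (E (mu i) j) (zmon a * w0 j) = ?f j + ?g j"
          by (simp add: cpoly.scale_right_diff_distrib)
      qed
      finally have z: "zmon \<gamma> = (\<Sum>j=1..d. ?f j + ?g j)" .
      have "wrep R (Sd \<gamma>) (\<Sum>j=1..d. ?f j + ?g j) (\<Sum>j=1..d. cmod (E (mu i) j) * (1 / ?r) +
          cmod (- E (mu i) j) * (\<Sum>\<delta>\<in>L j. cmod (lookup (w j) \<delta>) * (B / (?r * R))))"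
      proof (intro wrep_sum wrep_add wrep_cscale)
        show "0 < R" "0 < R" "0 < R" using R(1) by auto
        fix j assume j: "j \<in> {1..d}"
        have "a + mu j \<in> Sd \<gamma>" using 2 j ext_Std ext_edeg_upp by (auto simp: Sd_def keq_def)
        then have "wrep R (Sd \<gamma>) (eb (a + mu j)) (1 / R ^ edeg (low (a + mu j)))" by (rule wrep_eb) simp
        then show "wrep R (Sd \<gamma>) (eb (a + mu j)) (1 / ?r)" using 2 j ext_edeg_upp(2) by simp
        fix \<delta> assume \<delta>: "\<delta> \<in> L j"
        have ad: "a + \<delta> \<in> Std" using zmon_w_Std[OF 2(1) j] \<delta> by (auto simp: L_def keys_zmon_mult)
        have \<delta>t: "edeg \<delta> = t" "low \<delta> \<noteq> 0" "\<delta> \<in> keys (w j)" using \<delta> w_keys[OF j] by (auto simp: L_def)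
        have "kless \<delta> (mu i)" using low_nz_kless[of \<delta> "mu i"] \<delta>t mu_low 2 mu_edeg by auto
        then have k: "kless (a + \<delta>) \<gamma>" using kless_keq_add[OF _ keq_refl, of \<delta> "mu i" a] by (simp add: 2 add.commute)
        have sub: "Sd (a + \<delta>) \<subseteq> Sd \<gamma>"
          by (rule Sd_mono) (use ad k \<delta>t 2 mu_edeg in \<open>auto simp: Sd_def\<close>)
        have "wrep R (Sd (a + \<delta>)) (zmon (a + \<delta>)) (B / R ^ edeg (low (a + \<delta>)))"
          using less.IH[OF Std_keys[OF ad] kless_grevlex[OF k] ad] .
        moreover have "edeg (low \<delta>) \<noteq> 0"
          using \<delta>t(2) by (auto simp: edeg_def poly_mapping_eq_iff fun_eq_iff in_keys_iff)
        then have "edeg (low \<gamma>) + 1 \<le> edeg (low (a + \<delta>))"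
          by (simp add: low_add lg)
        then have "R ^ (edeg (low \<gamma>) + 1) \<le> R ^ edeg (low (a + \<delta>))"
          using R(1) by (rule power_increasing)
        then have "B / R ^ edeg (low (a + \<delta>)) \<le> B / (?r * R)"
          using R(1) B0 by (intro divide_left_mono) (simp_all add: B_def power_add mult.commute)
        ultimately show "wrep R (Sd \<gamma>) (zmon (a + \<delta>)) (B / (?r * R))"
          using wrep_mono[OF _ sub finite_Sd] by blast
      qed
      moreover have "(\<Sum>j=1..d. cmod (E (mu i) j) * (1 / ?r) +
          cmod (- E (mu i) j) * (\<Sum>\<delta>\<in>L j. cmod (lookup (w j) \<delta>) * (B / (?r * R)))) \<le> B / ?r"
      proof -
        have "(\<Sum>j=1..d. cmod (E (mu i) j) * (1 / ?r) +
            cmod (- E (mu i) j) * (\<Sum>\<delta>\<in>L j. cmod (lookup (w j) \<delta>) * (B / (?r * R)))) =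
            ((\<Sum>j=1..d. cmod (E (mu i) j)) + (\<Sum>j=1..d. cmod (E (mu i) j) * (\<Sum>\<delta>\<in>L j. cmod (lookup (w j) \<delta>))) * (B / R)) / ?r"
        proof -
          have "(\<Sum>j=1..d. cmod (E (mu i) j) * (1 / ?r) +
              cmod (- E (mu i) j) * (\<Sum>\<delta>\<in>L j. cmod (lookup (w j) \<delta>) * (B / (?r * R)))) =
              (\<Sum>j=1..d. cmod (E (mu i) j) / ?r +
              (cmod (E (mu i) j) * (\<Sum>\<delta>\<in>L j. cmod (lookup (w j) \<delta>))) * (B / R) / ?r)"
            by (rule sum.cong[OF refl], simp only: sum_distrib_right[symmetric] norm_minus_cancel)
               (simp add: mult.commute mult.left_commute)
          also have "\<dots> = (\<Sum>j=1..d. cmod (E (mu i) j)) / ?r +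
              (\<Sum>j=1..d. cmod (E (mu i) j) * (\<Sum>\<delta>\<in>L j. cmod (lookup (w j) \<delta>))) * (B / R) / ?r"
            by (simp only: sum.distrib sum_divide_distrib sum_distrib_right)
          finally show ?thesis by (simp only: add_divide_distrib)
        qed
        also have "\<dots> \<le> (B0 + B1 * (B / R)) / ?r"
        proof (intro divide_right_mono add_mono mult_right_mono)
          have "(\<Sum>j=1..d. cmod (E (mu i) j)) \<le> (\<Sum>i=1..d. \<Sum>j=1..d. cmod (E (mu i) j))"
            using 2(2) by (intro member_le_sum[of i "{1..d}" "\<lambda>i. \<Sum>j=1..d. cmod (E (mu i) j)"]) (auto intro: sum_nonneg)
          then show "(\<Sum>j=1..d. cmod (E (mu i) j)) \<le> B0" by (simp add: B0_def)
          show "(\<Sum>j=1..d. cmod (E (mu i) j) * (\<Sum>\<delta>\<in>L j. cmod (lookup (w j) \<delta>))) \<le> B1"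
            unfolding B1_def using 2(2) 
            by (intro member_le_sum[of i "{1..d}" "\<lambda>i. \<Sum>j=1..d. cmod (E (mu i) j) * (\<Sum>\<delta>\<in>L j. cmod (lookup (w j) \<delta>))"])
               (auto intro!: sum_nonneg mult_nonneg_nonneg)
          show "0 \<le> B / R" using B0 R(1) by (simp add: B_def)
          show "0 \<le> ?r" using rpos by simp
        qed
        also have "\<dots> \<le> B / ?r"
        proof (rule divide_right_mono)
          have "B1 * (B / R) = B0 * (2 * B1 / R)" by (simp add: B_def)
          also have "\<dots> \<le> B0 * 1" using R B0 by (intro mult_left_mono) auto
          finally show "B0 + B1 * (B / R) \<le> B" by (simp add: B_def)
        qed (use rpos in simp)
        finally show ?thesis .
      qed
      ultimately show ?thesis unfolding z using wrep_mono by (meson finite_Sd order_refl)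
    qed
  qed
  then show thesis using that[of R B] R(1) B0 Std_keys by (auto simp: B_def)
qed

lemma zmon_in_span: "\<gamma> \<in> Std \<Longrightarrow> zmon \<gamma> \<in> cpoly.span (eb ` Sd \<gamma>)"
proof -
  assume \<gamma>: "\<gamma> \<in> Std"
  obtain R B where "R \<ge> 1" "B \<ge> 1" "\<And>\<gamma>. \<gamma> \<in> Std \<Longrightarrow> wrep R (Sd \<gamma>) (zmon \<gamma>) (B / R ^ edeg (low \<gamma>))"
    using zmon_expand by blast
  then obtain x where "zmon \<gamma> = (\<Sum>\<delta>\<in>Sd \<gamma>. cscale (x \<delta>) (eb \<delta>))" using \<gamma> by (auto simp: wrep_def)
  also have "\<dots> \<in> cpoly.span (eb ` Sd \<gamma>)"
    by (intro cpoly.span_sum cpoly.span_scale cpoly.span_base imageI)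
  finally show ?thesis .
qed

definition coords :: "expo set \<Rightarrow> cpoly \<Rightarrow> (expo \<Rightarrow> complex) \<Rightarrow> bool" where
  "coords S f c \<longleftrightarrow> (\<forall>a\<in>V. peval a f = (\<Sum>\<delta>\<in>S. c \<delta> * peval a (eb \<delta>)))"

text \<open>
  First reduce to standard monomials, then expand these.
\<close>

lemma ex_coords:
  assumes S: "finite S" "S \<subseteq> Std" "\<And>\<gamma>. \<gamma> \<in> S \<Longrightarrow> Sd \<gamma> \<subseteq> S"
    and f: "f \<in> polys {1..n}" "\<And>\<gamma> \<delta>. \<gamma> \<in> keys f \<Longrightarrow> \<delta> \<in> Std \<Longrightarrow> \<delta> = \<gamma> \<or> grevlex \<delta> \<gamma> \<Longrightarrow> \<delta> \<in> S"
  shows "\<exists>c. coords S f c"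
proof -
  obtain r where r: "keys r \<subseteq> Std" "\<And>\<delta>. \<delta> \<in> keys r \<Longrightarrow> \<exists>\<gamma>\<in>keys f. \<delta> = \<gamma> \<or> grevlex \<delta> \<gamma>" "eqV V f r"
    using reduce_poly[OF f(1)] by metis
  have "zmon \<delta> \<in> cpoly.span (eb ` S)" if "\<delta> \<in> keys r" for \<delta>
  proof -
    have "\<delta> \<in> S" using r(1,2) that f(2) by blast
    then show ?thesis using zmon_in_span[of \<delta>] S(2,3) cpoly.span_mono[of "eb ` Sd \<delta>" "eb ` S"] by blast
  qed
  then have "(\<Sum>\<delta>\<in>keys r. cscale (lookup r \<delta>) (zmon \<delta>)) \<in> cpoly.span (eb ` S)"
    by (intro cpoly.span_sum cpoly.span_scale)
  then obtain c where "r = (\<Sum>\<delta>\<in>S. cscale (c \<delta>) (eb \<delta>))"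
    using span_image_coeffs[OF S(1)] poly_sum_zmon[of r] by metis
  then show ?thesis using r(3) by (intro exI[of _ c]) (simp add: coords_def eqV_def)
qed

lemma ex_coords_StdS:
  assumes "f \<in> polys {1..n}" "\<And>\<gamma>. \<gamma> \<in> keys f \<Longrightarrow> edeg \<gamma> \<le> s"
  shows "\<exists>c. coords (StdS s) f c"
proof (rule ex_coords)
  show "Sd \<gamma> \<subseteq> StdS s" if "\<gamma> \<in> StdS s" for \<gamma> using that by (auto simp: StdS_def Sd_def)
  show "\<delta> \<in> StdS s" if "\<gamma> \<in> keys f" "\<delta> \<in> Std" "\<delta> = \<gamma> \<or> grevlex \<delta> \<gamma>" for \<gamma> \<delta>
    using assms(2)[OF that(1)] that grevlex_edeg[of \<delta> \<gamma>] by (auto simp: StdS_def)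
  show "StdS s \<subseteq> Std" by (auto simp: StdS_def)
qed (use assms in simp_all)

lemma finite_kless: "finite {\<delta>\<in>Std. kless \<delta> \<gamma>}"
  by (rule finite_subset[OF _ finite_StdS[of "edeg \<gamma>"]]) (use kle_edeg in \<open>auto simp: StdS_def\<close>)

lemma ex_coords_kless:
  assumes "f \<in> polys {1..n}" "\<And>\<delta>. \<delta> \<in> keys f \<Longrightarrow> kless \<delta> \<gamma>"
  shows "\<exists>c. coords {\<delta>\<in>Std. kless \<delta> \<gamma>} f c"
proof (rule ex_coords)
  show "Sd \<delta> \<subseteq> {\<delta>\<in>Std. kless \<delta> \<gamma>}" if "\<delta> \<in> {\<delta>\<in>Std. kless \<delta> \<gamma>}" for \<delta>
    using that kle_kless_trans by (auto simp: Sd_def)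
  show "\<delta> \<in> {\<delta>\<in>Std. kless \<delta> \<gamma>}" if "\<epsilon> \<in> keys f" "\<delta> \<in> Std" "\<delta> = \<epsilon> \<or> grevlex \<delta> \<epsilon>" for \<epsilon> \<delta>
    using assms(2)[OF that(1)] that grevlex_kle[of \<delta> \<epsilon>] kle_kless_trans by blast
qed (use assms finite_kless in auto)

lemma coords_unique:
  assumes "finite S" "S \<subseteq> Std" "coords S f c" "coords S f c'" "\<delta> \<in> S" shows "c \<delta> = c' \<delta>"
proof -
  have "\<forall>\<delta>\<in>S. c \<delta> - c' \<delta> = 0"
    by (rule eb_independent) (use assms in \<open>auto simp: coords_def left_diff_distrib sum_subtractf\<close>)
  then show ?thesis using assms(5) by simp
qed

lemma eb_inj: "inj_on eb Std"
proof (rule inj_onI)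
  fix \<gamma> \<delta> assume gd: "\<gamma> \<in> Std" "\<delta> \<in> Std" "eb \<gamma> = eb \<delta>"
  show "\<gamma> = \<delta>"
  proof (rule ccontr)
    assume "\<gamma> \<noteq> \<delta>"
    then have "\<forall>\<epsilon>\<in>{\<gamma>, \<delta>}. (if \<epsilon> = \<gamma> then 1 else - 1 :: complex) = 0"
      by (intro eb_independent) (use gd in auto)
    then show False by auto
  qed
qed

lemma eb_not_in_span:
  assumes "\<gamma> \<in> Std" shows "eb \<gamma> \<notin> cpoly.span (eb ` (Std - {\<gamma>}))"
proof
  assume "eb \<gamma> \<in> cpoly.span (eb ` (Std - {\<gamma>}))"
  then obtain T r where T: "finite T" "T \<subseteq> eb ` (Std - {\<gamma>})" "eb \<gamma> = (\<Sum>f\<in>T. cscale (r f) f)"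
    unfolding cpoly.span_explicit by blast
  then obtain U where U: "U \<subseteq> Std - {\<gamma>}" "inj_on eb U" "T = eb ` U"
    using subset_image_inj[of T eb "Std - {\<gamma>}"] by blast
  have fU: "finite U" using T(1) U finite_imageD by blast
  have e: "eb \<gamma> = (\<Sum>\<delta>\<in>U. cscale (r (eb \<delta>)) (eb \<delta>))"
    unfolding T(3) U(3) by (simp add: sum.reindex[OF U(2)])
  let ?c = "\<lambda>\<delta>. if \<delta> = \<gamma> then - 1 else r (eb \<delta>)"
  have "\<forall>\<delta>\<in>insert \<gamma> U. ?c \<delta> = 0"
  proof (rule eb_independent)
    fix a assume "a \<in> V"
    have "(\<Sum>\<delta>\<in>insert \<gamma> U. ?c \<delta> * peval a (eb \<delta>)) = - peval a (eb \<gamma>) + (\<Sum>\<delta>\<in>U. r (eb \<delta>) * peval a (eb \<delta>))"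
      using fU U(1) by (subst sum.insert) (auto intro!: sum.cong)
    also have "\<dots> = 0" by (subst e) simp
    finally show "(\<Sum>\<delta>\<in>insert \<gamma> U. ?c \<delta> * peval a (eb \<delta>)) = 0" .
  qed (use fU U assms in auto)
  then show False by simp
qed

text \<open>
  The standard exponent represented by a label.  Under this bijection the two families become the two
  kinds of exponents.
\<close>

fun phi :: "label \<Rightarrow> expo" where
  "phi (Ord \<alpha> l \<beta>) = \<alpha> + Poly_Mapping.single m l + \<beta>"
| "phi (Ext \<alpha> l i) = \<alpha> + Poly_Mapping.single m l + mu i"

definition Labels :: "label set" where "Labels = ord_labels n m I t \<union> ext_labels m d"

lemma alpha_keys: "keys (\<alpha> :: expo) \<subseteq> {1..<m} \<Longrightarrow> keys (\<alpha> + Poly_Mapping.single m l) \<subseteq> {1..m}"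
proof -
  assume "keys \<alpha> \<subseteq> {1..<m}"
  also have "\<dots> \<subseteq> {1..m}" by auto
  finally show ?thesis using m1 by (simp add: keys_expo_add keys_single_subset)
qed

lemma alpha_inj:
  fixes \<alpha> \<alpha>' :: expo
  assumes "keys \<alpha> \<subseteq> {1..<m}" "keys \<alpha>' \<subseteq> {1..<m}"
    "\<alpha> + Poly_Mapping.single m l = \<alpha>' + Poly_Mapping.single m l'"
  shows "\<alpha> = \<alpha>' \<and> l = l'"
proof -
  have "lookup \<alpha> m = 0" "lookup \<alpha>' m = 0" using assms(1,2) by (auto simp: in_keys_iff subset_iff)
  then have "l = l'" using arg_cong[OF assms(3), of "\<lambda>x. lookup x m"] by (simp add: lookup_add)
  moreover have "\<alpha> = \<alpha>'"
  proof (rule poly_mapping_eqI)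
    show "lookup \<alpha> k = lookup \<alpha>' k" for k
      using arg_cong[OF assms(3), of "\<lambda>x. lookup x k"] unfolding \<open>l = l'\<close> lookup_add by linarith
  qed
  ultimately show ?thesis by simp
qed

lemma phi_ord:
  assumes "keys \<alpha> \<subseteq> {1..<m}" "(l, \<beta>) \<in> basisB n m I t"
  shows "phi (Ord \<alpha> l \<beta>) \<in> OrdE" "low (phi (Ord \<alpha> l \<beta>)) = \<alpha>" 
    "lookup (phi (Ord \<alpha> l \<beta>)) m = l" "restr (\<lambda>i. m < i) (phi (Ord \<alpha> l \<beta>)) = \<beta>"
    "elem n m I w (Ord \<alpha> l \<beta>) = zmon (phi (Ord \<alpha> l \<beta>))"
proof -
  let ?\<gamma> = "phi (Ord \<alpha> l \<beta>)"
  have \<beta>: "keys \<beta> \<subseteq> {m+1..n}" "l + edeg \<beta> < t" using assms(2) by (auto simp: basisB_def)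
  have z: "lookup \<alpha> i = 0" if "\<not> i < m" for i using assms(1) that by (auto simp: in_keys_iff subset_iff)
  have z': "lookup \<beta> i = 0" if "\<not> m < i" for i using \<beta>(1) that by (auto simp: in_keys_iff subset_iff Suc_le_eq)
  have pr: "zmon (\<alpha> + Poly_Mapping.single m l) * zmon \<beta> = zmon ?\<gamma>" by (simp add: mult_single)
  have nf: "zmon ?\<gamma> \<in> normal_forms n I" using ord_nf[OF assms] pr by simp
  then have std: "?\<gamma> \<in> Std" by (simp add: normal_forms_iff)
  show l: "low ?\<gamma> = \<alpha>"
    by (rule poly_mapping_eqI) (use z z' in \<open>auto simp: low_def lookup_add lookup_single when_def\<close>)
  show "lookup ?\<gamma> m = l" using z z' by (simp add: lookup_add)
  show "restr (\<lambda>i. m < i) ?\<gamma> = \<beta>"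
    by (rule poly_mapping_eqI) (use z z' in \<open>auto simp: lookup_add lookup_single when_def\<close>)
  have "edeg (upp ?\<gamma>) = l + edeg \<beta>" using edeg_low_upp[of ?\<gamma>] l by simp
  then show "?\<gamma> \<in> OrdE" using std \<beta> by (simp add: OrdE_def)
  show "elem n m I w (Ord \<alpha> l \<beta>) = zmon ?\<gamma>"
    by (simp only: elem.simps nf_mult_def pr nf_id[OF nf])
qed

lemma phi_ext:
  assumes "keys \<alpha> \<subseteq> {1..<m}" "i \<in> {1..d}"
  shows "phi (Ext \<alpha> l i) \<in> ExtE" "elem n m I w (Ext \<alpha> l i) = eb (phi (Ext \<alpha> l i))"
  using ExtI[OF alpha_keys[OF assms(1)] assms(2)] nf_id[OF ext_nf[OF assms]] 
    eb_ext[OF alpha_keys[OF assms(1)] assms(2)]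
  by (simp_all add: nf_mult_def)

lemma elem_phi: "x \<in> Labels \<Longrightarrow> elem n m I w x = eb (phi x)"
  using phi_ord phi_ext(2) by (auto simp: Labels_def ord_labels_def ext_labels_def eb_ord simp del: phi.simps elem.simps)

lemma phi_Std: "x \<in> Labels \<Longrightarrow> phi x \<in> Std"
  using phi_ord(1) phi_ext(1) by (auto simp: Labels_def ord_labels_def ext_labels_def Std_Ord_Ext simp del: phi.simps)

lemma phi_inj: "inj_on phi Labels"
proof (rule inj_onI)
  fix x y assume x: "x \<in> Labels" and y: "y \<in> Labels" and e: "phi x = phi y"
  show "x = y"
  proof (cases x)
    case (Ord \<alpha> l \<beta>)
    then have 1: "keys \<alpha> \<subseteq> {1..<m}" "(l, \<beta>) \<in> basisB n m I t"
      using x by (auto simp: Labels_def ord_labels_def ext_labels_def)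
    show ?thesis
    proof (cases y)
      case y': (Ord \<alpha>' l' \<beta>')
      then have 2: "keys \<alpha>' \<subseteq> {1..<m}" "(l', \<beta>') \<in> basisB n m I t"
        using y by (auto simp: Labels_def ord_labels_def ext_labels_def)
      show ?thesis using phi_ord(2-4)[OF 1] phi_ord(2-4)[OF 2] e Ord y' by metis
    next
      case y': (Ext \<alpha>' l' i)
      then have "phi y \<in> ExtE" using y phi_ext(1) by (auto simp: Labels_def ord_labels_def ext_labels_def simp del: phi.simps)
      moreover have "phi x \<in> OrdE" using phi_ord(1)[OF 1] Ord by simp
      ultimately show ?thesis using e Ord_Ext by auto
    qed
  next
    case (Ext \<alpha> l i)
    then have 1: "keys \<alpha> \<subseteq> {1..<m}" "i \<in> {1..d}"
      using x by (auto simp: Labels_def ord_labels_def ext_labels_def)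
    show ?thesis
    proof (cases y)
      case y': (Ord \<alpha>' l' \<beta>')
      then have "phi y \<in> OrdE" using y phi_ord(1) by (auto simp: Labels_def ord_labels_def ext_labels_def simp del: phi.simps)
      moreover have "phi x \<in> ExtE" using phi_ext(1)[OF 1] Ext by simp
      ultimately show ?thesis using e Ord_Ext by auto
    next
      case y': (Ext \<alpha>' l' j)
      then have 2: "keys \<alpha>' \<subseteq> {1..<m}" "j \<in> {1..d}"
        using y by (auto simp: Labels_def ord_labels_def ext_labels_def)
      show ?thesis
        using e ext_inj[OF alpha_keys[OF 1(1)] 1(2) alpha_keys[OF 2(1)] 2(2)] alpha_inj[OF 1(1) 2(1), of l l'] Ext y' by auto
    qed
  qed
qed

lemma phi_surj: "phi ` Labels = Std"
proof
  show "phi ` Labels \<subseteq> Std" using phi_Std by blast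
  show "Std \<subseteq> phi ` Labels"
  proof
    fix \<gamma> assume "\<gamma> \<in> Std"
    then show "\<gamma> \<in> phi ` Labels"
    proof (cases rule: Std_cases)
      case 1
      have std: "\<gamma> \<in> Std" and u: "edeg (upp \<gamma>) < t" using 1 by (auto simp: OrdE_def)
      let ?\<beta> = "restr (\<lambda>i. m < i) \<gamma>"
      have up: "upp \<gamma> = Poly_Mapping.single m (lookup \<gamma> m) + ?\<beta>"
        by (rule poly_mapping_eqI) (auto simp: upp_def lookup_add lookup_single when_def)
      have "upp \<gamma> \<in> Std" using Std_divisor[of "upp \<gamma>" "low \<gamma>"] std low_upp[of \<gamma>] by (simp add: add.commute)
      then have "zmon (Poly_Mapping.single m (lookup \<gamma> m) + ?\<beta>) \<notin> LT_ideal n I"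
        using up by (simp add: std_expos_def)
      moreover have "lookup \<gamma> m + edeg ?\<beta> < t" using u arg_cong[OF up, of edeg] by simp
      moreover have "keys ?\<beta> \<subseteq> {m+1..n}" using Std_keys[OF std] by auto
      ultimately have "(lookup \<gamma> m, ?\<beta>) \<in> basisB n m I t" by (simp add: basisB_def)
      moreover have "keys (low \<gamma>) \<subseteq> {1..<m}" using low_keys Std_keys[OF std] by blast
      ultimately have "Ord (low \<gamma>) (lookup \<gamma> m) ?\<beta> \<in> Labels" by (auto simp: Labels_def ord_labels_def)
      moreover have "\<gamma> = phi (Ord (low \<gamma>) (lookup \<gamma> m) ?\<beta>)"
        using low_upp[of \<gamma>] up by (simp add: add.assoc)
      ultimately show ?thesis by (rule rev_image_eqI)
    next
      case (2 a i)
      have "Ext (low a) (lookup a m) i \<in> Labels" using split_m(2)[OF 2(1)] 2(2) by (auto simp: Labels_def ext_labels_def)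
      moreover have "\<gamma> = phi (Ext (low a) (lookup a m) i)" using split_m(1)[OF 2(1)] 2(3) by simp
      ultimately show ?thesis by (rule rev_image_eqI)
    qed
  qed
qed

lemma label_grevlex_irrefl: "\<not> label_grevlex m x x"
  by (cases x) auto

text \<open>
  By independence of \<open>eb\<close> no element of the first family depends on the others, so nothing is discarded.
\<close>

lemma basisC_eq: "basisC n m d I t w = Labels"
proof -
  have "elem n m I w x \<notin> cpoly.span (elem n m I w ` (ext_labels m d \<union> {y \<in> ord_labels n m I t. label_grevlex m y x}))"
    if x: "x \<in> ord_labels n m I t" for x
  proof -
    let ?A = "ext_labels m d \<union> {y \<in> ord_labels n m I t. label_grevlex m y x}"
    have xL: "x \<in> Labels" using x by (simp add: Labels_def)
    have AL: "?A \<subseteq> Labels" by (auto simp: Labels_def)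
    have "x \<notin> ?A" using x label_grevlex_irrefl by (auto simp: ord_labels_def ext_labels_def)
    then have "elem n m I w ` ?A \<subseteq> eb ` (Std - {phi x})"
      using AL elem_phi phi_Std inj_onD[OF phi_inj _ _ xL] by (fastforce simp: image_subset_iff)
    then have "cpoly.span (elem n m I w ` ?A) \<subseteq> cpoly.span (eb ` (Std - {phi x}))" by (rule cpoly.span_mono)
    then show ?thesis using eb_not_in_span[OF phi_Std[OF xL]] elem_phi[OF xL] by auto
  qed
  then show ?thesis unfolding basisC_def Labels_def by blast
qed

lemma pdeg_elem: "x \<in> Labels \<Longrightarrow> pdeg (elem n m I w x) = edeg (phi x)"
  using pdeg_homog[OF eb_homog eb_nz] phi_Std by (simp add: elem_phi)

definition LabelsS :: "nat \<Rightarrow> label set" where "LabelsS s = {x\<in>Labels. edeg (phi x) \<le> s}"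

lemma phi_bij: "bij_betw phi (LabelsS s) (StdS s)"
  unfolding bij_betw_def
proof
  show "inj_on phi (LabelsS s)" using phi_inj by (rule inj_on_subset) (auto simp: LabelsS_def)
  show "phi ` LabelsS s = StdS s" using phi_surj by (auto simp: LabelsS_def StdS_def)
qed

lemma prec_trans: "prec n m I w x y \<Longrightarrow> prec n m I w y z \<Longrightarrow> prec n m I w x z"
proof -
  have "prec_same_degree m x y \<Longrightarrow> prec_same_degree m y z \<Longrightarrow> prec_same_degree m x z"
    by (cases x; cases y; cases z) (auto dest: grevlex_trans)
  then show "prec n m I w x y \<Longrightarrow> prec n m I w y z \<Longrightarrow> prec n m I w x z"
    by (auto simp: prec_def)
qed

lemma prec_irrefl: "\<not> prec n m I w x x"
  by (cases x) (auto simp: prec_def)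

lemma prec_total:
  assumes "x \<in> Labels" "y \<in> Labels"
  shows "x = y \<or> prec n m I w x y \<or> prec n m I w y x"
proof -
  have "x = y \<or> prec_same_degree m x y \<or> prec_same_degree m y x"
  proof (cases x)
    case (Ord \<alpha> l \<beta>)
    show ?thesis
    proof (cases y)
      case y: (Ord \<alpha>' l' \<beta>')
      then show ?thesis using Ord grevlex_total[of "phi x" "phi y"] inj_onD[OF phi_inj _ assms] by auto
    qed (simp add: Ord)
  next
    case (Ext \<alpha> l i)
    show ?thesis
    proof (cases y)
      case y: (Ext \<alpha>' l' j)
      have "\<alpha> = \<alpha>' \<and> l = l'" if "\<alpha> + Poly_Mapping.single m l = \<alpha>' + Poly_Mapping.single m l'"
        using alpha_inj[OF _ _ that] assms Ext y by (auto simp: Labels_def ord_labels_def ext_labels_def)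
      then show ?thesis using Ext y grevlex_total[of "\<alpha> + Poly_Mapping.single m l" "\<alpha>' + Poly_Mapping.single m l'"]
        by auto
    qed (simp add: Ext)
  qed
  then show ?thesis by (auto simp: prec_def)
qed

text \<open>
  The order \<open>prec\<close> compares degrees first, so the elements of degree at most \<open>s\<close> form an initial segment.
\<close>

lemma enumC_bij: 
  "bij_betw (enum_by (prec n m I w) (basisC n m d I t w)) {..<card (StdS s)} (LabelsS s)"
proof -
  have "bij_betw (enum_by (prec n m I w) Labels) {..<card (LabelsS s)} (LabelsS s)"
  proof (rule enum_by_initial_segment)
    show "finite (LabelsS s)" using bij_betw_finite[OF phi_bij] by simp
    show "y \<in> LabelsS s" if "x \<in> LabelsS s" "y \<in> Labels" "prec n m I w y x" for x y
      using that pdeg_elem by (auto simp: LabelsS_def prec_def)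
  qed (use prec_irrefl prec_trans prec_total in \<open>auto simp: LabelsS_def\<close>)
  then show ?thesis using bij_betw_same_card[OF phi_bij] by (simp add: basisC_eq)
qed

lemma grevlex_enum_bij:
  "bij_betw (enum_by grevlex Std) {..<card (StdS s)} (StdS s)"
proof (rule enum_by_initial_segment)
  show "y \<in> StdS s" if "x \<in> StdS s" "y \<in> Std" "grevlex y x" for x y
    using that grevlex_edeg[of y x] by (simp add: StdS_def)
qed (use grevlex_trans grevlex_total in \<open>auto simp: StdS_def simp del: finite_StdS intro: finite_StdS[unfolded StdS_def]\<close>)

text \<open>
  A homogeneous normal form is a combination of standard monomials of that degree.
\<close>

lemma nf_homog_dim: "h_dim n I s = card {\<gamma>\<in>Std. edeg \<gamma> = s}"
proof -
  let ?S = "{\<gamma>\<in>Std. edeg \<gamma> = s}"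
  have fin: "finite ?S" by (rule finite_subset[OF _ finite_StdS[of s]]) (auto simp: StdS_def)
  have inj: "inj_on zmon ?S" by (rule inj_onI) (drule arg_cong[of _ _ keys], simp)
  have "nf_homog n I s = cpoly.span (zmon ` ?S)"
  proof
    show "nf_homog n I s \<subseteq> cpoly.span (zmon ` ?S)"
    proof
      fix f assume f: "f \<in> nf_homog n I s"
      have "(\<Sum>\<gamma>\<in>keys f. cscale (lookup f \<gamma>) (zmon \<gamma>)) \<in> cpoly.span (zmon ` ?S)"
        by (intro cpoly.span_sum cpoly.span_scale cpoly.span_base)
           (use f in \<open>auto simp: nf_homog_def normal_forms_iff homog_def\<close>)
      then show "f \<in> cpoly.span (zmon ` ?S)" using poly_sum_zmon[of f] by simp
    qed
    show "cpoly.span (zmon ` ?S) \<subseteq> nf_homog n I s"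
    proof
      fix f assume "f \<in> cpoly.span (zmon ` ?S)"
      then obtain c where "f = (\<Sum>\<gamma>\<in>?S. cscale (c \<gamma>) (zmon \<gamma>))" using span_image_coeffs[OF fin] by blast
      then have "keys f \<subseteq> ?S" using keys_lin_comb[of c zmon ?S] by auto
      then show "f \<in> nf_homog n I s"
        by (auto simp: nf_homog_def normal_forms_iff homog_def intro!: Std_polys)
    qed
  qed
  moreover have "cpoly.independent (zmon ` ?S)"
    unfolding cpoly.independent_explicit_module
  proof (intro allI impI)
    fix T u v assume T: "finite T" "T \<subseteq> zmon ` ?S" "(\<Sum>v\<in>T. cscale (u v) v) = 0" "v \<in> T"
    then obtain \<gamma> where \<gamma>: "v = zmon \<gamma>" "\<gamma> \<in> ?S" by blast
    have "0 = (\<Sum>v'\<in>T. u v' * lookup v' \<gamma>)" using arg_cong[OF T(3), of "\<lambda>f. lookup f \<gamma>"] by (simp add: lookup_sum)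
    also have "\<dots> = (\<Sum>v'\<in>T. if v' = v then u v else 0)"
    proof (rule sum.cong[OF refl])
      fix v' assume "v' \<in> T"
      then obtain \<delta> where "v' = zmon \<delta>" using T(2) by blast
      then show "u v' * lookup v' \<gamma> = (if v' = v then u v else 0)"
        by (cases "\<delta> = \<gamma>") (auto simp: \<gamma>(1) lookup_single dest: arg_cong[of _ _ keys])
    qed
    finally show "u v = 0" using T(1,4) by simp
  qed
  ultimately show ?thesis
    unfolding h_dim_def using cpoly.dim_span_eq_card_independent[of "zmon ` ?S"] card_image[OF inj] by simp
qed

lemma m_dim_eq: "m_dim n I s = card (StdS s)"
proof -
  have "StdS s = (\<Union>\<nu>\<in>{..s}. {\<gamma>\<in>Std. edeg \<gamma> = \<nu>})" by (auto simp: StdS_def)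
  moreover have "card (\<Union>\<nu>\<in>{..s}. {\<gamma>\<in>Std. edeg \<gamma> = \<nu>}) = (\<Sum>\<nu>\<le>s. card {\<gamma>\<in>Std. edeg \<gamma> = \<nu>})"
    by (rule card_UN_disjoint) (auto intro: finite_subset[OF _ finite_StdS[of s]] simp: StdS_def)
  ultimately show ?thesis by (simp add: m_dim_def nf_homog_dim)
qed

lemma l_dim_eq: "l_dim n I s = (\<Sum>\<gamma>\<in>StdS s. edeg \<gamma>)"
proof -
  have "(\<Sum>\<gamma>\<in>StdS s. edeg \<gamma>) = (\<Sum>\<nu>\<le>s. \<Sum>\<gamma>\<in>{\<gamma>\<in>StdS s. edeg \<gamma> = \<nu>}. edeg \<gamma>)"
    by (rule sum.group[symmetric, OF finite_StdS]) (auto simp: StdS_def)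
  also have "\<dots> = (\<Sum>\<nu>\<le>s. \<nu> * card {\<gamma>\<in>Std. edeg \<gamma> = \<nu>})"
    by (rule sum.cong) (auto simp: StdS_def intro!: arg_cong[where f = card])
  finally show ?thesis by (simp add: l_dim_def nf_homog_dim)
qed

end

section \<open>Vandermonde determinants and Chebyshev constants\<close>

text \<open>
  The supremum includes \<open>0\<close> so that it is \<open>0\<close> for empty \<open>K\<close>.
\<close>

definition supK :: "(nat \<Rightarrow> complex) set \<Rightarrow> cpoly \<Rightarrow> real" where
  "supK K f = Sup (insert 0 ((\<lambda>a. cmod (peval a f)) ` K))"

lemma continuous_peval: "continuous_on S (\<lambda>a. peval a f)"
proof -
  have "continuous_on UNIV (\<lambda>a. peval a f)"
    unfolding peval_def by (intro continuous_intros continuous_on_product_coordinates)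
  then show ?thesis by (rule continuous_on_subset) simp
qed

lemma bdd_above_peval:
  assumes "compact K" shows "bdd_above (insert 0 ((\<lambda>a. cmod (peval a f)) ` K))"
proof -
  have "compact ((\<lambda>a. cmod (peval a f)) ` K)"
    using assms by (intro compact_continuous_image continuous_intros continuous_peval)
  then have "bdd_above ((\<lambda>a. cmod (peval a f)) ` K)"
  proof (cases "K = {}")
    case False
    then obtain b where "\<And>y. y \<in> (\<lambda>a. cmod (peval a f)) ` K \<Longrightarrow> y \<le> b"
      using compact_attains_sup[OF \<open>compact ((\<lambda>a. cmod (peval a f)) ` K)\<close>] by auto
    then show ?thesis by (rule bdd_aboveI)
  qed simp
  then show ?thesis by simp
qed

lemma supK_upper: "compact K \<Longrightarrow> a \<in> K \<Longrightarrow> cmod (peval a f) \<le> supK K f"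
  unfolding supK_def by (rule cSup_upper[OF _ bdd_above_peval]) auto

lemma supK_nonneg: "compact K \<Longrightarrow> 0 \<le> supK K f"
  unfolding supK_def by (rule cSup_upper[OF _ bdd_above_peval]) auto

lemma supK_least: "0 \<le> b \<Longrightarrow> (\<And>a. a \<in> K \<Longrightarrow> cmod (peval a f) \<le> b) \<Longrightarrow> supK K f \<le> b"
  unfolding supK_def by (rule cSup_least) auto

lemma supK_cong: "(\<And>a. a \<in> K \<Longrightarrow> peval a f = peval a g) \<Longrightarrow> supK K f = supK K g"
  unfolding supK_def by (metis (mono_tags, lifting) image_cong)

lemma supK_mult: "compact K \<Longrightarrow> supK K (f * g) \<le> supK K f * supK K g"
  by (rule supK_least) (auto simp: norm_mult supK_nonneg supK_upper intro!: mult_mono)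

text \<open>
  Multiplying out the product of row sums gives one term for each self-map of the index set; the Leibniz
  formula keeps those of permutations.
\<close>

lemma det_le_prod_row_sums:
  "cmod (Determinant.det (Matrix.mat n n (\<lambda>(i, j). x i j))) \<le> (\<Prod>i<n. \<Sum>j<n. cmod (x i j))"
proof -
  let ?A = "Matrix.mat n n (\<lambda>(i, j). x i j)"
  let ?P = "{p. p permutes {0..<n}}"
  have "Determinant.det ?A = (\<Sum>p\<in>?P. signof p * (\<Prod>i = 0..<n. ?A $$ (i, p i)))"
    by (rule det_def') simp
  also have "\<dots> = (\<Sum>p\<in>?P. signof p * (\<Prod>i<n. x i (p i)))"
    by (intro sum.cong arg_cong2[where f = "(*)"] prod.cong refl)
       (auto simp: atLeast0LessThan dest: permutes_in_image)
  finally have "cmod (Determinant.det ?A) \<le> (\<Sum>p\<in>?P. \<Prod>i<n. cmod (x i (p i)))"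
    by (simp only:) (rule sum_norm_le, simp add: norm_mult sign_def prod_norm)
  also have "\<dots> = (\<Sum>g\<in>(\<lambda>p. restrict p {..<n}) ` ?P. \<Prod>i<n. cmod (x i (g i)))"
  proof (subst sum.reindex)
    show "inj_on (\<lambda>p. restrict p {..<n}) ?P"
    proof (rule inj_onI)
      fix p q assume pq: "p \<in> ?P" "q \<in> ?P" "restrict p {..<n} = restrict q {..<n}"
      show "p = q"
      proof
        fix i show "p i = q i"
        proof (cases "i < n")
          case True
          then show ?thesis using fun_cong[OF pq(3), of i] by simp
        next
          case False
          then show ?thesis using pq(1,2) by (auto simp: permutes_def)
        qed
      qed
    qed
  qed (simp add: o_def)
  also have "\<dots> \<le> (\<Sum>g\<in>PiE {..<n} (\<lambda>_. {..<n}). \<Prod>i<n. cmod (x i (g i)))"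
    by (rule sum_mono2) (auto intro!: finite_PiE prod_nonneg dest: permutes_in_image)
  also have "\<dots> = (\<Prod>i<n. \<Sum>j<n. cmod (x i j))"
    by (rule prod_sum_PiE[symmetric]) auto
  finally show ?thesis .
qed

lemma det_scale_rows_cols:
  fixes x :: "nat \<Rightarrow> nat \<Rightarrow> complex"
  shows "Determinant.det (Matrix.mat n n (\<lambda>(i, j). r i * x i j * r' j)) =
     (\<Prod>i<n. r i) * (\<Prod>j<n. r' j) * Determinant.det (Matrix.mat n n (\<lambda>(i, j). x i j))"
proof -
  let ?P = "{p. p permutes {0..<n}}"
  have "Determinant.det (Matrix.mat n n (\<lambda>(i, j). r i * x i j * r' j)) =
      (\<Sum>p\<in>?P. signof p * (\<Prod>i = 0..<n. r i * x i (p i) * r' (p i)))"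
    by (subst det_def'[of _ n]) (auto intro!: sum.cong arg_cong2[where f = "(*)"] prod.cong dest: permutes_in_image)
  also have "\<dots> = (\<Sum>p\<in>?P. ((\<Prod>i<n. r i) * (\<Prod>j<n. r' j)) * (signof p * (\<Prod>i = 0..<n. x i (p i))))"
  proof (rule sum.cong[OF refl])
    fix p assume "p \<in> ?P"
    then have "(\<Prod>i = 0..<n. r' (p i)) = (\<Prod>j = 0..<n. r' j)"
      using prod.permute[of p "{0..<n}" r'] by (simp add: o_def)
    then show "signof p * (\<Prod>i = 0..<n. r i * x i (p i) * r' (p i)) =
       ((\<Prod>i<n. r i) * (\<Prod>j<n. r' j)) * (signof p * (\<Prod>i = 0..<n. x i (p i)))"
      by (simp add: prod.distrib atLeast0LessThan)
  qed
  also have "\<dots> = (\<Prod>i<n. r i) * (\<Prod>j<n. r' j) * Determinant.det (Matrix.mat n n (\<lambda>(i, j). x i j))"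
    by (subst det_def'[of "Matrix.mat n n (\<lambda>(i, j). x i j)" n])
       (auto simp: sum_distrib_left intro!: sum.cong arg_cong2[where f = "(*)"] prod.cong dest: permutes_in_image)
  finally show ?thesis .
qed

lemma vandermonde_transition:
  assumes "\<And>i k. i < M \<Longrightarrow> k < M \<Longrightarrow> peval (\<zeta> k) (u i) = (\<Sum>j<M. x i j * peval (\<zeta> k) (u' j))"
  shows "vandermonde u M \<zeta> = Determinant.det (Matrix.mat M M (\<lambda>(i, j). x i j)) * vandermonde u' M \<zeta>"
proof -
  let ?X = "Matrix.mat M M (\<lambda>(i, j). x i j)" and ?Z = "Matrix.mat M M (\<lambda>(i, j). peval (\<zeta> i) (u' j))"
  have "Matrix.mat M M (\<lambda>(i, j). peval (\<zeta> i) (u j)) = ?Z * transpose_mat ?X"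
    by (rule eq_matI)
       (auto simp: scalar_prod_def assms atLeast0LessThan mult.commute intro!: sum.cong)
  then show ?thesis
    unfolding vandermonde_def using det_mult[of ?Z M "transpose_mat ?X"] det_transpose[of ?X M]
    by (simp add: mult.commute)
qed

lemma bdd_above_vandermonde:
  assumes K: "compact K"
  shows "bdd_above (insert 0 {cmod (vandermonde e M \<zeta>) | \<zeta>. \<forall>i<M. \<zeta> i \<in> K})"
proof -
  have "cmod (vandermonde e M \<zeta>) \<le> (\<Prod>i<M. \<Sum>j<M. supK K (e j))" if "\<forall>i<M. \<zeta> i \<in> K" for \<zeta>
    unfolding vandermonde_def
    by (rule order_trans[OF det_le_prod_row_sums], intro prod_mono conjI sum_mono sum_nonneg norm_ge_zero)
       (use that K supK_upper in auto)
  moreover have "0 \<le> (\<Prod>i<M. \<Sum>j<M. supK K (e j))" by (intro prod_nonneg sum_nonneg supK_nonneg K)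
  ultimately show ?thesis by (intro bdd_aboveI[of _ "\<Prod>i<M. \<Sum>j<M. supK K (e j)"]) auto
qed

lemma vdm_sup_upper:
  "compact K \<Longrightarrow> (\<And>i. i < M \<Longrightarrow> \<zeta> i \<in> K) \<Longrightarrow> cmod (vandermonde e M \<zeta>) \<le> vdm_sup e K M"
  unfolding vdm_sup_def by (rule cSup_upper[OF _ bdd_above_vandermonde]) auto

lemma vdm_sup_nonneg: "compact K \<Longrightarrow> 0 \<le> vdm_sup e K M"
  unfolding vdm_sup_def by (rule cSup_upper[OF _ bdd_above_vandermonde]) auto

lemma vdm_sup_least:
  "0 \<le> b \<Longrightarrow> (\<And>\<zeta>. (\<And>i. i < M \<Longrightarrow> \<zeta> i \<in> K) \<Longrightarrow> cmod (vandermonde e M \<zeta>) \<le> b) \<Longrightarrow> vdm_sup e K M \<le> b"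
  unfolding vdm_sup_def by (rule cSup_least) auto

lemma vdm_sup_0: "vdm_sup e K 0 = 1"
proof -
  have "{cmod (vandermonde e 0 \<zeta>) | \<zeta>. \<forall>i<0. \<zeta> i \<in> K} = {1}"
    by (auto simp: vandermonde_def)
  then show ?thesis unfolding vdm_sup_def by (simp add: cSup_eq_Max)
qed

text \<open>
  Scaling rows by \<open>r\<close> and columns by \<open>1 / r'\<close> does not change the determinant of the transition matrix,
  as the products of the weights agree, but may make its row sums small.
\<close>

lemma vdm_sup_transition:
  fixes x :: "'a \<Rightarrow> 'b \<Rightarrow> complex" and r :: "'a \<Rightarrow> real" and r' :: "'b \<Rightarrow> real"
  assumes K: "compact K" and b: "bij_betw b {..<M} S" and b': "bij_betw b' {..<M} S'"
    and eq: "\<And>a s. a \<in> K \<Longrightarrow> s \<in> S \<Longrightarrow> peval a (u s) = (\<Sum>s'\<in>S'. x s s' * peval a (u' s'))"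
    and r: "\<And>s. s \<in> S \<Longrightarrow> r s > 0" "\<And>s. s \<in> S' \<Longrightarrow> r' s > 0" "(\<Prod>s\<in>S. r s) = (\<Prod>s\<in>S'. r' s)"
    and B: "\<And>s. s \<in> S \<Longrightarrow> (\<Sum>s'\<in>S'. cmod (x s s') / r' s') \<le> B s / r s"
  shows "vdm_sup (\<lambda>i. u (b i)) K M \<le> (\<Prod>s\<in>S. B s) * vdm_sup (\<lambda>i. u' (b' i)) K M"
proof -
  let ?D = "Determinant.det (Matrix.mat M M (\<lambda>(i, j). x (b i) (b' j)))"
  have bS: "b i \<in> S" "b' i \<in> S'" if "i < M" for i using b b' that by (auto simp: bij_betw_def)
  have rS: "(\<Prod>i<M. f (b i)) = (\<Prod>s\<in>S. f s)" "(\<Prod>i<M. g (b' i)) = (\<Prod>s\<in>S'. g s)" for f g :: "_ \<Rightarrow> real"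
    using prod.reindex_bij_betw[OF b, of f] prod.reindex_bij_betw[OF b', of g] by auto
  have pos: "(\<Prod>i<M. r (b i)) > 0" "(\<Prod>i<M. r' (b' i)) > 0" using r bS by (auto intro!: prod_pos)
  have one: "(\<Prod>i<M. r (b i)) * (\<Prod>i<M. 1 / r' (b' i)) = 1" using pos r(3) by (simp add: prod_dividef rS)
  have "Determinant.det (Matrix.mat M M (\<lambda>(i, j). of_real (r (b i)) * x (b i) (b' j) * of_real (1 / r' (b' j)))) =
      of_real ((\<Prod>i<M. r (b i)) * (\<Prod>i<M. 1 / r' (b' i))) * ?D"
    unfolding det_scale_rows_cols by (simp only: of_real_mult of_real_prod)
  then have "cmod ?D = cmod (Determinant.det (Matrix.mat M M (\<lambda>(i, j). of_real (r (b i)) * x (b i) (b' j) * of_real (1 / r' (b' j)))))"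
    by (simp only: one of_real_1 mult_1)
  also have "\<dots> \<le> (\<Prod>i<M. \<Sum>j<M. cmod (of_real (r (b i)) * x (b i) (b' j) * of_real (1 / r' (b' j))))"
    by (rule det_le_prod_row_sums)
  also have "\<dots> \<le> (\<Prod>i<M. B (b i))"
  proof (rule prod_mono, intro conjI sum_nonneg norm_ge_zero)
    fix i assume i: "i \<in> {..<M}"
    have "(\<Sum>j<M. cmod (of_real (r (b i)) * x (b i) (b' j) * of_real (1 / r' (b' j)))) =
        r (b i) * (\<Sum>j<M. cmod (x (b i) (b' j)) / r' (b' j))"
      unfolding sum_distrib_left
      by (rule sum.cong) (use i r bS in \<open>auto simp: norm_mult norm_divide less_imp_le\<close>)
    also have "(\<Sum>j<M. cmod (x (b i) (b' j)) / r' (b' j)) = (\<Sum>s'\<in>S'. cmod (x (b i) s') / r' s')"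
      by (rule sum.reindex_bij_betw[OF b'])
    also have "r (b i) * \<dots> \<le> r (b i) * (B (b i) / r (b i))"
      using i B bS r(1) by (intro mult_left_mono) (auto intro: less_imp_le)
    also have "\<dots> = B (b i)" using r(1)[OF bS(1)[of i]] i by simp
    finally show "(\<Sum>j<M. cmod (of_real (r (b i)) * x (b i) (b' j) * of_real (1 / r' (b' j)))) \<le> B (b i)" .
  qed
  finally have D: "cmod ?D \<le> (\<Prod>s\<in>S. B s)" by (simp add: rS)
  show ?thesis
  proof (rule vdm_sup_least)
    show "0 \<le> (\<Prod>s\<in>S. B s) * vdm_sup (\<lambda>i. u' (b' i)) K M"
      using D norm_ge_zero[of ?D] vdm_sup_nonneg[OF K] by (intro mult_nonneg_nonneg) linarith+
    fix \<zeta> assume \<zeta>: "\<And>i. i < M \<Longrightarrow> \<zeta> i \<in> K"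
    have "vandermonde (\<lambda>i. u (b i)) M \<zeta> = ?D * vandermonde (\<lambda>i. u' (b' i)) M \<zeta>"
    proof (rule vandermonde_transition)
      fix i k assume "i < M" "k < M"
      then show "peval (\<zeta> k) (u (b i)) = (\<Sum>j<M. x (b i) (b' j) * peval (\<zeta> k) (u' (b' j)))"
        using eq[OF \<zeta> bS(1)] sum.reindex_bij_betw[OF b', of "\<lambda>s'. x (b i) s' * peval (\<zeta> k) (u' s')"] by simp
    qed
    then have "cmod (vandermonde (\<lambda>i. u (b i)) M \<zeta>) = cmod ?D * cmod (vandermonde (\<lambda>i. u' (b' i)) M \<zeta>)"
      by (simp only: norm_mult)
    also have "\<dots> \<le> (\<Prod>s\<in>S. B s) * vdm_sup (\<lambda>i. u' (b' i)) K M"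
    proof (rule mult_mono[OF D])
      show "cmod (vandermonde (\<lambda>i. u' (b' i)) M \<zeta>) \<le> vdm_sup (\<lambda>i. u' (b' i)) K M"
        by (rule vdm_sup_upper[OF K \<zeta>])
      show "0 \<le> (\<Prod>s\<in>S. B s)" using D norm_ge_zero[of ?D] by linarith
    qed simp
    finally show "cmod (vandermonde (\<lambda>i. u (b i)) M \<zeta>) \<le> (\<Prod>s\<in>S. B s) * vdm_sup (\<lambda>i. u' (b' i)) K M" .
  qed
qed

text \<open>
  Chebyshev constants of a sequence of polynomials: minimal sup norm with leading coefficient 1.
\<close>

definition tcheb :: "(nat \<Rightarrow> cpoly) \<Rightarrow> (nat \<Rightarrow> complex) set \<Rightarrow> nat \<Rightarrow> real" where
  "tcheb e K k = Inf (range (\<lambda>c. supK K (e k + (\<Sum>j<k. cscale (c j) (e j)))))"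

lemma bdd_below_tcheb:
  "compact K \<Longrightarrow> bdd_below (range (\<lambda>c. supK K (e k + (\<Sum>j<k. cscale (c j) (e j)))))"
  by (rule bdd_belowI[of _ 0]) (auto intro: supK_nonneg)

lemma tcheb_nonneg: "compact K \<Longrightarrow> 0 \<le> tcheb e K k"
  unfolding tcheb_def by (rule cInf_greatest) (auto intro: supK_nonneg)

text \<open>
  Adding combinations of earlier columns to the last one leaves the determinant unchanged; then expand
  along this column.
\<close>

lemma vdm_sup_Suc_le:
  assumes K: "compact K"
  shows "vdm_sup e K (Suc M) \<le> real (Suc M) * supK K (e M + (\<Sum>j<M. cscale (c j) (e j))) * vdm_sup e K M"
    (is "_ \<le> _ * supK K ?p * _")
proof (rule vdm_sup_least)
  show "0 \<le> real (Suc M) * supK K ?p * vdm_sup e K M"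
    by (intro mult_nonneg_nonneg supK_nonneg vdm_sup_nonneg K) simp
  fix \<zeta> assume \<zeta>: "\<And>i. i < Suc M \<Longrightarrow> \<zeta> i \<in> K"
  let ?e = "e(M := ?p)"
  let ?x = "\<lambda>i j. if i = j then 1 else if i = M then - c j else 0"
  have "vandermonde e (Suc M) \<zeta> =
      Determinant.det (Matrix.mat (Suc M) (Suc M) (\<lambda>(i, j). ?x i j)) * vandermonde ?e (Suc M) \<zeta>"
  proof (rule vandermonde_transition)
    fix i k assume "i < Suc M" "k < Suc M"
    show "peval (\<zeta> k) (e i) = (\<Sum>j<Suc M. ?x i j * peval (\<zeta> k) (?e j))"
    proof (cases "i = M")
      case True
      have "(\<Sum>j<M. ?x i j * peval (\<zeta> k) (?e j)) = - (\<Sum>j<M. c j * peval (\<zeta> k) (e j))"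
        unfolding sum_negf[symmetric] using True by (intro sum.cong) auto
      then show ?thesis using True by simp
    next
      case False
      have "(\<Sum>j<Suc M. ?x i j * peval (\<zeta> k) (?e j)) = (\<Sum>j<Suc M. if j = i then peval (\<zeta> k) (e i) else 0)"
        by (rule sum.cong) (use False in auto)
      also have "\<dots> = peval (\<zeta> k) (e i)" using \<open>i < Suc M\<close> by (subst sum.delta) auto
      finally show ?thesis ..
    qed
  qed
  also have "Determinant.det (Matrix.mat (Suc M) (Suc M) (\<lambda>(i, j). ?x i j)) = 1"
    by (subst det_lower_triangular[of "Suc M"]) (auto simp: prod_list_diag_prod)
  finally have v: "vandermonde e (Suc M) \<zeta> = vandermonde ?e (Suc M) \<zeta>" by (simp only: mult_1)
  let ?A = "Matrix.mat (Suc M) (Suc M) (\<lambda>(i, j). peval (\<zeta> i) (?e j))"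
  have cof: "cmod (cofactor ?A i M) \<le> vdm_sup e K M" if i: "i < Suc M" for i
  proof -
    have "mat_delete ?A i M = Matrix.mat M M (\<lambda>(k, j). peval (\<zeta> (if k < i then k else Suc k)) (e j))"
      by (rule eq_matI) (auto simp: mat_delete_def)
    then have "Determinant.det (mat_delete ?A i M) = vandermonde e M (\<lambda>k. \<zeta> (if k < i then k else Suc k))"
      by (simp add: vandermonde_def)
    then have "cmod (cofactor ?A i M) = cmod (vandermonde e M (\<lambda>k. \<zeta> (if k < i then k else Suc k)))"
      by (simp add: cofactor_def norm_mult norm_power)
    also have "\<dots> \<le> vdm_sup e K M" by (rule vdm_sup_upper[OF K]) (use \<zeta> in auto)
    finally show ?thesis .
  qed
  have "vandermonde e (Suc M) \<zeta> = (\<Sum>i<Suc M. ?A $$ (i, M) * cofactor ?A i M)"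
    by (subst v, unfold vandermonde_def, rule laplace_expansion_column) auto
  then have "cmod (vandermonde e (Suc M) \<zeta>) = cmod (\<Sum>i<Suc M. ?A $$ (i, M) * cofactor ?A i M)"
    by (rule arg_cong)
  also have "\<dots> \<le> (\<Sum>i<Suc M. supK K ?p * vdm_sup e K M)"
  proof (rule sum_norm_le)
    fix i assume "i \<in> {..<Suc M}"
    then have i: "i < Suc M" by simp
    have "?A $$ (i, M) = peval (\<zeta> i) ?p" using i by (simp only: index_mat lessI split fun_upd_same)
    then show "cmod (?A $$ (i, M) * cofactor ?A i M) \<le> supK K ?p * vdm_sup e K M"
      unfolding norm_mult using cof[OF i] supK_upper[OF K \<zeta>[OF i], of ?p] supK_nonneg[OF K]
      by (intro mult_mono) (simp_all only: norm_ge_zero)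
  qed
  also have "\<dots> = real (Suc M) * supK K ?p * vdm_sup e K M"
    by (simp only: sum_constant card_lessThan mult.assoc)
  finally show "cmod (vandermonde e (Suc M) \<zeta>) \<le> real (Suc M) * supK K ?p * vdm_sup e K M" .
qed

text \<open>
  As a function of the last point alone, the determinant is the \<open>M\<close>-point determinant times a monic
  combination of \<open>e 0, ..., e M\<close>, whose sup norm is at least \<open>\<tau>\<close>.
\<close>

lemma vdm_sup_Suc_ge:
  assumes K: "compact K" and \<tau>: "\<And>c. \<tau> \<le> supK K (e M + (\<Sum>j<M. cscale (c j) (e j)))"
  shows "\<tau> * vdm_sup e K M \<le> vdm_sup e K (Suc M)"
proof (cases "\<tau> \<le> 0")
  case True
  then show ?thesis using vdm_sup_nonneg[OF K, of e M] vdm_sup_nonneg[OF K, of e "Suc M"]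
    by (meson mult_nonpos_nonneg order_trans)
next
  case False
  have "vdm_sup e K M \<le> vdm_sup e K (Suc M) / \<tau>"
  proof (rule vdm_sup_least)
    show "0 \<le> vdm_sup e K (Suc M) / \<tau>" using False vdm_sup_nonneg[OF K] by simp
    fix \<zeta> assume \<zeta>: "\<And>i. i < M \<Longrightarrow> \<zeta> i \<in> K"
    show "cmod (vandermonde e M \<zeta>) \<le> vdm_sup e K (Suc M) / \<tau>"
    proof (cases "vandermonde e M \<zeta> = 0")
      case True
      then show ?thesis using False vdm_sup_nonneg[OF K] by simp
    next
      case nz: False
      define A where "A z = Matrix.mat (Suc M) (Suc M) (\<lambda>(i, j). peval ((\<zeta>(M := z)) i) (e j))" for z
      define C where "C j = cofactor (A undefined) M j" for j
      have Cz: "cofactor (A z) M j = C j" if "j < Suc M" for j z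
      proof -
        have "mat_delete (A z) M j = mat_delete (A undefined) M j"
          by (rule eq_matI) (auto simp: mat_delete_def A_def)
        then show ?thesis by (simp add: C_def cofactor_def)
      qed
      have CM: "C M = vandermonde e M \<zeta>"
      proof -
        have "mat_delete (A undefined) M M = Matrix.mat M M (\<lambda>(i, j). peval (\<zeta> i) (e j))"
          by (rule eq_matI) (auto simp: mat_delete_def A_def)
        then show ?thesis by (simp add: C_def cofactor_def vandermonde_def flip: mult_2)
      qed
      define c where "c j = C j / C M" for j
      let ?p = "e M + (\<Sum>j<M. cscale (c j) (e j))"
      have "supK K ?p \<le> vdm_sup e K (Suc M) / cmod (C M)"
      proof (rule supK_least)
        show "0 \<le> vdm_sup e K (Suc M) / cmod (C M)" using vdm_sup_nonneg[OF K] by simp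
        fix z assume z: "z \<in> K"
        have "Determinant.det (A z) = (\<Sum>j<Suc M. A z $$ (M, j) * cofactor (A z) M j)"
          by (rule laplace_expansion_row[of _ "Suc M"]) (auto simp: A_def)
        also have "\<dots> = (\<Sum>j<Suc M. peval z (e j) * C j)"
          by (rule sum.cong) (auto simp: Cz, auto simp: A_def)
        also have "\<dots> = C M * peval z ?p"
          using nz CM by (simp add: c_def distrib_left sum_distrib_left mult.commute)
        finally have "C M * peval z ?p = vandermonde e (Suc M) (\<zeta>(M := z))"
          by (simp add: vandermonde_def A_def)
        moreover have "cmod (vandermonde e (Suc M) (\<zeta>(M := z))) \<le> vdm_sup e K (Suc M)"
          by (rule vdm_sup_upper[OF K]) (use \<zeta> z in auto)
        ultimately have "cmod (C M) * cmod (peval z ?p) \<le> vdm_sup e K (Suc M)"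
          by (metis norm_mult)
        then show "cmod (peval z ?p) \<le> vdm_sup e K (Suc M) / cmod (C M)"
          using nz CM by (simp add: pos_le_divide_eq mult.commute)
      qed
      then have "\<tau> \<le> vdm_sup e K (Suc M) / cmod (C M)" using \<tau>[of c] by simp
      then show ?thesis using nz False by (simp add: CM pos_le_divide_eq mult.commute)
    qed
  qed
  then show ?thesis using False by (simp add: pos_le_divide_eq mult.commute)
qed

lemma vdm_sup_le_prod_tcheb:
  assumes K: "compact K"
  shows "vdm_sup e K M \<le> fact M * (\<Prod>k<M. tcheb e K k)"
proof (induction M)
  case 0
  then show ?case by (simp add: vdm_sup_0)
next
  case (Suc M)
  have "vdm_sup e K (Suc M) \<le> real (Suc M) * tcheb e K M * vdm_sup e K M"
  proof (cases "vdm_sup e K M = 0")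
    case True
    then show ?thesis using vdm_sup_Suc_le[OF K, of e M "\<lambda>_. 0"] by simp
  next
    case False
    then have pos: "real (Suc M) * vdm_sup e K M > 0" using vdm_sup_nonneg[OF K, of e M] by simp
    have "vdm_sup e K (Suc M) / (real (Suc M) * vdm_sup e K M) \<le> tcheb e K M"
      unfolding tcheb_def
    proof (rule cInf_greatest)
      fix y assume "y \<in> range (\<lambda>c. supK K (e M + (\<Sum>j<M. cscale (c j) (e j))))"
      then obtain c where "y = supK K (e M + (\<Sum>j<M. cscale (c j) (e j)))" by blast
      then show "vdm_sup e K (Suc M) / (real (Suc M) * vdm_sup e K M) \<le> y"
        using vdm_sup_Suc_le[OF K, of e M c] pos by (simp add: pos_divide_le_eq mult.commute mult.left_commute)
    qed simp
    then show ?thesis using pos by (simp add: pos_divide_le_eq mult.commute mult.left_commute)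
  qed
  also have "\<dots> \<le> real (Suc M) * tcheb e K M * (fact M * (\<Prod>k<M. tcheb e K k))"
    using Suc.IH tcheb_nonneg[OF K] by (intro mult_left_mono) auto
  also have "\<dots> = fact (Suc M) * (\<Prod>k<Suc M. tcheb e K k)" by (simp add: mult.commute mult.left_commute)
  finally show ?case .
qed

lemma prod_le_vdm_sup:
  assumes K: "compact K"
    and \<tau>: "\<And>k. k < M \<Longrightarrow> 0 \<le> \<tau> k" "\<And>k c. k < M \<Longrightarrow> \<tau> k \<le> supK K (e k + (\<Sum>j<k. cscale (c j) (e j)))"
  shows "(\<Prod>k<M. \<tau> k) \<le> vdm_sup e K M"
  using \<tau>
proof (induction M)
  case 0
  then show ?case by (simp add: vdm_sup_0)
next
  case (Suc M)
  have "(\<Prod>k<M. \<tau> k) \<le> vdm_sup e K M"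
    by (rule Suc.IH) (use Suc.prems less_SucI in blast)+
  then have "(\<Prod>k<Suc M. \<tau> k) \<le> \<tau> M * vdm_sup e K M"
    using Suc.prems(1)[of M] by (simp add: mult.commute mult_left_mono)
  also have "\<dots> \<le> vdm_sup e K (Suc M)" by (rule vdm_sup_Suc_ge[OF K]) (use Suc.prems in auto)
  finally show ?case .
qed

text \<open>
  A homogeneous linear system with fewer equations than unknowns has a nontrivial solution.
\<close>

lemma nontrivial_linear_relation:
  fixes x :: "'a \<Rightarrow> 'b \<Rightarrow> complex"
  assumes "finite B" "finite A" "card B < card A"
  shows "\<exists>c. (\<exists>a\<in>A. c a \<noteq> 0) \<and> (\<forall>b\<in>B. (\<Sum>a\<in>A. c a * x a b) = 0)"
  using assms
proof (induction B arbitrary: A x rule: finite_induct)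
  case empty
  then obtain a where "a \<in> A" by fastforce
  then show ?case by (intro exI[of _ "\<lambda>_. 1"]) auto
next
  case (insert b B)
  show ?case
  proof (cases "\<forall>a\<in>A. x a b = 0")
    case True
    obtain c where "\<exists>a\<in>A. c a \<noteq> 0" "\<forall>b\<in>B. (\<Sum>a\<in>A. c a * x a b) = 0"
      using insert.IH[of A x] insert.prems insert.hyps by auto
    then show ?thesis using True by (intro exI[of _ c]) auto
  next
    case False
    then obtain a0 where a0: "a0 \<in> A" "x a0 b \<noteq> 0" by blast
    let ?A = "A - {a0}"
    have A: "A = insert a0 ?A" "a0 \<notin> ?A" "finite ?A" using a0 insert.prems by auto
    define y where "y a b' = x a b' - x a b / x a0 b * x a0 b'" for a b'
    have "card B < card ?A" using insert a0 by (simp add: card_Diff_singleton)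
    then obtain c where c: "\<exists>a\<in>?A. c a \<noteq> 0" "\<forall>b\<in>B. (\<Sum>a\<in>?A. c a * y a b) = 0"
      using insert.IH[of ?A y] A by blast
    let ?c = "\<lambda>a. if a = a0 then - (\<Sum>a\<in>?A. c a * (x a b / x a0 b)) else c a"
    have s: "(\<Sum>a\<in>A. ?c a * x a b') = (\<Sum>a\<in>?A. c a * y a b')" for b'
    proof -
      have "(\<Sum>a\<in>A. ?c a * x a b') = ?c a0 * x a0 b' + (\<Sum>a\<in>?A. ?c a * x a b')"
        using sum.insert[OF A(3,2), of "\<lambda>a. ?c a * x a b'"] A(1) by simp
      also have "(\<Sum>a\<in>?A. ?c a * x a b') = (\<Sum>a\<in>?A. c a * x a b')" by (rule sum.cong) auto
      also have "?c a0 * x a0 b' = - (\<Sum>a\<in>?A. c a * (x a b / x a0 b * x a0 b'))"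
        by (simp add: sum_distrib_right mult.assoc)
      finally show ?thesis by (simp add: y_def right_diff_distrib sum_subtractf)
    qed
    have "y a b = 0" for a using a0 by (simp add: y_def)
    then have "(\<Sum>a\<in>A. ?c a * x a b) = 0" unfolding s by simp
    moreover have "\<exists>a\<in>A. ?c a \<noteq> 0" using c(1) by auto
    ultimately show ?thesis using c(2) s by (intro exI[of _ ?c]) auto
  qed
qed

section \<open>Submultiplicative families over exponent vectors\<close>

definition ebox :: "nat set \<Rightarrow> (nat \<Rightarrow> nat) \<Rightarrow> expo" where
  "ebox A f = Abs_poly_mapping (\<lambda>i. if i \<in> A then f i else 0)"

lemma lookup_ebox: "finite A \<Longrightarrow> lookup (ebox A f) i = (if i \<in> A then f i else 0)"
proof -
  assume "finite A"
  then have fin: "finite {i. (if i \<in> A then f i else 0) \<noteq> 0}" by (rule rev_finite_subset) auto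
  show ?thesis unfolding ebox_def by (subst lookup_Abs_poly_mapping[OF fin]) rule
qed

lemma keys_ebox: "finite A \<Longrightarrow> keys (ebox A f) \<subseteq> A"
  by (auto simp: in_keys_iff lookup_ebox split: if_splits)

lemma edeg_ebox: "finite A \<Longrightarrow> edeg (ebox A f) = (\<Sum>i\<in>A. f i)"
  by (subst edeg_superset[of A]) (auto simp: keys_ebox lookup_ebox)

lemma keys_expo_sum: "(\<And>x. x \<in> B \<Longrightarrow> keys (f x) \<subseteq> A) \<Longrightarrow> keys (sum f B :: expo) \<subseteq> A"
  by (induction B rule: infinite_finite_induct) (auto simp: keys_expo_add)

text \<open>
  Hermite's identity for integer parts; it splits an exponent vector into \<open>r\<close> vectors close to its \<open>r\<close>-th
  part.
\<close>

lemma hermite_identity: "r > 0 \<Longrightarrow> (\<Sum>j<r. (x + j) div r) = (x::nat)"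
proof (induction x)
  case (Suc x)
  have "(\<Sum>j<r. (Suc x + j) div r) = (\<Sum>j<r. (x + Suc j) div r)" by simp
  also have "\<dots> = (\<Sum>j<Suc r. (x + j) div r) - x div r"
    by (subst sum.lessThan_Suc_shift) simp
  also have "\<dots> = (\<Sum>j<r. (x + j) div r) + 1" using Suc.prems by simp
  finally show ?case using Suc by simp
qed simp

lemma prod_le_subset:
  fixes f :: "'a \<Rightarrow> real"
  assumes "finite B" "A \<subseteq> B" "\<And>x. x \<in> B \<Longrightarrow> 0 \<le> f x \<and> f x \<le> 1"
  shows "(\<Prod>x\<in>B. f x) \<le> (\<Prod>x\<in>A. f x)"
proof -
  have "(\<Prod>x\<in>B. f x) = (\<Prod>x\<in>B - A. f x) * (\<Prod>x\<in>A. f x)"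
    by (rule prod.subset_diff) (use assms in auto)
  also have "\<dots> \<le> 1 * (\<Prod>x\<in>A. f x)"
    by (intro mult_right_mono prod_le_1 prod_nonneg) (use assms in auto)
  finally show ?thesis by simp
qed

text \<open>
  The shift \<open>h\<close> accounts for the factor \<open>z_m^t\<close> that appears when two elements \<open>w_i\<close> are multiplied, and for
  a monomial used to absorb a constant.
\<close>

locale fekete =
  fixes A :: "nat set" and T :: "expo \<Rightarrow> real" and h :: expo
  assumes finA: "finite A" and hA: "keys h \<subseteq> A"
    and T01: "keys a \<subseteq> A \<Longrightarrow> 0 \<le> T a \<and> T a \<le> 1"
    and T_sub: "keys a \<subseteq> A \<Longrightarrow> keys b \<subseteq> A \<Longrightarrow> T (a + b + h) \<le> T a * T b"
begin

definition P :: "nat \<Rightarrow> real" where "P s = (\<Prod>a\<in>expos A s. T a)"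

lemma P01: "0 \<le> P s" "P s \<le> 1"
  using T01 by (auto simp: P_def expos_def intro!: prod_nonneg prod_le_1)

lemma P_antimono: "s \<le> s' \<Longrightarrow> P s' \<le> P s"
  unfolding P_def by (rule prod_le_subset[OF finite_expos[OF finA]]) (use T01 in \<open>auto simp: expos_def\<close>)

primrec hs :: "nat \<Rightarrow> expo" where "hs 0 = 0" | "hs (Suc k) = hs k + h"

lemma edeg_hs: "edeg (hs k) = k * edeg h" and keys_hs: "keys (hs k) \<subseteq> A"
  using hA by (induction k) (auto simp: keys_nat_add)

text \<open>
  Submultiplicativity applied \<open>k\<close> times costs \<open>k\<close> shifts.
\<close>

lemma T_iterate:
  assumes "\<And>j. keys (b j) \<subseteq> A"
  shows "T ((\<Sum>j<Suc k. b j) + hs k) \<le> (\<Prod>j<Suc k. T (b j))"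
proof (induction k)
  case (Suc k)
  have "T ((\<Sum>j<Suc (Suc k). b j) + hs (Suc k)) = T (((\<Sum>j<Suc k. b j) + hs k) + b (Suc k) + h)"
    by (simp add: ac_simps)
  also have "\<dots> \<le> T ((\<Sum>j<Suc k. b j) + hs k) * T (b (Suc k))"
    by (rule T_sub) (use assms keys_hs[of k] keys_expo_sum[of "{..<Suc k}" b] in \<open>auto simp: keys_expo_add\<close>)
  also have "\<dots> \<le> (\<Prod>j<Suc k. T (b j)) * T (b (Suc k))"
    using Suc T01 assms by (intro mult_right_mono) auto
  finally show ?case by simp
qed simp

text \<open>
  Decompose each \<open>a\<close> of degree about \<open>r q\<close> as the sum of \<open>b j a = \<lfloor>(a + j) / r\<rfloor>\<close>, \<open>j < r\<close>.  For each \<open>j\<close> the map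
  \<open>b j\<close> takes every value \<open>c + one + h\<close> with \<open>deg c \<le> q\<close> at least \<open>r ^ card A\<close> times, namely at the
  exponents \<open>psi j (c, \<rho>)\<close> with \<open>\<rho>\<close> in a box of side \<open>r\<close>.  As \<open>T \<le> 1\<close>, all other factors may be dropped.  The extra
  vectors \<open>one\<close> and \<open>h\<close> keep the subtraction of \<open>j\<close> inside the natural numbers.
\<close>

lemma P_submultiplicative:
  assumes r: "r \<ge> 1"
  shows "P (r * (q + 2 * card A + 2 * edeg h)) \<le> P q ^ (r ^ (card A + 1))"
proof -
  define R where "R = r * (q + 2 * card A + edeg h)"
  define H where "H = hs (r - 1)"
  define Box where "Box = {\<rho>::expo. keys \<rho> \<subseteq> A \<and> (\<forall>i. lookup \<rho> i \<le> r - 1)}"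
  define b where "b j a = ebox A (\<lambda>i. (lookup a i + j) div r)" for j a
  define psi where "psi j = (\<lambda>(c, \<rho>). ebox A (\<lambda>i. r * (lookup c i + 1 + lookup h i) - j + lookup \<rho> i))" for j
  define one where "one = ebox A (\<lambda>_. 1)"
  have H: "keys H \<subseteq> A" "edeg H = (r - 1) * edeg h"
    by (simp_all add: H_def edeg_hs keys_hs)
  have Box: "finite Box" "card Box = r ^ card A"
    using finite_expo_box[OF finA, of "r - 1"] r by (auto simp: Box_def)
  have bk: "keys (b j a) \<subseteq> A" for j a unfolding b_def by (rule keys_ebox[OF finA])
  have bsum: "(\<Sum>j<r. b j a) = a" if "keys a \<subseteq> A" for a
  proof (rule poly_mapping_eqI)
    fix i
    have "lookup a i = 0" if "i \<notin> A" using \<open>keys a \<subseteq> A\<close> that by (auto simp: in_keys_iff subset_iff)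
    then show "lookup (\<Sum>j<r. b j a) i = lookup a i"
      using hermite_identity[of r "lookup a i"] r by (cases "i \<in> A") (simp_all add: lookup_sum b_def lookup_ebox[OF finA])
  qed
  have bpsi: "b j (psi j (c, \<rho>)) = c + one + h" if "j < r" "c \<in> expos A q" "\<rho> \<in> Box" for j c \<rho>
  proof (rule poly_mapping_eqI)
    fix i
    show "lookup (b j (psi j (c, \<rho>))) i = lookup (c + one + h) i"
    proof (cases "i \<in> A")
      case True
      have "lookup \<rho> i < r" using that(3) r by (auto simp: Box_def dest: spec[of _ i])
      moreover have "j \<le> r * (lookup c i + 1 + lookup h i)" using that(1) by (simp add: distrib_left)
      then have "r * (lookup c i + 1 + lookup h i) - j + lookup \<rho> i + j =
          lookup \<rho> i + r * (lookup c i + 1 + lookup h i)" by simp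
      ultimately show ?thesis using True r
        by (simp add: b_def psi_def lookup_ebox[OF finA] lookup_add one_def)
    next
      case False
      then have "lookup c i = 0" "lookup h i = 0"
        using that(2) hA by (auto simp: expos_def in_keys_iff subset_iff)
      then show ?thesis using False by (simp add: b_def lookup_ebox[OF finA] lookup_add one_def)
    qed
  qed
  have inj: "inj_on (psi j) (expos A q \<times> Box)" if j: "j < r" for j
  proof (rule inj_onI, clarify)
    fix c \<rho> c' \<rho>' assume *: "c \<in> expos A q" "\<rho> \<in> Box" "c' \<in> expos A q" "\<rho>' \<in> Box" "psi j (c, \<rho>) = psi j (c', \<rho>')"
    then have "c + one + h = c' + one + h" using bpsi[OF j] by metis
    then have cc: "c = c'"
      by (intro poly_mapping_eqI) (metis add_right_cancel lookup_add)
    have "lookup \<rho> i = lookup \<rho>' i" for i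
    proof (cases "i \<in> A")
      case True
      then show ?thesis using arg_cong[OF *(5), of "\<lambda>f. lookup f i"] cc
        by (simp add: psi_def lookup_ebox[OF finA])
    next
      case False
      then have "i \<notin> keys \<rho>" "i \<notin> keys \<rho>'" using *(2,4) by (auto simp: Box_def)
      then show ?thesis by (simp add: in_keys_iff)
    qed
    then show "c = c' \<and> \<rho> = \<rho>'" using cc by (simp add: poly_mapping_eqI)
  qed
  have psiR: "psi j ` (expos A q \<times> Box) \<subseteq> expos A R" for j
  proof (clarify)
    fix c \<rho> assume c: "c \<in> expos A q" and \<rho>: "\<rho> \<in> Box"
    have "edeg (psi j (c, \<rho>)) = (\<Sum>i\<in>A. r * (lookup c i + 1 + lookup h i) - j + lookup \<rho> i)"
      by (simp add: psi_def edeg_ebox[OF finA])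
    also have "\<dots> \<le> (\<Sum>i\<in>A. r * (lookup c i + 1 + lookup h i) + r)"
      using \<rho> r by (intro sum_mono add_mono) (auto simp: Box_def intro: le_trans[of _ "r - 1"])
    also have "\<dots> = r * ((\<Sum>i\<in>A. lookup c i) + 2 * card A + (\<Sum>i\<in>A. lookup h i))"
      by (simp add: sum.distrib sum_distrib_left distrib_left)
    also have "\<dots> = r * (edeg c + 2 * card A + edeg h)"
      using edeg_superset[OF finA, of c] edeg_superset[OF finA hA] c by (simp add: expos_def)
    also have "\<dots> \<le> R" using c by (simp add: R_def expos_def)
    finally show "psi j (c, \<rho>) \<in> expos A R" by (simp add: expos_def psi_def keys_ebox[OF finA])
  qed
  have "P (r * (q + 2 * card A + 2 * edeg h)) \<le> (\<Prod>a\<in>(\<lambda>a. a + H) ` expos A R. T a)"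
    unfolding P_def
  proof (rule prod_le_subset[OF finite_expos[OF finA]])
    show "(\<lambda>a. a + H) ` expos A R \<subseteq> expos A (r * (q + 2 * card A + 2 * edeg h))"
    proof clarify
      fix a assume a: "a \<in> expos A R"
      have "edeg (a + H) \<le> R + r * edeg h" using a H by (auto simp: expos_def intro!: add_mono)
      also have "\<dots> = r * (q + 2 * card A + 2 * edeg h)" by (simp add: R_def algebra_simps)
      finally show "a + H \<in> expos A (r * (q + 2 * card A + 2 * edeg h))"
        using a H by (simp add: expos_def keys_expo_add)
    qed
  qed (use T01 in \<open>auto simp: expos_def\<close>)
  also have "\<dots> = (\<Prod>a\<in>expos A R. T (a + H))"
  proof (subst prod.reindex)
    show "inj_on (\<lambda>a. a + H) (expos A R)"
      by (rule inj_onI, intro poly_mapping_eqI) (metis add_right_cancel lookup_add)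
  qed simp
  also have "\<dots> \<le> (\<Prod>a\<in>expos A R. \<Prod>j<r. T (b j a))"
  proof (rule prod_mono, intro conjI)
    fix a assume a: "a \<in> expos A R"
    show "0 \<le> T (a + H)" using T01 a H by (auto simp: expos_def keys_expo_add)
    have "T ((\<Sum>j<Suc (r - 1). b j a) + H) \<le> (\<Prod>j<Suc (r - 1). T (b j a))"
      unfolding H_def by (rule T_iterate[OF bk])
    then show "T (a + H) \<le> (\<Prod>j<r. T (b j a))" using bsum a r by (simp add: expos_def)
  qed
  also have "\<dots> = (\<Prod>j<r. \<Prod>a\<in>expos A R. T (b j a))" by (rule prod.swap)
  also have "\<dots> \<le> (\<Prod>j<r. \<Prod>c\<in>expos A q. \<Prod>\<rho>\<in>Box. T c)"
  proof (rule prod_mono, intro conjI)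
    fix j assume j: "j \<in> {..<r}"
    show "0 \<le> (\<Prod>a\<in>expos A R. T (b j a))" using T01 bk by (intro prod_nonneg) auto
    have "(\<Prod>a\<in>expos A R. T (b j a)) \<le> (\<Prod>a\<in>psi j ` (expos A q \<times> Box). T (b j a))"
      by (rule prod_le_subset[OF finite_expos[OF finA] psiR]) (use T01 bk in auto)
    also have "\<dots> = (\<Prod>x\<in>expos A q \<times> Box. T (b j (psi j x)))"
      using prod.reindex[OF inj, of j "\<lambda>a. T (b j a)"] j by (simp add: o_def)
    also have "\<dots> \<le> (\<Prod>(c, \<rho>)\<in>expos A q \<times> Box. T c)"
    proof (rule prod_mono, clarify)
      fix c \<rho> assume c: "c \<in> expos A q" and \<rho>: "\<rho> \<in> Box"
      have k: "keys c \<subseteq> A" "keys one \<subseteq> A" using c by (auto simp: expos_def one_def intro!: subsetD[OF keys_ebox[OF finA]])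
      have "T (c + one + h) \<le> T c * T one" by (rule T_sub[OF k])
      also have "\<dots> \<le> T c * 1" using T01[OF k(1)] T01[OF k(2)] by (intro mult_left_mono) auto
      finally show "0 \<le> T (b j (psi j (c, \<rho>))) \<and> T (b j (psi j (c, \<rho>))) \<le> T c"
        using bpsi[of j c \<rho>] c \<rho> j T01[OF bk[of j "psi j (c, \<rho>)"]] by simp
    qed
    also have "\<dots> = (\<Prod>c\<in>expos A q. \<Prod>\<rho>\<in>Box. T c)"
      by (rule prod.cartesian_product[symmetric])
    finally show "(\<Prod>a\<in>expos A R. T (b j a)) \<le> (\<Prod>c\<in>expos A q. \<Prod>\<rho>\<in>Box. T c)" .
  qed
  also have "\<dots> = P q ^ (r ^ (card A + 1))"
    by (simp add: Box(2) P_def prod_power_distrib power_mult[symmetric] power_add mult.commute)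
  finally show ?thesis .
qed

end

text \<open>
  Convexity of the exponential function.
\<close>

lemma powr_le_affine:
  fixes y \<theta> :: real assumes "0 \<le> y" "0 \<le> \<theta>" "\<theta> \<le> 1" "y \<le> 1"
  shows "y powr \<theta> \<le> y + (1 - \<theta>)"
proof (cases "y = 0")
  case False
  define l where "l = ln y"
  have y: "y = exp l" using False assms by (simp add: l_def)
  have "1 = \<theta> * (1 + (1 - \<theta>) * l) + (1 - \<theta>) * (1 + - \<theta> * l)" by (simp add: algebra_simps)
  also have "\<dots> \<le> \<theta> * exp ((1 - \<theta>) * l) + (1 - \<theta>) * exp (- \<theta> * l)"
    using assms by (intro add_mono mult_left_mono exp_ge_add_one_self) auto
  finally have "exp (\<theta> * l) * 1 \<le> exp (\<theta> * l) * (\<theta> * exp ((1 - \<theta>) * l) + (1 - \<theta>) * exp (- \<theta> * l))"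
    by (intro mult_left_mono) auto
  also have "\<dots> = \<theta> * exp (\<theta> * l + (1 - \<theta>) * l) + (1 - \<theta>) * exp (\<theta> * l + - \<theta> * l)"
    by (simp only: exp_add) (simp add: algebra_simps)
  also have "\<dots> = \<theta> * y + (1 - \<theta>)" by (simp add: y algebra_simps)
  also have "\<dots> \<le> 1 * y + (1 - \<theta>)" using assms by (intro add_mono mult_right_mono) auto
  finally show ?thesis by (simp add: powr_def l_def False)
qed (use assms in simp)

lemma div_ratio_tendsto:
  assumes "Q > 0" shows "(\<lambda>s. real (s div Q) / real s) \<longlonglongrightarrow> 1 / real Q"
proof (rule tendsto_sandwich)
  show "\<forall>\<^sub>F s in sequentially. 1 / real Q - 1 / real s \<le> real (s div Q) / real s"
    using eventually_gt_at_top[of 0]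
  proof eventually_elim
    case (elim s)
    have "real s \<le> real (Q * (s div Q) + Q)" using mod_less_divisor[OF assms, of s]
      by (metis mult_div_mod_eq add_left_mono less_imp_le of_nat_le_iff)
    then have "real s / real Q - 1 \<le> real (s div Q)" using assms by (simp add: field_simps)
    then have "(real s / real Q - 1) / real s \<le> real (s div Q) / real s" by (intro divide_right_mono) auto
    then show ?case using elim by (simp add: diff_divide_distrib)
  qed
  show "\<forall>\<^sub>F s in sequentially. real (s div Q) / real s \<le> 1 / real Q"
    using eventually_gt_at_top[of 0]
  proof eventually_elim
    case (elim s)
    have "real (s div Q) * real Q \<le> real s" by (metis div_times_less_eq_dividend of_nat_le_iff of_nat_mult)
    then show ?case using elim assms by (simp add: field_simps)
  qed
  show "(\<lambda>s. 1 / real Q - 1 / real s) \<longlonglongrightarrow> 1 / real Q"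
    using tendsto_diff[OF tendsto_const lim_1_over_n, of "1 / real Q"] by simp
qed simp

context fekete
begin

text \<open>
  The roots \<open>x s\<close> lie in \<open>[0, 1]\<close>.  Comparing \<open>s\<close> with the multiples of \<open>q + c\<close> shows that the limit superior is at
  most \<open>x q + (1 - \<theta> q)\<close>, for every \<open>q\<close>, with \<open>\<theta> q\<close> tending to 1; so the limit superior \<open>L\<close> is the limit.
\<close>

lemma P_root_converges:
  "\<exists>L\<ge>0. (\<lambda>s. P s powr (1 / real s ^ (card A + 1))) \<longlonglongrightarrow> L"
proof -
  define k where "k = card A + 1"
  define c where "c = 2 * card A + 2 * edeg h"
  define x where "x s = P s powr (1 / real s ^ k)" for s
  define \<theta> where "\<theta> q = (real q / real (q + c)) ^ k" for q
  have x01: "0 \<le> x s" "x s \<le> 1" for s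
    using P01[of s] powr_mono2[of "1 / real s ^ k" "P s" 1] by (auto simp: x_def)
  \<comment> \<open>The infimum of \<open>U\<close> is the limit superior of \<open>x\<close>.\<close>
  define U where "U = {u. \<forall>\<^sub>F s in sequentially. x s \<le> u}"
  have ub: "x q + (1 - \<theta> q) + \<eta> \<in> U" if q: "q > 0" and \<eta>: "\<eta> > 0" for q \<eta>
  proof -
    define Q where "Q = q + c"
    have Q: "Q > 0" using q by (simp add: Q_def)
    have \<theta>: "\<theta> q = (real q / real Q) ^ k" "0 \<le> \<theta> q" "\<theta> q \<le> 1"
      using q by (auto simp: \<theta>_def Q_def intro!: power_le_one)
    have main: "P s \<le> P q ^ ((s div Q) ^ k)" if "s \<ge> Q" for s
    proof -
      have "s div Q \<ge> 1" using that Q by (simp add: div_greater_zero_iff Suc_le_eq One_nat_def)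
      have "P s \<le> P (s div Q * Q)" by (rule P_antimono) simp
      also have "\<dots> \<le> P q ^ ((s div Q) ^ k)"
        using P_submultiplicative[OF \<open>s div Q \<ge> 1\<close>, of q] by (simp add: Q_def c_def k_def add.assoc)
      finally show ?thesis .
    qed
    show ?thesis
    proof (cases "P q = 0")
      case True
      have "x s \<le> x q + (1 - \<theta> q) + \<eta>" if "s \<ge> Q" for s
      proof -
        have "s div Q \<ge> 1" using that Q by (simp add: div_greater_zero_iff Suc_le_eq One_nat_def)
        then have "P s \<le> 0" using main[OF that] True by (simp add: power_0_left)
        then have "P s = 0" using P01(1)[of s] by simp
        then show ?thesis using x01(1)[of q] \<theta> \<eta> by (simp add: x_def)
      qed
      then show ?thesis unfolding U_def by (auto simp: eventually_sequentially)
    next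
      case False
      then have Pq: "P q > 0" using P01(1)[of q] by simp
      have "(\<lambda>s. P q powr ((real (s div Q) / real s) ^ k)) \<longlonglongrightarrow> P q powr ((1 / real Q) ^ k)"
        using False by (intro tendsto_powr tendsto_const tendsto_power div_ratio_tendsto[OF Q])
      moreover have "P q powr ((1 / real Q) ^ k) < x q + (1 - \<theta> q) + \<eta>"
      proof -
        have "P q powr ((1 / real Q) ^ k) = x q powr \<theta> q"
          unfolding x_def powr_powr \<theta>(1) using q by (simp add: power_divide)
        also have "\<dots> \<le> x q + (1 - \<theta> q)" using powr_le_affine x01 \<theta> by blast
        finally show ?thesis using \<eta> by simp
      qed
      ultimately have "\<forall>\<^sub>F s in sequentially. P q powr ((real (s div Q) / real s) ^ k) < x q + (1 - \<theta> q) + \<eta>"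
        by (rule order_tendstoD)
      then have "\<forall>\<^sub>F s in sequentially. x s \<le> x q + (1 - \<theta> q) + \<eta>"
        using eventually_ge_at_top[of Q]
      proof eventually_elim
        case (elim s)
        have s: "s > 0" using elim Q by simp
        have "x s \<le> (P q ^ ((s div Q) ^ k)) powr (1 / real s ^ k)"
          unfolding x_def using main[OF elim(2)] P01 by (intro powr_mono2) auto
        also have "\<dots> = P q powr ((real (s div Q) / real s) ^ k)"
          using Pq by (simp add: powr_realpow[symmetric] powr_powr power_divide)
        finally show ?case using elim(1) by simp
      qed
      then show ?thesis by (simp add: U_def)
    qed
  qed
  have bdd: "bdd_below U"
  proof (rule bdd_belowI)
    fix u assume "u \<in> U"
    then obtain s where "x s \<le> u" by (auto simp: U_def eventually_sequentially)
    then show "0 \<le> u" using x01(1)[of s] by simp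
  qed
  have Une: "U \<noteq> {}" using ub[of 1 1] by (auto simp: One_nat_def)
  define L where "L = Inf U"
  have L0: "0 \<le> L" unfolding L_def
  proof (rule cInf_greatest[OF Une])
    fix u assume "u \<in> U"
    then obtain s where "x s \<le> u" by (auto simp: U_def eventually_sequentially)
    then show "0 \<le> u" using x01(1)[of s] by simp
  qed
  have "x \<longlonglongrightarrow> L"
  proof (rule order_tendstoI)
    fix a assume "L < a"
    then obtain u where "u \<in> U" "u < a" using cInf_lessD[OF Une] by (auto simp: L_def)
    then show "\<forall>\<^sub>F s in sequentially. x s < a" by (auto simp: U_def elim: eventually_mono)
  next
    fix a assume a: "a < L"
    have "(\<lambda>q. real q / real (q + c)) \<longlonglongrightarrow> 1"
    proof (rule Lim_transform_eventually)
      show "(\<lambda>q. 1 - real c / real (q + c)) \<longlonglongrightarrow> 1"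
        using tendsto_diff[OF tendsto_const LIMSEQ_ignore_initial_segment[OF lim_const_over_n[of "real c"], of c], of 1]
        by simp
      show "\<forall>\<^sub>F q in sequentially. 1 - real c / real (q + c) = real q / real (q + c)"
        by (rule eventually_mono[OF eventually_gt_at_top[of 0]]) (simp add: field_simps)
    qed
    then have "\<theta> \<longlonglongrightarrow> 1 ^ k" unfolding \<theta>_def by (intro tendsto_power)
    then have "\<theta> \<longlonglongrightarrow> 1" by simp
    then have "\<forall>\<^sub>F q in sequentially. 1 - (L - a) / 2 < \<theta> q" using a by (intro order_tendstoD(1)) auto
    then show "\<forall>\<^sub>F q in sequentially. a < x q"
      using eventually_gt_at_top[of 0]
    proof eventually_elim
      case (elim q)
      have "L \<le> x q + (1 - \<theta> q) + (L - a) / 4"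
        unfolding L_def by (rule cInf_lower[OF ub bdd]) (use elim a in \<open>auto simp: L_def\<close>)
      then show ?case using elim(1) a by (simp add: field_simps)
    qed
  qed
  then show ?thesis using L0 unfolding x_def k_def by blast
qed

end

lemma expos_card_ge: "finite A \<Longrightarrow> A \<noteq> {} \<Longrightarrow> (u + 1) ^ card A \<le> card (expos A (card A * u))"
proof -
  assume A: "finite A" "A \<noteq> {}"
  have "edeg \<gamma> \<le> card A * u" if "keys \<gamma> \<subseteq> A" "\<forall>i. lookup \<gamma> i \<le> u" for \<gamma> :: expo
    using sum_bounded_above[of A "lookup \<gamma>" u] that edeg_superset[OF A(1) that(1)] by simp
  then have "{\<gamma> :: expo. keys \<gamma> \<subseteq> A \<and> (\<forall>i. lookup \<gamma> i \<le> u)} \<subseteq> expos A (card A * u)"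
    by (auto simp: expos_def)
  from card_mono[OF finite_expos[OF A(1)] this] show ?thesis
    by (simp only: finite_expo_box(2)[OF A(1), of u])
qed

text \<open>
  The number of exponents of degree at most \<open>s\<close> grows like \<open>s ^ card A\<close>, faster than any polynomial of
  smaller degree.
\<close>

lemma expos_outgrow:
  assumes "finite A" "A \<noteq> {}" "card A = Suc k"
  shows "\<exists>s. C * (s + c + 1) ^ k < card (expos A s)"
proof -
  \<comment> \<open>Chosen such that \<open>C (s + c + 1)^k \<le> u (u + 1)^k\<close> for \<open>s = card A * u\<close>.\<close>
  define u where "u = C * (card A + c + 1) ^ k"
  define s where "s = card A * u"
  have "s + c + 1 \<le> (card A + c + 1) * (u + 1)" by (simp add: s_def algebra_simps)
  then have "C * (s + c + 1) ^ k \<le> C * ((card A + c + 1) * (u + 1)) ^ k"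
    by (intro mult_left_mono power_mono) auto
  also have "\<dots> = u * (u + 1) ^ k" by (simp add: u_def power_mult_distrib)
  also have "\<dots> < (u + 1) * (u + 1) ^ k" by (intro mult_strict_right_mono) auto
  also have "\<dots> = (u + 1) ^ card A" by (simp add: assms(3))
  also have "\<dots> \<le> card (expos A s)" unfolding s_def by (rule expos_card_ge[OF assms(1,2)])
  finally show ?thesis by blast
qed

text \<open>
  Translate a box of side \<open>u\<close> by the vector with all entries \<open>u\<close>: it has more than \<open>u ^ card A\<close>
  elements, all of degree at least \<open>u\<close>.
\<close>

lemma sum_edeg_ge:
  assumes A: "finite A" "A \<noteq> {}"
  shows "u ^ (card A + 1) \<le> (\<Sum>a\<in>expos A (2 * card A * u). edeg a)"
proof -
  let ?B = "{\<gamma> :: expo. keys \<gamma> \<subseteq> A \<and> (\<forall>i. lookup \<gamma> i \<le> u)}"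
  let ?o = "ebox A (\<lambda>_. u)"
  have eo: "edeg ?o = card A * u" by (simp add: edeg_ebox[OF A(1)])
  have inj: "inj_on (\<lambda>\<gamma>. \<gamma> + ?o) ?B"
    by (rule inj_onI, intro poly_mapping_eqI) (metis add_right_cancel lookup_add)
  have sub: "(\<lambda>\<gamma>. \<gamma> + ?o) ` ?B \<subseteq> expos A (2 * card A * u)"
  proof (rule image_subsetI)
    fix \<gamma> assume \<gamma>: "\<gamma> \<in> ?B"
    then have "edeg \<gamma> \<le> card A * u"
      using sum_bounded_above[of A "lookup \<gamma>" u] edeg_superset[OF A(1), of \<gamma>] by simp
    then show "\<gamma> + ?o \<in> expos A (2 * card A * u)"
      using \<gamma> keys_ebox[OF A(1), of "\<lambda>_. u"] by (simp add: expos_def keys_expo_add eo mult.commute[of u])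
  qed
  have "u ^ (card A + 1) = u ^ card A * u" by (simp add: power_add)
  also have "\<dots> \<le> (u + 1) ^ card A * u" by (intro mult_right_mono power_mono) auto
  also have "\<dots> = (\<Sum>\<gamma>\<in>?B. u)" using finite_expo_box(2)[OF A(1), of u] by simp
  also have "\<dots> \<le> (\<Sum>\<gamma>\<in>?B. edeg (\<gamma> + ?o))"
  proof (rule sum_mono)
    fix \<gamma> assume "\<gamma> \<in> ?B"
    have "card A > 0" using A by (simp add: card_gt_0_iff)
    then have "u \<le> card A * u" by simp
    then show "u \<le> edeg (\<gamma> + ?o)" unfolding edeg_add eo by (rule trans_le_add2)
  qed
  also have "\<dots> = (\<Sum>a\<in>(\<lambda>\<gamma>. \<gamma> + ?o) ` ?B. edeg a)" by (simp add: sum.reindex[OF inj])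
  also have "\<dots> \<le> (\<Sum>a\<in>expos A (2 * card A * u). edeg a)"
    by (rule sum_mono2[OF finite_expos[OF A(1)] sub]) simp
  finally show ?thesis .
qed

text \<open>
  The family \<open>exp (- deg a)\<close> is multiplicative, so convergence is the special case without shift of
  \<open>P_root_converges\<close>; crude bounds place the limit strictly between \<open>0\<close> and \<open>1\<close>.
\<close>

lemma sum_edeg_asymptotics:
  assumes A: "finite A" "A \<noteq> {}"
  shows "\<exists>l>0. (\<lambda>s. real (\<Sum>a\<in>expos A s. edeg a) / real s ^ (card A + 1)) \<longlonglongrightarrow> l"
proof -
  define k where "k = card A + 1"
  define S where "S s = (\<Sum>a\<in>expos A s. edeg a)" for s
  interpret fekete A "\<lambda>a. exp (- real (edeg a))" 0
    by unfold_locales (use A in \<open>auto simp: exp_add[symmetric]\<close>)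
  have P: "P s = exp (- real (S s))" for s
    by (simp add: P_def S_def exp_sum[symmetric] sum_negf A(1))
  obtain L where L: "L \<ge> 0" "(\<lambda>s. P s powr (1 / real s ^ k)) \<longlonglongrightarrow> L"
    using P_root_converges unfolding k_def by blast
  have eq: "P s powr (1 / real s ^ k) = exp (- (real (S s) / real s ^ k))" for s
    by (simp add: P exp_powr_real)
  have upper: "real (S s) / real s ^ k \<le> 2 ^ card A" if "s > 0" for s
  proof -
    have "S s \<le> card (expos A s) * s"
      unfolding S_def using sum_bounded_above[of "expos A s" edeg s] by (simp add: expos_def)
    also have "\<dots> \<le> (s + 1) ^ card A * s" by (intro mult_right_mono card_expos_le A(1)) simp
    also have "\<dots> \<le> (2 * s) ^ card A * s" using that by (intro mult_right_mono power_mono) auto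
    also have "\<dots> = 2 ^ card A * s ^ k" by (simp add: k_def power_mult_distrib power_add)
    finally have "real (S s) \<le> real (2 ^ card A * s ^ k)" by (rule of_nat_mono)
    then show ?thesis using that by (simp add: pos_divide_le_eq)
  qed
  have "exp (- (2 ^ card A)) \<le> L"
    by (rule tendsto_lowerbound[OF L(2)[unfolded eq]])
       (use upper in \<open>auto intro!: eventually_mono[OF eventually_gt_at_top[of 0]]\<close>)
  then have Lpos: "L > 0" using exp_gt_zero less_le_trans by blast
  have "(\<lambda>s. - ln (exp (- (real (S s) / real s ^ k)))) \<longlonglongrightarrow> - ln L"
    using L(2)[unfolded eq] Lpos by (intro tendsto_minus tendsto_ln) auto
  then have lim: "(\<lambda>s. real (S s) / real s ^ k) \<longlonglongrightarrow> - ln L" by simp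
  define M where "M = 2 * card A"
  have M: "M > 0" using A by (simp add: M_def card_gt_0_iff)
  have "(\<lambda>s. (real (s div M) / real s) ^ k) \<longlonglongrightarrow> (1 / real M) ^ k"
    by (intro tendsto_power div_ratio_tendsto[OF M])
  moreover have "(real (s div M) / real s) ^ k \<le> real (S s) / real s ^ k" for s
  proof -
    have "(s div M) ^ k \<le> S (M * (s div M))"
      using sum_edeg_ge[OF A, of "s div M"] by (simp add: S_def k_def M_def)
    also have "\<dots> \<le> S s" unfolding S_def
      by (rule sum_mono2[OF finite_expos[OF A(1)]])
         (auto simp: expos_def intro: le_trans[OF _ times_div_less_eq_dividend])
    finally have "real ((s div M) ^ k) \<le> real (S s)" by (rule of_nat_mono)
    then show ?thesis by (simp add: power_divide divide_right_mono)
  qed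
  ultimately have "(1 / real M) ^ k \<le> - ln L"
    by (intro tendsto_le[OF _ lim]) auto
  moreover have "(1 / real M) ^ k > 0" using M by simp
  ultimately have "- ln L > 0" by linarith
  then show ?thesis using lim unfolding S_def k_def by blast
qed

section \<open>Chebyshev constants on the variety\<close>

context noether_setup
begin

definition Below :: "expo \<Rightarrow> expo set" where "Below \<gamma> = {\<delta>\<in>Std. grevlex \<delta> \<gamma>}"

lemma finite_Below [simp]: "finite (Below \<gamma>)"
  by (rule finite_subset[OF _ finite_StdS[of "edeg \<gamma>"]]) (use grevlex_edeg in \<open>auto simp: Below_def StdS_def\<close>)

text \<open>
  The monic functions with leading exponent \<open>\<gamma>\<close> in the basis \<open>eb\<close>.
\<close>

definition adm :: "expo \<Rightarrow> cpoly \<Rightarrow> bool" where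
  "adm \<gamma> f \<longleftrightarrow> f \<in> polys {1..n} \<and> (\<exists>g\<in>cpoly.span (eb ` Below \<gamma>). eqV V f (eb \<gamma> + g))"

lemma kless_in_span:
  assumes "g \<in> polys {1..n}" "\<And>\<delta>. \<delta> \<in> keys g \<Longrightarrow> kless \<delta> \<gamma>"
  shows "\<exists>g'\<in>cpoly.span (eb ` Below \<gamma>). eqV V g g'"
proof -
  obtain c where c: "coords {\<delta>\<in>Std. kless \<delta> \<gamma>} g c" using ex_coords_kless[OF assms] by blast
  let ?g = "\<Sum>\<delta>\<in>{\<delta>\<in>Std. kless \<delta> \<gamma>}. cscale (c \<delta>) (eb \<delta>)"
  have "?g \<in> cpoly.span (eb ` Below \<gamma>)"
    by (intro cpoly.span_sum cpoly.span_scale cpoly.span_base imageI) (auto simp: Below_def kless_grevlex)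
  moreover have "eqV V g ?g" using c by (simp add: coords_def eqV_def)
  ultimately show ?thesis by blast
qed

lemma admI:
  assumes a: "keys a \<subseteq> {1..m}" and i: "i \<in> {1..d}" and f: "f \<in> polys {1..n}"
    and c: "c i = 1" "\<And>j. j \<in> {1..d} \<Longrightarrow> j \<noteq> i \<Longrightarrow> c j \<noteq> 0 \<Longrightarrow> grevlex (mu j) (mu i)"
    and g: "g \<in> polys {1..n}" "\<And>\<delta>. \<delta> \<in> keys g \<Longrightarrow> kless \<delta> (a + mu i)"
    and eq: "eqV V f ((\<Sum>j=1..d. cscale (c j) (zmon a * w j)) + g)"
  shows "adm (a + mu i) f"
proof -
  let ?S = "cpoly.span (eb ` Below (a + mu i))"
  obtain g' where g': "g' \<in> ?S" "eqV V g g'" using kless_in_span[OF g] by blast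
  let ?r = "\<Sum>j\<in>{1..d} - {i}. cscale (c j) (zmon a * w j)"
  have "cscale (c j) (zmon a * w j) \<in> ?S" if j: "j \<in> {1..d} - {i}" for j
  proof (cases "c j = 0")
    case False
    then have "a + mu j \<in> Below (a + mu i)" using c(2)[of j] j ext_Std[OF a, of j]
      by (auto simp: Below_def grevlex_add_left)
    then have "eb (a + mu j) \<in> ?S" by (intro cpoly.span_base imageI)
    then show ?thesis using eb_ext[OF a, of j] j by (auto intro: cpoly.span_scale)
  qed (simp add: cpoly.span_zero)
  then have r: "?r \<in> ?S" by (intro cpoly.span_sum)
  have "(\<Sum>j=1..d. cscale (c j) (zmon a * w j)) = eb (a + mu i) + ?r"
    using sum.remove[of "{1..d}" i "\<lambda>j. cscale (c j) (zmon a * w j)"] i c(1) eb_ext[OF a i] by simp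
  then have "eqV V f (eb (a + mu i) + (?r + g'))" using eq g'(2) by (simp add: eqV_def add.assoc)
  then show ?thesis unfolding adm_def using f cpoly.span_add[OF r g'(1)] by blast
qed

text \<open>
  The lower terms with the same degree and \<open>low\<close> as \<open>a + mu i\<close> are multiples of \<open>z^a w_j\<close> with
  \<open>mu j\<close> below \<open>mu i\<close>; all others are \<open>kless\<close>.  Together with \<open>admI\<close> this turns leading exponents into a statement about polynomials,
  in which products can be computed.
\<close>

lemma admE:
  assumes a: "keys a \<subseteq> {1..m}" and i: "i \<in> {1..d}" and f: "adm (a + mu i) f"
  shows "\<exists>c g. c i = 1 \<and> (\<forall>j\<in>{1..d}. j \<noteq> i \<longrightarrow> c j \<noteq> 0 \<longrightarrow> grevlex (mu j) (mu i)) \<and>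
    g \<in> polys {1..n} \<and> (\<forall>\<delta>\<in>keys g. kless \<delta> (a + mu i)) \<and>
    eqV V f ((\<Sum>j=1..d. cscale (c j) (zmon a * w j)) + g)"
proof -
  let ?\<gamma> = "a + mu i"
  obtain g0 where g0: "g0 \<in> cpoly.span (eb ` Below ?\<gamma>)" "eqV V f (eb ?\<gamma> + g0)" using f by (auto simp: adm_def)
  have "\<exists>c g. (\<forall>j\<in>{1..d}. c j \<noteq> 0 \<longrightarrow> grevlex (mu j) (mu i)) \<and> g \<in> polys {1..n} \<and>
      (\<forall>\<delta>\<in>keys g. kless \<delta> ?\<gamma>) \<and> g0 = (\<Sum>j=1..d. cscale (c j) (zmon a * w j)) + g"
    using g0(1)
  proof (induction rule: cpoly.span_induct_alt)
    case base
    show ?case by (intro exI[of _ "\<lambda>_. 0"] exI[of _ 0]) auto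
  next
    case (step k x y)
    then obtain \<delta> where \<delta>: "x = eb \<delta>" "\<delta> \<in> Std" "grevlex \<delta> ?\<gamma>" by (auto simp: Below_def)
    obtain c g where IH: "\<forall>j\<in>{1..d}. c j \<noteq> 0 \<longrightarrow> grevlex (mu j) (mu i)" "g \<in> polys {1..n}"
      "\<forall>\<delta>\<in>keys g. kless \<delta> ?\<gamma>" "y = (\<Sum>j=1..d. cscale (c j) (zmon a * w j)) + g" using step by blast
    show ?case
    proof (cases "kless \<delta> ?\<gamma>")
      case True
      have kg: "kless \<epsilon> ?\<gamma>" if "\<epsilon> \<in> keys (cscale k x + g)" for \<epsilon>
      proof -
        have "\<epsilon> \<in> keys (eb \<delta>) \<or> \<epsilon> \<in> keys g"
          using that keys_add[of "cscale k x" g] by (auto simp: \<delta>(1) keys_cscale split: if_splits)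
        then show ?thesis using eb_keys(2)[OF \<delta>(2)] True kle_kless_trans IH(3) by blast
      qed
      have "cscale k x + g \<in> polys {1..n}"
        using IH(2) eb_polys[OF \<delta>(2)] \<delta>(1) by (auto intro!: polys_add polys_cscale)
      then show ?thesis using IH(1) kg
        by (intro exI[of _ c] exI[of _ "cscale k x + g"]) (simp add: IH(4) algebra_simps)
    next
      case False
      then have kq: "keq \<delta> ?\<gamma>" using grevlex_kle[OF \<delta>(3)] by blast
      have "edeg (upp \<delta>) \<ge> t" using keq_edeg_upp[OF kq] ext_edeg_upp(1)[OF a i] by simp
      then have "\<delta> \<notin> OrdE" by (simp add: OrdE_def)
      then obtain b j where b: "keys b \<subseteq> {1..m}" "j \<in> {1..d}" "\<delta> = b + mu j"
        using Std_cases[OF \<delta>(2)] by metis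
      then have ba: "b = a" using keq_ext_eq[OF b(1,2) a i] kq by simp
      then have gj: "grevlex (mu j) (mu i)" using \<delta>(3) b(3) by (simp add: grevlex_add_left)
      have "(\<Sum>l=1..d. cscale ((if l = j then k else 0) + c l) (zmon a * w l)) =
          (\<Sum>l=1..d. (if l = j then cscale k (zmon a * w l) else 0) + cscale (c l) (zmon a * w l))"
        by (rule sum.cong) (auto simp: cpoly.scale_left_distrib)
      also have "\<dots> = cscale k x + (\<Sum>l=1..d. cscale (c l) (zmon a * w l))"
        using b(2,3) ba eb_ext[OF a b(2)] \<delta>(1) by (simp add: sum.distrib)
      finally have "cscale k x + y = (\<Sum>l=1..d. cscale ((if l = j then k else 0) + c l) (zmon a * w l)) + g"
        by (simp add: IH(4) add.assoc)
      then show ?thesis using IH(1-3) gj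
        by (intro exI[of _ "\<lambda>l. (if l = j then k else 0) + c l"] exI[of _ g]) auto
    qed
  qed
  then obtain c g where c: "\<forall>j\<in>{1..d}. c j \<noteq> 0 \<longrightarrow> grevlex (mu j) (mu i)" "g \<in> polys {1..n}"
      "\<forall>\<delta>\<in>keys g. kless \<delta> ?\<gamma>" "g0 = (\<Sum>j=1..d. cscale (c j) (zmon a * w j)) + g" by blast
  have ci: "c i = 0" using c(1) i grevlex_irrefl by blast
  have "(\<Sum>j=1..d. cscale ((c(i := 1)) j) (zmon a * w j)) = eb ?\<gamma> + (\<Sum>j=1..d. cscale (c j) (zmon a * w j))"
    using sum.remove[of "{1..d}" i "\<lambda>j. cscale ((c(i := 1)) j) (zmon a * w j)"]
      sum.remove[of "{1..d}" i "\<lambda>j. cscale (c j) (zmon a * w j)"] i ci eb_ext[OF a i]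
    by (simp cong: sum.cong_simp)
  then have "eqV V f ((\<Sum>j=1..d. cscale ((c(i := 1)) j) (zmon a * w j)) + g)"
    using g0(2) c(4) by (simp add: add.assoc)
  then show ?thesis by (intro exI[of _ "c(i := 1)"] exI[of _ g] conjI) (use c in auto)
qed

text \<open>
  The difference of the two sides vanishes at all \<open>p_l\<close>, so \<open>evaluation_kernel\<close> applies.
\<close>

lemma w_products:
  assumes j: "j \<in> {1..d}" and k: "k \<in> {1..d}"
  shows "\<exists>g. g \<in> polys {1..n} \<and>
    eqV V (w j * w k) ((if j = k then zmon (Poly_Mapping.single m t) * w j else 0) + g) \<and>
    (\<forall>\<delta>\<in>keys g. edeg \<delta> < 2 * t \<or> edeg \<delta> = 2 * t \<and> low \<delta> \<noteq> 0)"
proof -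
  let ?u = "if j = k then zmon (Poly_Mapping.single m t) * w j else 0"
  let ?f = "w j * w k - ?u"
  have up: "?u \<in> polys {1..n}" using w_polys[OF j] m1 mn
    by (cases "j = k") (auto intro!: polys_mult simp: keys_single_subset)
  have "\<delta> \<in> keys ?f \<Longrightarrow> edeg \<delta> = 2 * t" for \<delta>
  proof -
    assume "\<delta> \<in> keys ?f"
    then consider "\<delta> \<in> keys (w j * w k)" | "\<delta> \<in> keys (zmon (Poly_Mapping.single m t) * w j)"
      using keys_diff_subset[of "w j * w k" ?u] by (auto split: if_splits)
    then show "edeg \<delta> = 2 * t"
    proof cases
      case 1
      then obtain \<alpha> \<beta> where "\<alpha> \<in> keys (w j)" "\<beta> \<in> keys (w k)" "\<delta> = \<alpha> + \<beta>"
        using keys_mult[of "w j" "w k"] by blast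
      then show ?thesis using w_keys j k by simp
    next
      case 2
      then show ?thesis using w_keys[OF j] by (auto simp: keys_zmon_mult)
    qed
  qed
  then have h: "?f \<in> homog {1..n} (2 * t)"
    using polys_diff[OF polys_mult[OF w_polys[OF j] w_polys[OF k]] up] by (simp add: homog_def)
  have "peval (p l) ?f = 0" if l: "l \<in> {1..d}" for l
    using w_val[OF j l] w_val[OF k l] by (auto simp: power_add)
  then obtain g where g: "g \<in> polys {1..n}" "eqV V ?f g"
      "\<And>\<delta>. \<delta> \<in> keys g \<Longrightarrow> edeg \<delta> < 2 * t \<or> edeg \<delta> = 2 * t \<and> low \<delta> \<noteq> 0"
    using evaluation_kernel[OF h] by (metis le_add1 mult_2)
  moreover have "eqV V (w j * w k) (?u + g)" using g(2) by (simp add: eqV_def algebra_simps)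
  ultimately show ?thesis using g(1,3) by blast
qed

lemma keys_Sigma_w:
  assumes a: "keys a \<subseteq> {1..m}" and i: "i \<in> {1..d}" and \<delta>: "\<delta> \<in> keys (\<Sum>j=1..d. cscale (c j) (zmon a * w j))"
  shows "kle \<delta> (a + mu i)"
proof -
  obtain j where j: "j \<in> {1..d}" "\<delta> \<in> keys (zmon a * w j)"
    using subsetD[OF keys_lin_comb \<delta>] by blast
  then have "kle \<delta> (a + mu j)" using eb_keys(2)[OF ext_Std[OF a j(1)]] eb_ext[OF a j(1)] by simp
  moreover have "keq (a + mu j) (a + mu i)" using ext_edeg_upp a i j(1) by (simp add: keq_def)
  ultimately show ?thesis using kle_trans by blast
qed

text \<open>
  Only the diagonal products \<open>w_j w_j\<close> have a term of the top size, and for \<open>j \<noteq> i\<close> the coefficient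
  \<open>c j * c' j\<close> is nonzero only if \<open>mu j\<close> is below \<open>mu i\<close>.  The remainder \<open>H\<close> gathers everything that is
  \<open>kless\<close>.
\<close>

lemma adm_mult:
  assumes a: "keys a \<subseteq> {1..m}" and b: "keys b \<subseteq> {1..m}" and i: "i \<in> {1..d}"
    and f: "adm (a + mu i) f" and f': "adm (b + mu i) f'" and x: "keys x \<subseteq> {1..m}"
  shows "adm (a + b + (x + Poly_Mapping.single m t) + mu i) (zmon x * f * f')"
proof -
  obtain c g where c: "c i = 1" "\<forall>j\<in>{1..d}. j \<noteq> i \<longrightarrow> c j \<noteq> 0 \<longrightarrow> grevlex (mu j) (mu i)"
    and g: "g \<in> polys {1..n}" "\<forall>\<delta>\<in>keys g. kless \<delta> (a + mu i)"
    and fc: "eqV V f ((\<Sum>j=1..d. cscale (c j) (zmon a * w j)) + g)" (is "eqV V f (?F + g)")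
    using admE[OF a i f] by auto
  obtain c' g' where c': "c' i = 1" "\<forall>j\<in>{1..d}. j \<noteq> i \<longrightarrow> c' j \<noteq> 0 \<longrightarrow> grevlex (mu j) (mu i)"
    and g': "g' \<in> polys {1..n}" "\<forall>\<delta>\<in>keys g'. kless \<delta> (b + mu i)"
    and fc': "eqV V f' ((\<Sum>j=1..d. cscale (c' j) (zmon b * w j)) + g')" (is "eqV V f' (?F' + g')")
    using admE[OF b i f'] by auto
  \<comment> \<open>\<open>G j k\<close> is the error term in the product \<open>w_j w_k\<close>.\<close>
  define G where "G j k = (SOME g. g \<in> polys {1..n} \<and>
      eqV V (w j * w k) ((if j = k then zmon (Poly_Mapping.single m t) * w j else 0) + g) \<and>
      (\<forall>\<delta>\<in>keys g. edeg \<delta> < 2 * t \<or> edeg \<delta> = 2 * t \<and> low \<delta> \<noteq> 0))" for j k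
  have G: "G j k \<in> polys {1..n} \<and>
      eqV V (w j * w k) ((if j = k then zmon (Poly_Mapping.single m t) * w j else 0) + G j k) \<and>
      (\<forall>\<delta>\<in>keys (G j k). edeg \<delta> < 2 * t \<or> edeg \<delta> = 2 * t \<and> low \<delta> \<noteq> 0)" if "j \<in> {1..d}" "k \<in> {1..d}" for j k
    unfolding G_def by (rule someI_ex[OF w_products[OF that]])
  let ?x = "a + b + (x + Poly_Mapping.single m t)"
  let ?\<gamma> = "?x + mu i"
  define H where "H = (\<Sum>j=1..d. \<Sum>k=1..d. cscale (c j * c' k) (zmon (x + a + b) * G j k)) +
      zmon x * (?F * g' + g * (?F' + g'))"
  have xk: "keys ?x \<subseteq> {1..m}" using a b x m1 by (simp add: keys_expo_add keys_single_subset)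
  have sub: "keys y \<subseteq> {1..n}" if "keys y \<subseteq> {1..m}" for y :: expo using that mn by (auto intro: order_trans)
  have lsm: "low (Poly_Mapping.single m t) = 0" by (auto simp: low_eq_0_iff lookup_single)
  have keqx: "keq (x + ((a + mu i) + (b + mu i))) ?\<gamma>" "keq ((x + a + b) + (Poly_Mapping.single m t + mu i)) ?\<gamma>"
  proof -
    show "keq (x + ((a + mu i) + (b + mu i))) ?\<gamma>" "keq ((x + a + b) + (Poly_Mapping.single m t + mu i)) ?\<gamma>"
      using mu_edeg[OF i] mu_low[OF i] by (simp_all add: keq_def low_add ac_simps lsm)
  qed
  show ?thesis
  proof (rule admI[OF xk i])
    show "zmon x * f * f' \<in> polys {1..n}" using f f' sub[OF x] by (auto simp: adm_def intro!: polys_mult)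
    show "(\<lambda>j. c j * c' j) i = 1" using c c' by simp
    show "grevlex (mu j) (mu i)" if "j \<in> {1..d}" "j \<noteq> i" "(\<lambda>j. c j * c' j) j \<noteq> 0" for j
      using c(2) that by simp
    show "H \<in> polys {1..n}"
      unfolding H_def using G g g' a b x sub w_polys
      by (intro polys_add polys_sum polys_cscale polys_mult) (auto simp: keys_expo_add)
    show "kless \<delta> ?\<gamma>" if \<delta>: "\<delta> \<in> keys H" for \<delta>
    proof -
      consider "\<delta> \<in> keys (\<Sum>j=1..d. \<Sum>k=1..d. cscale (c j * c' k) (zmon (x + a + b) * G j k))"
        | "\<delta> \<in> keys (zmon x * (?F * g' + g * (?F' + g')))"
        using subsetD[OF keys_add \<delta>[unfolded H_def]] by blast
      then show ?thesis
      proof cases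
        case 1
        obtain j where j: "j \<in> {1..d}" "\<delta> \<in> keys (\<Sum>k=1..d. cscale (c j * c' k) (zmon (x + a + b) * G j k))"
          using subsetD[OF keys_sum 1] by blast
        then obtain k where k: "k \<in> {1..d}" "\<delta> \<in> keys (zmon (x + a + b) * G j k)"
          using subsetD[OF keys_lin_comb j(2)] by blast
        then obtain \<epsilon> where \<epsilon>: "\<epsilon> \<in> keys (G j k)" "\<delta> = (x + a + b) + \<epsilon>" by (auto simp: keys_zmon_mult)
        have "edeg \<epsilon> < 2 * t \<or> edeg \<epsilon> = 2 * t \<and> low \<epsilon> \<noteq> 0" using G[OF j(1) k(1)] \<epsilon>(1) by blast
        moreover have "low (Poly_Mapping.single m t + mu i) = 0" "edeg (Poly_Mapping.single m t + mu i) = 2 * t"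
          using mu_low[OF i] mu_edeg[OF i] by (simp_all add: low_add lsm)
        ultimately have "kless \<epsilon> (Poly_Mapping.single m t + mu i)"
          by (metis low_nz_kless)
        then have "kless (\<epsilon> + (x + a + b)) ((Poly_Mapping.single m t + mu i) + (x + a + b))"
          by (rule kless_keq_add) simp
        then show ?thesis using kless_keq2[OF _ keqx(2)] \<epsilon>(2) by (simp add: add.commute)
      next
        case 2
        then obtain \<epsilon> where \<epsilon>: "\<epsilon> \<in> keys (?F * g' + g * (?F' + g'))" "\<delta> = x + \<epsilon>" by (auto simp: keys_zmon_mult)
        have kF': "kle \<beta> (b + mu i)" if "\<beta> \<in> keys (?F' + g')" for \<beta>
          using subsetD[OF keys_add that] keys_Sigma_w[OF b i] g'(2) by blast
        have "kless \<epsilon> ((a + mu i) + (b + mu i))"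
        proof -
          consider "\<epsilon> \<in> keys (?F * g')" | "\<epsilon> \<in> keys (g * (?F' + g'))" using subsetD[OF keys_add \<epsilon>(1)] by blast
          then show ?thesis
          proof cases
            case 1
            obtain \<alpha> \<beta> where ab: "\<alpha> \<in> keys ?F" "\<beta> \<in> keys g'" "\<epsilon> = \<alpha> + \<beta>"
              using subsetD[OF keys_mult 1] by blast
            have "kless (\<beta> + \<alpha>) ((b + mu i) + (a + mu i))"
              by (rule kless_kle_add[OF bspec[OF g'(2) ab(2)] keys_Sigma_w[OF a i ab(1)]])
            then show ?thesis using ab(3) by (simp add: add.commute)
          next
            case 2
            obtain \<alpha> \<beta> where ab: "\<alpha> \<in> keys g" "\<beta> \<in> keys (?F' + g')" "\<epsilon> = \<alpha> + \<beta>"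
              using subsetD[OF keys_mult 2] by blast
            then show ?thesis using kless_kle_add[OF bspec[OF g(2) ab(1)] kF'[OF ab(2)]] by simp
          qed
        qed
        then have "kless (\<epsilon> + x) (((a + mu i) + (b + mu i)) + x)" by (rule kless_keq_add) simp
        then show ?thesis using kless_keq2[OF _ keqx(1)] \<epsilon>(2) by (simp add: add.commute)
      qed
    qed
    show "eqV V (zmon x * f * f') ((\<Sum>j=1..d. cscale (c j * c' j) (zmon ?x * w j)) + H)"
      unfolding eqV_def
    proof
      fix z assume z: "z \<in> V"
      let ?W = "\<lambda>j. peval z (w j)"
      let ?FF = "\<Sum>j=1..d. c j * (mval z a * ?W j)" and ?FF' = "\<Sum>j=1..d. c' j * (mval z b * ?W j)"
      have fz: "peval z f = ?FF + peval z g" using fc z by (simp add: eqV_def)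
      have fz': "peval z f' = ?FF' + peval z g'" using fc' z by (simp add: eqV_def)
      have ww: "?W j * ?W k = (if j = k then z m ^ t * ?W j else 0) + peval z (G j k)"
        if "j \<in> {1..d}" "k \<in> {1..d}" for j k
        using G[OF that] z by (auto simp: eqV_def)
      have "mval z x * (?FF * ?FF') = (\<Sum>j=1..d. \<Sum>k=1..d. c j * c' k * mval z (x + a + b) * (?W j * ?W k))"
        by (simp add: sum_product sum_distrib_left mval_add mult.assoc mult.commute mult.left_commute)
      also have "\<dots> = (\<Sum>j=1..d. \<Sum>k=1..d. (if j = k then c j * c' j * (mval z ?x * ?W j) else 0) +
          c j * c' k * (mval z (x + a + b) * peval z (G j k)))"
        by (intro sum.cong refl) (auto simp: ww mval_add algebra_simps)
      also have "\<dots> = (\<Sum>j=1..d. c j * c' j * (mval z ?x * ?W j)) +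
          (\<Sum>j=1..d. \<Sum>k=1..d. c j * c' k * (mval z (x + a + b) * peval z (G j k)))"
        by (simp add: sum.distrib)
      finally have 1: "mval z x * (?FF * ?FF') = \<dots>" .
      have "peval z (zmon x * f * f') = mval z x * (?FF * ?FF') +
          mval z x * (?FF * peval z g' + peval z g * (?FF' + peval z g'))"
        by (simp add: fz fz' algebra_simps)
      then show "peval z (zmon x * f * f') = peval z ((\<Sum>j=1..d. cscale (c j * c' j) (zmon ?x * w j)) + H)"
        unfolding 1 by (simp add: H_def add.assoc)
    qed
  qed
qed

end

locale compact_setup = noether_setup n V I m d t p w
  for n :: nat and V :: "(nat \<Rightarrow> complex) set" and I :: "cpoly set" and m d t p w +
  fixes K :: "(nat \<Rightarrow> complex) set"
  assumes KV: "K \<subseteq> V" and K: "compact K"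
begin

text \<open>
  The Chebyshev constant of the exponent \<open>\<gamma>\<close>.
\<close>

definition T :: "expo \<Rightarrow> real" where "T \<gamma> = Inf (supK K ` Collect (adm \<gamma>))"

lemma adm_eb: "\<gamma> \<in> Std \<Longrightarrow> adm \<gamma> (eb \<gamma>)"
  unfolding adm_def by (intro conjI bexI[of _ 0]) (auto simp: eb_polys eqV_def cpoly.span_zero)

lemma T_le: "adm \<gamma> f \<Longrightarrow> T \<gamma> \<le> supK K f"
  unfolding T_def by (rule cInf_lower) (auto intro!: bdd_belowI[of _ 0] supK_nonneg K)

lemma T_nonneg: "\<gamma> \<in> Std \<Longrightarrow> 0 \<le> T \<gamma>"
  unfolding T_def by (rule cInf_greatest) (auto intro: adm_eb supK_nonneg K)

lemma le_TI: "\<gamma> \<in> Std \<Longrightarrow> (\<And>f. adm \<gamma> f \<Longrightarrow> b \<le> supK K f) \<Longrightarrow> b \<le> T \<gamma>"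
  unfolding T_def by (rule cInf_greatest) (auto intro: adm_eb)

text \<open>
  Take infima in \<open>adm_mult\<close>, one factor at a time; a vanishing factor is treated separately because it cannot be divided out.
\<close>

lemma T_submultiplicative:
  assumes a: "keys a \<subseteq> {1..m}" and b: "keys b \<subseteq> {1..m}" and i: "i \<in> {1..d}" and x: "keys x \<subseteq> {1..m}"
  shows "T (a + b + (x + Poly_Mapping.single m t) + mu i) \<le> supK K (zmon x) * (T (a + mu i) * T (b + mu i))"
proof -
  let ?L = "T (a + b + (x + Poly_Mapping.single m t) + mu i)" and ?C = "supK K (zmon x)"
  have C: "?C \<ge> 0" by (rule supK_nonneg[OF K])
  have nn: "T (a + mu i) \<ge> 0" "T (b + mu i) \<ge> 0" using T_nonneg ext_Std a b i by auto
  have main: "?L \<le> ?C * supK K f * supK K f'" if "adm (a + mu i) f" "adm (b + mu i) f'" for f f'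
  proof -
    have "?L \<le> supK K (zmon x * f * f')" by (rule T_le[OF adm_mult[OF a b i that x]])
    also have "\<dots> \<le> supK K (zmon x * f) * supK K f'" by (rule supK_mult[OF K])
    also have "\<dots> \<le> ?C * supK K f * supK K f'" by (intro mult_right_mono supK_mult supK_nonneg K)
    finally show ?thesis .
  qed
  have half: "?L \<le> ?C * supK K f * T (b + mu i)" if f: "adm (a + mu i) f" for f
  proof (cases "?C * supK K f = 0")
    case True
    show ?thesis using main[OF f adm_eb[OF ext_Std[OF b i]]] unfolding True by simp
  next
    case False
    then have pos: "?C * supK K f > 0" using C supK_nonneg[OF K, of f] by (simp add: less_le)
    have "?L / (?C * supK K f) \<le> T (b + mu i)"
      by (rule le_TI[OF ext_Std[OF b i]]) (use main[OF f] pos in \<open>simp add: pos_divide_le_eq mult.commute\<close>)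
    then show ?thesis using pos by (simp add: pos_divide_le_eq mult.commute)
  qed
  show ?thesis
  proof (cases "?C * T (b + mu i) = 0")
    case True
    then show ?thesis using half[OF adm_eb[OF ext_Std[OF a i]]] by (auto simp: mult.commute mult.left_commute)
  next
    case False
    then have pos: "?C * T (b + mu i) > 0" using C nn by (simp add: less_le)
    have "?L / (?C * T (b + mu i)) \<le> T (a + mu i)"
      by (rule le_TI[OF ext_Std[OF a i]]) (use half pos in \<open>simp add: pos_divide_le_eq mult.commute mult.assoc\<close>)
    then show ?thesis using pos by (simp add: pos_divide_le_eq mult.commute mult.left_commute)
  qed
qed

lemma supK_zmon_bound: "\<exists>\<rho>\<ge>1. \<forall>\<gamma>. keys \<gamma> \<subseteq> {1..n} \<longrightarrow> supK K (zmon \<gamma>) \<le> \<rho> ^ edeg \<gamma>"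
proof -
  define \<rho> where "\<rho> = 1 + (\<Sum>i=1..n. supK K (zvar i))"
  have \<rho>: "\<rho> \<ge> 1" by (auto simp: \<rho>_def intro!: sum_nonneg supK_nonneg K)
  have "cmod (mval a \<gamma>) \<le> \<rho> ^ edeg \<gamma>" if k: "keys \<gamma> \<subseteq> {1..n}" and a: "a \<in> K" for a \<gamma>
  proof -
    have "cmod (mval a \<gamma>) = (\<Prod>i\<in>keys \<gamma>. cmod (a i) ^ lookup \<gamma> i)"
      by (simp add: mval_def prod_norm[symmetric] norm_power)
    also have "\<dots> \<le> (\<Prod>i\<in>keys \<gamma>. \<rho> ^ lookup \<gamma> i)"
    proof (intro prod_mono conjI power_mono)
      fix i assume i: "i \<in> keys \<gamma>"
      have "cmod (a i) \<le> supK K (zvar i)" using supK_upper[OF K a, of "zvar i"] by simp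
      also have "\<dots> \<le> (\<Sum>i=1..n. supK K (zvar i))"
        using k i by (intro member_le_sum) (auto intro: supK_nonneg K)
      finally show "cmod (a i) \<le> \<rho>" by (simp add: \<rho>_def)
    qed auto
    also have "\<dots> = \<rho> ^ edeg \<gamma>" by (simp add: edeg_def power_sum)
    finally show ?thesis .
  qed
  then show ?thesis using \<rho> by (intro exI[of _ \<rho>] conjI allI impI supK_least) auto
qed

text \<open>
  A basis element is a monomial times one of finitely many polynomials.
\<close>

lemma supK_eb_bound: "\<exists>C\<ge>1. \<forall>\<gamma>\<in>Std. supK K (eb \<gamma>) \<le> C ^ (edeg \<gamma> + 1)"
proof -
  obtain \<rho> where \<rho>: "\<rho> \<ge> 1" "\<And>\<gamma>. keys \<gamma> \<subseteq> {1..n} \<Longrightarrow> supK K (zmon \<gamma>) \<le> \<rho> ^ edeg \<gamma>"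
    using supK_zmon_bound by blast
  define \<omega> where "\<omega> = 1 + (\<Sum>i=1..d. supK K (w i))"
  have \<omega>: "\<omega> \<ge> 1" by (auto simp: \<omega>_def intro!: sum_nonneg supK_nonneg K)
  have "supK K (eb \<gamma>) \<le> (\<rho> * \<omega>) ^ (edeg \<gamma> + 1)" if "\<gamma> \<in> Std" for \<gamma>
  proof -
    have "supK K (eb \<gamma>) \<le> \<rho> ^ edeg \<gamma> * \<omega>" using that
    proof (cases rule: Std_cases)
      case 1
      have "supK K (eb \<gamma>) \<le> \<rho> ^ edeg \<gamma> * 1" using \<rho>(2)[OF Std_keys[OF that]] 1 by (simp add: eb_ord)
      also have "\<dots> \<le> \<rho> ^ edeg \<gamma> * \<omega>" using \<omega> \<rho>(1) by (intro mult_left_mono) auto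
      finally show ?thesis .
    next
      case (2 a i)
      have ak: "keys a \<subseteq> {1..n}" using 2(1) mn by (auto intro: order_trans)
      have "supK K (eb \<gamma>) \<le> supK K (zmon a) * supK K (w i)" using 2 supK_mult[OF K] by (simp add: eb_ext)
      also have "\<dots> \<le> \<rho> ^ edeg \<gamma> * \<omega>"
      proof (intro mult_mono supK_nonneg K)
        have "\<rho> ^ edeg a \<le> \<rho> ^ edeg \<gamma>" using \<rho>(1) 2 by (intro power_increasing) auto
        then show "supK K (zmon a) \<le> \<rho> ^ edeg \<gamma>" using \<rho>(2)[OF ak] by simp
        have "supK K (w i) \<le> (\<Sum>i=1..d. supK K (w i))"
          using 2 by (intro member_le_sum) (auto intro: supK_nonneg K)
        then show "supK K (w i) \<le> \<omega>" by (simp add: \<omega>_def)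
      qed (use \<rho>(1) in simp)
      finally show ?thesis .
    qed
    also have "\<dots> \<le> \<rho> ^ (edeg \<gamma> + 1) * \<omega> ^ (edeg \<gamma> + 1)"
      using \<rho>(1) \<omega> by (intro mult_mono power_increasing self_le_power) auto
    finally show ?thesis by (simp add: power_mult_distrib)
  qed
  moreover have "\<rho> * \<omega> \<ge> 1" using mult_mono[of 1 \<rho> 1 \<omega>] \<rho>(1) \<omega> by simp
  ultimately show ?thesis by blast
qed

lemma T_le_supK_eb: "\<gamma> \<in> Std \<Longrightarrow> T \<gamma> \<le> supK K (eb \<gamma>)"
  by (rule T_le[OF adm_eb])

definition en :: "nat \<Rightarrow> expo" where "en = enum_by grevlex Std"

lemma en_bij: "bij_betw en {..<card (StdS s)} (StdS s)"
  unfolding en_def by (rule grevlex_enum_bij)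

lemma en_less:
  assumes "\<delta> \<in> StdS s" "\<gamma> \<in> StdS s" "grevlex \<delta> \<gamma>"
  shows "\<exists>i j. i < j \<and> j < card (StdS s) \<and> en i = \<delta> \<and> en j = \<gamma>"
  unfolding en_def
proof (rule enum_by_initial_segment(2)[where lt = grevlex and S = Std and D = "StdS s", OF _ _ _ finite_StdS _ _ assms])
  show "StdS s \<subseteq> Std" by (auto simp: StdS_def)
  show "y \<in> StdS s" if "x \<in> StdS s" "y \<in> Std" "grevlex y x" for x y
    using that grevlex_edeg[of y x] by (simp add: StdS_def)
qed (use grevlex_trans grevlex_total in auto)

text \<open>
  Exponents below \<open>en k\<close> are those enumerated before it, so the Chebyshev constants of the enumerated
  basis are bounded by the \<open>T (en k)\<close>.
\<close>

lemma vdm_eb_upper: "vdm_sup (\<lambda>k. eb (en k)) K (card (StdS s)) \<le> fact (card (StdS s)) * (\<Prod>\<gamma>\<in>StdS s. T \<gamma>)"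
proof -
  let ?M = "card (StdS s)"
  have enS: "en k \<in> StdS s" if "k < ?M" for k using en_bij[of s] that by (auto simp: bij_betw_def)
  have "tcheb (\<lambda>k. eb (en k)) K k \<le> T (en k)" if k: "k < ?M" for k
  proof (rule le_TI)
    show st: "en k \<in> Std" using enS[OF k] by (simp add: StdS_def)
    fix f assume "adm (en k) f"
    then obtain g where g: "g \<in> cpoly.span (eb ` Below (en k))" "eqV V f (eb (en k) + g)" by (auto simp: adm_def)
    have sub: "Below (en k) \<subseteq> en ` {..<k}"
    proof
      fix \<delta> assume \<delta>: "\<delta> \<in> Below (en k)"
      then have "\<delta> \<in> StdS s" using enS[OF k] grevlex_edeg[of \<delta> "en k"] by (auto simp: Below_def StdS_def)
      obtain i' j' where ij: "i' < j'" "j' < ?M" "en i' = \<delta>" "en j' = en k"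
        using en_less[OF \<open>\<delta> \<in> StdS s\<close> enS[OF k]] \<delta> by (auto simp: Below_def)
      have "j' = k" using ij k en_bij[of s] by (auto simp: bij_betw_def inj_on_def)
      then show "\<delta> \<in> en ` {..<k}" using ij by auto
    qed
    have "g \<in> cpoly.span ((\<lambda>j. eb (en j)) ` {..<k})"
      using g(1) cpoly.span_mono[of "eb ` Below (en k)" "(\<lambda>j. eb (en j)) ` {..<k}"] sub by fastforce
    then obtain c where c: "g = (\<Sum>j<k. cscale (c j) (eb (en j)))"
      using span_image_coeffs[of "{..<k}"] by blast
    have "supK K f = supK K (eb (en k) + (\<Sum>j<k. cscale (c j) (eb (en j))))"
      by (rule supK_cong) (use g(2) KV c in \<open>auto simp: eqV_def\<close>)
    then show "tcheb (\<lambda>k. eb (en k)) K k \<le> supK K f"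
      unfolding tcheb_def using cInf_lower[OF _ bdd_below_tcheb[OF K, of "\<lambda>k. eb (en k)" k]] by auto
  qed
  then have "(\<Prod>k<?M. tcheb (\<lambda>k. eb (en k)) K k) \<le> (\<Prod>k<?M. T (en k))"
    by (intro prod_mono) (auto simp: tcheb_nonneg K)
  also have "\<dots> = (\<Prod>\<gamma>\<in>StdS s. T \<gamma>)" by (rule prod.reindex_bij_betw[OF en_bij])
  finally have "fact ?M * (\<Prod>k<?M. tcheb (\<lambda>k. eb (en k)) K k) \<le> fact ?M * (\<Prod>\<gamma>\<in>StdS s. T \<gamma>)"
    by (intro mult_left_mono) auto
  then show ?thesis using vdm_sup_le_prod_tcheb[OF K, of "\<lambda>k. eb (en k)" ?M] by linarith
qed

end

section \<open>Dimension, growth and zero divisors\<close>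

text \<open>
  The largest such \<open>N\<close> is the value at \<open>s\<close> of the affine Hilbert function of \<open>Z\<close>.  Its growth serves as a
  substitute for dimension.
\<close>

definition indep_on :: "nat \<Rightarrow> (nat \<Rightarrow> complex) set \<Rightarrow> nat \<Rightarrow> nat \<Rightarrow> bool" where
  "indep_on n Z s N \<longleftrightarrow> (\<exists>g. (\<forall>i<N. g i \<in> polys {1..n} \<and> (\<forall>\<gamma>\<in>keys (g i). edeg \<gamma> \<le> s)) \<and>
     (\<forall>c. (\<forall>a\<in>Z. (\<Sum>i<N. c i * peval a (g i)) = 0) \<longrightarrow> (\<forall>i<N. c i = 0)))"

lemma algebraic_set_zeros:
  assumes "algebraic_set n Z" "f \<in> polys {1..n}"
  shows "algebraic_set n {a\<in>Z. peval a f = 0}"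
proof -
  obtain S where "S \<subseteq> polys {1..n}" "Z = {a \<in> affine_pts n. \<forall>f\<in>S. peval a f = 0}"
    using assms(1) by (auto simp: algebraic_set_def)
  then show ?thesis unfolding algebraic_set_def using assms(2)
    by (intro exI[of _ "insert f S"]) auto
qed

text \<open>
  Functions on an irreducible set form an integral domain.
\<close>

lemma irreducible_set_cancel:
  assumes "irreducible_set n Z" "f \<in> polys {1..n}" "g \<in> polys {1..n}"
    and "a \<in> Z" "peval a f \<noteq> 0" and 0: "\<And>b. b \<in> Z \<Longrightarrow> peval b f * peval b g = 0"
  shows "\<forall>b\<in>Z. peval b g = 0"
proof -
  have "algebraic_set n {b\<in>Z. peval b f = 0}" "algebraic_set n {b\<in>Z. peval b g = 0}"
    using assms by (auto intro!: algebraic_set_zeros simp: irreducible_set_def)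
  moreover have "Z = {b\<in>Z. peval b f = 0} \<union> {b\<in>Z. peval b g = 0}" using 0 by auto
  ultimately have "Z = {b\<in>Z. peval b f = 0} \<or> Z = {b\<in>Z. peval b g = 0}"
    using assms(1) unfolding irreducible_set_def by blast
  then show ?thesis using assms(4,5) by blast
qed

lemma keys_power_edeg: "\<gamma> \<in> keys (f ^ k) \<Longrightarrow> edeg \<gamma> \<le> k * pdeg f"
proof (induction k arbitrary: \<gamma>)
  case (Suc k)
  then obtain \<alpha> \<beta> where "\<alpha> \<in> keys f" "\<beta> \<in> keys (f ^ k)" "\<gamma> = \<alpha> + \<beta>"
    using keys_mult[of f "f ^ k"] by auto
  then show ?case using Suc.IH[of \<beta>] pdeg_ge[of \<alpha> f] by simp
qed simp

text \<open>
  Choose \<open>f\<close> vanishing on \<open>Z'\<close> but not on \<open>Z\<close>.  If the \<open>g_i\<close> are independent on \<open>Z'\<close>, the products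
  \<open>f^j g_i\<close>, \<open>j < r\<close>, are independent on \<open>Z\<close>: restriction to \<open>Z'\<close> kills the coefficients with \<open>j = 0\<close>, and \<open>f\<close> can
  be cancelled from the rest.
\<close>

lemma indep_on_powers:
  assumes Z: "irreducible_set n Z" and Z': "algebraic_set n Z'" "Z' \<subset> Z"
  shows "\<exists>\<delta>. \<forall>s N r. indep_on n Z' s N \<longrightarrow> indep_on n Z (s + r * \<delta>) (r * N)"
proof -
  obtain S where S: "S \<subseteq> polys {1..n}" "Z' = {a \<in> affine_pts n. \<forall>f\<in>S. peval a f = 0}"
    using Z'(1) by (auto simp: algebraic_set_def)
  obtain a where a: "a \<in> Z" "a \<notin> Z'" using Z'(2) by blast
  have "Z \<subseteq> affine_pts n" using Z by (auto simp: irreducible_set_def algebraic_set_def)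
  then obtain f where f: "f \<in> polys {1..n}" "peval a f \<noteq> 0" "\<And>b. b \<in> Z' \<Longrightarrow> peval b f = 0"
    using a S by blast
  have "indep_on n Z (s + r * pdeg f) (r * N)" if ind: "indep_on n Z' s N" for s N r
  proof -
    obtain g where g: "\<And>i. i < N \<Longrightarrow> g i \<in> polys {1..n}" "\<And>i \<gamma>. i < N \<Longrightarrow> \<gamma> \<in> keys (g i) \<Longrightarrow> edeg \<gamma> \<le> s"
      and gi: "\<And>c. (\<forall>a\<in>Z'. (\<Sum>i<N. c i * peval a (g i)) = 0) \<Longrightarrow> (\<forall>i<N. c i = 0)"
      using ind unfolding indep_on_def by blast
    have main: "(\<forall>b\<in>Z. (\<Sum>j<r. peval b f ^ j * (\<Sum>i<N. c j i * peval b (g i))) = 0) \<Longrightarrow>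
        \<forall>j<r. \<forall>i<N. c j i = 0" for c :: "nat \<Rightarrow> nat \<Rightarrow> complex"
    proof (induction r arbitrary: c)
      case (Suc r)
      let ?rest = "\<lambda>b. \<Sum>j<r. peval b f ^ j * (\<Sum>i<N. c (Suc j) i * peval b (g i))"
      have split: "(\<Sum>j<Suc r. peval b f ^ j * (\<Sum>i<N. c j i * peval b (g i))) =
          (\<Sum>i<N. c 0 i * peval b (g i)) + peval b f * ?rest b" for b
        by (subst sum.lessThan_Suc_shift) (simp add: sum_distrib_left mult.assoc)
      have "\<forall>b\<in>Z'. (\<Sum>i<N. c 0 i * peval b (g i)) = 0"
      proof
        fix b assume b: "b \<in> Z'"
        then have "b \<in> Z" using Z'(2) by blast
        then show "(\<Sum>i<N. c 0 i * peval b (g i)) = 0"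
          using bspec[OF Suc.prems \<open>b \<in> Z\<close>] unfolding split unfolding f(3)[OF b] by simp
      qed
      then have c0: "\<forall>i<N. c 0 i = 0" by (rule gi)
      let ?G = "\<Sum>j<r. f ^ j * (\<Sum>i<N. cscale (c (Suc j) i) (g i))"
      have "\<forall>b\<in>Z. peval b ?G = 0"
      proof (rule irreducible_set_cancel[OF Z f(1) _ a(1) f(2)])
        show "?G \<in> polys {1..n}"
          by (intro polys_sum polys_mult polys_power polys_cscale) (use f g in auto)
        fix b assume "b \<in> Z"
        then show "peval b f * peval b ?G = 0"
          using bspec[OF Suc.prems \<open>b \<in> Z\<close>] unfolding split using c0 by simp
      qed
      then have "\<forall>j<r. \<forall>i<N. c (Suc j) i = 0" by (intro Suc.IH) simp
      then show ?case using c0 by (metis less_Suc_eq_0_disj)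
    qed simp
    \<comment> \<open>The products \<open>f^j g_i\<close> listed as a single sequence by \<open>k = j N + i\<close>.\<close>
    let ?g = "\<lambda>k. f ^ (k div N) * g (k mod N)"
    show ?thesis unfolding indep_on_def
    proof (intro exI[of _ ?g] conjI allI impI ballI)
      fix k assume k: "k < r * N"
      then have N: "N > 0" by (cases N) auto
      show "?g k \<in> polys {1..n}" using f g N by (intro polys_mult polys_power) auto
      fix \<gamma> assume "\<gamma> \<in> keys (?g k)"
      then obtain \<alpha> \<beta> where ab: "\<alpha> \<in> keys (f ^ (k div N))" "\<beta> \<in> keys (g (k mod N))" "\<gamma> = \<alpha> + \<beta>"
        using keys_mult[of "f ^ (k div N)" "g (k mod N)"] by blast
      have "edeg \<alpha> \<le> (k div N) * pdeg f" by (rule keys_power_edeg[OF ab(1)])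
      also have "\<dots> \<le> r * pdeg f" using k N by (intro mult_right_mono) (auto simp: less_mult_imp_div_less less_imp_le)
      finally show "edeg \<gamma> \<le> s + r * pdeg f" using g(2)[OF _ ab(2)] N ab(3) by simp
    next
      fix c k assume c: "\<forall>a\<in>Z. (\<Sum>i<r * N. c i * peval a (?g i)) = 0" and k: "k < r * N"
      then have N: "N > 0" by (cases N) auto
      have "\<forall>j<r. \<forall>i<N. c (j * N + i) = 0"
      proof (rule main, intro ballI)
        fix b assume b: "b \<in> Z"
        have "(\<Sum>j<r. peval b f ^ j * (\<Sum>i<N. c (j * N + i) * peval b (g i))) =
            (\<Sum>j<r. \<Sum>i<N. c (j * N + i) * peval b (?g (j * N + i)))"
          using N by (intro sum.cong refl) (auto simp: sum_distrib_left intro!: sum.cong)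
        also have "\<dots> = (\<Sum>j<r. \<Sum>k\<in>{j * N..<j * N + N}. c k * peval b (?g k))"
        proof (rule sum.cong[OF refl])
          fix j
          show "(\<Sum>i<N. c (j * N + i) * peval b (?g (j * N + i))) = (\<Sum>k\<in>{j * N..<j * N + N}. c k * peval b (?g k))"
            by (rule sum.reindex_bij_witness[of _ "\<lambda>k. k - j * N" "\<lambda>i. j * N + i"]) auto
        qed
        also have "\<dots> = (\<Sum>k<r * N. c k * peval b (?g k))" by (rule sum.nat_group)
        finally show "(\<Sum>j<r. peval b f ^ j * (\<Sum>i<N. c (j * N + i) * peval b (g i))) = 0" using c b by simp
      qed
      moreover have "k div N < r" "k mod N < N" using k N by (auto simp: less_mult_imp_div_less)
      ultimately have "c (k div N * N + k mod N) = 0" by blast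
      then show "c k = 0" by simp
    qed
  qed
  then show ?thesis by blast
qed

text \<open>
  Take \<open>r = s\<close> in \<open>indep_on_powers\<close>: a proper algebraic subset loses one order of growth.
\<close>

lemma indep_on_dimension_drop:
  assumes Z: "irreducible_set n Z" and Z': "algebraic_set n Z'" "Z' \<subset> Z"
    and C: "\<exists>C. \<forall>s\<ge>1. \<forall>N. indep_on n Z s N \<longrightarrow> N * s ^ Suc j \<le> C * s ^ m"
  shows "\<exists>C. \<forall>s\<ge>1. \<forall>N. indep_on n Z' s N \<longrightarrow> N * s ^ Suc (Suc j) \<le> C * s ^ m"
proof -
  obtain C where C: "\<And>s N. s \<ge> 1 \<Longrightarrow> indep_on n Z s N \<Longrightarrow> N * s ^ Suc j \<le> C * s ^ m" using C by blast
  obtain \<delta> where \<delta>: "\<And>s N r. indep_on n Z' s N \<Longrightarrow> indep_on n Z (s + r * \<delta>) (r * N)"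
    using indep_on_powers[OF Z Z'] by blast
  have "N * s ^ Suc (Suc j) \<le> (C * (1 + \<delta>) ^ m) * s ^ m" if s: "s \<ge> 1" and i: "indep_on n Z' s N" for s N
  proof -
    have "N * s ^ Suc (Suc j) * 1 \<le> N * s ^ Suc (Suc j) * (1 + \<delta>) ^ Suc j"
      by (rule mult_left_mono[OF one_le_power]) simp_all
    also have "\<dots> = (s * N) * (s * (1 + \<delta>)) ^ Suc j" by (simp add: power_mult_distrib)
    also have "\<dots> \<le> C * (s * (1 + \<delta>)) ^ m"
      using C[OF _ \<delta>[OF i, of s]] s by (simp add: distrib_left)
    also have "\<dots> = (C * (1 + \<delta>) ^ m) * s ^ m" by (simp add: power_mult_distrib)
    finally show ?thesis by simp
  qed
  then show ?thesis by blast
qed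

text \<open>
  Zorn's lemma for the irreducible subsets of \<open>V\<close> through \<open>a\<close>.  An upper bound of a chain is the Zariski
  closure of its union, which is again irreducible.
\<close>

lemma ex_irreducible_component:
  assumes V: "algebraic_set n V" and a: "a \<in> V"
  shows "\<exists>Z. irreducible_component n V Z \<and> a \<in> Z"
proof -
  have aff: "V \<subseteq> affine_pts n" using V by (auto simp: algebraic_set_def)
  define F where "F = {Z. irreducible_set n Z \<and> a \<in> Z \<and> Z \<subseteq> V}"
  have single: "irreducible_set n {a}"
    unfolding irreducible_set_def
  proof (intro conjI allI impI)
    show "algebraic_set n {a}"
      unfolding algebraic_set_def
    proof (intro exI[of _ "(\<lambda>i. zvar i - Poly_Mapping.single 0 (a i)) ` {1..n}"] conjI)
      show "(\<lambda>i. zvar i - Poly_Mapping.single 0 (a i)) ` {1..n} \<subseteq> polys {1..n}"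
        by (auto intro!: polys_diff simp: keys_single_subset)
      show "{a} = {b \<in> affine_pts n. \<forall>f\<in>(\<lambda>i. zvar i - Poly_Mapping.single 0 (a i)) ` {1..n}. peval b f = 0}"
      proof
        show "{a} \<subseteq> {b \<in> affine_pts n. \<forall>f\<in>(\<lambda>i. zvar i - Poly_Mapping.single 0 (a i)) ` {1..n}. peval b f = 0}"
          using aff a by auto
        show "{b \<in> affine_pts n. \<forall>f\<in>(\<lambda>i. zvar i - Poly_Mapping.single 0 (a i)) ` {1..n}. peval b f = 0} \<subseteq> {a}"
        proof
          fix b assume b: "b \<in> {b \<in> affine_pts n. \<forall>f\<in>(\<lambda>i. zvar i - Poly_Mapping.single 0 (a i)) ` {1..n}. peval b f = 0}"
          have "b i = a i" for i
          proof (cases "i \<in> {1..n}")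
            case True
            then have "peval b (zvar i - Poly_Mapping.single 0 (a i)) = 0" using b by blast
            then show ?thesis by simp
          next
            case False
            then show ?thesis using b subsetD[OF aff a] by (simp add: affine_pts_def)
          qed
          then show "b \<in> {a}" by auto
        qed
      qed
    qed
    fix Z1 Z2 assume Z: "algebraic_set n Z1 \<and> algebraic_set n Z2 \<and> {a} = Z1 \<union> Z2"
    then have "Z1 \<subseteq> {a}" "Z2 \<subseteq> {a}" "a \<in> Z1 \<or> a \<in> Z2" by blast+
    then show "{a} = Z1 \<or> {a} = Z2" by blast
  qed simp
  have "\<exists>M\<in>F. \<forall>X\<in>F. M \<subseteq> X \<longrightarrow> X = M"
  proof (rule subset_Zorn)
    fix C assume C: "subset.chain F C"
    show "\<exists>U\<in>F. \<forall>X\<in>C. X \<subseteq> U"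
    proof (cases "C = {}")
      case True
      have "{a} \<in> F" using single a by (simp add: F_def)
      then show ?thesis by (rule rev_bexI) (simp add: True)
    next
      case False
      have CF: "C \<subseteq> F" and comp: "\<forall>X\<in>C. \<forall>Y\<in>C. X \<subseteq> Y \<or> Y \<subseteq> X"
        using C by (simp_all add: subset_chain_def)
      define S where "S = {f \<in> polys {1..n}. \<forall>b\<in>\<Union>C. peval b f = 0}"
      define W where "W = {b \<in> affine_pts n. \<forall>f\<in>S. peval b f = 0}"
      have Walg: "algebraic_set n W" 
        unfolding algebraic_set_def W_def by (rule exI[of _ S]) (simp add: S_def)
      have CW: "X \<subseteq> W" if "X \<in> C" for X
        using that CF aff by (auto simp: W_def S_def F_def)
      have min: "W \<subseteq> Y" if Y: "algebraic_set n Y" "\<Union>C \<subseteq> Y" for Y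
      proof -
        obtain S' where S': "S' \<subseteq> polys {1..n}" "Y = {b \<in> affine_pts n. \<forall>f\<in>S'. peval b f = 0}"
          using Y(1) by (auto simp: algebraic_set_def)
        then have "S' \<subseteq> S" using Y(2) by (auto simp: S_def)
        then show ?thesis using S'(2) by (auto simp: W_def)
      qed
      have WV: "W \<subseteq> V" using CF by (intro min[OF V]) (auto simp: F_def)
      have aW: "a \<in> W" using False CF CW by (auto simp: F_def)
      have "irreducible_set n W"
        unfolding irreducible_set_def
      proof (intro conjI allI impI)
        fix Z1 Z2 assume Z: "algebraic_set n Z1 \<and> algebraic_set n Z2 \<and> W = Z1 \<union> Z2"
        have alt: "X \<subseteq> Z1 \<or> X \<subseteq> Z2" if X: "X \<in> C" for X
        proof -
          have irr: "irreducible_set n X" using X CF by (auto simp: F_def)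
          have inter: "algebraic_set n (X \<inter> Y)" if Y: "algebraic_set n Y" for Y
          proof -
            obtain S1 S2 where "S1 \<subseteq> polys {1..n}" "X = {b \<in> affine_pts n. \<forall>f\<in>S1. peval b f = 0}"
              "S2 \<subseteq> polys {1..n}" "Y = {b \<in> affine_pts n. \<forall>f\<in>S2. peval b f = 0}"
              using irr Y by (auto simp: irreducible_set_def algebraic_set_def)
            then show ?thesis unfolding algebraic_set_def by (intro exI[of _ "S1 \<union> S2"]) auto
          qed
          have "X = (X \<inter> Z1) \<union> (X \<inter> Z2)" using CW[OF X] Z by blast
          then have "X = X \<inter> Z1 \<or> X = X \<inter> Z2"
            using irr inter Z unfolding irreducible_set_def by blast
          then show ?thesis by blast
        qed
        have "(\<forall>X\<in>C. X \<subseteq> Z1) \<or> (\<forall>X\<in>C. X \<subseteq> Z2)"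
        proof (rule ccontr)
          assume "\<not> ?thesis"
          then obtain X Y where XY: "X \<in> C" "\<not> X \<subseteq> Z1" "Y \<in> C" "\<not> Y \<subseteq> Z2" by blast
          then have "X \<subseteq> Z2" "Y \<subseteq> Z1" using alt by blast+
          then show False using bspec[OF bspec[OF comp XY(1)] XY(3)] XY(2,4) by blast
        qed
        then have "W \<subseteq> Z1 \<or> W \<subseteq> Z2" using min Z by blast
        then show "W = Z1 \<or> W = Z2" using Z by blast
      qed (use Walg aW in auto)
      then have "W \<in> F" using aW WV by (simp add: F_def)
      then show ?thesis by (rule rev_bexI) (use CW in blast)
    qed
  qed
  then obtain Z where Z: "Z \<in> F" "\<And>X. X \<in> F \<Longrightarrow> Z \<subseteq> X \<Longrightarrow> X = Z" by blast
  have "irreducible_component n V Z"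
    unfolding irreducible_component_def using Z by (auto simp: F_def)
  then show ?thesis using Z(1) by (auto simp: F_def)
qed

text \<open>
  The dimension is a supremum; a chain longer than \<open>m - 1\<close> exists since the supremum exceeds \<open>m - 1\<close>.
\<close>

lemma pure_dim_chain:
  assumes "pure_dim n V m" "irreducible_component n V Z" "m \<ge> 1"
  obtains k C where "k \<ge> m" "\<And>i. i \<le> k \<Longrightarrow> irreducible_set n (C i)" "C k \<subseteq> Z" "\<And>i. i < k \<Longrightarrow> C i \<subset> C (Suc i)"
proof -
  let ?S = "{enat k | k. \<exists>C :: nat \<Rightarrow> (nat \<Rightarrow> complex) set.
     (\<forall>i\<le>k. irreducible_set n (C i) \<and> C i \<subseteq> Z) \<and> (\<forall>i<k. C i \<subset> C (Suc i))}"
  have dim: "Sup ?S = enat m" using assms(1,2) by (simp add: pure_dim_def alg_dim_def)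
  have "\<exists>x\<in>?S. enat (m - 1) < x"
  proof (rule ccontr)
    assume "\<not> ?thesis"
    then have "x \<le> enat (m - 1)" if "x \<in> ?S" for x using that not_less by blast
    then have "Sup ?S \<le> enat (m - 1)" by (rule Sup_least)
    then show False using dim assms(3) by simp
  qed
  then obtain k C where "enat (m - 1) < enat k" 
    "\<forall>i\<le>k. irreducible_set n (C i) \<and> C i \<subseteq> Z" "\<forall>i<k. C i \<subset> C (Suc i)" by blast
  then show thesis using that[of k C] assms(3) by auto
qed

context noether_setup
begin

text \<open>
  The ordinary exponents in \<open>z_m, ..., z_n\<close>.  They are finitely many, and all ordinary exponents arise
  from them by adding exponents in only \<open>m - 1\<close> variables.
\<close>

definition QO :: "expo set" where "QO = {\<nu>\<in>OrdE. low \<nu> = 0}"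

lemma low_0 [simp]: "low 0 = 0" by (simp add: low_eq_0_iff)
lemma low_low [simp]: "low (low \<gamma>) = low \<gamma>" by (auto simp: low_def intro!: poly_mapping_eqI)
lemma upp_low [simp]: "upp (low \<gamma>) = 0" "low (upp \<gamma>) = 0" "upp (upp \<gamma>) = upp \<gamma>"
  by (auto simp: low_def upp_def intro!: poly_mapping_eqI)

lemma finite_QO [simp]: "finite QO" 
proof (rule finite_subset[OF _ finite_StdS[of t]])
  show "QO \<subseteq> StdS t"
  proof
    fix \<nu> assume "\<nu> \<in> QO"
    then show "\<nu> \<in> StdS t" using edeg_low_upp[of \<nu>] by (auto simp: QO_def OrdE_def StdS_def)
  qed
qed

lemma OrdE_decomp: "\<gamma> \<in> OrdE \<Longrightarrow> low \<gamma> + upp \<gamma> = \<gamma> \<and> keys (low \<gamma>) \<subseteq> {1..<m} \<and> upp \<gamma> \<in> QO"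
proof -
  assume g: "\<gamma> \<in> OrdE"
  then have std: "\<gamma> \<in> Std" by (simp add: OrdE_def)
  have "upp \<gamma> \<in> Std" using Std_divisor[of "upp \<gamma>" "low \<gamma>"] std low_upp[of \<gamma>] by (simp add: add.commute)
  then show ?thesis using g low_upp[of \<gamma>] low_keys[OF Std_keys[OF std]] by (simp add: QO_def OrdE_def)
qed

text \<open>
  This is the normal form hypothesis for the first family.
\<close>

lemma OrdE_shift:
  assumes "\<gamma> \<in> OrdE" "keys \<alpha> \<subseteq> {1..<m}" shows "\<alpha> + \<gamma> \<in> OrdE"
proof -
  obtain x where x: "x \<in> Labels" "phi x = \<gamma>" using phi_surj assms(1) by (force simp: OrdE_def)
  obtain \<alpha>' l \<beta> where x': "x = Ord \<alpha>' l \<beta>" "keys \<alpha>' \<subseteq> {1..<m}" "(l, \<beta>) \<in> basisB n m I t"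
  proof (cases x)
    case (Ord \<alpha>' l \<beta>)
    then show ?thesis using that x by (auto simp: Labels_def ord_labels_def ext_labels_def)
  next
    case (Ext \<alpha>' l i)
    then have "phi x \<in> ExtE" using x phi_ext(1)[of \<alpha>' i l] by (auto simp: Labels_def ord_labels_def ext_labels_def)
    then show ?thesis using assms(1) x(2) Ord_Ext by blast
  qed
  have "\<alpha> + \<gamma> = phi (Ord (\<alpha> + \<alpha>') l \<beta>)" using x(2) x'(1) by (simp add: add.assoc)
  also have "\<dots> \<in> OrdE" by (rule phi_ord(1)) (use assms(2) x' in \<open>auto simp: keys_expo_add\<close>)
  finally show ?thesis .
qed

lemma card_Ord_le: "card (OrdE \<inter> StdS s) \<le> card QO * (s + 1) ^ (m - 1)"
proof -
  have "card (OrdE \<inter> StdS s) \<le> card (QO \<times> expos {1..<m} s)"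
  proof (rule card_inj_on_le)
    show "inj_on (\<lambda>\<gamma>. (upp \<gamma>, low \<gamma>)) (OrdE \<inter> StdS s)"
      by (rule inj_onI) (metis low_upp prod.inject)
    show "(\<lambda>\<gamma>. (upp \<gamma>, low \<gamma>)) ` (OrdE \<inter> StdS s) \<subseteq> QO \<times> expos {1..<m} s"
    proof clarify
      fix \<gamma> assume g: "\<gamma> \<in> OrdE" "\<gamma> \<in> StdS s"
      have "edeg (low \<gamma>) \<le> s" using g(2) edeg_low_upp[of \<gamma>] by (simp add: StdS_def)
      then show "upp \<gamma> \<in> QO \<and> low \<gamma> \<in> expos {1..<m} s" using OrdE_decomp[OF g(1)] by (simp add: expos_def)
    qed
  qed simp
  also have "\<dots> \<le> card QO * (s + 1) ^ (m - 1)"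
    unfolding card_cartesian_product using card_expos_le[of "{1..<m}" s] by (intro mult_left_mono) auto
  finally show ?thesis .
qed

text \<open>
  Membership of the function \<open>f\<close> in the \<open>C[z_1, ..., z_m]\<close>-module spanned by the \<open>w_i\<close>.
\<close>

definition inF :: "cpoly \<Rightarrow> bool" where "inF f \<longleftrightarrow> (\<exists>g\<in>cpoly.span (eb ` ExtE). eqV V f g)"

lemma inF_sum: "(\<And>x. x \<in> A \<Longrightarrow> inF (f x)) \<Longrightarrow> inF (\<Sum>x\<in>A. cscale (c x) (f x))"
proof -
  assume "\<And>x. x \<in> A \<Longrightarrow> inF (f x)"
  then have "\<forall>x\<in>A. \<exists>g. g \<in> cpoly.span (eb ` ExtE) \<and> eqV V (f x) g" by (auto simp: inF_def)
  from bchoice[OF this] obtain g where g: "\<forall>x\<in>A. g x \<in> cpoly.span (eb ` ExtE) \<and> eqV V (f x) (g x)" ..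
  then have "(\<Sum>x\<in>A. cscale (c x) (g x)) \<in> cpoly.span (eb ` ExtE)"
    by (intro cpoly.span_sum cpoly.span_scale) auto
  moreover have "eqV V (\<Sum>x\<in>A. cscale (c x) (f x)) (\<Sum>x\<in>A. cscale (c x) (g x))"
    using g by (auto simp: eqV_def intro!: sum.cong)
  ultimately show ?thesis unfolding inF_def by blast
qed

lemma inF_eqV: "eqV V f g \<Longrightarrow> inF g \<Longrightarrow> inF f"
  by (auto simp: inF_def eqV_def)

lemma zmon_eb_ext:
  assumes "\<gamma> \<in> ExtE" "keys b \<subseteq> {1..m}" shows "b + \<gamma> \<in> ExtE" "zmon b * eb \<gamma> = eb (b + \<gamma>)"
proof -
  obtain a i where a: "keys a \<subseteq> {1..m}" "i \<in> {1..d}" "\<gamma> = a + mu i" using assms(1) by (auto simp: ExtE_def)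
  have k: "keys (b + a) \<subseteq> {1..m}" using a assms(2) by (simp add: keys_expo_add)
  have e: "b + \<gamma> = (b + a) + mu i" by (simp add: a add.assoc)
  show "b + \<gamma> \<in> ExtE" unfolding e by (rule ExtI[OF k a(2)])
  show "zmon b * eb \<gamma> = eb (b + \<gamma>)"
    unfolding e eb_ext[OF k a(2)] unfolding a(3) eb_ext[OF a(1,2)]
    by (simp add: mult_single mult.assoc[symmetric])
qed

lemma inF_zmon_mult:
  assumes "inF f" "keys b \<subseteq> {1..m}" shows "inF (zmon b * f)"
proof -
  obtain g where g: "g \<in> cpoly.span (eb ` ExtE)" "eqV V f g" using assms(1) by (auto simp: inF_def)
  have "zmon b * g \<in> cpoly.span (eb ` ExtE)"
    using g(1)
  proof (induction rule: cpoly.span_induct_alt)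
    case (step c x y)
    then obtain \<gamma> where \<gamma>: "\<gamma> \<in> ExtE" "x = eb \<gamma>" by blast
    have "zmon b * (cscale c x + y) = cscale c (eb (b + \<gamma>)) + zmon b * y"
      using zmon_eb_ext(2)[OF \<gamma>(1) assms(2)] by (simp add: \<gamma>(2) distrib_left cscale_mult mult.left_commute)
    then show ?case using step zmon_eb_ext(1)[OF \<gamma>(1) assms(2)]
      by (auto intro!: cpoly.span_add cpoly.span_scale intro: cpoly.span_base)
  qed (simp add: cpoly.span_zero)
  moreover have "eqV V (zmon b * f) (zmon b * g)" using g(2) by (simp add: eqV_def)
  ultimately show ?thesis unfolding inF_def by blast
qed

text \<open>
  Seek \<open>h\<close> with unknown coefficients in degree at most \<open>s\<close>.  The ordinary coordinates of \<open>h z^\<nu>\<close>, \<open>\<nu> \<in> QO\<close>, are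
  \<open>O(s ^ (m - 1))\<close> linear conditions on more than \<open>O(s ^ (m - 1))\<close> unknowns.  Multiplication by monomials in
  \<open>z_1, ..., z_m\<close> preserves \<open>inF\<close>, so finitely many \<open>\<nu>\<close> suffice.
\<close>

lemma conductor_exists:
  obtains h c0 where "h \<in> polys {1..m}" "is_lead h c0" "lookup h c0 = 1"
    "\<And>f. f \<in> polys {1..n} \<Longrightarrow> inF (h * f)"
proof -
  have mk: "m = Suc (m - 1)" using m1 by simp
  obtain s where s: "(card QO * card QO) * (s + t + 1) ^ (m - 1) < card (expos {1..m} s)"
    using expos_outgrow[of "{1..m}" "m - 1" "card QO * card QO" t] m1 by auto
  have sub: "keys y \<subseteq> {1..n}" if "keys y \<subseteq> {1..m}" for y :: expo using that mn by (auto intro: order_trans)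
  have QOd: "edeg \<nu> \<le> t" "\<nu> \<in> Std" if "\<nu> \<in> QO" for \<nu>
    using that edeg_low_upp[of \<nu>] by (auto simp: QO_def OrdE_def)
  have "\<exists>c. coords (StdS (s + t)) (zmon (a + \<nu>)) c" if "a \<in> expos {1..m} s" "\<nu> \<in> QO" for a \<nu>
    by (rule ex_coords_StdS)
       (use that QOd[of \<nu>] Std_keys[of \<nu>] sub[of a] in \<open>auto simp: expos_def keys_expo_add intro!: add_mono\<close>)
  then obtain cc where cc: "\<And>a \<nu>. a \<in> expos {1..m} s \<Longrightarrow> \<nu> \<in> QO \<Longrightarrow> coords (StdS (s + t)) (zmon (a + \<nu>)) (cc a \<nu>)"
    by metis
  let ?B = "QO \<times> (OrdE \<inter> StdS (s + t))"
  have "card ?B < card (expos {1..m} s)"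
  proof -
    have "card ?B \<le> card QO * (card QO * (s + t + 1) ^ (m - 1))"
      unfolding card_cartesian_product by (rule mult_left_mono[OF card_Ord_le]) simp
    also have "\<dots> = card QO * card QO * (s + t + 1) ^ (m - 1)" by (rule mult.assoc[symmetric])
    also note s
    finally show ?thesis .
  qed
  then obtain c where c: "\<exists>a\<in>expos {1..m} s. c a \<noteq> 0"
      "\<forall>b\<in>?B. (\<Sum>a\<in>expos {1..m} s. c a * (case b of (\<nu>, \<delta>) \<Rightarrow> cc a \<nu> \<delta>)) = 0"
    using nontrivial_linear_relation[of ?B "expos {1..m} s" "\<lambda>a (\<nu>, \<delta>). cc a \<nu> \<delta>"] by auto
  define h0 where "h0 = (\<Sum>a\<in>expos {1..m} s. cscale (c a) (zmon a))"
  have lh0: "lookup h0 a = c a" if "a \<in> expos {1..m} s" for a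
    using that by (simp add: h0_def lookup_sum lookup_single when_def if_distrib[of "\<lambda>x. _ * x"] cong: if_cong)
  then have h0nz: "h0 \<noteq> 0" using c(1) by (metis lookup_zero)
  have h0p: "h0 \<in> polys {1..m}" by (auto simp: h0_def expos_def intro!: polys_sum polys_cscale)
  have F_QO: "inF (h0 * zmon \<nu>)" if \<nu>: "\<nu> \<in> QO" for \<nu>
  proof -
    define x where "x \<delta> = (\<Sum>a\<in>expos {1..m} s. c a * cc a \<nu> \<delta>)" for \<delta>
    have x0: "x \<delta> = 0" if "\<delta> \<in> OrdE \<inter> StdS (s + t)" for \<delta>
      using c(2) \<nu> that by (auto simp: x_def)
    have "eqV V (h0 * zmon \<nu>) (\<Sum>\<delta>\<in>StdS (s + t). cscale (x \<delta>) (eb \<delta>))"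
      unfolding eqV_def
    proof
      fix z assume z: "z \<in> V"
      have "peval z (h0 * zmon \<nu>) = (\<Sum>a\<in>expos {1..m} s. c a * peval z (zmon (a + \<nu>)))"
        by (simp add: h0_def sum_distrib_right mval_add mult.assoc)
      also have "\<dots> = (\<Sum>a\<in>expos {1..m} s. c a * (\<Sum>\<delta>\<in>StdS (s + t). cc a \<nu> \<delta> * peval z (eb \<delta>)))"
        using cc[OF _ \<nu>] z by (intro sum.cong refl) (simp add: coords_def)
      also have "\<dots> = (\<Sum>\<delta>\<in>StdS (s + t). x \<delta> * peval z (eb \<delta>))"
        unfolding sum_distrib_left by (subst sum.swap) (simp add: x_def sum_distrib_right mult.assoc)
      finally show "peval z (h0 * zmon \<nu>) = peval z (\<Sum>\<delta>\<in>StdS (s + t). cscale (x \<delta>) (eb \<delta>))" by simp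
    qed
    moreover have "(\<Sum>\<delta>\<in>StdS (s + t). cscale (x \<delta>) (eb \<delta>)) \<in> cpoly.span (eb ` ExtE)"
    proof (rule cpoly.span_sum)
      fix \<delta> assume d: "\<delta> \<in> StdS (s + t)"
      show "cscale (x \<delta>) (eb \<delta>) \<in> cpoly.span (eb ` ExtE)"
      proof (cases "\<delta> \<in> OrdE")
        case True
        then show ?thesis using x0[of \<delta>] d by (simp add: cpoly.span_zero)
      next
        case False
        then have "\<delta> \<in> ExtE" using d Std_Ord_Ext by (auto simp: StdS_def)
        then show ?thesis by (intro cpoly.span_scale cpoly.span_base imageI)
      qed
    qed
    ultimately show ?thesis unfolding inF_def by blast
  qed
  have F_eb: "inF (h0 * eb \<gamma>)" if \<gamma>: "\<gamma> \<in> Std" for \<gamma>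
  proof (cases "\<gamma> \<in> OrdE")
    case True
    have "h0 * eb \<gamma> = zmon (low \<gamma>) * (h0 * zmon (upp \<gamma>))"
      using low_upp[of \<gamma>] by (simp add: eb_ord[OF True] mult.left_commute mult_single)
    moreover have "keys (low \<gamma>) \<subseteq> {1..m}" using OrdE_decomp[OF True] by auto
    then have "inF (zmon (low \<gamma>) * (h0 * zmon (upp \<gamma>)))"
      by (intro inF_zmon_mult F_QO) (use OrdE_decomp[OF True] in auto)
    ultimately show ?thesis by (simp only:)
  next
    case False
    then have e: "\<gamma> \<in> ExtE" using \<gamma> Std_Ord_Ext by blast
    have "inF (eb (a + \<gamma>))" if "a \<in> expos {1..m} s" for a
      unfolding inF_def using zmon_eb_ext(1)[OF e, of a] that
      by (intro bexI[of _ "eb (a + \<gamma>)"] cpoly.span_base imageI) (auto simp: eqV_def expos_def)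
    then have "inF (\<Sum>a\<in>expos {1..m} s. cscale (c a) (eb (a + \<gamma>)))" by (rule inF_sum)
    moreover have "h0 * eb \<gamma> = (\<Sum>a\<in>expos {1..m} s. cscale (c a) (eb (a + \<gamma>)))"
      unfolding h0_def sum_distrib_right
      by (rule sum.cong) (auto simp: zmon_eb_ext(2)[OF e, symmetric] expos_def cscale_mult mult.assoc)
    ultimately show ?thesis by simp
  qed
  have F_all: "inF (h0 * f)" if f: "f \<in> polys {1..n}" for f
  proof -
    obtain x where x: "coords (StdS (pdeg f)) f x" using ex_coords_StdS[OF f] pdeg_ge by blast
    have "inF (\<Sum>\<delta>\<in>StdS (pdeg f). cscale (x \<delta>) (h0 * eb \<delta>))"
      by (rule inF_sum) (auto intro: F_eb simp: StdS_def)
    moreover have "eqV V (h0 * f) (\<Sum>\<delta>\<in>StdS (pdeg f). cscale (x \<delta>) (h0 * eb \<delta>))"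
      using x by (simp add: eqV_def coords_def sum_distrib_left mult.left_commute)
    ultimately show ?thesis using inF_eqV by blast
  qed
  define \<gamma>0 where "\<gamma>0 = lead_expo h0"
  have l: "is_lead h0 \<gamma>0" unfolding \<gamma>0_def by (rule is_lead_expo[OF h0nz])
  then have nz: "lookup h0 \<gamma>0 \<noteq> 0" by (auto simp: is_lead_def in_keys_iff)
  let ?h = "cscale (inverse (lookup h0 \<gamma>0)) h0"
  show thesis
  proof (rule that[of ?h \<gamma>0])
    show "?h \<in> polys {1..m}" using h0p by (rule polys_cscale)
    show "is_lead ?h \<gamma>0" using l nz by (simp add: is_lead_def keys_cscale)
    show "lookup ?h \<gamma>0 = 1" using nz by simp
    fix f assume "f \<in> polys {1..n}"
    then have "inF (\<Sum>_\<in>{()}. cscale (inverse (lookup h0 \<gamma>0)) (h0 * f))" by (intro inF_sum F_all)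
    then show "inF (?h * f)" by (simp add: cscale_mult mult.assoc)
  qed
qed

text \<open>
  On the zero set of \<open>g\<close> the leading monomial of \<open>g\<close> is a combination of smaller ones, so the basis elements
  \<open>z^a w_i\<close> with \<open>a\<close> not divisible by it suffice.  Such \<open>a\<close> have a bounded exponent in some variable, which
  leaves \<open>O(s ^ (m - 1))\<close> of them.
\<close>

lemma hypersurface_growth:
  assumes g: "g \<in> polys {1..m}" "g \<noteq> 0" and Z: "Z \<subseteq> V" "\<And>a. a \<in> Z \<Longrightarrow> peval a g = 0"
  shows "\<exists>C. \<forall>s\<ge>1. \<forall>N. indep_on n Z s N \<longrightarrow> N * s ^ Suc 0 \<le> C * s ^ m"
proof -
  define c0 where "c0 = lead_expo g"
  have l: "is_lead g c0" unfolding c0_def by (rule is_lead_expo[OF g(2)])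
  then have c0k: "keys c0 \<subseteq> {1..m}" and lc: "lookup g c0 \<noteq> 0"
    using g(1) by (auto simp: is_lead_def polys_def in_keys_iff)
  \<comment> \<open>\<open>X s\<close>: exponents not divisible by the leading exponent of \<open>g\<close>; \<open>GS s\<close>: indices of the basis elements
      that still span on \<open>Z\<close>.\<close>
  define X where "X s = {a\<in>expos {1..m} s. \<exists>j\<in>{1..m}. lookup a j < lookup c0 j}" for s
  define GS where "GS s = (OrdE \<inter> StdS s) \<union> (\<lambda>(a, i). a + mu i) ` (X s \<times> {1..d})" for s
  define C where "C = card QO + edeg c0 * d"
  have cardX: "card (X s) \<le> edeg c0 * (s + 1) ^ (m - 1)" for s
  proof -
    have cj: "card {a\<in>expos {1..m} s. lookup a j < lookup c0 j} \<le> lookup c0 j * (s + 1) ^ (m - 1)" 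
      if j: "j \<in> {1..m}" for j
    proof -
      have "card {a\<in>expos {1..m} s. lookup a j < lookup c0 j} \<le> card ({..<lookup c0 j} \<times> expos ({1..m} - {j}) s)"
      proof (rule card_inj_on_le)
        show "inj_on (\<lambda>a. (lookup a j, restr (\<lambda>i. i \<noteq> j) a)) {a\<in>expos {1..m} s. lookup a j < lookup c0 j}"
        proof (rule inj_onI, intro poly_mapping_eqI)
          fix a b i assume "(lookup a j, restr (\<lambda>i. i \<noteq> j) a) = (lookup b j, restr (\<lambda>i. i \<noteq> j) b)"
          then show "lookup a i = lookup b i"
            by (cases "i = j") (auto dest: arg_cong[of _ _ "\<lambda>f. lookup f i"])
        qed
        show "(\<lambda>a. (lookup a j, restr (\<lambda>i. i \<noteq> j) a)) ` {a\<in>expos {1..m} s. lookup a j < lookup c0 j}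
            \<subseteq> {..<lookup c0 j} \<times> expos ({1..m} - {j}) s"
        proof clarify
          fix a assume a: "a \<in> expos {1..m} s" "lookup a j < lookup c0 j"
          have "edeg (restr (\<lambda>i. i \<noteq> j) a) \<le> s" using edeg_restr_split[of "\<lambda>i. i \<noteq> j" a] a by (simp add: expos_def)
          then show "lookup a j \<in> {..<lookup c0 j} \<and> restr (\<lambda>i. i \<noteq> j) a \<in> expos ({1..m} - {j}) s"
            using a by (auto simp: expos_def)
        qed
      qed simp
      also have "\<dots> \<le> lookup c0 j * (s + 1) ^ (m - 1)"
        unfolding card_cartesian_product using card_expos_le[of "{1..m} - {j}" s] j
        by (intro mult_mono) auto
      finally show ?thesis .
    qed
    have "X s = (\<Union>j\<in>{1..m}. {a\<in>expos {1..m} s. lookup a j < lookup c0 j})" by (auto simp: X_def)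
    then have "card (X s) \<le> (\<Sum>j\<in>{1..m}. card {a\<in>expos {1..m} s. lookup a j < lookup c0 j})"
      using card_UN_le[of "{1..m}" "\<lambda>j. {a\<in>expos {1..m} s. lookup a j < lookup c0 j}"] by simp
    also have "\<dots> \<le> (\<Sum>j\<in>{1..m}. lookup c0 j * (s + 1) ^ (m - 1))" by (rule sum_mono[OF cj])
    also have "\<dots> = edeg c0 * (s + 1) ^ (m - 1)"
      by (simp add: edeg_superset[OF _ c0k] sum_distrib_right)
    finally show ?thesis .
  qed
  have finX: "finite (X s)" for s unfolding X_def by (rule finite_subset[OF _ finite_expos[of "{1..m}" s]]) auto
  have finGS: "finite (GS s)" for s unfolding GS_def using finX by auto
  have cardGS: "card (GS s) \<le> C * (s + 1) ^ (m - 1)" for s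
  proof -
    have "card (GS s) \<le> card (OrdE \<inter> StdS s) + card ((\<lambda>(a, i). a + mu i) ` (X s \<times> {1..d}))"
      unfolding GS_def by (rule card_Un_le)
    also have "\<dots> \<le> card QO * (s + 1) ^ (m - 1) + card (X s \<times> {1..d})"
      by (intro add_mono card_Ord_le card_image_le) (use finX in auto)
    also have "\<dots> \<le> card QO * (s + 1) ^ (m - 1) + edeg c0 * (s + 1) ^ (m - 1) * d"
      using cardX[of s] by (simp add: card_cartesian_product)
    finally show ?thesis by (simp add: C_def algebra_simps)
  qed
  define onZ where "onZ s f \<longleftrightarrow> (\<exists>c. \<forall>a\<in>Z. peval a f = (\<Sum>\<delta>\<in>GS s. c \<delta> * peval a (eb \<delta>)))" for s f
  have onZ_sum: "onZ s (\<Sum>x\<in>A. cscale (k x) (f x))" if "\<And>x. x \<in> A \<Longrightarrow> onZ s (f x)" for s A k and f :: "expo \<Rightarrow> cpoly"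
  proof -
    have "\<forall>x\<in>A. \<exists>c. \<forall>a\<in>Z. peval a (f x) = (\<Sum>\<delta>\<in>GS s. c \<delta> * peval a (eb \<delta>))"
      using that unfolding onZ_def by blast
    from bchoice[OF this] obtain c where c: "\<forall>x\<in>A. \<forall>a\<in>Z. peval a (f x) = (\<Sum>\<delta>\<in>GS s. c x \<delta> * peval a (eb \<delta>))" ..
    show ?thesis unfolding onZ_def
    proof (intro exI[of _ "\<lambda>\<delta>. \<Sum>x\<in>A. k x * c x \<delta>"] ballI)
      fix a assume a: "a \<in> Z"
      have "peval a (\<Sum>x\<in>A. cscale (k x) (f x)) = (\<Sum>x\<in>A. k x * (\<Sum>\<delta>\<in>GS s. c x \<delta> * peval a (eb \<delta>)))"
        using c a by simp
      also have "\<dots> = (\<Sum>\<delta>\<in>GS s. (\<Sum>x\<in>A. k x * c x \<delta>) * peval a (eb \<delta>))"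
        unfolding sum_distrib_left sum_distrib_right by (subst sum.swap) (simp add: mult.assoc)
      finally show "peval a (\<Sum>x\<in>A. cscale (k x) (f x)) = \<dots>" .
    qed
  qed
  have onZ_GS: "onZ s (eb \<delta>)" if "\<delta> \<in> GS s" for s \<delta>
    unfolding onZ_def by (rule exI[of _ "\<lambda>\<epsilon>. if \<epsilon> = \<delta> then 1 else 0"])
      (use that finGS in \<open>simp add: if_distrib[of "\<lambda>x. x * _"] sum.delta cong: if_cong\<close>)
  have onZ_eb: "\<delta> \<in> StdS s \<Longrightarrow> onZ s (eb \<delta>)" if "keys \<delta> \<subseteq> {1..n}" for s \<delta>
    using finite_atLeastAtMost[of 1 n] that
  proof (induction \<delta> rule: grevlex_induct)
    case (less \<delta>)
    show ?case
    proof (cases "\<delta> \<in> GS s")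
      case True then show ?thesis by (rule onZ_GS)
    next
      case False
      have "\<delta> \<in> Std" using less.prems by (simp add: StdS_def)
      then obtain a i where a: "keys a \<subseteq> {1..m}" "i \<in> {1..d}" "\<delta> = a + mu i"
      proof (cases rule: Std_cases)
        case 1
        then show ?thesis using False less.prems by (simp add: GS_def)
      qed blast
      have "edeg a \<le> s" using less.prems a by (simp add: StdS_def)
      then have "a \<notin> X s" using False a by (auto simp: GS_def)
      have ge: "lookup c0 j \<le> lookup a j" for j
      proof (cases "j \<in> {1..m}")
        case True
        then show ?thesis using a(1) \<open>edeg a \<le> s\<close> \<open>a \<notin> X s\<close> by (auto simp: X_def expos_def not_less)
      next
        case False
        then have "j \<notin> keys c0" using c0k by blast
        then show ?thesis by (simp add: in_keys_iff)
      qed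
      define b where "b = a - c0"
      have ab: "a = b + c0" using ge by (intro poly_mapping_eqI) (simp add: b_def lookup_add lookup_minus)
      have bk: "keys b \<subseteq> {1..m}" using a(1) ab by (simp add: keys_expo_add)
      let ?K = "keys g - {c0}"
      have kk: "keys (b + e) \<subseteq> {1..m}" if "e \<in> keys g" for e
        using bk that g(1) by (auto simp: keys_expo_add polys_def)
      have "onZ s (\<Sum>e\<in>?K. cscale (- lookup g e / lookup g c0) (eb (b + e + mu i)))"
      proof (rule onZ_sum)
        fix e assume e: "e \<in> ?K"
        then have "grevlex e c0" using l by (auto simp: is_lead_def)
        then have gr: "grevlex (b + e + mu i) \<delta>" by (simp add: a ab grevlex_add grevlex_add_left)
        have std: "b + e + mu i \<in> Std" using ext_Std[OF kk a(2)] e by blast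
        then have "b + e + mu i \<in> StdS s" using less.prems grevlex_edeg[OF gr] by (simp add: StdS_def)
        then show "onZ s (eb (b + e + mu i))" by (rule less.IH[OF Std_keys[OF std] gr])
      qed
      moreover have "peval z (eb \<delta>) = peval z (\<Sum>e\<in>?K. cscale (- lookup g e / lookup g c0) (eb (b + e + mu i)))"
        if z: "z \<in> Z" for z
      proof -
        have "(\<Sum>e\<in>keys g. lookup g e * mval z e) = 0" using Z(2)[OF z] by (simp add: peval_mval)
        then have "lookup g c0 * mval z c0 = - (\<Sum>e\<in>?K. lookup g e * mval z e)"
          using sum.remove[of "keys g" c0 "\<lambda>e. lookup g e * mval z e"] l by (simp add: is_lead_def add_eq_0_iff)
        then have mc: "mval z c0 = - (\<Sum>e\<in>?K. lookup g e * mval z e) / lookup g c0"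
          using lc by (simp add: field_simps)
        have "peval z (eb \<delta>) = mval z b * mval z c0 * peval z (w i)"
          using a bk c0k by (simp add: a(3) eb_ext[OF a(1,2)]) (simp add: ab mval_add)
        also have "\<dots> = (\<Sum>e\<in>?K. - lookup g e / lookup g c0 * (mval z (b + e) * peval z (w i)))"
          unfolding mc by (simp add: mval_add sum_distrib_left sum_distrib_right sum_divide_distrib sum_negf[symmetric] algebra_simps)
        also have "\<dots> = peval z (\<Sum>e\<in>?K. cscale (- lookup g e / lookup g c0) (eb (b + e + mu i)))"
          using kk a(2) by (auto simp: eb_ext intro!: sum.cong)
        finally show ?thesis .
      qed
      ultimately show ?thesis unfolding onZ_def by auto
    qed
  qed
  have bound: "N \<le> card (GS s)" if ind: "indep_on n Z s N" for s N
  proof (rule ccontr)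
    assume "\<not> N \<le> card (GS s)"
    obtain f where f: "\<And>i. i < N \<Longrightarrow> f i \<in> polys {1..n}" "\<And>i \<gamma>. i < N \<Longrightarrow> \<gamma> \<in> keys (f i) \<Longrightarrow> edeg \<gamma> \<le> s"
      and fi: "\<And>c. (\<forall>a\<in>Z. (\<Sum>i<N. c i * peval a (f i)) = 0) \<Longrightarrow> (\<forall>i<N. c i = 0)"
      using ind unfolding indep_on_def by auto
    have "\<exists>c. \<forall>a\<in>Z. peval a (f i) = (\<Sum>\<delta>\<in>GS s. c \<delta> * peval a (eb \<delta>))" if i: "i < N" for i
    proof -
      obtain x where x: "coords (StdS s) (f i) x" using ex_coords_StdS[OF f(1)[OF i] f(2)[OF i]] by blast
      have "onZ s (\<Sum>\<delta>\<in>StdS s. cscale (x \<delta>) (eb \<delta>))"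
        by (rule onZ_sum) (rule onZ_eb[OF Std_keys], simp_all add: StdS_def)
      then obtain c where c: "\<forall>a\<in>Z. peval a (\<Sum>\<delta>\<in>StdS s. cscale (x \<delta>) (eb \<delta>)) = (\<Sum>\<delta>\<in>GS s. c \<delta> * peval a (eb \<delta>))"
        unfolding onZ_def ..
      have "peval a (f i) = (\<Sum>\<delta>\<in>GS s. c \<delta> * peval a (eb \<delta>))" if a: "a \<in> Z" for a
        using bspec[OF c a] bspec[OF x[unfolded coords_def] subsetD[OF Z(1) a]] by simp
      then show ?thesis by blast
    qed
    then have "\<forall>i\<in>{..<N}. \<exists>c. \<forall>a\<in>Z. peval a (f i) = (\<Sum>\<delta>\<in>GS s. c \<delta> * peval a (eb \<delta>))" by simp
    from bchoice[OF this] obtain y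
      where y: "\<forall>i\<in>{..<N}. \<forall>a\<in>Z. peval a (f i) = (\<Sum>\<delta>\<in>GS s. y i \<delta> * peval a (eb \<delta>))" ..
    obtain c where c: "\<exists>i\<in>{..<N}. c i \<noteq> 0" "\<forall>\<delta>\<in>GS s. (\<Sum>i<N. c i * y i \<delta>) = 0"
      using nontrivial_linear_relation[OF finGS[of s], of "{..<N}" y] \<open>\<not> N \<le> card (GS s)\<close> by auto
    have "\<forall>a\<in>Z. (\<Sum>i<N. c i * peval a (f i)) = 0"
    proof
      fix a assume a: "a \<in> Z"
      have "(\<Sum>i<N. c i * peval a (f i)) = (\<Sum>i<N. c i * (\<Sum>\<delta>\<in>GS s. y i \<delta> * peval a (eb \<delta>)))"
        using y a by (intro sum.cong) auto
      also have "\<dots> = (\<Sum>\<delta>\<in>GS s. (\<Sum>i<N. c i * y i \<delta>) * peval a (eb \<delta>))"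
        unfolding sum_distrib_left sum_distrib_right by (subst sum.swap) (simp add: mult.assoc)
      also have "\<dots> = 0" using c(2) by simp
      finally show "(\<Sum>i<N. c i * peval a (f i)) = 0" .
    qed
    then show False using fi[of c] c(1) by auto
  qed
  have "N * s ^ Suc 0 \<le> (C * 2 ^ (m - 1)) * s ^ m" if s: "s \<ge> 1" and "indep_on n Z s N" for s N
  proof -
    have "N \<le> C * (s + 1) ^ (m - 1)" using bound[OF that(2)] cardGS[of s] by simp
    also have "\<dots> \<le> C * (2 * s) ^ (m - 1)" using s by (intro mult_left_mono power_mono) auto
    finally have "N * s \<le> C * (2 * s) ^ (m - 1) * s" by (rule mult_right_mono) simp
    also have "\<dots> = (C * 2 ^ (m - 1)) * (s ^ (m - 1) * s)" by (simp add: power_mult_distrib)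
    also have "s ^ (m - 1) * s = s ^ m" using m1 by (cases m) (auto simp: One_nat_def)
    finally show ?thesis by simp
  qed
  then show ?thesis by blast
qed

text \<open>
  If \<open>f\<close> does not vanish at some point of \<open>V\<close>, then \<open>g\<close> vanishes on an irreducible component through it.
  The function spaces on this component have growth at most \<open>s ^ (m - 1)\<close>, and one order less for each step down
  a chain of \<open>m\<close> or more proper inclusions of irreducible subsets; at the bottom no room is left even for a constant.
\<close>

lemma nonzero_divisor:
  assumes V: "algebraic_set n V" "pure_dim n V m"
    and g: "g \<in> polys {1..m}" "g \<noteq> 0" and f: "f \<in> polys {1..n}" and gf: "eqV V (g * f) 0"
  shows "eqV V f 0"
proof (rule ccontr)
  assume "\<not> eqV V f 0"
  then obtain a where a: "a \<in> V" "peval a f \<noteq> 0" by (auto simp: eqV_def)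
  obtain Z where Z: "irreducible_component n V Z" "a \<in> Z" using ex_irreducible_component[OF V(1) a(1)] by blast
  have Zirr: "irreducible_set n Z" and ZV: "Z \<subseteq> V" using Z(1) by (auto simp: irreducible_component_def)
  have gn: "g \<in> polys {1..n}" by (rule polys_mono[OF _ g(1)]) (use mn in auto)
  have g0: "\<forall>b\<in>Z. peval b g = 0"
    by (rule irreducible_set_cancel[OF Zirr f gn Z(2) a(2)]) (use gf ZV in \<open>auto simp: eqV_def\<close>)
  obtain k C where C: "k \<ge> m" "\<And>i. i \<le> k \<Longrightarrow> irreducible_set n (C i)" "C k \<subseteq> Z" "\<And>i. i < k \<Longrightarrow> C i \<subset> C (Suc i)"
    using pure_dim_chain[OF V(2) Z(1) m1] by metis
  have "j \<le> k \<Longrightarrow> \<exists>B. \<forall>s\<ge>1. \<forall>N. indep_on n (C (k - j)) s N \<longrightarrow> N * s ^ Suc j \<le> B * s ^ m" for j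
  proof (induction j)
    case 0
    show ?case by (rule hypersurface_growth[OF g]) (use C(3) ZV g0 in auto)
  next
    case (Suc j)
    show ?case
    proof (rule indep_on_dimension_drop)
      show "irreducible_set n (C (k - j))" by (rule C(2)) simp
      show "algebraic_set n (C (k - Suc j))" using C(2)[of "k - Suc j"] by (simp add: irreducible_set_def)
      show "C (k - Suc j) \<subset> C (k - j)" using C(4)[of "k - Suc j"] Suc.prems by (simp add: Suc_diff_Suc)
    qed (use Suc in simp)
  qed
  from this[of k] obtain B where B: "\<And>s N. s \<ge> 1 \<Longrightarrow> indep_on n (C 0) s N \<Longrightarrow> N * s ^ Suc k \<le> B * s ^ m" by auto
  obtain b where b: "b \<in> C 0" using C(2)[of 0] by (auto simp: irreducible_set_def)
  have "indep_on n (C 0) s 1" for s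
    unfolding indep_on_def using b by (intro exI[of _ "\<lambda>_. 1"]) (auto simp: One_nat_def)
  then have "1 * (B + 1) ^ Suc k \<le> B * (B + 1) ^ m" by (intro B) auto
  then have "(B + 1) ^ Suc k \<le> B * (B + 1) ^ m" by (simp only: mult_1)
  moreover have "(B + 1) ^ Suc m \<le> (B + 1) ^ Suc k" using C(1) by (intro power_increasing) auto
  ultimately have "(B + 1) ^ Suc m \<le> B * (B + 1) ^ m" by (rule order_trans[rotated])
  then have "(B + 1) * (B + 1) ^ m \<le> B * (B + 1) ^ m" by (simp only: power_Suc)
  then show False by simp
qed

end

section \<open>Leading exponents of multiples of the conductor\<close>

text \<open>
  Dickson's lemma for tuples read off by \<open>q\<close>.  In the induction step, tuples whose new
  coordinate is at least that of all finitely many representatives found for the old coordinates need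
  no new representative, and each of the finitely many smaller values of the new coordinate is
  handled by the induction hypothesis.
\<close>

lemma dickson:
  fixes q :: "'b \<Rightarrow> nat \<Rightarrow> nat"
  assumes "finite A"
  shows "\<exists>F\<subseteq>U. finite F \<and> (\<forall>u\<in>U. \<exists>v\<in>F. \<forall>j\<in>A. q v j \<le> q u j)"
  using assms
proof (induction A arbitrary: U rule: finite_induct)
  case empty
  show ?case
  proof (cases "U = {}")
    case False
    then obtain u where "u \<in> U" by blast
    then show ?thesis by (intro exI[of _ "{u}"]) auto
  qed auto
next
  case (insert x A)
  obtain F0 where F0: "F0 \<subseteq> U" "finite F0" "\<forall>u\<in>U. \<exists>v\<in>F0. \<forall>j\<in>A. q v j \<le> q u j"
    using insert.IH[of U] by blast
  define N where "N = Max (insert 0 ((\<lambda>v. q v x) ` F0))"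
  have N: "q v x \<le> N" if "v \<in> F0" for v unfolding N_def by (rule Max_ge) (use that F0(2) in auto)
  have "\<forall>k. \<exists>F. F \<subseteq> {u\<in>U. q u x = k} \<and> finite F \<and> (\<forall>u\<in>{u\<in>U. q u x = k}. \<exists>v\<in>F. \<forall>j\<in>A. q v j \<le> q u j)"
    using insert.IH by blast
  from choice[OF this] obtain F where F: "\<forall>k. F k \<subseteq> {u\<in>U. q u x = k} \<and> finite (F k) \<and>
      (\<forall>u\<in>{u\<in>U. q u x = k}. \<exists>v\<in>F k. \<forall>j\<in>A. q v j \<le> q u j)" ..
  show ?case
  proof (intro exI[of _ "F0 \<union> (\<Union>k<N. F k)"] conjI ballI)
    show "F0 \<union> (\<Union>k<N. F k) \<subseteq> U" using F0(1) F by auto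
    show "finite (F0 \<union> (\<Union>k<N. F k))" using F0(2) F by auto
    fix u assume u: "u \<in> U"
    show "\<exists>v\<in>F0 \<union> (\<Union>k<N. F k). \<forall>j\<in>insert x A. q v j \<le> q u j"
    proof (cases "N \<le> q u x")
      case True
      obtain v where v: "v \<in> F0" "\<forall>j\<in>A. q v j \<le> q u j" using F0(3) u by blast
      moreover have "q v x \<le> q u x" using N[OF v(1)] True by simp
      ultimately show ?thesis by (intro bexI[of _ v]) auto
    next
      case False
      obtain v where v: "v \<in> F (q u x)" "\<forall>j\<in>A. q v j \<le> q u j" using F[rule_format, of "q u x"] u by blast
      moreover have "q v x = q u x" using v(1) F[rule_format, of "q u x"] by blast
      ultimately show ?thesis using False by (intro bexI[of _ v]) auto
    qed
  qed
qed

context noether_setup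
begin

text \<open>
  A polynomial in standard monomials that vanishes on \<open>V\<close> is zero, so independence of \<open>eb\<close> applies.
\<close>

lemma leading_coefficient_zero:
  assumes "\<theta> \<in> Std" "g \<in> cpoly.span (eb ` (Std - {\<theta>}))" "eqV V (cscale \<kappa> (eb \<theta>) + g) 0"
  shows "\<kappa> = 0"
proof (rule ccontr)
  assume k: "\<kappa> \<noteq> 0"
  let ?S = "{f. keys f \<subseteq> Std}"
  have sub: "cpoly.subspace ?S"
  proof (rule cpoly.subspaceI)
    show "0 \<in> ?S" by simp
    show "f + g \<in> ?S" if "f \<in> ?S" "g \<in> ?S" for f g
      using subset_trans[OF keys_add[of f g]] that by simp
    show "cscale c f \<in> ?S" if "f \<in> ?S" for c f
      using that by (simp add: keys_cscale)
  qed
  have "g \<in> ?S"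
    by (rule subsetD[OF cpoly.span_minimal[OF _ sub] assms(2)]) (use eb_Std in \<open>simp add: image_subset_iff\<close>)
  then have "keys (cscale \<kappa> (eb \<theta>) + g) \<subseteq> Std"
    using cpoly.subspace_add[OF sub cpoly.subspace_scale[OF sub] \<open>g \<in> ?S\<close>] eb_Std[OF assms(1)] by simp
  then have "cscale \<kappa> (eb \<theta>) + g = 0" by (rule Std_eqV_0[OF _ assms(3)])
  then have "cscale \<kappa> (eb \<theta>) = - g" by (simp only: eq_neg_iff_add_eq_0)
  then have "cscale (1 / \<kappa>) (cscale \<kappa> (eb \<theta>)) = cscale (1 / \<kappa>) (- g)" by (rule arg_cong)
  moreover have "cscale (1 / \<kappa>) (cscale \<kappa> (eb \<theta>)) = eb \<theta>" using k by simp
  ultimately have "eb \<theta> = cscale (1 / \<kappa>) (- g)" by (simp only:)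
  then have "eb \<theta> \<in> cpoly.span (eb ` (Std - {\<theta>}))"
    using cpoly.span_scale[OF cpoly.span_neg[OF assms(2)]] by (simp only:)
  then show False using eb_not_in_span[OF assms(1)] by blast
qed

definition nrm :: "nat \<Rightarrow> cpoly \<Rightarrow> real \<Rightarrow> bool" where
  "nrm N f b \<longleftrightarrow> (\<exists>x. coords (StdS N) f x \<and> (\<Sum>\<delta>\<in>StdS N. cmod (x \<delta>)) \<le> b)"

lemma nrm_eqV: "nrm N f b \<Longrightarrow> eqV V g f \<Longrightarrow> nrm N g b"
  by (auto simp: nrm_def coords_def eqV_def)

lemma StdS_mono: "N \<le> N' \<Longrightarrow> StdS N \<subseteq> StdS N'"
  by (auto simp: StdS_def)

lemma coords_extend:
  assumes "coords S f x" "S \<subseteq> S'" "finite S'"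
  shows "coords S' f (\<lambda>\<delta>. if \<delta> \<in> S then x \<delta> else 0)"
  unfolding coords_def
proof
  fix a assume "a \<in> V"
  then have "peval a f = (\<Sum>\<delta>\<in>S. x \<delta> * peval a (eb \<delta>))" using assms(1) by (simp add: coords_def)
  also have "\<dots> = (\<Sum>\<delta>\<in>S'. (if \<delta> \<in> S then x \<delta> else 0) * peval a (eb \<delta>))"
    by (rule sum.mono_neutral_cong_left) (use assms in auto)
  finally show "peval a f = \<dots>" .
qed

lemma nrm_mono:
  assumes "nrm N f b" "N \<le> N'" "b \<le> b'" shows "nrm N' f b'"
proof -
  obtain x where x: "coords (StdS N) f x" "(\<Sum>\<delta>\<in>StdS N. cmod (x \<delta>)) \<le> b" using assms(1) by (auto simp: nrm_def)
  have "(\<Sum>\<delta>\<in>StdS N'. cmod (if \<delta> \<in> StdS N then x \<delta> else 0)) = (\<Sum>\<delta>\<in>StdS N. cmod (x \<delta>))"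
    by (rule sum.mono_neutral_cong_right) (use StdS_mono[OF assms(2)] in auto)
  then show ?thesis unfolding nrm_def
    using coords_extend[OF x(1) StdS_mono[OF assms(2)]] x(2) assms(3) by (intro exI conjI) auto
qed

lemma nrm_eb: "\<gamma> \<in> StdS N \<Longrightarrow> nrm N (eb \<gamma>) 1"
  unfolding nrm_def coords_def
  by (intro exI[of _ "\<lambda>\<epsilon>. if \<epsilon> = \<gamma> then 1 else 0"])
     (simp add: if_distrib[of "\<lambda>x. x * _"] if_distrib[of cmod] sum.delta cong: if_cong)

lemma nrm_sum:
  fixes f :: "expo \<Rightarrow> cpoly"
  assumes "\<And>x. x \<in> A \<Longrightarrow> nrm N (f x) (b x)"
  shows "nrm N (\<Sum>x\<in>A. cscale (c x) (f x)) (\<Sum>x\<in>A. cmod (c x) * b x)"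
proof -
  have "\<forall>x\<in>A. \<exists>y. coords (StdS N) (f x) y \<and> (\<Sum>\<delta>\<in>StdS N. cmod (y \<delta>)) \<le> b x"
    using assms by (auto simp: nrm_def)
  from bchoice[OF this] obtain y where y: "\<forall>x\<in>A. coords (StdS N) (f x) (y x) \<and> (\<Sum>\<delta>\<in>StdS N. cmod (y x \<delta>)) \<le> b x" ..
  show ?thesis unfolding nrm_def
  proof (intro exI[of _ "\<lambda>\<delta>. \<Sum>x\<in>A. c x * y x \<delta>"] conjI)
    show "coords (StdS N) (\<Sum>x\<in>A. cscale (c x) (f x)) (\<lambda>\<delta>. \<Sum>x\<in>A. c x * y x \<delta>)"
      unfolding coords_def
    proof
      fix a assume a: "a \<in> V"
      have "peval a (\<Sum>x\<in>A. cscale (c x) (f x)) = (\<Sum>x\<in>A. c x * (\<Sum>\<delta>\<in>StdS N. y x \<delta> * peval a (eb \<delta>)))"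
        using y a by (auto simp: coords_def intro!: sum.cong)
      also have "\<dots> = (\<Sum>\<delta>\<in>StdS N. (\<Sum>x\<in>A. c x * y x \<delta>) * peval a (eb \<delta>))"
        unfolding sum_distrib_left sum_distrib_right by (subst sum.swap) (simp add: mult.assoc)
      finally show "peval a (\<Sum>x\<in>A. cscale (c x) (f x)) = \<dots>" .
    qed
    have "(\<Sum>\<delta>\<in>StdS N. cmod (\<Sum>x\<in>A. c x * y x \<delta>)) \<le> (\<Sum>\<delta>\<in>StdS N. \<Sum>x\<in>A. cmod (c x) * cmod (y x \<delta>))"
      by (intro sum_mono order_trans[OF norm_sum]) (simp add: norm_mult)
    also have "\<dots> = (\<Sum>x\<in>A. cmod (c x) * (\<Sum>\<delta>\<in>StdS N. cmod (y x \<delta>)))"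
      by (subst sum.swap) (simp add: sum_distrib_left)
    also have "\<dots> \<le> (\<Sum>x\<in>A. cmod (c x) * b x)"
      using y by (intro sum_mono mult_left_mono) auto
    finally show "(\<Sum>\<delta>\<in>StdS N. cmod (\<Sum>x\<in>A. c x * y x \<delta>)) \<le> \<dots>" .
  qed
qed

lemma nrm_mult:
  assumes f: "nrm N f b" and g: "\<And>\<delta>. \<delta> \<in> StdS N \<Longrightarrow> nrm N' (g * eb \<delta>) B" and B: "B \<ge> 0"
  shows "nrm N' (g * f) (B * b)"
proof -
  obtain x where x: "coords (StdS N) f x" "(\<Sum>\<delta>\<in>StdS N. cmod (x \<delta>)) \<le> b" using f by (auto simp: nrm_def)
  have "nrm N' (\<Sum>\<delta>\<in>StdS N. cscale (x \<delta>) (g * eb \<delta>)) (\<Sum>\<delta>\<in>StdS N. cmod (x \<delta>) * B)"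
    by (rule nrm_sum) (rule g)
  then have "nrm N' (g * f) (\<Sum>\<delta>\<in>StdS N. cmod (x \<delta>) * B)"
    by (rule nrm_eqV) (use x(1) in \<open>simp add: eqV_def coords_def sum_distrib_left mult.left_commute\<close>)
  moreover have "(\<Sum>\<delta>\<in>StdS N. cmod (x \<delta>) * B) \<le> B * b"
    unfolding sum_distrib_right[symmetric] using mult_right_mono[OF x(2) B] by (simp add: mult.commute)
  ultimately show ?thesis using nrm_mono by blast
qed

lemma zmon_low_eb:
  assumes "\<gamma> \<in> Std" "keys \<alpha> \<subseteq> {1..<m}"
  shows "\<alpha> + \<gamma> \<in> Std" "zmon \<alpha> * eb \<gamma> = eb (\<alpha> + \<gamma>)"
proof -
  have k: "keys \<alpha> \<subseteq> {1..m}" using assms(2) by force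
  have "\<alpha> + \<gamma> \<in> Std \<and> zmon \<alpha> * eb \<gamma> = eb (\<alpha> + \<gamma>)"
  proof (cases "\<gamma> \<in> ExtE")
    case True
    then show ?thesis using zmon_eb_ext[OF True k] Ext_Std by blast
  next
    case False
    then have o: "\<gamma> \<in> OrdE" using assms(1) Std_Ord_Ext by blast
    from OrdE_shift[OF o assms(2)] have "\<alpha> + \<gamma> \<in> OrdE" .
    then show ?thesis using o eb_ord by (simp add: mult_single OrdE_def)
  qed
  then show "\<alpha> + \<gamma> \<in> Std" "zmon \<alpha> * eb \<gamma> = eb (\<alpha> + \<gamma>)" by auto
qed

lemma nrm_zmon_low:
  assumes "nrm N f b" "keys \<alpha> \<subseteq> {1..<m}" shows "nrm (N + edeg \<alpha>) (zmon \<alpha> * f) b"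
proof -
  have "nrm (N + edeg \<alpha>) (zmon \<alpha> * f) (1 * b)"
  proof (rule nrm_mult[OF assms(1)])
    fix \<delta> assume "\<delta> \<in> StdS N"
    then have d: "\<delta> \<in> Std" "edeg \<delta> \<le> N" by (auto simp: StdS_def)
    show "nrm (N + edeg \<alpha>) (zmon \<alpha> * eb \<delta>) 1"
      unfolding zmon_low_eb(2)[OF d(1) assms(2)]
      by (rule nrm_eb) (use zmon_low_eb(1)[OF d(1) assms(2)] d(2) in \<open>simp add: StdS_def\<close>)
  qed simp
  then show ?thesis by simp
qed

lemma ex_nrm:
  assumes "f \<in> polys {1..n}" "\<And>\<gamma>. \<gamma> \<in> keys f \<Longrightarrow> edeg \<gamma> \<le> s"
  shows "\<exists>b. nrm s f b"
  using ex_coords_StdS[OF assms] by (auto simp: nrm_def)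

text \<open>
  Multiplication by a variable \<open>z_1, ..., z_m\<close> sends basis elements to basis elements, except that \<open>z_m\<close> may lead out of
  the ordinary monomials.  These exceptions are \<open>z^\<alpha> z_m z^\<nu>\<close> with \<open>\<nu>\<close> in the finite set \<open>QO\<close>, and
  the factor \<open>z^\<alpha>\<close> does not affect the norm.
\<close>

lemma nrm_zvar_growth:
  "\<exists>C\<ge>1. \<forall>j\<in>{1..m}. \<forall>N f b. nrm N f b \<longrightarrow> nrm (N + 1) (zvar j * f) (C * b)"
proof -
  have "\<forall>\<nu>\<in>QO. \<exists>b. nrm (edeg \<nu> + 1) (zmon (Poly_Mapping.single m 1 + \<nu>)) b"
  proof
    fix \<nu> assume "\<nu> \<in> QO"
    then have "\<nu> \<in> Std" by (simp add: QO_def OrdE_def)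
    from Std_keys[OF this] have "keys (Poly_Mapping.single m 1 + \<nu>) \<subseteq> {1..n}"
      using m1 mn by (simp add: keys_expo_add keys_single_subset)
    then show "\<exists>b. nrm (edeg \<nu> + 1) (zmon (Poly_Mapping.single m 1 + \<nu>)) b"
      by (intro ex_nrm) auto
  qed
  from bchoice[OF this] obtain b where b: "\<forall>\<nu>\<in>QO. nrm (edeg \<nu> + 1) (zmon (Poly_Mapping.single m 1 + \<nu>)) (b \<nu>)" ..
  define C where "C = 1 + (\<Sum>\<nu>\<in>QO. \<bar>b \<nu>\<bar>)"
  have C1: "C \<ge> 1" by (simp add: C_def sum_nonneg)
  have Cb: "b \<nu> \<le> C" if "\<nu> \<in> QO" for \<nu>
  proof -
    have "\<bar>b \<nu>\<bar> \<le> (\<Sum>\<nu>\<in>QO. \<bar>b \<nu>\<bar>)" by (rule member_le_sum) (use that in auto)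
    then show ?thesis by (simp add: C_def)
  qed
  have e: "nrm (N + 1) (zvar j * eb \<delta>) C" if j: "j \<in> {1..m}" and d: "\<delta> \<in> StdS N" for j N \<delta>
  proof (cases "j < m \<or> \<delta> \<in> ExtE")
    case True
    have ds: "\<delta> \<in> Std" "edeg \<delta> \<le> N" using d by (auto simp: StdS_def)
    have k: "keys (Poly_Mapping.single j 1) \<subseteq> {1..m}" using j by (simp add: keys_single_subset)
    have "Poly_Mapping.single j 1 + \<delta> \<in> Std \<and> zvar j * eb \<delta> = eb (Poly_Mapping.single j 1 + \<delta>)"
    proof (cases "\<delta> \<in> ExtE")
      case True
      then show ?thesis using zmon_eb_ext[OF True k] Ext_Std by blast
    next
      case False
      then have "keys (Poly_Mapping.single j 1) \<subseteq> {1..<m}" using \<open>j < m \<or> \<delta> \<in> ExtE\<close> j by (simp add: keys_single_subset)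
      from zmon_low_eb[OF ds(1) this] show ?thesis by blast
    qed
    then have "nrm (N + 1) (zvar j * eb \<delta>) 1" using nrm_eb[of "Poly_Mapping.single j 1 + \<delta>" "N + 1"] ds
      by (simp add: StdS_def)
    then show ?thesis by (rule nrm_mono[OF _ order_refl C1])
  next
    case False
    then have jm: "j = m" and o: "\<delta> \<in> OrdE" using j d Std_Ord_Ext by (auto simp: StdS_def)
    have D: "low \<delta> + upp \<delta> = \<delta>" "keys (low \<delta>) \<subseteq> {1..<m}" "upp \<delta> \<in> QO" using OrdE_decomp[OF o] by auto
    have "nrm (edeg (upp \<delta>) + 1 + edeg (low \<delta>)) (zmon (low \<delta>) * zmon (Poly_Mapping.single m 1 + upp \<delta>)) (b (upp \<delta>))"
      by (rule nrm_zmon_low) (use b D in auto)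
    moreover have "zmon (low \<delta>) * zmon (Poly_Mapping.single m 1 + upp \<delta>) = zvar j * eb \<delta>"
    proof -
      have "low \<delta> + (Poly_Mapping.single m 1 + upp \<delta>) = Poly_Mapping.single m 1 + (low \<delta> + upp \<delta>)"
        by (simp add: ac_simps)
      then show ?thesis by (simp add: mult_single eb_ord[OF o] jm D(1))
    qed
    moreover have "edeg (upp \<delta>) + 1 + edeg (low \<delta>) \<le> N + 1"
      using edeg_low_upp[of \<delta>] d by (simp add: StdS_def)
    ultimately show ?thesis using nrm_mono[OF _ _ Cb[OF D(3)]] by simp
  qed
  have "nrm (N + 1) (zvar j * f) (C * b)" if "j \<in> {1..m}" "nrm N f b" for j N f b
    by (rule nrm_mult[OF that(2)]) (use e[OF that(1)] C1 in auto)
  then show ?thesis using C1 by blast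
qed

lemma nrm_zmon_growth:
  "\<exists>C\<ge>1. \<forall>a N f b. keys a \<subseteq> {1..m} \<longrightarrow> nrm N f b \<longrightarrow> nrm (N + edeg a) (zmon a * f) (C ^ edeg a * b)"
proof -
  obtain C where C: "C \<ge> 1" "\<forall>j\<in>{1..m}. \<forall>N f b. nrm N f b \<longrightarrow> nrm (N + 1) (zvar j * f) (C * b)"
    using nrm_zvar_growth by blast
  have "nrm (N + k) (zmon a * f) (C ^ k * b)" if "keys a \<subseteq> {1..m}" "edeg a = k" "nrm N f b" for k a N f b
    using that(1,2)
  proof (induction k arbitrary: a)
    case 0
    have "a = 0" by (rule poly_mapping_eqI) (use lookup_le_edeg[of a] 0 in simp)
    then show ?case using that(3) by simp
  next
    case (Suc k)
    have "a \<noteq> 0" using Suc.prems(2) by auto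
    then obtain j where j: "j \<in> keys a" by fastforce
    define a' where "a' = a - Poly_Mapping.single j 1"
    have a: "a = Poly_Mapping.single j 1 + a'"
      by (rule poly_mapping_eqI) (use j in \<open>auto simp: a'_def lookup_add lookup_minus lookup_single when_def in_keys_iff\<close>)
    have k': "keys a' \<subseteq> {1..m}" using Suc.prems(1) a keys_expo_add by metis
    have "edeg a = 1 + edeg a'" by (subst a) simp
    then have "edeg a' = k" using Suc.prems(2) by simp
    have "nrm (N + k + 1) (zvar j * (zmon a' * f)) (C * (C ^ k * b))"
      using C(2)[rule_format, OF _ Suc.IH[OF k' \<open>edeg a' = k\<close>]] j Suc.prems(1) by blast
    moreover have "zvar j * (zmon a' * f) = zmon a * f"
      by (subst a) (simp add: mult_single mult.assoc[symmetric])
    ultimately have "nrm (N + k + 1) (zmon a * f) (C * (C ^ k * b))" by (simp only:)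
    moreover have "N + k + 1 = N + Suc k" "C * (C ^ k * b) = C ^ Suc k * b" by simp_all
    ultimately show ?case by (simp only:)
  qed
  then show ?thesis using C(1) by blast
qed

text \<open>
  Coordinates are unique, so a function in the span of the \<open>z^a w_i\<close> has no ordinary coordinates.
\<close>

lemma inF_coords:
  assumes "inF f" "coords (StdS N) f x" "\<delta> \<in> StdS N" "\<delta> \<notin> ExtE" shows "x \<delta> = 0"
proof -
  obtain g where g: "g \<in> cpoly.span (eb ` ExtE)" "eqV V f g" using assms(1) by (auto simp: inF_def)
  obtain U r where U: "finite U" "U \<subseteq> eb ` ExtE" "g = (\<Sum>u\<in>U. cscale (r u) u)"
    using g(1) unfolding cpoly.span_explicit by blast
  obtain W where W: "W \<subseteq> ExtE" "finite W" "U = eb ` W" using U(1,2) by (meson finite_subset_image)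
  have "inj_on eb W" using eb_inj W(1) Ext_Std by (meson inj_on_subset subsetI subset_iff)
  then have "coords W f (\<lambda>\<delta>. r (eb \<delta>))"
    using g(2) unfolding U(3) W(3) by (simp add: coords_def eqV_def sum.reindex)
  then have c1: "coords (StdS N \<union> W) f (\<lambda>\<delta>. if \<delta> \<in> W then r (eb \<delta>) else 0)"
    by (rule coords_extend) (use W(2) in auto)
  have c2: "coords (StdS N \<union> W) f (\<lambda>\<delta>. if \<delta> \<in> StdS N then x \<delta> else 0)"
    by (rule coords_extend[OF assms(2)]) (use W(2) in auto)
  have "StdS N \<union> W \<subseteq> Std" using W(1) Ext_Std by (auto simp: StdS_def)
  from coords_unique[OF _ this c2 c1, of \<delta>] W(2) assms(3)
  have "(if \<delta> \<in> StdS N then x \<delta> else 0) = (if \<delta> \<in> W then r (eb \<delta>) else 0)" by simp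
  then show ?thesis using assms(3,4) W(1) by auto
qed

end

text \<open>
  \<open>h\<close> plays the role of a conductor of the ring of functions into the module \<open>inF\<close>.
\<close>

locale conductor_setup = compact_setup n V I m d t p w K
  for n :: nat and V :: "(nat \<Rightarrow> complex) set" and I :: "cpoly set" and m d t p w K +
  fixes h :: cpoly and c0 :: expo
  assumes hp: "h \<in> polys {1..m}" and hlead: "is_lead h c0" and h1: "lookup h c0 = 1"
    and hF: "f \<in> polys {1..n} \<Longrightarrow> inF (h * f)"
    and nzd: "f \<in> polys {1..n} \<Longrightarrow> eqV V (h * f) 0 \<Longrightarrow> eqV V f 0"
    and Vne: "V \<noteq> {}"
begin

text \<open>
  The leading exponent attached to \<open>f\<close> is that of \<open>h f\<close>, so that it is never ordinary.
\<close>

definition HL :: "cpoly \<Rightarrow> expo \<Rightarrow> bool" where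
  "HL f \<theta> \<longleftrightarrow> f \<in> polys {1..n} \<and> \<theta> \<in> ExtE \<and>
     (\<exists>g\<in>cpoly.span (eb ` {\<delta>\<in>ExtE. grevlex \<delta> \<theta>}). eqV V (h * f) (eb \<theta> + g))"

lemma hn: "h \<in> polys {1..n}"
  by (rule polys_mono[OF _ hp]) (use mn in auto)

lemma c0_keys: "keys c0 \<subseteq> {1..m}"
  using hp hlead by (auto simp: polys_def is_lead_def)

lemma HL_zmon:
  assumes "HL f \<theta>" "keys b \<subseteq> {1..m}" shows "HL (zmon b * f) (b + \<theta>)"
proof -
  have f: "f \<in> polys {1..n}" "\<theta> \<in> ExtE" using assms(1) by (auto simp: HL_def)
  obtain g where g: "g \<in> cpoly.span (eb ` {\<delta>\<in>ExtE. grevlex \<delta> \<theta>})" "eqV V (h * f) (eb \<theta> + g)"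
    using assms(1) by (auto simp: HL_def)
  have "zmon b * g \<in> cpoly.span (eb ` {\<delta>\<in>ExtE. grevlex \<delta> (b + \<theta>)})"
    using g(1)
  proof (induction rule: cpoly.span_induct_alt)
    case (step c x y)
    then obtain \<gamma> where \<gamma>: "\<gamma> \<in> ExtE" "grevlex \<gamma> \<theta>" "x = eb \<gamma>" by blast
    have "zmon b * (cscale c x + y) = cscale c (eb (b + \<gamma>)) + zmon b * y"
      using zmon_eb_ext(2)[OF \<gamma>(1) assms(2)] by (simp add: \<gamma>(3) distrib_left cscale_mult mult.left_commute)
    then show ?case using step zmon_eb_ext(1)[OF \<gamma>(1) assms(2)] \<gamma>(2)
      by (auto intro!: cpoly.span_add cpoly.span_scale intro: cpoly.span_base simp: grevlex_add_left)
  qed (simp add: cpoly.span_zero)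
  moreover have "eqV V (h * (zmon b * f)) (eb (b + \<theta>) + zmon b * g)"
    unfolding eqV_def
  proof
    fix a assume "a \<in> V"
    then have "peval a (h * f) = peval a (eb \<theta> + g)" using g(2) by (simp add: eqV_def)
    then have "mval a b * peval a (h * f) = mval a b * peval a (eb \<theta> + g)" by simp
    then show "peval a (h * (zmon b * f)) = peval a (eb (b + \<theta>) + zmon b * g)"
      unfolding zmon_eb_ext(2)[OF f(2) assms(2), symmetric] by (simp add: distrib_left mult.left_commute)
  qed
  moreover have "zmon b * f \<in> polys {1..n}"
    by (rule polys_mult[OF _ f(1)]) (use assms(2) mn in \<open>auto intro: order_trans\<close>)
  ultimately show ?thesis unfolding HL_def using zmon_eb_ext(1)[OF f(2) assms(2)] by blast
qed

lemma HL_eb: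
  assumes "\<gamma> \<in> ExtE" shows "HL (eb \<gamma>) (c0 + \<gamma>)"
proof -
  have k: "keys \<kappa> \<subseteq> {1..m}" if "\<kappa> \<in> keys h" for \<kappa> using hp that by (auto simp: polys_def)
  have e: "eb (\<kappa> + \<gamma>) = zmon \<kappa> * eb \<gamma>" if "\<kappa> \<in> keys h" for \<kappa>
    using zmon_eb_ext(2)[OF assms k[OF that]] by simp
  define g where "g = (\<Sum>\<kappa>\<in>keys h - {c0}. cscale (lookup h \<kappa>) (eb (\<kappa> + \<gamma>)))"
  have "g \<in> cpoly.span (eb ` {\<delta>\<in>ExtE. grevlex \<delta> (c0 + \<gamma>)})"
    unfolding g_def
  proof (intro cpoly.span_sum cpoly.span_scale cpoly.span_base imageI CollectI conjI)
    fix \<kappa> assume \<kappa>: "\<kappa> \<in> keys h - {c0}"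
    then show "\<kappa> + \<gamma> \<in> ExtE" by (intro zmon_eb_ext(1)[OF assms k]) simp
    show "grevlex (\<kappa> + \<gamma>) (c0 + \<gamma>)" using \<kappa> hlead by (simp add: grevlex_add is_lead_def)
  qed
  moreover have "eqV V (h * eb \<gamma>) (eb (c0 + \<gamma>) + g)"
    unfolding eqV_def
  proof
    fix a assume "a \<in> V"
    have "peval a (h * eb \<gamma>) = (\<Sum>\<kappa>\<in>keys h. lookup h \<kappa> * peval a (eb (\<kappa> + \<gamma>)))"
      by (simp add: peval_mval[of a h] e sum_distrib_right mult.assoc)
    also have "\<dots> = peval a (eb (c0 + \<gamma>) + g)"
      using sum.remove[of "keys h" c0 "\<lambda>\<kappa>. lookup h \<kappa> * peval a (eb (\<kappa> + \<gamma>))"] hlead h1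
      by (simp add: g_def is_lead_def)
    finally show "peval a (h * eb \<gamma>) = peval a (eb (c0 + \<gamma>) + g)" .
  qed
  ultimately show ?thesis unfolding HL_def
    using eb_polys[OF Ext_Std[OF assms]] zmon_eb_ext(1)[OF assms c0_keys] by blast
qed

lemma h_degree:
  assumes "f \<in> polys {1..n}" "\<And>\<gamma>. \<gamma> \<in> keys f \<Longrightarrow> edeg \<gamma> \<le> s" "\<gamma> \<in> keys (h * f)"
  shows "edeg \<gamma> \<le> s + edeg c0"
proof -
  obtain a b where ab: "\<gamma> = a + b" "a \<in> keys h" "b \<in> keys f"
    using subsetD[OF keys_mult assms(3)] by blast
  then have "edeg a \<le> edeg c0" using hlead grevlex_edeg[of a c0] by (cases "a = c0") (auto simp: is_lead_def)
  then show ?thesis using assms(2)[OF ab(3)] ab(1) by simp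
qed

text \<open>
  As \<open>h\<close> is not a zero divisor, \<open>h f\<close> has a nonzero coordinate.
\<close>

lemma HL_exists:
  assumes f: "f \<in> polys {1..n}" "\<not> eqV V f 0" and x: "coords (StdS N) (h * f) x"
  shows "\<exists>\<theta>\<in>StdS N. x \<theta> \<noteq> 0 \<and> HL (cscale (1 / x \<theta>) f) \<theta>"
proof -
  let ?S = "{\<delta>\<in>StdS N. x \<delta> \<noteq> 0}"
  have "?S \<noteq> {}"
  proof
    assume "?S = {}"
    then have "eqV V (h * f) 0" using x by (auto simp: eqV_def coords_def intro!: sum.neutral)
    then show False using nzd f by blast
  qed
  then obtain \<theta> where \<theta>: "\<theta> \<in> ?S" "\<And>\<delta>. \<delta> \<in> ?S \<Longrightarrow> \<delta> \<noteq> \<theta> \<Longrightarrow> grevlex \<delta> \<theta>"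
    using finite_has_grevlex_max[of ?S] by auto
  have ext: "\<delta> \<in> ExtE" if "\<delta> \<in> ?S" for \<delta> using inF_coords[OF hF[OF f(1)] x] that by auto
  define g where "g = (\<Sum>\<delta>\<in>?S - {\<theta>}. cscale (x \<delta> / x \<theta>) (eb \<delta>))"
  have "g \<in> cpoly.span (eb ` {\<delta>\<in>ExtE. grevlex \<delta> \<theta>})"
    unfolding g_def
    by (intro cpoly.span_sum cpoly.span_scale cpoly.span_base imageI CollectI conjI) (use \<theta>(2) ext in auto)
  moreover have "eqV V (h * cscale (1 / x \<theta>) f) (eb \<theta> + g)"
    unfolding eqV_def
  proof
    fix a assume "a \<in> V"
    then have "peval a (h * f) = (\<Sum>\<delta>\<in>StdS N. x \<delta> * peval a (eb \<delta>))" using x by (simp add: coords_def)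
    also have "\<dots> = (\<Sum>\<delta>\<in>?S. x \<delta> * peval a (eb \<delta>))" by (rule sum.mono_neutral_right) auto
    also have "\<dots> = x \<theta> * peval a (eb \<theta>) + (\<Sum>\<delta>\<in>?S - {\<theta>}. x \<delta> * peval a (eb \<delta>))"
      by (rule sum.remove) (use \<theta>(1) in auto)
    also have "(\<Sum>\<delta>\<in>?S - {\<theta>}. x \<delta> * peval a (eb \<delta>)) = x \<theta> * peval a g"
      using \<theta>(1) by (simp add: g_def sum_distrib_left)
    finally have "peval a (h * f) = x \<theta> * peval a (eb \<theta> + g)" by (simp add: distrib_left)
    then show "peval a (h * cscale (1 / x \<theta>) f) = peval a (eb \<theta> + g)" using \<theta>(1) by simp
  qed
  ultimately have "HL (cscale (1 / x \<theta>) f) \<theta>"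
    unfolding HL_def using ext[OF \<theta>(1)] polys_cscale[OF f(1)] by blast
  then show ?thesis using \<theta>(1) by blast
qed

text \<open>
  The greatest \<open>\<theta>\<close> with \<open>c \<theta> \<noteq> 0\<close> would be the leading exponent of \<open>h\<close> times the combination.
\<close>

lemma HL_independent:
  fixes f :: "expo \<Rightarrow> cpoly"
  assumes L: "finite L" and f: "\<And>\<theta>. \<theta> \<in> L \<Longrightarrow> HL (f \<theta>) \<theta>"
    and 0: "eqV V (\<Sum>\<theta>\<in>L. cscale (c \<theta>) (f \<theta>)) 0"
  shows "\<forall>\<theta>\<in>L. c \<theta> = 0"
proof (rule ccontr)
  assume "\<not> (\<forall>\<theta>\<in>L. c \<theta> = 0)"
  then obtain \<theta> where \<theta>: "\<theta> \<in> {\<theta>\<in>L. c \<theta> \<noteq> 0}" "\<And>\<delta>. \<delta> \<in> {\<theta>\<in>L. c \<theta> \<noteq> 0} \<Longrightarrow> \<delta> \<noteq> \<theta> \<Longrightarrow> grevlex \<delta> \<theta>"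
    using finite_has_grevlex_max[of "{\<theta>\<in>L. c \<theta> \<noteq> 0}"] L by auto
  have "\<forall>\<delta>\<in>L. \<exists>g. g \<in> cpoly.span (eb ` {\<epsilon>\<in>ExtE. grevlex \<epsilon> \<delta>}) \<and> eqV V (h * f \<delta>) (eb \<delta> + g)"
    using f by (auto simp: HL_def)
  from bchoice[OF this] obtain g where
    g: "\<forall>\<delta>\<in>L. g \<delta> \<in> cpoly.span (eb ` {\<epsilon>\<in>ExtE. grevlex \<epsilon> \<delta>}) \<and> eqV V (h * f \<delta>) (eb \<delta> + g \<delta>)" ..
  let ?W = "cpoly.span (eb ` (Std - {\<theta>}))"
  have inW: "g \<delta> \<in> ?W" if "\<delta> \<in> L" "\<delta> = \<theta> \<or> grevlex \<delta> \<theta>" for \<delta>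
  proof (rule subsetD[OF cpoly.span_mono])
    show "g \<delta> \<in> cpoly.span (eb ` {\<epsilon>\<in>ExtE. grevlex \<epsilon> \<delta>})" using g that(1) by blast
    show "eb ` {\<epsilon>\<in>ExtE. grevlex \<epsilon> \<delta>} \<subseteq> eb ` (Std - {\<theta>})"
      using that(2) Ext_Std grevlex_asym[of \<delta> \<theta>] by (intro image_mono) auto
  qed
  have fT: "f \<delta> \<in> polys {1..n} \<and> \<delta> \<in> Std" if "\<delta> \<in> L" for \<delta> using f[OF that] Ext_Std by (auto simp: HL_def)
  define G where "G = cscale (c \<theta>) (g \<theta>) + (\<Sum>\<delta>\<in>L - {\<theta>}. cscale (c \<delta>) (eb \<delta> + g \<delta>))"
  have "G \<in> ?W" unfolding G_def
  proof (intro cpoly.span_add cpoly.span_sum)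
    show "cscale (c \<theta>) (g \<theta>) \<in> ?W" using inW[of \<theta>] \<theta>(1) by (auto intro: cpoly.span_scale)
    fix \<delta> assume d: "\<delta> \<in> L - {\<theta>}"
    show "cscale (c \<delta>) (eb \<delta> + g \<delta>) \<in> ?W"
    proof (cases "c \<delta> = 0")
      case False
      then have gr: "grevlex \<delta> \<theta>" using \<theta>(2)[of \<delta>] d by simp
      have "eb \<delta> \<in> ?W" using d fT by (auto intro: cpoly.span_base)
      then show ?thesis using inW[of \<delta>] d gr by (intro cpoly.span_scale cpoly.span_add) auto
    qed (simp add: cpoly.span_zero)
  qed
  moreover have "eqV V (cscale (c \<theta>) (eb \<theta>) + G) 0"
    unfolding eqV_def
  proof
    fix a assume a: "a \<in> V"
    have "peval a (cscale (c \<theta>) (eb \<theta>) + G) = c \<theta> * peval a (eb \<theta> + g \<theta>) + (\<Sum>\<delta>\<in>L - {\<theta>}. c \<delta> * peval a (eb \<delta> + g \<delta>))"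
      by (simp add: G_def algebra_simps)
    also have "\<dots> = (\<Sum>\<delta>\<in>L. c \<delta> * peval a (eb \<delta> + g \<delta>))"
      by (rule sum.remove[symmetric]) (use L \<theta>(1) in auto)
    also have "\<dots> = (\<Sum>\<delta>\<in>L. c \<delta> * peval a (h * f \<delta>))"
      using g a by (intro sum.cong) (auto simp: eqV_def)
    also have "\<dots> = peval a h * peval a (\<Sum>\<theta>\<in>L. cscale (c \<theta>) (f \<theta>))"
      by (simp add: sum_distrib_left mult.left_commute)
    also have "\<dots> = 0" using 0 a by (simp add: eqV_def)
    finally show "peval a (cscale (c \<theta>) (eb \<theta>) + G) = peval a 0" by simp
  qed
  ultimately have "c \<theta> = 0" using leading_coefficient_zero[of \<theta> G "c \<theta>"] fT \<theta>(1) by blast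
  then show False using \<theta>(1) by simp
qed

text \<open>
  The counterpart of \<open>StdS s\<close> among the exponents in \<open>ExtE\<close>; the bound on the degree makes it
  finite.
\<close>

definition Lam :: "nat \<Rightarrow> expo set" where
  "Lam s = {\<theta>\<in>StdS (s + edeg c0). \<exists>f. (\<forall>\<gamma>\<in>keys f. edeg \<gamma> \<le> s) \<and> HL f \<theta>}"

lemma finite_Lam [simp]: "finite (Lam s)"
  by (rule finite_subset[OF _ finite_StdS]) (auto simp: Lam_def)

text \<open>
  Functions with distinct leading exponents are independent, which bounds \<open>Lam s\<close> by the dimension.  If it were
  smaller, a nonzero \<open>f\<close> could be chosen such that \<open>h f\<close> has no coordinate in \<open>Lam s\<close>, contradicting
  the definition of \<open>Lam s\<close>.
\<close>

lemma card_Lam: "card (Lam s) = card (StdS s)"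
proof (rule antisym)
  show "card (Lam s) \<le> card (StdS s)"
  proof (rule ccontr)
    assume less: "\<not> ?thesis"
    have "\<forall>\<theta>\<in>Lam s. \<exists>f. (\<forall>\<gamma>\<in>keys f. edeg \<gamma> \<le> s) \<and> HL f \<theta>" by (auto simp: Lam_def)
    from bchoice[OF this] obtain f where f: "\<forall>\<theta>\<in>Lam s. (\<forall>\<gamma>\<in>keys (f \<theta>). edeg \<gamma> \<le> s) \<and> HL (f \<theta>) \<theta>" ..
    have "\<forall>\<theta>\<in>Lam s. \<exists>y. coords (StdS s) (f \<theta>) y"
      using f ex_coords_StdS by (auto simp: HL_def)
    from bchoice[OF this] obtain y where y: "\<forall>\<theta>\<in>Lam s. coords (StdS s) (f \<theta>) (y \<theta>)" ..
    obtain c where c: "\<exists>\<theta>\<in>Lam s. c \<theta> \<noteq> 0" "\<forall>\<delta>\<in>StdS s. (\<Sum>\<theta>\<in>Lam s. c \<theta> * y \<theta> \<delta>) = 0"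
      using nontrivial_linear_relation[of "StdS s" "Lam s" y] less by auto
    have "eqV V (\<Sum>\<theta>\<in>Lam s. cscale (c \<theta>) (f \<theta>)) 0"
      unfolding eqV_def
    proof
      fix a assume a: "a \<in> V"
      have "peval a (\<Sum>\<theta>\<in>Lam s. cscale (c \<theta>) (f \<theta>)) = (\<Sum>\<theta>\<in>Lam s. c \<theta> * (\<Sum>\<delta>\<in>StdS s. y \<theta> \<delta> * peval a (eb \<delta>)))"
        using y a by (auto simp: coords_def intro!: sum.cong)
      also have "\<dots> = (\<Sum>\<delta>\<in>StdS s. (\<Sum>\<theta>\<in>Lam s. c \<theta> * y \<theta> \<delta>) * peval a (eb \<delta>))"
        unfolding sum_distrib_left sum_distrib_right by (subst sum.swap) (simp add: mult.assoc)
      also have "\<dots> = 0" using c(2) by simp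
      finally show "peval a (\<Sum>\<theta>\<in>Lam s. cscale (c \<theta>) (f \<theta>)) = peval a 0" by simp
    qed
    then have "\<forall>\<theta>\<in>Lam s. c \<theta> = 0"
      by (intro HL_independent) (use f in auto)
    then show False using c(1) by blast
  qed
  show "card (StdS s) \<le> card (Lam s)"
  proof (rule ccontr)
    assume less: "\<not> ?thesis"
    let ?N = "s + edeg c0"
    have eb: "eb \<gamma> \<in> polys {1..n} \<and> (\<forall>\<delta>\<in>keys (eb \<gamma>). edeg \<delta> \<le> s)" if "\<gamma> \<in> StdS s" for \<gamma>
      using that eb_polys[of \<gamma>] eb_keys(1)[of \<gamma>] by (auto simp: StdS_def)
    have "\<forall>\<gamma>\<in>StdS s. \<exists>y. coords (StdS ?N) (h * eb \<gamma>) y"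
    proof
      fix \<gamma> assume g: "\<gamma> \<in> StdS s"
      show "\<exists>y. coords (StdS ?N) (h * eb \<gamma>) y"
        by (rule ex_coords_StdS) (use eb[OF g] h_degree[of "eb \<gamma>" s] polys_mult[OF hn] in auto)
    qed
    from bchoice[OF this] obtain y where y: "\<forall>\<gamma>\<in>StdS s. coords (StdS ?N) (h * eb \<gamma>) (y \<gamma>)" ..
    obtain c where c: "\<exists>\<gamma>\<in>StdS s. c \<gamma> \<noteq> 0" "\<forall>\<delta>\<in>Lam s. (\<Sum>\<gamma>\<in>StdS s. c \<gamma> * y \<gamma> \<delta>) = 0"
      using nontrivial_linear_relation[of "Lam s" "StdS s" y] less by auto
    define f where "f = (\<Sum>\<gamma>\<in>StdS s. cscale (c \<gamma>) (eb \<gamma>))"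
    have fp: "f \<in> polys {1..n}" unfolding f_def by (intro polys_sum polys_cscale) (use eb in blast)
    have fd: "edeg \<delta> \<le> s" if "\<delta> \<in> keys f" for \<delta>
    proof -
      from subsetD[OF keys_sum that[unfolded f_def]] obtain \<gamma> where "\<gamma> \<in> StdS s" "\<delta> \<in> keys (cscale (c \<gamma>) (eb \<gamma>))" by blast
      then show ?thesis using eb[of \<gamma>] by (auto simp: keys_cscale split: if_splits)
    qed
    have fnz: "\<not> eqV V f 0"
    proof
      assume "eqV V f 0"
      then have "\<forall>\<gamma>\<in>StdS s. c \<gamma> = 0"
        by (intro eb_independent) (use finite_StdS in \<open>auto simp: eqV_def f_def StdS_def\<close>)
      then show False using c(1) by blast
    qed
    have "coords (StdS ?N) (h * f) (\<lambda>\<delta>. \<Sum>\<gamma>\<in>StdS s. c \<gamma> * y \<gamma> \<delta>)"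
      unfolding coords_def
    proof
      fix a assume a: "a \<in> V"
      have "peval a (h * f) = (\<Sum>\<gamma>\<in>StdS s. c \<gamma> * peval a (h * eb \<gamma>))"
        by (simp add: f_def sum_distrib_left mult.left_commute)
      also have "\<dots> = (\<Sum>\<gamma>\<in>StdS s. c \<gamma> * (\<Sum>\<delta>\<in>StdS ?N. y \<gamma> \<delta> * peval a (eb \<delta>)))"
        using y a by (intro sum.cong) (auto simp: coords_def)
      also have "\<dots> = (\<Sum>\<delta>\<in>StdS ?N. (\<Sum>\<gamma>\<in>StdS s. c \<gamma> * y \<gamma> \<delta>) * peval a (eb \<delta>))"
        unfolding sum_distrib_left sum_distrib_right by (subst sum.swap) (simp add: mult.assoc)
      finally show "peval a (h * f) = \<dots>" .
    qed
    from HL_exists[OF fp fnz this] obtain \<theta> where \<theta>: "\<theta> \<in> StdS ?N" "(\<Sum>\<gamma>\<in>StdS s. c \<gamma> * y \<gamma> \<theta>) \<noteq> 0"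
      "HL (cscale (1 / (\<Sum>\<gamma>\<in>StdS s. c \<gamma> * y \<gamma> \<theta>)) f) \<theta>" by auto
    have "\<theta> \<in> Lam s"
      unfolding Lam_def using \<theta> fd by (intro CollectI conjI exI[of _ "cscale (1 / (\<Sum>\<gamma>\<in>StdS s. c \<gamma> * y \<gamma> \<theta>)) f"]) (auto simp: keys_cscale)
    then show False using c(2) \<theta>(2) by blast
  qed
qed

text \<open>
  For \<open>d = 0\<close> the module \<open>inF\<close> would be zero, and \<open>h\<close> would vanish on \<open>V\<close>.
\<close>

lemma d_pos: "d > 0"
proof (rule ccontr)
  assume "\<not> d > 0"
  then have "{1..d} = {}" by simp
  then have "ExtE = {}" unfolding ExtE_def by blast
  then have "eqV V (h * 1) 0" using hF[of 1] by (auto simp: inF_def)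
  then have "eqV V 1 0" using nzd[of 1] by simp
  then show False using Vne by (auto simp: eqV_def)
qed

text \<open>
  Attach to \<open>a + mu i \<in> Lam s\<close> the vector of the slack \<open>s + deg c0 - deg (a + mu i)\<close> and the entries of \<open>a\<close>.  If this vector dominates that of
  \<open>a' + mu i \<in> Lam s'\<close>, then \<open>z^(a - a')\<close> times a function realising \<open>a' + mu i\<close> has degree at most \<open>s\<close> and
  realises \<open>a + mu i\<close>.  By Dickson's lemma finitely many functions generate all others in this way, and
  multiplication by \<open>z^(a - a')\<close> is controlled by \<open>nrm_zmon_growth\<close>.
\<close>

lemma Lam_bounded: "\<exists>C\<ge>1. \<forall>s. \<forall>\<theta>\<in>Lam s. \<exists>f. HL f \<theta> \<and> nrm s f (C ^ (s + 1))"
proof -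
  define U where "U i = {(s, a). keys a \<subseteq> {1..m} \<and> a + mu i \<in> Lam s}" for i
  define q :: "nat \<times> expo \<Rightarrow> nat \<Rightarrow> nat" where
    "q = (\<lambda>(s, a) j. if j = 0 then s + edeg c0 - (edeg a + t) else lookup a j)"
  have "\<forall>i. \<exists>F. F \<subseteq> U i \<and> finite F \<and> (\<forall>u\<in>U i. \<exists>v\<in>F. \<forall>j\<in>{0..m}. q v j \<le> q u j)"
    using dickson[of "{0..m}" _ q] by blast
  from choice[OF this] obtain F where
    F: "\<forall>i. F i \<subseteq> U i \<and> finite (F i) \<and> (\<forall>u\<in>U i. \<exists>v\<in>F i. \<forall>j\<in>{0..m}. q v j \<le> q u j)" ..
  define G where "G = Sigma {1..d} F"
  have finG: "finite G" unfolding G_def using F by (intro finite_SigmaI) auto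
  have "\<forall>g\<in>G. \<exists>fb. case (g, fb) of ((i, s, a), (f, b)) \<Rightarrow> HL f (a + mu i) \<and> nrm s f b"
  proof
    fix g assume g: "g \<in> G"
    obtain i s a where gi: "g = (i, s, a)" by (cases g) auto
    have "(s, a) \<in> U i" using g F unfolding G_def gi by blast
    then obtain f where f: "\<forall>\<gamma>\<in>keys f. edeg \<gamma> \<le> s" "HL f (a + mu i)" by (auto simp: U_def Lam_def)
    then obtain b where "nrm s f b" using ex_nrm[of f s] by (auto simp: HL_def)
    then show "\<exists>fb. case (g, fb) of ((i, s, a), (f, b)) \<Rightarrow> HL f (a + mu i) \<and> nrm s f b"
      using f(2) by (intro exI[of _ "(f, b)"]) (simp add: gi)
  qed
  from bchoice[OF this] obtain fb where
    fb: "\<forall>g\<in>G. case (g, fb g) of ((i, s, a), (f, b)) \<Rightarrow> HL f (a + mu i) \<and> nrm s f b" ..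
  obtain C1 where C1: "C1 \<ge> 1"
    "\<forall>a N f b. keys a \<subseteq> {1..m} \<longrightarrow> nrm N f b \<longrightarrow> nrm (N + edeg a) (zmon a * f) (C1 ^ edeg a * b)"
    using nrm_zmon_growth by blast
  define B where "B = 1 + (\<Sum>g\<in>G. \<bar>snd (fb g)\<bar>)"
  have B1: "B \<ge> 1" by (simp add: B_def sum_nonneg)
  have Bb: "snd (fb g) \<le> B" if "g \<in> G" for g
  proof -
    have "\<bar>snd (fb g)\<bar> \<le> (\<Sum>g\<in>G. \<bar>snd (fb g)\<bar>)" by (rule member_le_sum) (use that finG in auto)
    then show ?thesis by (simp add: B_def)
  qed
  have "\<exists>f. HL f \<theta> \<and> nrm s f ((C1 * B) ^ (s + 1))" if \<theta>: "\<theta> \<in> Lam s" for \<theta> s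
  proof -
    have "\<theta> \<in> ExtE" using \<theta> by (auto simp: Lam_def HL_def)
    then obtain a i where a: "keys a \<subseteq> {1..m}" "i \<in> {1..d}" "\<theta> = a + mu i" by (auto simp: ExtE_def)
    have "(s, a) \<in> U i" using a \<theta> by (simp add: U_def)
    then obtain v where v: "v \<in> F i" "\<forall>j\<in>{0..m}. q v j \<le> q (s, a) j" using F by blast
    obtain s' a' where v': "v = (s', a')" by (cases v)
    have g: "(i, s', a') \<in> G" using v(1) a(2) by (simp add: G_def v')
    have "(s', a') \<in> U i" using v(1) F v' by blast
    then have a'k: "keys a' \<subseteq> {1..m}" and a'L: "a' + mu i \<in> Lam s'" by (auto simp: U_def)
    have le: "lookup a' j \<le> lookup a j" for j
    proof (cases "j \<in> {1..m}")
      case True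
      then show ?thesis using v(2)[rule_format, of j] by (simp add: q_def v')
    next
      case False
      then have "j \<notin> keys a'" using a'k by blast
      then show ?thesis by (simp add: in_keys_iff)
    qed
    define b where "b = a - a'"
    have ab: "a = b + a'" using le by (intro poly_mapping_eqI) (simp add: b_def lookup_add lookup_minus)
    have bk: "keys b \<subseteq> {1..m}" using a(1) ab by (simp add: keys_expo_add)
    have "edeg a' + t \<le> s' + edeg c0" "edeg a + t \<le> s + edeg c0"
      using a'L \<theta> mu_edeg[OF a(2)] by (auto simp: Lam_def StdS_def a(3))
    moreover have "s' + edeg c0 - (edeg a' + t) \<le> s + edeg c0 - (edeg a + t)"
      using v(2)[rule_format, of 0] by (simp add: q_def v')
    ultimately have sb: "s' + edeg b \<le> s" by (simp add: ab)
    obtain f y where fy: "fb (i, s', a') = (f, y)" by (cases "fb (i, s', a')")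
    have f: "HL f (a' + mu i)" "nrm s' f y" using fb[rule_format, OF g] by (simp_all add: fy)
    have y: "y \<le> B" using Bb[OF g] by (simp add: fy)
    have "HL (zmon b * f) \<theta>" using HL_zmon[OF f(1) bk] by (simp add: a(3) ab add.assoc)
    moreover have "nrm s (zmon b * f) ((C1 * B) ^ (s + 1))"
    proof (rule nrm_mono[OF _ sb])
      show "nrm (s' + edeg b) (zmon b * f) (C1 ^ edeg b * B)"
        using C1(2)[rule_format, OF bk nrm_mono[OF f(2) order_refl y]] .
      have "C1 ^ edeg b \<le> C1 ^ (s + 1)" using C1(1) sb by (intro power_increasing) auto
      moreover have "B ^ 1 \<le> B ^ (s + 1)" using B1 by (intro power_increasing) auto
      ultimately show "C1 ^ edeg b * B \<le> (C1 * B) ^ (s + 1)"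
        unfolding power_mult_distrib using C1(1) B1 by (intro mult_mono) auto
    qed
    ultimately show ?thesis by blast
  qed
  moreover have "1 * 1 \<le> C1 * B" by (rule mult_mono) (use C1(1) B1 in auto)
  ultimately show ?thesis by (intro exI[of _ "C1 * B"]) auto
qed

text \<open>
  For these exponents the basis elements themselves serve as \<open>f\<close>.
\<close>

lemma Lam_shift: "(+) c0 ` (ExtE \<inter> StdS s) \<subseteq> Lam s"
proof
  fix \<theta> assume "\<theta> \<in> (+) c0 ` (ExtE \<inter> StdS s)"
  then obtain \<gamma> where g: "\<gamma> \<in> ExtE" "\<gamma> \<in> StdS s" "\<theta> = c0 + \<gamma>" by blast
  have "\<theta> \<in> StdS (s + edeg c0)"
    using Ext_Std[OF zmon_eb_ext(1)[OF g(1) c0_keys]] g(2,3) by (simp add: StdS_def)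
  moreover have "\<forall>\<delta>\<in>keys (eb \<gamma>). edeg \<delta> \<le> s" using g(2) eb_keys(1)[of \<gamma>] by (auto simp: StdS_def)
  ultimately show "\<theta> \<in> Lam s" unfolding Lam_def g(3) using HL_eb[OF g(1)] by blast
qed

lemma card_Lam_rest: "card (Lam s - (+) c0 ` (ExtE \<inter> StdS s)) = card (OrdE \<inter> StdS s)"
proof -
  have "card ((+) c0 ` (ExtE \<inter> StdS s)) = card (ExtE \<inter> StdS s)"
    by (rule card_image) (simp add: inj_on_def)
  moreover have "card (StdS s) = card (OrdE \<inter> StdS s) + card (ExtE \<inter> StdS s)"
  proof (subst card_Un_disjoint[symmetric])
    show "(OrdE \<inter> StdS s) \<inter> (ExtE \<inter> StdS s) = {}" using Ord_Ext by blast
    have "OrdE \<inter> StdS s \<union> ExtE \<inter> StdS s = StdS s" using Std_Ord_Ext by (auto simp: StdS_def)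
    then show "card (StdS s) = card (OrdE \<inter> StdS s \<union> ExtE \<inter> StdS s)" by simp
  qed auto
  ultimately show ?thesis
    using card_Diff_subset[OF finite_subset[OF Lam_shift finite_Lam] Lam_shift, of s] card_Lam[of s] by simp
qed

text \<open>
  In grevlex order, \<open>h\<close> times the functions realising \<open>Lam s\<close> is a triangular system with leading exponents \<open>Lam s\<close>, so each
  of its Chebyshev constants is at least the corresponding \<open>T \<theta>\<close>.
\<close>

lemma prod_T_le_vdm_sup:
  assumes F: "\<forall>\<theta>\<in>Lam s. HL (F \<theta>) \<theta>"
  defines "el \<equiv> enum_by grevlex (Lam s)"
  shows "bij_betw el {..<card (StdS s)} (Lam s)"
    and "(\<Prod>\<theta>\<in>Lam s. T \<theta>) \<le> vdm_sup (\<lambda>k. h * F (el k)) K (card (StdS s))"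
proof -
  have irr: "\<not> grevlex x x" for x by simp
  have tr: "grevlex x z" if "grevlex x y" "grevlex y z" for x y z using that by (rule grevlex_trans)
  have tot: "x = y \<or> grevlex x y \<or> grevlex y x" for x y by (rule grevlex_total)
  have bij: "bij_betw el {..<card (Lam s)} (Lam s)"
    unfolding el_def by (rule enum_by_initial_segment(1)[OF irr tr tot finite_Lam order_refl])
  have mono: "\<exists>i j. i < j \<and> j < card (Lam s) \<and> el i = x \<and> el j = y" if "x \<in> Lam s" "y \<in> Lam s" "grevlex x y" for x y
    unfolding el_def by (rule enum_by_initial_segment(2)[OF irr tr tot finite_Lam order_refl _ that])
  show bij': "bij_betw el {..<card (StdS s)} (Lam s)" using bij by (simp add: card_Lam)
  have elL: "el k \<in> Lam s" if "k < card (StdS s)" for k using bij' that by (auto simp: bij_betw_def)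
  have less: "grevlex (el j) (el k)" if "j < k" "k < card (StdS s)" for j k
  proof (rule ccontr)
    assume "\<not> ?thesis"
    moreover have "el j \<noteq> el k" using bij' that by (auto simp: bij_betw_def inj_on_def)
    ultimately have "grevlex (el k) (el j)" using grevlex_total by blast
    from mono[OF elL elL this] that obtain i i' where i: "i < i'" "i' < card (Lam s)" "el i = el k" "el i' = el j" by auto
    have "i = k" "i' = j" using inj_onD[OF bij_betw_imp_inj_on[OF bij] i(3)] inj_onD[OF bij_betw_imp_inj_on[OF bij] i(4)] i(1,2) that
      by (auto simp: card_Lam)
    then show False using i(1) that(1) by simp
  qed
  have "\<forall>\<theta>\<in>Lam s. \<exists>g. g \<in> cpoly.span (eb ` Below \<theta>) \<and> eqV V (h * F \<theta>) (eb \<theta> + g)"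
  proof
    fix \<theta> assume "\<theta> \<in> Lam s"
    then obtain g where g: "g \<in> cpoly.span (eb ` {\<delta>\<in>ExtE. grevlex \<delta> \<theta>})" "eqV V (h * F \<theta>) (eb \<theta> + g)"
      using F by (auto simp: HL_def)
    have "eb ` {\<delta>\<in>ExtE. grevlex \<delta> \<theta>} \<subseteq> eb ` Below \<theta>" using Ext_Std by (intro image_mono) (auto simp: Below_def)
    from subsetD[OF cpoly.span_mono[OF this] g(1)] g(2)
    show "\<exists>g. g \<in> cpoly.span (eb ` Below \<theta>) \<and> eqV V (h * F \<theta>) (eb \<theta> + g)" by blast
  qed
  from bchoice[OF this] obtain g where
    g: "\<forall>\<theta>\<in>Lam s. g \<theta> \<in> cpoly.span (eb ` Below \<theta>) \<and> eqV V (h * F \<theta>) (eb \<theta> + g \<theta>)" ..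
  have FP: "h * F \<theta> \<in> polys {1..n}" "\<theta> \<in> Std" if "\<theta> \<in> Lam s" for \<theta>
    using F that polys_mult[OF hn] Ext_Std by (auto simp: HL_def)
  have "(\<Prod>\<theta>\<in>Lam s. T \<theta>) = (\<Prod>k<card (StdS s). T (el k))"
    by (rule prod.reindex_bij_betw[OF bij', symmetric])
  also have "\<dots> \<le> vdm_sup (\<lambda>k. h * F (el k)) K (card (StdS s))"
  proof (rule prod_le_vdm_sup[OF K])
    fix k assume k: "k < card (StdS s)"
    show "0 \<le> T (el k)" by (rule T_nonneg[OF FP(2)[OF elL[OF k]]])
    fix c :: "nat \<Rightarrow> complex"
    define G where "G = g (el k) + (\<Sum>j<k. cscale (c j) (eb (el j) + g (el j)))"
    have G: "G \<in> cpoly.span (eb ` Below (el k))"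
      unfolding G_def
    proof (intro cpoly.span_add cpoly.span_sum cpoly.span_scale)
      show "g (el k) \<in> cpoly.span (eb ` Below (el k))" using g elL[OF k] by blast
      fix j assume "j \<in> {..<k}"
      then have j: "j < k" "j < card (StdS s)" using k by auto
      show "eb (el j) \<in> cpoly.span (eb ` Below (el k))"
        using less[OF j(1) k] FP(2)[OF elL[OF j(2)]] by (intro cpoly.span_base imageI) (simp add: Below_def)
      have "eb ` Below (el j) \<subseteq> eb ` Below (el k)"
        using less[OF j(1) k] grevlex_trans by (intro image_mono) (auto simp: Below_def)
      from subsetD[OF cpoly.span_mono[OF this]] show "g (el j) \<in> cpoly.span (eb ` Below (el k))"
        using g elL[OF j(2)] by blast
    qed
    have "eqV V (h * F (el k) + (\<Sum>j<k. cscale (c j) (h * F (el j)))) (eb (el k) + G)"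
      unfolding eqV_def
    proof
      fix a assume a: "a \<in> V"
      have e: "peval a (h * F (el j)) = peval a (eb (el j) + g (el j))" if "j < card (StdS s)" for j
        using g elL[OF that] a by (simp add: eqV_def)
      have "(\<Sum>j<k. c j * peval a (h * F (el j))) = (\<Sum>j<k. c j * peval a (eb (el j) + g (el j)))"
        by (rule sum.cong) (use e k in auto)
      then show "peval a (h * F (el k) + (\<Sum>j<k. cscale (c j) (h * F (el j)))) = peval a (eb (el k) + G)"
        using e[OF k] by (simp add: G_def)
    qed
    moreover have "h * F (el k) + (\<Sum>j<k. cscale (c j) (h * F (el j))) \<in> polys {1..n}"
      by (intro polys_add polys_sum polys_cscale FP(1) elL) (use k in auto)
    ultimately have "adm (el k) (h * F (el k) + (\<Sum>j<k. cscale (c j) (h * F (el j))))"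
      unfolding adm_def using G by blast
    then show "T (el k) \<le> supK K (h * F (el k) + (\<Sum>j<k. cscale (c j) (h * F (el j))))" by (rule T_le)
  qed
  finally show "(\<Prod>\<theta>\<in>Lam s. T \<theta>) \<le> vdm_sup (\<lambda>k. h * F (el k)) K (card (StdS s))" .
qed

text \<open>
  Multiplying all functions by \<open>h\<close> multiplies the determinant by the product of the values of \<open>h\<close> at
  the points.
\<close>

lemma vdm_sup_mult:
  "vdm_sup (\<lambda>k. h * u k) K M \<le> (max 1 (supK K h)) ^ M * vdm_sup u K M"
proof (rule vdm_sup_least)
  show "0 \<le> (max 1 (supK K h)) ^ M * vdm_sup u K M" by (simp add: vdm_sup_nonneg[OF K])
  fix \<zeta> :: "nat \<Rightarrow> nat \<Rightarrow> complex" assume \<zeta>: "\<And>i. i < M \<Longrightarrow> \<zeta> i \<in> K"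
  have "vandermonde (\<lambda>k. h * u k) M \<zeta> = (\<Prod>i<M. peval (\<zeta> i) h) * vandermonde u M \<zeta>"
    using det_scale_rows_cols[of M "\<lambda>i. peval (\<zeta> i) h" "\<lambda>i j. peval (\<zeta> i) (u j)" "\<lambda>_. 1"]
    by (simp add: vandermonde_def)
  then have "cmod (vandermonde (\<lambda>k. h * u k) M \<zeta>) = (\<Prod>i<M. cmod (peval (\<zeta> i) h)) * cmod (vandermonde u M \<zeta>)"
    by (simp add: norm_mult prod_norm)
  also have "\<dots> \<le> (\<Prod>i<M. max 1 (supK K h)) * vdm_sup u K M"
  proof (rule mult_mono)
    show "(\<Prod>i<M. cmod (peval (\<zeta> i) h)) \<le> (\<Prod>i<M. max 1 (supK K h))"
      using supK_upper[OF K \<zeta>] by (intro prod_mono) (auto simp: le_max_iff_disj)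
  qed (auto intro: vdm_sup_upper[OF K \<zeta>] prod_nonneg)
  finally show "cmod (vandermonde (\<lambda>k. h * u k) M \<zeta>) \<le> (max 1 (supK K h)) ^ M * vdm_sup u K M" by simp
qed

text \<open>
  Remove \<open>h\<close> and express the functions realising \<open>Lam s\<close> in the basis \<open>eb\<close>.  The row sums are \<open>1\<close> except at as many
  exponents as there are ordinary ones.
\<close>

lemma vdm_eb_lower:
  "\<exists>\<rho>\<ge>1. \<exists>C\<ge>1. \<forall>s. (\<Prod>\<theta>\<in>Lam s. T \<theta>) \<le> \<rho> ^ card (StdS s) * C ^ ((s + 1) * card (OrdE \<inter> StdS s))
     * vdm_sup (\<lambda>k. eb (en k)) K (card (StdS s))"
proof -
  obtain C where C: "C \<ge> 1" "\<forall>s. \<forall>\<theta>\<in>Lam s. \<exists>f. HL f \<theta> \<and> nrm s f (C ^ (s + 1))" using Lam_bounded by blast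
  define \<rho> where "\<rho> = max 1 (supK K h)"
  have "(\<Prod>\<theta>\<in>Lam s. T \<theta>) \<le> \<rho> ^ card (StdS s) * C ^ ((s + 1) * card (OrdE \<inter> StdS s))
     * vdm_sup (\<lambda>k. eb (en k)) K (card (StdS s))" for s
  proof -
    let ?I = "(+) c0 ` (ExtE \<inter> StdS s)" and ?M = "card (StdS s)"
    define B where "B \<theta> = (if \<theta> \<in> ?I then 1 else C ^ (s + 1))" for \<theta>
    have "\<forall>\<theta>\<in>Lam s. \<exists>f. HL f \<theta> \<and> nrm s f (B \<theta>)"
    proof
      fix \<theta> assume \<theta>: "\<theta> \<in> Lam s"
      show "\<exists>f. HL f \<theta> \<and> nrm s f (B \<theta>)"
      proof (cases "\<theta> \<in> ?I")
        case True
        then obtain \<gamma> where "\<gamma> \<in> ExtE" "\<gamma> \<in> StdS s" "\<theta> = c0 + \<gamma>" by blast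
        then show ?thesis using HL_eb nrm_eb True by (intro exI[of _ "eb \<gamma>"]) (simp add: B_def)
      next
        case False
        then show ?thesis using C(2)[rule_format, OF \<theta>] by (simp add: B_def)
      qed
    qed
    from bchoice[OF this] obtain F where F: "\<forall>\<theta>\<in>Lam s. HL (F \<theta>) \<theta> \<and> nrm s (F \<theta>) (B \<theta>)" ..
    then have "\<forall>\<theta>\<in>Lam s. \<exists>x. coords (StdS s) (F \<theta>) x \<and> (\<Sum>\<delta>\<in>StdS s. cmod (x \<delta>)) \<le> B \<theta>"
      by (simp add: nrm_def)
    from bchoice[OF this] obtain x where x: "\<forall>\<theta>\<in>Lam s. coords (StdS s) (F \<theta>) (x \<theta>) \<and> (\<Sum>\<delta>\<in>StdS s. cmod (x \<theta> \<delta>)) \<le> B \<theta>" ..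
    have F': "\<forall>\<theta>\<in>Lam s. HL (F \<theta>) \<theta>" using F by blast
    define el where "el = enum_by grevlex (Lam s)"
    have el: "bij_betw el {..<?M} (Lam s)" "(\<Prod>\<theta>\<in>Lam s. T \<theta>) \<le> vdm_sup (\<lambda>k. h * F (el k)) K ?M"
      using prod_T_le_vdm_sup[OF F'] by (simp_all add: el_def)
    note el(2)
    also have "vdm_sup (\<lambda>k. h * F (el k)) K ?M \<le> \<rho> ^ ?M * vdm_sup (\<lambda>k. F (el k)) K ?M"
      unfolding \<rho>_def by (rule vdm_sup_mult)
    also have "vdm_sup (\<lambda>k. F (el k)) K ?M \<le> (\<Prod>\<theta>\<in>Lam s. B \<theta>) * vdm_sup (\<lambda>k. eb (en k)) K ?M"
    proof (rule vdm_sup_transition[OF K el(1) en_bij, where r = "\<lambda>_. 1" and r' = "\<lambda>_. 1" and x = x])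
      show "peval a (F \<theta>) = (\<Sum>s'\<in>StdS s. x \<theta> s' * peval a (eb s'))" if "a \<in> K" "\<theta> \<in> Lam s" for a \<theta>
        using x that KV by (auto simp: coords_def)
      show "(\<Sum>s'\<in>StdS s. cmod (x \<theta> s') / 1) \<le> B \<theta> / 1" if "\<theta> \<in> Lam s" for \<theta>
        using x that by simp
    qed simp_all
    also have "(\<Prod>\<theta>\<in>Lam s. B \<theta>) = (\<Prod>\<theta>\<in>Lam s - ?I. C ^ (s + 1))"
      by (rule prod.mono_neutral_cong_right) (auto simp: B_def)
    also have "\<dots> = C ^ ((s + 1) * card (OrdE \<inter> StdS s))"
      by (simp add: card_Lam_rest flip: power_mult)
    finally show ?thesis by (simp add: \<rho>_def mult.assoc)
  qed
  moreover have "\<rho> \<ge> 1" by (simp add: \<rho>_def)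
  ultimately show ?thesis using C(1) by blast
qed

end

section \<open>Asymptotics of the maximal determinants\<close>

lemma shift_ratio: "(\<lambda>s. real (s + a - b) / real s) \<longlonglongrightarrow> 1"
proof -
  have 1: "(\<lambda>s. (real a - real b) * inverse (real s)) \<longlonglongrightarrow> (real a - real b) * 0"
    by (intro tendsto_mult tendsto_const LIMSEQ_inverse_real_of_nat[THEN filterlim_sequentially_Suc[THEN iffD1]])
  have "(\<lambda>s. 1 + (real a - real b) * inverse (real s)) \<longlonglongrightarrow> 1 + (real a - real b) * 0"
    by (intro tendsto_add tendsto_const 1)
  moreover have "\<forall>\<^sub>F s in sequentially. 1 + (real a - real b) * inverse (real s) = real (s + a - b) / real s"
    using eventually_ge_at_top[of "b + 1"]
  proof eventually_elim
    case (elim s)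
    then have "real (s + a - b) = real s + (real a - real b)" by (simp add: of_nat_diff)
    then show ?case using elim by (simp add: field_simps)
  qed
  ultimately show ?thesis by (simp add: Lim_transform_eventually)
qed

lemma filterlim_shift: "filterlim (\<lambda>s::nat. s + a - b) at_top sequentially"
  unfolding filterlim_at_top
proof
  fix Z :: nat
  show "\<forall>\<^sub>F s in sequentially. Z \<le> s + a - b"
    using eventually_ge_at_top[of "Z + b"] by eventually_elim simp
qed

lemma tendsto_shift_growth:
  fixes f :: "nat \<Rightarrow> real"
  assumes "(\<lambda>s. f s / real s ^ k) \<longlonglongrightarrow> l"
  shows "(\<lambda>s. f (s + a - b) / real s ^ k) \<longlonglongrightarrow> l"
proof -
  have "(\<lambda>s. f (s + a - b) / real (s + a - b) ^ k * (real (s + a - b) / real s) ^ k) \<longlonglongrightarrow> l * 1 ^ k"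
    by (intro tendsto_mult tendsto_power shift_ratio filterlim_compose[OF assms filterlim_shift])
  moreover have "\<forall>\<^sub>F s in sequentially. f (s + a - b) / real (s + a - b) ^ k * (real (s + a - b) / real s) ^ k
      = f (s + a - b) / real s ^ k"
    using eventually_ge_at_top[of "b + 1"] by eventually_elim (simp add: power_divide)
  ultimately show ?thesis by (simp add: Lim_transform_eventually)
qed

text \<open>
  Rewrite the exponent \<open>1 / L s\<close> as \<open>1 / u^k\<close> times a convergent factor, where \<open>u = s + a - b\<close>.  A limit \<open>x = 0\<close> is allowed, since
  the factor has a positive limit.
\<close>

lemma tendsto_shift_root:
  fixes P L :: "nat \<Rightarrow> real"
  assumes P: "(\<lambda>s. P s powr (1 / real s ^ k)) \<longlonglongrightarrow> x" "\<And>s. P s \<ge> 0"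
    and L: "(\<lambda>s. L s / real s ^ k) \<longlonglongrightarrow> l" "l > 0"
  shows "(\<lambda>s. P (s + a - b) powr (1 / L s)) \<longlonglongrightarrow> x powr (1 / l)"
proof -
  let ?u = "\<lambda>s. s + a - b"
  have 1: "(\<lambda>s. P (?u s) powr (1 / real (?u s) ^ k)) \<longlonglongrightarrow> x"
    by (rule filterlim_compose[OF P(1) filterlim_shift])
  have "(\<lambda>s. (real (?u s) / real s) ^ k * (1 / (L s / real s ^ k))) \<longlonglongrightarrow> 1 ^ k * (1 / l)"
    using L by (intro tendsto_mult tendsto_power shift_ratio tendsto_divide tendsto_const) auto
  then have 2: "(\<lambda>s. (real (?u s) / real s) ^ k * (1 / (L s / real s ^ k))) \<longlonglongrightarrow> 1 / l" by simp
  have "(\<lambda>s. (P (?u s) powr (1 / real (?u s) ^ k)) powr ((real (?u s) / real s) ^ k * (1 / (L s / real s ^ k)))) \<longlonglongrightarrow> x powr (1 / l)"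
    by (rule tendsto_powr'[OF 1 2]) (use L(2) in auto)
  moreover have "\<forall>\<^sub>F s in sequentially. (P (?u s) powr (1 / real (?u s) ^ k)) powr ((real (?u s) / real s) ^ k * (1 / (L s / real s ^ k)))
      = P (?u s) powr (1 / L s)"
    using eventually_ge_at_top[of "b + 1"]
  proof eventually_elim
    case (elim s)
    then have "real (?u s) ^ k \<noteq> 0" "real s ^ k \<noteq> 0" by auto
    moreover have "1 / X * (X / Y * (1 / (z / Y))) = 1 / z" if "X \<noteq> 0" "Y \<noteq> 0" for X Y z :: real
      using that by simp
    ultimately have "1 / real (?u s) ^ k * ((real (?u s) / real s) ^ k * (1 / (L s / real s ^ k))) = 1 / L s"
      unfolding power_divide by blast
    then show ?case by (simp only: powr_powr)
  qed
  ultimately show ?thesis by (rule Lim_transform_eventually)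
qed

lemma negligible_growth:
  "(\<lambda>s. real (s + 1) ^ m * (1 + ln (real (s + 1))) / real s ^ (m + 1)) \<longlonglongrightarrow> 0"
proof -
  have "(\<lambda>s. (real (s + 1 - 0) / real s) ^ m * ((1 + ln (real s + 1)) / real s)) \<longlonglongrightarrow> 1 ^ m * 0"
    by (intro tendsto_mult tendsto_power shift_ratio) real_asymp
  moreover have "(real (s + 1 - 0) / real s) ^ m * ((1 + ln (real s + 1)) / real s) =
      real (s + 1) ^ m * (1 + ln (real (s + 1))) / real s ^ (m + 1)" for s
    by (simp add: power_divide add.commute power_add mult.commute)
  ultimately show ?thesis by simp
qed

context conductor_setup
begin

abbreviation Nst :: "nat \<Rightarrow> nat" where "Nst s \<equiv> card (StdS s)"
definition Ls :: "nat \<Rightarrow> real" where "Ls s = real (\<Sum>\<gamma>\<in>StdS s. edeg \<gamma>)"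
definition ExtS :: "nat \<Rightarrow> expo set" where "ExtS s = ExtE \<inter> StdS s"
definition OrdS :: "nat \<Rightarrow> expo set" where "OrdS s = OrdE \<inter> StdS s"

lemma finite_ExtS [simp]: "finite (ExtS s)" and finite_OrdS [simp]: "finite (OrdS s)"
  by (simp_all add: ExtS_def OrdS_def)

lemma StdS_split: "StdS s = OrdS s \<union> ExtS s" "OrdS s \<inter> ExtS s = {}"
  using Std_Ord_Ext Ord_Ext by (auto simp: StdS_def OrdS_def ExtS_def)

lemma card_OrdS: "(s + 1) * card (OrdS s) \<le> card QO * (s + 1) ^ m"
proof -
  have "(s + 1) * card (OrdS s) \<le> (s + 1) * (card QO * (s + 1) ^ (m - 1))"
    unfolding OrdS_def by (rule mult_left_mono[OF card_Ord_le]) simp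
  also have "\<dots> = card QO * ((s + 1) * (s + 1) ^ (m - 1))" by (simp only: mult.left_commute)
  also have "(s + 1) * (s + 1) ^ (m - 1) = (s + 1) ^ m" using m1 by (cases m) (auto simp: One_nat_def)
  finally show ?thesis .
qed

text \<open>
  For \<open>s \<ge> t\<close> only: below, the truncated difference \<open>s - t\<close> would give spurious elements.
\<close>

lemma ExtS_bij:
  assumes "t \<le> s"
  shows "bij_betw (\<lambda>(i, a). a + mu i) ({1..d} \<times> expos {1..m} (s - t)) (ExtS s)"
  unfolding bij_betw_def
proof
  show "inj_on (\<lambda>(i, a). a + mu i) ({1..d} \<times> expos {1..m} (s - t))"
  proof (rule inj_onI)
    fix x y assume xy: "x \<in> {1..d} \<times> expos {1..m} (s - t)" "y \<in> {1..d} \<times> expos {1..m} (s - t)"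
      "(case x of (i, a) \<Rightarrow> a + mu i) = (case y of (i, a) \<Rightarrow> a + mu i)"
    obtain i a j b where e: "x = (i, a)" "y = (j, b)" by (cases x, cases y) auto
    then show "x = y" using xy ext_inj[of a i b j] by (simp add: expos_def)
  qed
  show "(\<lambda>(i, a). a + mu i) ` ({1..d} \<times> expos {1..m} (s - t)) = ExtS s"
  proof (intro equalityI subsetI)
    fix x assume "x \<in> (\<lambda>(i, a). a + mu i) ` ({1..d} \<times> expos {1..m} (s - t))"
    then obtain i a where a: "i \<in> {1..d}" "keys a \<subseteq> {1..m}" "edeg a \<le> s - t" "x = a + mu i" by (auto simp: expos_def)
    then show "x \<in> ExtS s" using ExtI[OF a(2,1)] Ext_Std[OF ExtI[OF a(2,1)]] assms mu_edeg[OF a(1)]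
      by (simp add: ExtS_def StdS_def)
  next
    fix x assume x: "x \<in> ExtS s"
    then obtain a i where a: "keys a \<subseteq> {1..m}" "i \<in> {1..d}" "x = a + mu i" by (auto simp: ExtS_def ExtE_def)
    then have "edeg a + t \<le> s" using x mu_edeg[OF a(2)] by (simp add: ExtS_def StdS_def)
    then show "x \<in> (\<lambda>(i, a). a + mu i) ` ({1..d} \<times> expos {1..m} (s - t))"
      using a by (intro image_eqI[of _ _ "(i, a)"]) (auto simp: expos_def)
  qed
qed

lemma sum_ExtS: "t \<le> s \<Longrightarrow> (\<Sum>\<gamma>\<in>ExtS s. f \<gamma>) = (\<Sum>i=1..d. \<Sum>a\<in>expos {1..m} (s - t). f (a + mu i))"
  unfolding sum.cartesian_product by (subst sum.reindex_bij_betw[OF ExtS_bij, symmetric]) (auto intro!: sum.cong)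

lemma prod_ExtS: "t \<le> s \<Longrightarrow> (\<Prod>\<gamma>\<in>ExtS s. f \<gamma>) = (\<Prod>i=1..d. \<Prod>a\<in>expos {1..m} (s - t). f (a + mu i))"
  unfolding prod.cartesian_product by (subst prod.reindex_bij_betw[OF ExtS_bij, symmetric]) (auto intro!: prod.cong)

lemma N_bound: "\<exists>c\<ge>1. \<forall>s. real (Nst s) \<le> c * real (s + 1) ^ m"
proof -
  have "Nst s \<le> (card QO + d + 1) * (s + 1) ^ m" for s
  proof -
    have "ExtS s \<subseteq> (\<lambda>(i, a). a + mu i) ` ({1..d} \<times> expos {1..m} s)"
    proof
      fix x assume x: "x \<in> ExtS s"
      then obtain a i where a: "keys a \<subseteq> {1..m}" "i \<in> {1..d}" "x = a + mu i" by (auto simp: ExtS_def ExtE_def)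
      then have "edeg a \<le> s" using x by (simp add: ExtS_def StdS_def)
      then show "x \<in> (\<lambda>(i, a). a + mu i) ` ({1..d} \<times> expos {1..m} s)"
        using a by (intro image_eqI[of _ _ "(i, a)"]) (auto simp: expos_def)
    qed
    then have "card (ExtS s) \<le> card ({1..d} \<times> expos {1..m} s)"
      by (rule surj_card_le[rotated]) simp
    also have "\<dots> \<le> d * (s + 1) ^ m"
      using card_expos_le[of "{1..m}" s] by (simp add: card_cartesian_product)
    finally have "card (ExtS s) \<le> d * (s + 1) ^ m" .
    moreover have "card (OrdS s) \<le> card QO * (s + 1) ^ m"
      using card_OrdS[of s] by (rule order_trans[rotated]) simp
    ultimately have "card (OrdS s) + card (ExtS s) \<le> (card QO + d + 1) * (s + 1) ^ m"
      by (simp add: distrib_right)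
    then show ?thesis using card_Un_le[of "OrdS s" "ExtS s"] StdS_split(1)[of s] by simp
  qed
  then have "real (Nst s) \<le> real ((card QO + d + 1) * (s + 1) ^ m)" for s using of_nat_le_iff by blast
  then have "real (Nst s) \<le> real (card QO + d + 1) * real (s + 1) ^ m" for s by (simp only: of_nat_mult of_nat_power)
  then show ?thesis by (intro exI[of _ "real (card QO + d + 1)"]) auto
qed

text \<open>
  Factors of size \<open>exp (O(s ^ m log s))\<close>; their \<open>l_s\<close>-th roots tend to 1 (\<open>negl_root\<close>).
\<close>

definition negl :: "(nat \<Rightarrow> real) \<Rightarrow> bool" where
  "negl g \<longleftrightarrow> (\<exists>c. \<forall>s. 1 \<le> g s \<and> ln (g s) \<le> c * (real (s + 1) ^ m * (1 + ln (real (s + 1)))))"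

lemma negl_mult:
  assumes "negl g" "negl g'" shows "negl (\<lambda>s. g s * g' s)"
proof -
  obtain c where c: "\<forall>s. 1 \<le> g s \<and> ln (g s) \<le> c * (real (s + 1) ^ m * (1 + ln (real (s + 1))))" using assms(1) by (auto simp: negl_def)
  obtain c' where c': "\<forall>s. 1 \<le> g' s \<and> ln (g' s) \<le> c' * (real (s + 1) ^ m * (1 + ln (real (s + 1))))" using assms(2) by (auto simp: negl_def)
  have "1 \<le> g s * g' s \<and> ln (g s * g' s) \<le> (c + c') * (real (s + 1) ^ m * (1 + ln (real (s + 1))))" for s
  proof
    have g: "1 \<le> g s" "1 \<le> g' s" using c c' by auto
    then show "1 \<le> g s * g' s" using mult_mono[of 1 "g s" 1 "g' s"] by simp
    have "ln (g s * g' s) = ln (g s) + ln (g' s)" using g by (intro ln_mult_pos) auto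
    also have "\<dots> \<le> c * (real (s + 1) ^ m * (1 + ln (real (s + 1)))) + c' * (real (s + 1) ^ m * (1 + ln (real (s + 1))))"
      using c c' by (intro add_mono) auto
    finally show "ln (g s * g' s) \<le> (c + c') * (real (s + 1) ^ m * (1 + ln (real (s + 1))))"
      by (simp only: distrib_right)
  qed
  then show ?thesis unfolding negl_def by blast
qed

lemma growth_ge: "real (s + 1) ^ m \<le> real (s + 1) ^ m * (1 + ln (real (s + 1)))"
  using mult_left_mono[of 1 "1 + ln (real (s + 1))" "real (s + 1) ^ m"] by simp

lemma negl_power:
  assumes "G \<ge> 1" "c \<ge> 0" "\<And>s. real (e s) \<le> c * real (s + 1) ^ m" shows "negl (\<lambda>s. G ^ e s)"
  unfolding negl_def
proof (intro exI[of _ "ln G * c"] allI conjI)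
  fix s
  show "1 \<le> G ^ e s" using assms(1) by simp
  have lG: "0 \<le> ln G" using assms(1) by simp
  have "ln (G ^ e s) = ln G * real (e s)" using assms(1) by (simp add: ln_realpow)
  also have "\<dots> \<le> ln G * (c * (real (s + 1) ^ m * (1 + ln (real (s + 1)))))"
    by (rule mult_left_mono[OF order_trans[OF assms(3) mult_left_mono[OF growth_ge assms(2)]] lG])
  finally show "ln (G ^ e s) \<le> ln G * c * (real (s + 1) ^ m * (1 + ln (real (s + 1))))" by (simp only: mult.assoc)
qed

lemma negl_power_N: "G \<ge> 1 \<Longrightarrow> negl (\<lambda>s. G ^ Nst s)"
proof -
  assume G: "G \<ge> 1"
  obtain c where c: "c \<ge> 1" "\<forall>s. real (Nst s) \<le> c * real (s + 1) ^ m" using N_bound by blast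
  show ?thesis by (rule negl_power[OF G, of c]) (use c in auto)
qed

lemma negl_power_OrdS: "G \<ge> 1 \<Longrightarrow> negl (\<lambda>s. G ^ ((s + 1) * card (OrdS s)))"
proof (rule negl_power)
  fix s
  show "real ((s + 1) * card (OrdS s)) \<le> real (card QO) * real (s + 1) ^ m"
    using card_OrdS[of s] by (metis of_nat_le_iff of_nat_mult of_nat_power)
qed auto

lemma negl_fact: "negl (\<lambda>s. fact (Nst s))"
proof -
  obtain c where c: "c \<ge> 1" "\<forall>s. real (Nst s) \<le> c * real (s + 1) ^ m" using N_bound by blast
  have lc: "0 \<le> ln c" using c(1) by simp
  have "ln (fact (Nst s)) \<le> c * (ln c + real m) * (real (s + 1) ^ m * (1 + ln (real (s + 1))))" for s
  proof (cases "Nst s = 0")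
    case True
    then show ?thesis using c(1) lc by (simp add: mult_nonneg_nonneg)
  next
    case False
    have x: "real (s + 1) ^ m \<ge> 1" "ln (real (s + 1)) \<ge> 0" by simp_all
    have "ln (fact (Nst s)) \<le> ln (real (Nst s ^ Nst s))"
      using False by (intro ln_mono fact_le_power) auto
    also have "\<dots> = real (Nst s) * ln (real (Nst s))" using False by (simp add: ln_realpow)
    also have "\<dots> \<le> (c * real (s + 1) ^ m) * (ln c + real m * ln (real (s + 1)))"
    proof (rule mult_mono)
      have "ln (real (Nst s)) \<le> ln (c * real (s + 1) ^ m)" using False c by (intro ln_mono) auto
      also have "\<dots> = ln c + real m * ln (real (s + 1))" using c(1) by (subst ln_mult) (auto simp: ln_realpow)
      finally show "ln (real (Nst s)) \<le> ln c + real m * ln (real (s + 1))" .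
      have "1 \<le> Nst s" using False by linarith
      from of_nat_mono[OF this, where 'a = real] have "1 \<le> real (Nst s)" unfolding of_nat_1 .
      then show "0 \<le> ln (real (Nst s))" by (rule ln_ge_zero)
    qed (use c in auto)
    also have "\<dots> \<le> (c * real (s + 1) ^ m) * ((ln c + real m) * (1 + ln (real (s + 1))))"
    proof (rule mult_left_mono)
      have "0 \<le> ln c * ln (real (s + 1))" using lc x(2) by simp
      then show "ln c + real m * ln (real (s + 1)) \<le> (ln c + real m) * (1 + ln (real (s + 1)))"
        by (simp add: algebra_simps)
    qed (use c(1) in simp)
    finally show ?thesis by (simp only: ac_simps)
  qed
  moreover have "1 \<le> (fact (Nst s) :: real)" for s by (rule fact_ge_1)
  ultimately show ?thesis unfolding negl_def by blast
qed

definition S1 :: "nat \<Rightarrow> real" where "S1 s = real (\<Sum>a\<in>expos {1..m} s. edeg a)"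

lemma small_ratio:
  assumes "\<And>s. \<bar>f s\<bar> \<le> c * real (s + 1) ^ m"
  shows "(\<lambda>s. f s / real s ^ (m + 1)) \<longlonglongrightarrow> 0"
proof (rule tendsto_0_le[OF negligible_growth[of m]])
  have c: "c \<ge> 0" using order_trans[OF abs_ge_zero assms[of 0]] by simp
  show "\<forall>\<^sub>F s in sequentially. norm (f s / real s ^ (m + 1)) \<le>
      norm (real (s + 1) ^ m * (1 + ln (real (s + 1))) / real s ^ (m + 1)) * c"
  proof (intro always_eventually allI)
    fix s
    have "\<bar>f s\<bar> / real s ^ (m + 1) \<le> c * (real (s + 1) ^ m * (1 + ln (real (s + 1)))) / real s ^ (m + 1)"
      by (rule divide_right_mono[OF order_trans[OF assms mult_left_mono[OF growth_ge c]]]) simp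
    moreover have "0 \<le> real (s + 1) ^ m * (1 + ln (real (s + 1))) / real s ^ (m + 1)" by simp
    ultimately show "norm (f s / real s ^ (m + 1)) \<le>
        norm (real (s + 1) ^ m * (1 + ln (real (s + 1))) / real s ^ (m + 1)) * c"
      by (simp add: abs_divide mult.commute)
  qed
qed

text \<open>
  Ordinary exponents and the shift by \<open>t\<close> contribute \<open>O(s ^ m)\<close>.
\<close>

lemma Ls_asymptotics:
  "\<exists>l>0. (\<lambda>s. S1 s / real s ^ (m + 1)) \<longlonglongrightarrow> l \<and> (\<lambda>s. Ls s / real s ^ (m + 1)) \<longlonglongrightarrow> real d * l"
proof -
  have "\<exists>l>0. (\<lambda>s. S1 s / real s ^ (m + 1)) \<longlonglongrightarrow> l"
    using sum_edeg_asymptotics[of "{1..m}"] m1 by (simp add: S1_def)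
  then obtain l where l: "l > 0" "(\<lambda>s. S1 s / real s ^ (m + 1)) \<longlonglongrightarrow> l" by blast
  define R where "R s = (if t \<le> s then real (\<Sum>\<gamma>\<in>OrdS s. edeg \<gamma>) + real (d * (t * card (expos {1..m} (s - t)))) else 0)" for s
  have "\<bar>R s\<bar> \<le> real (card QO + d * t) * real (s + 1) ^ m" for s
  proof (cases "t \<le> s")
    case True
    have "(\<Sum>\<gamma>\<in>OrdS s. edeg \<gamma>) \<le> (\<Sum>\<gamma>\<in>OrdS s. s + 1)"
      by (rule sum_mono) (simp add: OrdS_def StdS_def)
    also have "\<dots> = (s + 1) * card (OrdS s)" by (simp only: sum_constant of_nat_id mult.commute)
    also note card_OrdS
    finally have 1: "(\<Sum>\<gamma>\<in>OrdS s. edeg \<gamma>) \<le> card QO * (s + 1) ^ m" .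
    have "card (expos {1..m} (s - t)) \<le> (s - t + 1) ^ m" using card_expos_le[of "{1..m}" "s - t"] by simp
    also have "\<dots> \<le> (s + 1) ^ m" by (rule power_mono) auto
    finally have "d * (t * card (expos {1..m} (s - t))) \<le> d * (t * (s + 1) ^ m)" by (intro mult_le_mono2)
    then have "(\<Sum>\<gamma>\<in>OrdS s. edeg \<gamma>) + d * (t * card (expos {1..m} (s - t))) \<le> (card QO + d * t) * (s + 1) ^ m"
      using 1 by (simp only: distrib_right mult.assoc)
    then have "real ((\<Sum>\<gamma>\<in>OrdS s. edeg \<gamma>) + d * (t * card (expos {1..m} (s - t)))) \<le> real ((card QO + d * t) * (s + 1) ^ m)"
      by (simp only: of_nat_le_iff)
    moreover have "R s = real ((\<Sum>\<gamma>\<in>OrdS s. edeg \<gamma>) + d * (t * card (expos {1..m} (s - t))))"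
      using True by (simp only: R_def of_nat_add if_True)
    ultimately show ?thesis by (simp only: of_nat_mult of_nat_power abs_of_nat)
  qed (simp add: R_def)
  from small_ratio[OF this] have "(\<lambda>s. real d * (S1 (s + 0 - t) / real s ^ (m + 1)) + R s / real s ^ (m + 1)) \<longlonglongrightarrow> real d * l + 0"
    by (intro tendsto_add tendsto_mult tendsto_const tendsto_shift_growth[OF l(2)])
  moreover have "\<forall>\<^sub>F s in sequentially. real d * (S1 (s + 0 - t) / real s ^ (m + 1)) + R s / real s ^ (m + 1) = Ls s / real s ^ (m + 1)"
    using eventually_ge_at_top[of t]
  proof eventually_elim
    case (elim s)
    have "(\<Sum>\<gamma>\<in>StdS s. edeg \<gamma>) = (\<Sum>\<gamma>\<in>OrdS s. edeg \<gamma>) + (\<Sum>\<gamma>\<in>ExtS s. edeg \<gamma>)"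
      unfolding StdS_split(1) by (rule sum.union_disjoint) (use StdS_split(2) in auto)
    also have "(\<Sum>\<gamma>\<in>ExtS s. edeg \<gamma>) = (\<Sum>i=1..d. \<Sum>a\<in>expos {1..m} (s - t). edeg a + t)"
      unfolding sum_ExtS[OF elim] by (intro sum.cong refl) (simp add: mu_edeg)
    also have "\<dots> = d * ((\<Sum>a\<in>expos {1..m} (s - t). edeg a) + t * card (expos {1..m} (s - t)))"
      by (simp add: sum.distrib)
    finally have "Ls s = real d * S1 (s - t) + R s"
      using elim by (simp add: Ls_def S1_def R_def algebra_simps)
    then show ?case by (simp add: add_divide_distrib)
  qed
  ultimately have "(\<lambda>s. Ls s / real s ^ (m + 1)) \<longlonglongrightarrow> real d * l" by (simp add: Lim_transform_eventually)
  then show ?thesis using l by blast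
qed

lemma Ls_nonneg: "Ls s \<ge> 0"
  by (simp add: Ls_def sum_nonneg)

lemma negl_root:
  assumes "negl g" shows "(\<lambda>s. g s powr (1 / Ls s)) \<longlonglongrightarrow> 1"
proof -
  obtain c where c: "\<forall>s. 1 \<le> g s \<and> ln (g s) \<le> c * (real (s + 1) ^ m * (1 + ln (real (s + 1))))" using assms by (auto simp: negl_def)
  obtain l where l: "l > 0" "(\<lambda>s. Ls s / real s ^ (m + 1)) \<longlonglongrightarrow> real d * l" using Ls_asymptotics by blast
  have dl: "real d * l > 0" using l(1) d_pos by simp
  have "(\<lambda>s. c * (real (s + 1) ^ m * (1 + ln (real (s + 1))) / real s ^ (m + 1)) * (1 / (Ls s / real s ^ (m + 1)))) \<longlonglongrightarrow> c * 0 * (1 / (real d * l))"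
    by (intro tendsto_mult tendsto_const negligible_growth tendsto_divide l(2)) (use dl d_pos in auto)
  then have 0: "(\<lambda>s. c * (real (s + 1) ^ m * (1 + ln (real (s + 1))) / real s ^ (m + 1)) * (1 / (Ls s / real s ^ (m + 1)))) \<longlonglongrightarrow> 0" by simp
  have "(\<lambda>s. 1 / Ls s * ln (g s)) \<longlonglongrightarrow> 0"
  proof (rule tendsto_sandwich[OF _ _ tendsto_const 0])
    show "\<forall>\<^sub>F s in sequentially. 0 \<le> 1 / Ls s * ln (g s)"
      using c Ls_nonneg by (intro always_eventually allI mult_nonneg_nonneg) auto
    show "\<forall>\<^sub>F s in sequentially. 1 / Ls s * ln (g s) \<le> c * (real (s + 1) ^ m * (1 + ln (real (s + 1))) / real s ^ (m + 1)) * (1 / (Ls s / real s ^ (m + 1)))"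
      using eventually_gt_at_top[of 0]
    proof eventually_elim
      case (elim s)
      have "1 / Ls s * ln (g s) \<le> 1 / Ls s * (c * (real (s + 1) ^ m * (1 + ln (real (s + 1)))))"
        using c Ls_nonneg by (intro mult_left_mono) auto
      also have "\<dots> = c * (real (s + 1) ^ m * (1 + ln (real (s + 1))) / real s ^ (m + 1)) * (1 / (Ls s / real s ^ (m + 1)))"
        using elim by simp
      finally show ?case .
    qed
  qed
  then have "(\<lambda>s. exp (1 / Ls s * ln (g s))) \<longlonglongrightarrow> exp 0" by (rule tendsto_exp)
  moreover have "exp (1 / Ls s * ln (g s)) = g s powr (1 / Ls s)" for s
    using c[rule_format, of s] by (simp add: powr_def)
  ultimately show ?thesis by simp
qed

lemma negl_ge_1: "negl g \<Longrightarrow> 1 \<le> g s"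
  by (auto simp: negl_def)

lemma negl_sandwich:
  fixes lo hi f :: "nat \<Rightarrow> real"
  assumes g: "negl g" "negl g'" and nn: "\<And>s. 0 \<le> lo s" "\<And>s. 0 \<le> hi s" "\<And>s. 0 \<le> f s"
    and le: "\<And>s. lo s \<le> g s * f s" "\<And>s. f s \<le> g' s * hi s"
    and lim: "(\<lambda>s. lo s powr (1 / Ls s)) \<longlonglongrightarrow> X" "(\<lambda>s. hi s powr (1 / Ls s)) \<longlonglongrightarrow> X"
  shows "(\<lambda>s. f s powr (1 / Ls s)) \<longlonglongrightarrow> X"
proof (rule tendsto_sandwich)
  have y: "0 \<le> 1 / Ls s" for s using Ls_nonneg by simp
  show "\<forall>\<^sub>F s in sequentially. f s powr (1 / Ls s) \<le> g' s powr (1 / Ls s) * hi s powr (1 / Ls s)"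
  proof (intro always_eventually allI)
    fix s
    have "f s powr (1 / Ls s) \<le> (g' s * hi s) powr (1 / Ls s)" by (rule powr_mono2[OF y nn(3) le(2)])
    then show "f s powr (1 / Ls s) \<le> g' s powr (1 / Ls s) * hi s powr (1 / Ls s)"
      using negl_ge_1[OF g(2), of s] nn(2) by (simp add: powr_mult)
  qed
  show "\<forall>\<^sub>F s in sequentially. lo s powr (1 / Ls s) / g s powr (1 / Ls s) \<le> f s powr (1 / Ls s)"
  proof (intro always_eventually allI)
    fix s
    have "lo s powr (1 / Ls s) \<le> (g s * f s) powr (1 / Ls s)" by (rule powr_mono2[OF y nn(1) le(1)])
    also have "\<dots> = g s powr (1 / Ls s) * f s powr (1 / Ls s)"
      using negl_ge_1[OF g(1), of s] nn(3) by (simp add: powr_mult)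
    finally show "lo s powr (1 / Ls s) / g s powr (1 / Ls s) \<le> f s powr (1 / Ls s)"
      using negl_ge_1[OF g(1), of s] by (simp add: divide_le_eq mult.commute)
  qed
  show "(\<lambda>s. g' s powr (1 / Ls s) * hi s powr (1 / Ls s)) \<longlonglongrightarrow> X"
    using tendsto_mult[OF negl_root[OF g(2)] lim(2)] by simp
  show "(\<lambda>s. lo s powr (1 / Ls s) / g s powr (1 / Ls s)) \<longlonglongrightarrow> X"
    using tendsto_divide[OF lim(1) negl_root[OF g(1)]] by simp
qed

text \<open>
  \<open>T\<close> rescaled to lie between \<open>0\<close> and \<open>1\<close>, as required for Fekete's lemma.  For \<open>\<gamma> = a + mu i\<close> the exponent
  of \<open>A\<close> is \<open>deg a + 1\<close>.
\<close>

definition Tm :: "real \<Rightarrow> expo \<Rightarrow> real" where "Tm A \<gamma> = T \<gamma> / A ^ (edeg \<gamma> - t + 1)"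

text \<open>
  The factor \<open>A ^ (t + 1)\<close> gained from the shift absorbs the sup norm of \<open>z_m^2\<close>.
\<close>

lemma Tm_fekete:
  "\<exists>A\<ge>1. \<forall>i\<in>{1..d}. fekete {1..m} (\<lambda>a. Tm A (a + mu i)) (Poly_Mapping.single m (t + 2))"
proof -
  obtain C where C: "C \<ge> 1" "\<forall>\<gamma>\<in>Std. supK K (eb \<gamma>) \<le> C ^ (edeg \<gamma> + 1)" using supK_eb_bound by blast
  let ?x = "Poly_Mapping.single m 2 :: expo"
  \<comment> \<open>The first bound makes \<open>Tm A \<le> 1\<close>, the second absorbs the norm of \<open>z_m^2\<close>.\<close>
  define A where "A = max (C ^ (t + 1)) (supK K (zmon ?x))"
  have A1: "A \<ge> 1" using one_le_power[OF C(1), of "t + 1"] unfolding A_def le_max_iff_disj by blast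
  have Tm: "Tm A (a + mu i) = T (a + mu i) / A ^ (edeg a + 1)" if "i \<in> {1..d}" for a i
    using that by (simp add: Tm_def mu_edeg)
  have Ts: "a + mu i \<in> Std" if "keys a \<subseteq> {1..m}" "i \<in> {1..d}" for a i by (rule Ext_Std[OF ExtI[OF that]])
  have T0: "0 \<le> Tm A (a + mu i)" if "keys a \<subseteq> {1..m}" "i \<in> {1..d}" for a i
    using T_nonneg[OF Ts[OF that]] A1 Tm[OF that(2)] by simp
  have "fekete {1..m} (\<lambda>a. Tm A (a + mu i)) (Poly_Mapping.single m (t + 2))" if i: "i \<in> {1..d}" for i
  proof
    show "keys (Poly_Mapping.single m (t + 2)) \<subseteq> {1..m}" using m1 by (simp add: keys_single_subset)
    fix a :: expo assume a: "keys a \<subseteq> {1..m}"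
    have "T (a + mu i) \<le> C ^ (edeg (a + mu i) + 1)"
      using T_le_supK_eb[OF Ts[OF a i]] C(2) Ts[OF a i] order_trans by blast
    also have "\<dots> \<le> C ^ ((t + 1) * (edeg a + 1))" using C(1) i by (intro power_increasing) (simp_all add: mu_edeg algebra_simps)
    also have "\<dots> = (C ^ (t + 1)) ^ (edeg a + 1)" by (rule power_mult)
    also have "\<dots> \<le> A ^ (edeg a + 1)" using C(1) by (intro power_mono) (auto simp: A_def)
    finally have "T (a + mu i) \<le> A ^ (edeg a + 1)" .
    then show "0 \<le> Tm A (a + mu i) \<and> Tm A (a + mu i) \<le> 1"
      using T0[OF a i] A1 Tm[OF i] by (simp add: divide_le_eq_1)
    fix b :: expo assume b: "keys b \<subseteq> {1..m}"
    have e: "a + b + Poly_Mapping.single m (t + 2) = a + b + (?x + Poly_Mapping.single m t)"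
      by (simp add: single_add[symmetric] add.commute)
    have "T (a + b + Poly_Mapping.single m (t + 2) + mu i) \<le> supK K (zmon ?x) * (T (a + mu i) * T (b + mu i))"
      unfolding e by (rule T_submultiplicative[OF a b i]) (use m1 in \<open>simp add: keys_single_subset\<close>)
    also have "\<dots> \<le> A ^ (t + 1) * (T (a + mu i) * T (b + mu i))"
    proof (rule mult_right_mono)
      have "supK K (zmon ?x) \<le> A ^ 1" by (simp add: A_def)
      also have "\<dots> \<le> A ^ (t + 1)" using A1 by (intro power_increasing) auto
      finally show "supK K (zmon ?x) \<le> A ^ (t + 1)" .
    qed (use T_nonneg[OF Ts[OF a i]] T_nonneg[OF Ts[OF b i]] in simp)
    finally have le: "T (a + b + Poly_Mapping.single m (t + 2) + mu i) \<le> A ^ (t + 1) * (T (a + mu i) * T (b + mu i))" .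
    have "Tm A (a + b + Poly_Mapping.single m (t + 2) + mu i)
        \<le> A ^ (t + 1) * (T (a + mu i) * T (b + mu i)) / A ^ (edeg (a + b + Poly_Mapping.single m (t + 2)) + 1)"
      unfolding Tm[OF i] using A1 by (intro divide_right_mono[OF le]) simp
    also have "A ^ (edeg (a + b + Poly_Mapping.single m (t + 2)) + 1) = A ^ (t + 1) * (A ^ (edeg a + 1) * A ^ (edeg b + 1))"
      unfolding power_add[symmetric] by (rule arg_cong[of _ _ "\<lambda>k. A ^ k"]) simp
    also have "A ^ (t + 1) * (T (a + mu i) * T (b + mu i)) / (A ^ (t + 1) * (A ^ (edeg a + 1) * A ^ (edeg b + 1))) = Tm A (a + mu i) * Tm A (b + mu i)"
      unfolding Tm[OF i] using A1 by simp
    finally show "Tm A (a + b + Poly_Mapping.single m (t + 2) + mu i) \<le> Tm A (a + mu i) * Tm A (b + mu i)" .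
  qed simp
  then show ?thesis using A1 by blast
qed

end

context conductor_setup
begin

abbreviation Ve :: "nat \<Rightarrow> real" where "Ve s \<equiv> vdm_sup (\<lambda>k. eb (en k)) K (Nst s)"

definition Ex :: "nat \<Rightarrow> nat" where "Ex s = (\<Sum>\<gamma>\<in>ExtS s. edeg \<gamma> - t + 1)"

lemma Ext_edeg_ge: "\<gamma> \<in> ExtE \<Longrightarrow> t \<le> edeg \<gamma>"
  by (auto simp: ExtE_def mu_edeg)

text \<open>
  \<open>Ex s\<close> and \<open>l_s\<close> differ by \<open>O(s ^ m)\<close>.
\<close>

lemma Ex_ratio: "(\<lambda>s. real (Ex s) / Ls s) \<longlonglongrightarrow> 1"
proof -
  obtain l where l: "l > 0" "(\<lambda>s. Ls s / real s ^ (m + 1)) \<longlonglongrightarrow> real d * l" using Ls_asymptotics by blast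
  obtain c where c: "c \<ge> 1" "\<forall>s. real (Nst s) \<le> c * real (s + 1) ^ m" using N_bound by blast
  have dl: "real d * l \<noteq> 0" using l(1) d_pos by simp
  have "\<bar>real (Ex s) - Ls s\<bar> \<le> (real (card QO) + (real t + 1) * c) * real (s + 1) ^ m" for s
  proof -
    have "Ls s = real (\<Sum>\<gamma>\<in>OrdS s. edeg \<gamma>) + real (\<Sum>\<gamma>\<in>ExtS s. edeg \<gamma>)"
      unfolding Ls_def StdS_split(1) by (subst sum.union_disjoint) (use StdS_split(2) in auto)
    moreover have "(\<Sum>\<gamma>\<in>ExtS s. edeg \<gamma>) + card (ExtS s) = Ex s + t * card (ExtS s)"
    proof -
      have "(\<Sum>\<gamma>\<in>ExtS s. edeg \<gamma> + 1) = (\<Sum>\<gamma>\<in>ExtS s. (edeg \<gamma> - t + 1) + t)"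
      proof (rule sum.cong[OF refl])
        fix \<gamma> assume "\<gamma> \<in> ExtS s"
        then have "t \<le> edeg \<gamma>" using Ext_edeg_ge by (simp add: ExtS_def)
        then show "edeg \<gamma> + 1 = (edeg \<gamma> - t + 1) + t" by simp
      qed
      then show ?thesis unfolding sum.distrib Ex_def by simp
    qed
    moreover have "(\<Sum>\<gamma>\<in>OrdS s. edeg \<gamma>) \<le> card QO * (s + 1) ^ m"
    proof -
      have "(\<Sum>\<gamma>\<in>OrdS s. edeg \<gamma>) \<le> (\<Sum>\<gamma>\<in>OrdS s. s + 1)"
        by (rule sum_mono) (simp add: OrdS_def StdS_def)
      also have "\<dots> = (s + 1) * card (OrdS s)" by (simp only: sum_constant of_nat_id mult.commute)
      also note card_OrdS
      finally show ?thesis .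
    qed
    moreover have "card (ExtS s) \<le> Nst s"
      by (rule card_mono) (auto simp: ExtS_def)
    ultimately have "\<bar>real (Ex s) - Ls s\<bar> \<le> real (card QO * (s + 1) ^ m) + real ((t + 1) * Nst s)"
    proof -
      let ?O = "\<Sum>\<gamma>\<in>OrdS s. edeg \<gamma>" and ?E = "\<Sum>\<gamma>\<in>ExtS s. edeg \<gamma>" and ?c = "card (ExtS s)"
      assume a: "Ls s = real ?O + real ?E" "?E + ?c = Ex s + t * ?c" "?O \<le> card QO * (s + 1) ^ m" "?c \<le> Nst s"
      have "\<bar>real X - (real O' + real E')\<bar> \<le> real O' + (real t + 1) * real c'" if "E' + c' = X + t * c'" for X O' E' c'
      proof -
        have "real E' + real c' = real X + real t * real c'" using that by (metis of_nat_add of_nat_mult)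
        moreover have "0 \<le> real t * real c'" by simp
        ultimately have "real X - (real O' + real E') = real c' - real t * real c' - real O'" by linarith
        then show ?thesis using \<open>0 \<le> real t * real c'\<close> by (simp add: abs_le_iff distrib_right)
      qed
      from this[OF a(2), of ?O] have "\<bar>real (Ex s) - Ls s\<bar> \<le> real ?O + (real t + 1) * real ?c"
        unfolding a(1) .
      also have "real ?O \<le> real (card QO * (s + 1) ^ m)" using a(3) of_nat_le_iff by blast
      also have "(real t + 1) * real ?c \<le> (real t + 1) * real (Nst s)" using a(4) by (intro mult_left_mono) auto
      finally show ?thesis by (simp add: algebra_simps)
    qed
    also have "real (card QO * (s + 1) ^ m) + real ((t + 1) * Nst s) = real (card QO) * real (s + 1) ^ m + (real t + 1) * real (Nst s)"
      by simp
    also have "\<dots> \<le> real (card QO) * real (s + 1) ^ m + (real t + 1) * (c * real (s + 1) ^ m)"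
      using c(2) by (intro add_left_mono mult_left_mono) auto
    finally show ?thesis by (simp only: distrib_right mult.assoc)
  qed
  from small_ratio[OF this]
  have "(\<lambda>s. (real (Ex s) - Ls s) / real s ^ (m + 1) / (Ls s / real s ^ (m + 1)) + 1) \<longlonglongrightarrow> 0 / (real d * l) + 1"
    by (intro tendsto_add tendsto_divide l(2) tendsto_const dl)
  moreover have "\<forall>\<^sub>F s in sequentially. (real (Ex s) - Ls s) / real s ^ (m + 1) / (Ls s / real s ^ (m + 1)) + 1 = real (Ex s) / Ls s"
  proof -
    have "\<forall>\<^sub>F s in sequentially. Ls s / real s ^ (m + 1) > 0"
      using order_tendstoD(1)[OF l(2)] l(1) d_pos by simp
    then show ?thesis
    proof eventually_elim
      case (elim s)
      have "z \<noteq> 0 \<and> y \<noteq> 0" if "y / z > 0" for y z :: real using that by auto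
      from this[OF elim] have "real s ^ (m + 1) \<noteq> 0" "Ls s \<noteq> 0" by blast+
      moreover have "(x - y) / z / (y / z) + 1 = x / y" if "z \<noteq> 0" "y \<noteq> 0" for x y z :: real
        using that by (simp add: field_simps)
      ultimately show ?case by blast
    qed
  qed
  ultimately show ?thesis by (simp add: Lim_transform_eventually)
qed

lemma prod_T_ExtS:
  assumes "A \<ge> 1" "F \<subseteq> ExtE" shows "(\<Prod>\<gamma>\<in>F. T \<gamma>) = A ^ (\<Sum>\<gamma>\<in>F. edeg \<gamma> - t + 1) * (\<Prod>\<gamma>\<in>F. Tm A \<gamma>)"
proof -
  have "(\<Prod>\<gamma>\<in>F. T \<gamma>) = (\<Prod>\<gamma>\<in>F. A ^ (edeg \<gamma> - t + 1) * Tm A \<gamma>)"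
    by (rule prod.cong) (use assms(1) in \<open>auto simp: Tm_def\<close>)
  then show ?thesis by (simp only: prod.distrib power_sum)
qed

text \<open>
  Up to negligible factors the determinant lies between \<open>A ^ Ex s\<close> times the product of \<open>Tm A\<close> over
  all exponents \<open>a + mu i\<close> of degree at most \<open>s + deg c0\<close>, respectively \<open>s\<close>.  For the lower bound, \<open>Lam s\<close> is a subset of the former
  (and \<open>Tm A \<le> 1\<close>) which contains a shift of the latter (and \<open>A \<ge> 1\<close>).  A bounded shift of \<open>s\<close> does not change
  the limit.
\<close>

lemma Ve_root_converges: "\<exists>X. (\<lambda>s. Ve s powr (1 / Ls s)) \<longlonglongrightarrow> X"
proof -
  obtain A where A: "A \<ge> 1" "\<forall>i\<in>{1..d}. fekete {1..m} (\<lambda>a. Tm A (a + mu i)) (Poly_Mapping.single m (t + 2))"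
    using Tm_fekete by blast
  obtain l where l: "l > 0" "(\<lambda>s. Ls s / real s ^ (m + 1)) \<longlonglongrightarrow> real d * l" using Ls_asymptotics by blast
  have dl: "real d * l > 0" using l(1) d_pos by simp
  define Q where "Q i s = (\<Prod>a\<in>expos {1..m} s. Tm A (a + mu i))" for i s
  have Tm01: "0 \<le> Tm A \<gamma> \<and> Tm A \<gamma> \<le> 1" if "\<gamma> \<in> ExtE" for \<gamma>
  proof -
    obtain a i where a: "keys a \<subseteq> {1..m}" "i \<in> {1..d}" "\<gamma> = a + mu i" using \<open>\<gamma> \<in> ExtE\<close> unfolding ExtE_def by blast
    show ?thesis using fekete.T01[OF A(2)[rule_format, OF a(2)] a(1)] a(3) by simp
  qed
  have Q0: "0 \<le> Q i s" if "i \<in> {1..d}" for i s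
    unfolding Q_def by (rule prod_nonneg) (use Tm01 ExtI that in \<open>auto simp: expos_def\<close>)
  have "\<forall>i\<in>{1..d}. \<exists>x. (\<lambda>s. Q i s powr (1 / real s ^ (m + 1))) \<longlonglongrightarrow> x"
  proof
    fix i assume i: "i \<in> {1..d}"
    have "fekete.P {1..m} (\<lambda>a. Tm A (a + mu i)) = Q i"
      by (rule ext) (simp add: Q_def fekete.P_def[OF A(2)[rule_format, OF i]])
    then show "\<exists>x. (\<lambda>s. Q i s powr (1 / real s ^ (m + 1))) \<longlonglongrightarrow> x"
      using fekete.P_root_converges[OF A(2)[rule_format, OF i]] by auto
  qed
  from bchoice[OF this] obtain x where x: "\<forall>i\<in>{1..d}. (\<lambda>s. Q i s powr (1 / real s ^ (m + 1))) \<longlonglongrightarrow> x i" ..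
  define PP where "PP s = (\<Prod>\<gamma>\<in>ExtS s. Tm A \<gamma>)" for s
  have PP0: "0 \<le> PP s" for s unfolding PP_def by (rule prod_nonneg) (use Tm01 in \<open>auto simp: ExtS_def\<close>)
  define X where "X = A powr 1 * (\<Prod>i=1..d. x i powr (1 / (real d * l)))"
  have lim: "(\<lambda>s. (A ^ Ex s * PP (s + e)) powr (1 / Ls s)) \<longlonglongrightarrow> X" for e
  proof -
    have "(\<lambda>s. A powr (real (Ex s) / Ls s) * (\<Prod>i=1..d. Q i (s + e - t) powr (1 / Ls s))) \<longlonglongrightarrow> X"
      unfolding X_def
    proof (rule tendsto_mult[OF tendsto_powr[OF tendsto_const Ex_ratio] tendsto_prod])
      show "A \<noteq> 0" using A(1) by simp
      fix i assume i: "i \<in> {1..d}"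
      show "(\<lambda>s. Q i (s + e - t) powr (1 / Ls s)) \<longlonglongrightarrow> x i powr (1 / (real d * l))"
        by (rule tendsto_shift_root[OF bspec[OF x i] Q0[OF i] l(2) dl])
    qed
    moreover have "\<forall>\<^sub>F s in sequentially. A powr (real (Ex s) / Ls s) * (\<Prod>i=1..d. Q i (s + e - t) powr (1 / Ls s))
        = (A ^ Ex s * PP (s + e)) powr (1 / Ls s)"
      using eventually_ge_at_top[of t]
    proof eventually_elim
      case (elim s)
      have "PP (s + e) = (\<Prod>i=1..d. Q i (s + e - t))"
        unfolding PP_def Q_def by (rule prod_ExtS) (use elim in simp)
      moreover have "A powr (real (Ex s) / Ls s) = (A ^ Ex s) powr (1 / Ls s)"
        using A(1) by (simp add: powr_realpow[symmetric] powr_powr)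
      ultimately show ?case by (simp only: powr_mult prod_powr_distrib)
    qed
    ultimately show ?thesis by (rule Lim_transform_eventually)
  qed
  obtain C where C: "C \<ge> 1" "\<forall>\<gamma>\<in>Std. supK K (eb \<gamma>) \<le> C ^ (edeg \<gamma> + 1)" using supK_eb_bound by blast
  obtain \<rho> C' where low: "\<rho> \<ge> 1" "C' \<ge> 1"
    "\<forall>s. (\<Prod>\<theta>\<in>Lam s. T \<theta>) \<le> \<rho> ^ Nst s * C' ^ ((s + 1) * card (OrdE \<inter> StdS s)) * Ve s"
    using vdm_eb_lower by blast
  have "(\<lambda>s. Ve s powr (1 / Ls s)) \<longlonglongrightarrow> X"
  proof (rule negl_sandwich)
    show "negl (\<lambda>s. \<rho> ^ Nst s * C' ^ ((s + 1) * card (OrdS s)))"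
      by (intro negl_mult negl_power_N negl_power_OrdS low)
    show "negl (\<lambda>s. fact (Nst s) * C ^ ((s + 1) * card (OrdS s)))"
      by (intro negl_mult negl_fact negl_power_OrdS C)
    show "0 \<le> A ^ Ex s * PP (s + edeg c0)" "0 \<le> A ^ Ex s * PP (s + 0)" for s using PP0 A(1) by auto
    show "0 \<le> Ve s" for s by (rule vdm_sup_nonneg[OF K])
    show "(\<lambda>s. (A ^ Ex s * PP (s + edeg c0)) powr (1 / Ls s)) \<longlonglongrightarrow> X"
      "(\<lambda>s. (A ^ Ex s * PP (s + 0)) powr (1 / Ls s)) \<longlonglongrightarrow> X" by (rule lim)+
    fix s
    show "Ve s \<le> fact (Nst s) * C ^ ((s + 1) * card (OrdS s)) * (A ^ Ex s * PP (s + 0))"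
    proof -
      have "(\<Prod>\<gamma>\<in>StdS s. T \<gamma>) = (\<Prod>\<gamma>\<in>OrdS s. T \<gamma>) * (\<Prod>\<gamma>\<in>ExtS s. T \<gamma>)"
        unfolding StdS_split(1) by (rule prod.union_disjoint) (use StdS_split(2) in auto)
      also have "(\<Prod>\<gamma>\<in>ExtS s. T \<gamma>) = A ^ Ex s * PP s"
        unfolding PP_def Ex_def by (rule prod_T_ExtS[OF A(1)]) (simp add: ExtS_def)
      also have "(\<Prod>\<gamma>\<in>OrdS s. T \<gamma>) * (A ^ Ex s * PP s) \<le> (\<Prod>\<gamma>\<in>OrdS s. C ^ (s + 1)) * (A ^ Ex s * PP s)"
      proof (rule mult_right_mono[OF prod_mono])
        fix \<gamma> assume "\<gamma> \<in> OrdS s"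
        then have g: "\<gamma> \<in> Std" "edeg \<gamma> \<le> s" by (auto simp: OrdS_def StdS_def)
        have "T \<gamma> \<le> C ^ (edeg \<gamma> + 1)" using T_le_supK_eb[OF g(1)] C(2) g(1) order_trans by blast
        also have "\<dots> \<le> C ^ (s + 1)" using C(1) g(2) by (intro power_increasing) auto
        finally show "0 \<le> T \<gamma> \<and> T \<gamma> \<le> C ^ (s + 1)" using T_nonneg[OF g(1)] by simp
      qed (use PP0 A(1) in auto)
      also have "(\<Prod>\<gamma>\<in>OrdS s. C ^ (s + 1)) = C ^ ((s + 1) * card (OrdS s))" by (simp only: prod_constant power_mult)
      finally have "(\<Prod>\<gamma>\<in>StdS s. T \<gamma>) \<le> C ^ ((s + 1) * card (OrdS s)) * (A ^ Ex s * PP s)" .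
      then have "fact (Nst s) * (\<Prod>\<gamma>\<in>StdS s. T \<gamma>) \<le> fact (Nst s) * (C ^ ((s + 1) * card (OrdS s)) * (A ^ Ex s * PP s))"
        by (rule mult_left_mono) simp
      from order_trans[OF vdm_eb_upper this] show ?thesis by (simp only: mult.assoc add_0_right)
    qed
    show "A ^ Ex s * PP (s + edeg c0) \<le> \<rho> ^ Nst s * C' ^ ((s + 1) * card (OrdS s)) * Ve s"
    proof -
      have LE: "Lam s \<subseteq> ExtS (s + edeg c0)" by (auto simp: Lam_def ExtS_def HL_def)
      then have LE': "Lam s \<subseteq> ExtE" by (auto simp: ExtS_def)
      have "Ex s \<le> (\<Sum>\<gamma>\<in>ExtS s. edeg (c0 + \<gamma>) - t + 1)" unfolding Ex_def by (rule sum_mono) simp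
      also have "\<dots> = (\<Sum>\<theta>\<in>(+) c0 ` ExtS s. edeg \<theta> - t + 1)" by (simp add: sum.reindex inj_on_def)
      also have "\<dots> \<le> (\<Sum>\<theta>\<in>Lam s. edeg \<theta> - t + 1)"
        by (rule sum_mono2) (use Lam_shift in \<open>auto simp: ExtS_def\<close>)
      finally have "A ^ Ex s \<le> A ^ (\<Sum>\<theta>\<in>Lam s. edeg \<theta> - t + 1)" using A(1) by (rule power_increasing)
      moreover have "PP (s + edeg c0) \<le> (\<Prod>\<theta>\<in>Lam s. Tm A \<theta>)"
        unfolding PP_def by (rule prod_le_subset) (use LE Tm01 in \<open>auto simp: ExtS_def\<close>)
      ultimately have "A ^ Ex s * PP (s + edeg c0) \<le> A ^ (\<Sum>\<theta>\<in>Lam s. edeg \<theta> - t + 1) * (\<Prod>\<theta>\<in>Lam s. Tm A \<theta>)"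
        using A(1) PP0 by (intro mult_mono) auto
      also have "\<dots> = (\<Prod>\<theta>\<in>Lam s. T \<theta>)" by (rule prod_T_ExtS[OF A(1) LE', symmetric])
      also have "\<dots> \<le> \<rho> ^ Nst s * C' ^ ((s + 1) * card (OrdS s)) * Ve s" using low(3) by (simp only: OrdS_def)
      finally show ?thesis .
    qed
  qed
  then show ?thesis by blast
qed

section \<open>Comparison of the bases\<close>

lemma vdm_mon_le:
  "\<exists>B\<ge>1. \<forall>s. vdm_sup (\<lambda>k. zmon (en k)) K (Nst s) \<le> B ^ Nst s * Ve s"
proof -
  obtain R B where RB: "R \<ge> 1" "B \<ge> 1" "\<And>\<gamma>. \<gamma> \<in> Std \<Longrightarrow> wrep R (Sd \<gamma>) (zmon \<gamma>) (B / R ^ edeg (low \<gamma>))"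
    using zmon_expand by blast
  have "vdm_sup (\<lambda>k. zmon (en k)) K (Nst s) \<le> B ^ Nst s * Ve s" for s
  proof -
    have "\<forall>\<gamma>\<in>StdS s. \<exists>x. zmon \<gamma> = (\<Sum>\<delta>\<in>StdS s. cscale (x \<delta>) (eb \<delta>)) \<and>
       (\<Sum>\<delta>\<in>StdS s. cmod (x \<delta>) / R ^ edeg (low \<delta>)) \<le> B / R ^ edeg (low \<gamma>)"
    proof
      fix \<gamma> assume g: "\<gamma> \<in> StdS s"
      then have "wrep R (StdS s) (zmon \<gamma>) (B / R ^ edeg (low \<gamma>))"
        by (intro wrep_mono[OF RB(3) _ finite_StdS]) (auto simp: StdS_def Sd_def)
      then show "\<exists>x. zmon \<gamma> = (\<Sum>\<delta>\<in>StdS s. cscale (x \<delta>) (eb \<delta>)) \<and>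
       (\<Sum>\<delta>\<in>StdS s. cmod (x \<delta>) / R ^ edeg (low \<delta>)) \<le> B / R ^ edeg (low \<gamma>)" by (simp add: wrep_def)
    qed
    from bchoice[OF this] obtain x where x: "\<forall>\<gamma>\<in>StdS s. zmon \<gamma> = (\<Sum>\<delta>\<in>StdS s. cscale (x \<gamma> \<delta>) (eb \<delta>)) \<and>
       (\<Sum>\<delta>\<in>StdS s. cmod (x \<gamma> \<delta>) / R ^ edeg (low \<delta>)) \<le> B / R ^ edeg (low \<gamma>)" ..
    have "vdm_sup (\<lambda>k. zmon (en k)) K (Nst s) \<le> (\<Prod>\<gamma>\<in>StdS s. B) * Ve s"
    proof (rule vdm_sup_transition[OF K en_bij en_bij, where r = "\<lambda>\<gamma>. R ^ edeg (low \<gamma>)" and r' = "\<lambda>\<gamma>. R ^ edeg (low \<gamma>)" and x = x])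
      fix a \<gamma> assume "\<gamma> \<in> StdS s"
      then have "zmon \<gamma> = (\<Sum>\<delta>\<in>StdS s. cscale (x \<gamma> \<delta>) (eb \<delta>))" using x by blast
      then have "peval a (zmon \<gamma>) = peval a (\<Sum>\<delta>\<in>StdS s. cscale (x \<gamma> \<delta>) (eb \<delta>))" by (rule arg_cong)
      then show "peval a (zmon \<gamma>) = (\<Sum>\<delta>\<in>StdS s. x \<gamma> \<delta> * peval a (eb \<delta>))" by (simp only: peval_sum peval_cscale)
    qed (use x RB(1) in auto)
    then show ?thesis by simp
  qed
  then show ?thesis using RB(2) by blast
qed

text \<open>
  The \<open>l1\<close> norm of the coefficients of \<open>z^a w_i\<close> is that of \<open>w_i\<close>.
\<close>

lemma vdm_mon_ge:
  "\<exists>B\<ge>1. \<forall>s. Ve s \<le> B ^ Nst s * vdm_sup (\<lambda>k. zmon (en k)) K (Nst s)"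
proof -
  define B where "B = 1 + (\<Sum>i=1..d. \<Sum>\<delta>\<in>keys (w i). cmod (lookup (w i) \<delta>))"
  have B1: "B \<ge> 1" by (simp add: B_def sum_nonneg)
  have Bi: "(\<Sum>\<delta>\<in>keys (w i). cmod (lookup (w i) \<delta>)) \<le> B" if "i \<in> {1..d}" for i
  proof -
    have "(\<Sum>\<delta>\<in>keys (w i). cmod (lookup (w i) \<delta>)) \<le> (\<Sum>i=1..d. \<Sum>\<delta>\<in>keys (w i). cmod (lookup (w i) \<delta>))"
      by (rule member_le_sum) (use that in \<open>auto intro: sum_nonneg\<close>)
    then show ?thesis by (simp add: B_def)
  qed
  have ebB: "(\<Sum>\<delta>\<in>keys (eb \<gamma>). cmod (lookup (eb \<gamma>) \<delta>)) \<le> B" if g: "\<gamma> \<in> Std" for \<gamma>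
    using g
  proof (cases rule: Std_cases)
    case 1
    then show ?thesis using B1 by (simp add: eb_ord)
  next
    case (2 a i)
    have "(\<Sum>\<delta>\<in>keys (eb \<gamma>). cmod (lookup (eb \<gamma>) \<delta>)) = (\<Sum>\<delta>\<in>keys (w i). cmod (lookup (w i) \<delta>))"
      unfolding 2(3) eb_ext[OF 2(1,2)] keys_zmon_mult by (subst sum.reindex) (auto simp: inj_on_def)
    then show ?thesis using Bi[OF 2(2)] by simp
  qed
  have "Ve s \<le> B ^ Nst s * vdm_sup (\<lambda>k. zmon (en k)) K (Nst s)" for s
  proof -
    have sub: "keys (eb \<gamma>) \<subseteq> StdS s" if "\<gamma> \<in> StdS s" for \<gamma>
      using that eb_Std[of \<gamma>] eb_keys(1)[of \<gamma>] by (auto simp: StdS_def)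
    have "Ve s \<le> (\<Prod>\<gamma>\<in>StdS s. B) * vdm_sup (\<lambda>k. zmon (en k)) K (Nst s)"
    proof (rule vdm_sup_transition[OF K en_bij en_bij, where r = "\<lambda>_. 1" and r' = "\<lambda>_. 1" and x = "\<lambda>\<gamma>. lookup (eb \<gamma>)"])
      fix a \<gamma> assume g: "\<gamma> \<in> StdS s"
      show "peval a (eb \<gamma>) = (\<Sum>\<delta>\<in>StdS s. lookup (eb \<gamma>) \<delta> * peval a (zmon \<delta>))"
        using peval_superset[OF finite_StdS sub[OF g]] by simp
    next
      fix \<gamma> assume g: "\<gamma> \<in> StdS s"
      have "(\<Sum>\<delta>\<in>StdS s. cmod (lookup (eb \<gamma>) \<delta>)) = (\<Sum>\<delta>\<in>keys (eb \<gamma>). cmod (lookup (eb \<gamma>) \<delta>))"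
        by (rule sum.mono_neutral_right) (use sub[OF g] in \<open>auto simp: in_keys_iff\<close>)
      then show "(\<Sum>\<delta>\<in>StdS s. cmod (lookup (eb \<gamma>) \<delta>) / 1) \<le> B / 1" using ebB[of \<gamma>] g by (simp add: StdS_def)
    qed simp_all
    then show ?thesis by simp
  qed
  then show ?thesis using B1 by blast
qed

text \<open>
  Reordering the basis changes the determinant by a sign.
\<close>

lemma vdm_enumC: "vdm_sup (enumC n m d I t w) K (Nst s) = Ve s"
proof -
  let ?b = "enum_by (prec n m I w) (basisC n m d I t w)"
  note b = enumC_bij[of s] and phi = phi_bij[of s]
  have L: "x \<in> Labels" if "x \<in> LabelsS s" for x using that by (simp add: LabelsS_def)
  have e: "enumC n m d I t w = (\<lambda>k. elem n m I w (?b k))" by (rule ext) (simp add: enumC_def)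
  have phiS: "phi x \<in> StdS s" if "x \<in> LabelsS s" for x using phi that by (auto simp: bij_betw_def)
  have "vdm_sup (\<lambda>k. elem n m I w (?b k)) K (Nst s) \<le> (\<Prod>x\<in>LabelsS s. 1) * Ve s"
  proof (rule vdm_sup_transition[OF K b en_bij, where r = "\<lambda>_. 1" and r' = "\<lambda>_. 1" and x = "\<lambda>x \<delta>. if \<delta> = phi x then 1 else 0"])
    fix a x assume x: "x \<in> LabelsS s"
    show "peval a (elem n m I w x) = (\<Sum>\<delta>\<in>StdS s. (if \<delta> = phi x then 1 else 0) * peval a (eb \<delta>))"
      using phiS[OF x] by (simp add: elem_phi[OF L[OF x]] if_distrib[of "\<lambda>y. y * _"] sum.delta cong: if_cong)
  next
    fix x assume x: "x \<in> LabelsS s"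
    have "(\<Sum>\<delta>\<in>StdS s. cmod (if \<delta> = phi x then 1 else 0)) = 1"
      using phiS[OF x] by (simp add: if_distrib[of cmod] sum.delta cong: if_cong)
    then show "(\<Sum>\<delta>\<in>StdS s. cmod (if \<delta> = phi x then 1 else 0) / 1) \<le> 1 / 1" by simp
  qed simp_all
  moreover have "Ve s \<le> (\<Prod>\<gamma>\<in>StdS s. 1) * vdm_sup (\<lambda>k. elem n m I w (?b k)) K (Nst s)"
  proof (rule vdm_sup_transition[OF K en_bij b, where r = "\<lambda>_. 1" and r' = "\<lambda>_. 1" and x = "\<lambda>\<delta> x. if \<delta> = phi x then 1 else 0"])
    fix a \<gamma> assume g: "\<gamma> \<in> StdS s"
    have "(\<Sum>x\<in>LabelsS s. (if \<gamma> = phi x then 1 else 0) * peval a (elem n m I w x))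
        = (\<Sum>x\<in>LabelsS s. (if \<gamma> = phi x then 1 else 0) * peval a (eb (phi x)))"
      by (rule sum.cong) (simp_all add: elem_phi L)
    also have "\<dots> = (\<Sum>\<delta>\<in>StdS s. (if \<gamma> = \<delta> then 1 else 0) * peval a (eb \<delta>))"
      by (rule sum.reindex_bij_betw[OF phi])
    also have "\<dots> = peval a (eb \<gamma>)"
      using g by (simp add: if_distrib[of "\<lambda>y. y * _"] sum.delta cong: if_cong)
    finally show "peval a (eb \<gamma>) = (\<Sum>x\<in>LabelsS s. (if \<gamma> = phi x then 1 else 0) * peval a (elem n m I w x))" by simp
  next
    fix \<gamma> assume g: "\<gamma> \<in> StdS s"
    have "(\<Sum>x\<in>LabelsS s. cmod (if \<gamma> = phi x then 1 else 0)) = (\<Sum>\<delta>\<in>StdS s. cmod (if \<gamma> = \<delta> then 1 else 0))"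
      by (rule sum.reindex_bij_betw[OF phi])
    also have "\<dots> = 1" using g by (simp add: if_distrib[of cmod] sum.delta cong: if_cong)
    finally show "(\<Sum>x\<in>LabelsS s. cmod (if \<gamma> = phi x then 1 else 0) / 1) \<le> 1 / 1" by simp
  qed simp_all
  ultimately show ?thesis unfolding e by simp
qed

lemma enum_mon_en: "enum_mon n I = (\<lambda>k. zmon (en k))"
  by (rule ext) (simp add: enum_mon_def en_def std_expos_def)

text \<open>
  Monomial determinants and those of the basis \<open>\<C>\<close> differ by negligible factors in both directions.
\<close>

theorem vandermonde_roots_agree:
  "(\<lambda>s. vdm_sup (enum_mon n I) K (m_dim n I s) powr (1 / real (l_dim n I s)))
     \<longlonglongrightarrow> transfinite_diameter n m d I t w K"
proof -
  obtain X where X: "(\<lambda>s. Ve s powr (1 / Ls s)) \<longlonglongrightarrow> X" using Ve_root_converges by blast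
  have LM: "real (l_dim n I s) = Ls s" "m_dim n I s = Nst s" for s by (simp_all only: l_dim_eq m_dim_eq Ls_def)
  have "transfinite_diameter n m d I t w K = X"
    unfolding transfinite_diameter_def LM vdm_enumC by (rule limI[OF X])
  moreover obtain B where B: "B \<ge> 1" "\<forall>s. vdm_sup (\<lambda>k. zmon (en k)) K (Nst s) \<le> B ^ Nst s * Ve s" using vdm_mon_le by blast
  obtain B' where B': "B' \<ge> 1" "\<forall>s. Ve s \<le> B' ^ Nst s * vdm_sup (\<lambda>k. zmon (en k)) K (Nst s)" using vdm_mon_ge by blast
  have "(\<lambda>s. vdm_sup (\<lambda>k. zmon (en k)) K (Nst s) powr (1 / Ls s)) \<longlonglongrightarrow> X"
    by (rule negl_sandwich[OF negl_power_N[OF B'(1)] negl_power_N[OF B(1)] _ _ _ _ _ X X])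
       (use B(2) B'(2) vdm_sup_nonneg[OF K] in auto)
  ultimately show ?thesis unfolding LM enum_mon_en by simp
qed

end

theorem theorem7p2:
  fixes n m d t :: nat
    and V K :: "(nat \<Rightarrow> complex) set"
    and I :: "cpoly set"
    and p :: "nat \<Rightarrow> nat \<Rightarrow> complex"
    and v w :: "nat \<Rightarrow> cpoly"
  assumes "1 \<le> m" and "m \<le> n"
    and "algebraic_set n V"
    and "I = vanishing_ideal n V"
    and "pure_dim n V m" and "has_degree n I d"
    and "noether_normalization n m I"
    and "\<And>i. i \<in> {1..d} \<Longrightarrow> p i \<in> hcoords n"
    and "bij_betw (\<lambda>i. proj_pt (p i)) {1..d}
           (proj_zeros n (homog_ideal n I) \<inter> proj_zeros n (zvar ` {0..<m}))"
    and "\<And>i. i \<in> {1..d} \<Longrightarrow> p i m \<noteq> 0"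
    and "\<And>\<tau> c. t \<le> \<tau> \<Longrightarrow> \<exists>f\<in>homog {0..n} \<tau>. \<forall>i\<in>{1..d}. form_eval m \<tau> (p i) f = c i"
    and "\<And>\<tau>. t \<le> \<tau> \<Longrightarrow> {f \<in> homog {0..n} \<tau>. \<forall>i\<in>{1..d}. form_eval m \<tau> (p i) f = 0}
           = (homog_ideal n I + ideal_gen {0..n} (zvar ` {0..<m})) \<inter> homog {0..n} \<tau>"
    and "\<And>i. i \<in> {1..d} \<Longrightarrow> v i \<in> homog {0..n} t"
    and "\<And>i j. i \<in> {1..d} \<Longrightarrow> j \<in> {1..d} \<Longrightarrow> form_eval m t (p j) (v i) = (if i = j then 1 else 0)"
    and "w = (\<lambda>i. bold_v n I t (v i))"
    and "K \<subseteq> V" and "compact K"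
    and "\<And>\<alpha> l \<beta>. Poly_Mapping.keys \<alpha> \<subseteq> {1..<m} \<Longrightarrow> (l, \<beta>) \<in> basisB n m I t \<Longrightarrow>
           zmon (\<alpha> + Poly_Mapping.single m l) * zmon \<beta> \<in> normal_forms n I"
    and "\<And>\<alpha> l i. Poly_Mapping.keys \<alpha> \<subseteq> {1..<m} \<Longrightarrow> i \<in> {1..d} \<Longrightarrow>
           zmon (\<alpha> + Poly_Mapping.single m l) * w i \<in> normal_forms n I"
  shows "(\<lambda>s. vdm_sup (enum_mon n I) K (m_dim n I s) powr (1 / real (l_dim n I s)))
           \<longlonglongrightarrow> transfinite_diameter n m d I t w K"
proof -
  interpret affine_variety n V I by unfold_locales (rule assms(4))
  note p_m = assms(10)
  have vn: "bold_v n I t (v i) \<in> nf_homog n I t" "v i - bold_v n I t (v i) \<in> Jdl 1" if "i \<in> {1..d}" for i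
    using bold_v[OF assms(13)[OF that]] .
  have Jdl_le: "f \<in> Jdl m" if "f \<in> Jdl 1" for f
  proof -
    have "ideal_gen {0..n} (zvar ` {0..<1}) \<subseteq> ideal_gen {0..n} (zvar ` {0..<m})"
      unfolding ideal_gen_def using assms(1) by fastforce
    then show ?thesis using that unfolding Jdl_def by (meson set_plus_mono2 order_refl subset_iff)
  qed
  have kernel: "f \<in> Jdl m \<longleftrightarrow> (\<forall>i\<in>{1..d}. peval (p i) f = 0)" if "t \<le> s" "f \<in> homog {0..n} s" for s f
  proof -
    have "f \<in> {f \<in> homog {0..n} s. \<forall>i\<in>{1..d}. form_eval m s (p i) f = 0} \<longleftrightarrow> f \<in> Jdl m"
      unfolding assms(12)[OF that(1)] Jdl_def using that(2) by blast
    moreover have "form_eval m s (p i) f = 0 \<longleftrightarrow> peval (p i) f = 0" if "i \<in> {1..d}" for i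
      using p_m[OF that] by (simp add: form_eval_def)
    ultimately show ?thesis using that(2) by auto
  qed
  interpret noether_setup n V I m d t p w
  proof unfold_locales
    show "p i k = 0" if i: "i \<in> {1..d}" and k: "k < m" for i k
    proof -
      have "proj_pt (p i) \<in> proj_zeros n (zvar ` {0..<m})" using assms(9) i by (auto simp: bij_betw_def)
      then obtain a where a: "proj_pt (p i) = proj_pt a" "\<forall>f\<in>zvar ` {0..<m}. peval a f = 0"
        by (auto simp: proj_zeros_def)
      have "p i \<in> proj_pt (p i)" unfolding proj_pt_def by (intro CollectI exI[of _ 1]) simp
      then have "p i \<in> proj_pt a" unfolding a(1) .
      then obtain c where "p i = (\<lambda>k. c * a k)" unfolding proj_pt_def by blast
      moreover have "peval a (zvar k) = 0" using a(2) k by simp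
      ultimately show ?thesis by simp
    qed
    show "f \<in> Jdl m" if "t \<le> s" "f \<in> homog {0..n} s" "\<And>i. i \<in> {1..d} \<Longrightarrow> peval (p i) f = 0" for s f
      using kernel[OF that(1,2)] that(3) by blast
    show "w i \<in> nf_homog n I t" if "i \<in> {1..d}" for i using vn(1)[OF that] by (simp add: assms(15))
    show "peval (p j) (w i) = (if i = j then p j m ^ t else 0)" if i: "i \<in> {1..d}" and j: "j \<in> {1..d}" for i j
    proof -
      let ?w = "bold_v n I t (v i)"
      have "?w \<in> homog {0..n} t" using vn(1)[OF i] polys_mono[of "{1..n}" "{0..n}" ?w] by (auto simp: nf_homog_def homog_def)
      then have "v i - ?w \<in> homog {0..n} t"
        using assms(13)[OF i] polys_diff keys_diff_subset[of "v i" ?w] by (auto simp: homog_def)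
      from kernel[OF order_refl this] Jdl_le[OF vn(2)[OF i]] j have "peval (p j) (v i) = peval (p j) ?w" by auto
      moreover have "peval (p j) (v i) / p j m ^ t = (if i = j then 1 else 0)"
        using assms(14)[OF i j] by (simp add: form_eval_def)
      ultimately show ?thesis using p_m[OF j] by (auto simp: assms(15) divide_simps split: if_splits)
    qed
  qed (use assms p_m in auto)
  have pI: "polys {1..m} \<inter> I = {0}" using assms(7) by (simp add: noether_normalization_def)
  obtain h c0 where h: "h \<in> polys {1..m}" "is_lead h c0" "lookup h c0 = 1" "\<And>f. f \<in> polys {1..n} \<Longrightarrow> inF (h * f)"
    using conductor_exists by blast
  have h0: "h \<noteq> 0" using h(3) by auto
  interpret conductor_setup n V I m d t p w K h c0
  proof unfold_locales
    show "eqV V f 0" if "f \<in> polys {1..n}" "eqV V (h * f) 0" for f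
      by (rule nonzero_divisor[OF assms(3,5) h(1) h0 that])
    show "V \<noteq> {}"
    proof
      assume "V = {}"
      then have "1 \<in> polys {1..m} \<inter> I" by (simp add: I_iff eqV_def)
      then show False unfolding pI by simp
    qed
  qed (use assms h in auto)
  show ?thesis by (rule vandermonde_roots_agree)
qed

end
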